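(* Let $c\in(-1,1)$ and consider the Klein-Gordon-Zakharov system $$u_{tt}-u_{xx}+u+nu=0,\qquad n_{tt}-n_{xx}-\tfrac12(|u|^2)_{xx}=0,\qquad (t,x)\in\mathbf R_+\times\mathbf R,$$ with the traveling wave solution $(u,n)=(\varphi(x-ct),\psi(x-ct))$, where $$\varphi(y)=2\sqrt{1-c^2}\,\operatorname{sech}\!\left(\tfrac{y}{\sqrt{1-c^2}}\right),\qquad \psi(y)=-2\operatorname{sech}^2\!\left(\tfrac{y}{\sqrt{1-c^2}}\right).$$ This traveling wave is spectrally/linearly stable for $|c|\in[\frac{\sqrt2}{2},1)$ and spectrally/linearly unstable for $|c|\in[0,\frac{\sqrt2}{2})$.
   Context: Writing $u=\varphi(x-ct)+v(t,x-ct)$, $n=\psi(x-ct)+w(t,x-ct)$ with real-valued $v,w$ and dropping quadratic terms gives the linearized system $$v_{tt}-2cv_{tx}-(1-c^2)v_{xx}+v+\psi v+\varphi w=0,\qquad w_{tt}-2cw_{tx}-(1-c^2)w_{xx}-(\varphi v)_{xx}=0.$$ The wave is called (spectrally/linearly) unstable if this linear system has a nonzero solution of the form $e^{\lambda t}(V(x),W(x))$ with $\Re\lambda>0$ and $V,W\in H^2(\mathbf R)$; otherwise it is called (spectrally/linearly) stable. *)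

theory Defs
  imports "HOL-Analysis.Analysis"
begin

section \<open>Weak derivatives and \<open>H\<^sup>2\<close> on the real line\<close>

definition smooth :: "(real \<Rightarrow> real) \<Rightarrow> bool" where
  "smooth f \<longleftrightarrow> (\<forall>k x. (deriv ^^ k) f differentiable (at x))"

definition test_function :: "(real \<Rightarrow> real) \<Rightarrow> bool" where
  "test_function \<theta> \<longleftrightarrow> smooth \<theta> \<and> compact (closure {x. \<theta> x \<noteq> 0})"

definition locally_integrable :: "(real \<Rightarrow> complex) \<Rightarrow> bool" where
  "locally_integrable f \<longleftrightarrow> (\<forall>a b. set_integrable lborel {a..b} f)"

definition weak_deriv :: "(real \<Rightarrow> complex) \<Rightarrow> (real \<Rightarrow> complex) \<Rightarrow> bool" where
  "weak_deriv f g \<longleftrightarrow> locally_integrable f \<and> locally_integrable g \<and>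
     (\<forall>\<theta>. test_function \<theta> \<longrightarrow>
        (LINT x|lborel. deriv \<theta> x *\<^sub>R f x) = - (LINT x|lborel. \<theta> x *\<^sub>R g x))"

definition weak_deriv2 :: "(real \<Rightarrow> complex) \<Rightarrow> (real \<Rightarrow> complex) \<Rightarrow> bool" where
  "weak_deriv2 f h \<longleftrightarrow> (\<exists>g. weak_deriv f g \<and> weak_deriv g h)"

text \<open>Elements of \<open>L\<^sup>2\<close> and \<open>H\<^sup>2\<close> are represented by functions; equality is almost everywhere.\<close>

definition L2 :: "(real \<Rightarrow> complex) set" where
  "L2 = {f. f \<in> borel_measurable lborel \<and> integrable lborel (\<lambda>x. (cmod (f x))\<^sup>2)}"

definition H2 :: "(real \<Rightarrow> complex) set" where
  "H2 = {f \<in> L2. \<exists>g\<in>L2. \<exists>h\<in>L2. weak_deriv f g \<and> weak_deriv g h}"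


section \<open>The Klein--Gordon--Zakharov system\<close>

text \<open>Partial derivatives of functions of \<open>(t, x)\<close> on \<open>[0,\<infinity>) \<times> \<real>\<close>, one-sided at \<open>t = 0\<close>.\<close>

definition has_dt ::
  "(real \<Rightarrow> real \<Rightarrow> 'a::real_normed_vector) \<Rightarrow> (real \<Rightarrow> real \<Rightarrow> 'a) \<Rightarrow> bool" where
  "has_dt f f' \<longleftrightarrow>
     (\<forall>t\<ge>0. \<forall>x. ((\<lambda>s. f s x) has_vector_derivative f' t x) (at t within {0..}))"

definition has_dx ::
  "(real \<Rightarrow> real \<Rightarrow> 'a::real_normed_vector) \<Rightarrow> (real \<Rightarrow> real \<Rightarrow> 'a) \<Rightarrow> bool" where
  "has_dx f f' \<longleftrightarrow> (\<forall>t\<ge>0. \<forall>x. (f t has_vector_derivative f' t x) (at x))"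

definition kgz_solution :: "(real \<Rightarrow> real \<Rightarrow> complex) \<Rightarrow> (real \<Rightarrow> real \<Rightarrow> real) \<Rightarrow> bool" where
  "kgz_solution u n \<longleftrightarrow>
     (\<exists>ut utt ux uxx nt ntt nx nxx qx qxx.
        has_dt u ut \<and> has_dt ut utt \<and> has_dx u ux \<and> has_dx ux uxx \<and>
        has_dt n nt \<and> has_dt nt ntt \<and> has_dx n nx \<and> has_dx nx nxx \<and>
        has_dx (\<lambda>t x. (cmod (u t x))\<^sup>2) qx \<and> has_dx qx qxx \<and>
        (\<forall>t\<ge>0. \<forall>x.
           utt t x - uxx t x + u t x + complex_of_real (n t x) * u t x = 0 \<and>
           ntt t x - nxx t x - 1/2 * qxx t x = 0))"

definition kgz_\<phi> :: "real \<Rightarrow> real \<Rightarrow> real" where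
  "kgz_\<phi> c y = 2 * sqrt (1 - c\<^sup>2) * (1 / cosh (y / sqrt (1 - c\<^sup>2)))"

definition kgz_\<psi> :: "real \<Rightarrow> real \<Rightarrow> real" where
  "kgz_\<psi> c y = - 2 * (1 / cosh (y / sqrt (1 - c\<^sup>2)))\<^sup>2"


section \<open>Linearization about a traveling wave and stability\<close>

text \<open>
  The system obtained by inserting \<open>u = \<phi>(x - ct) + v(t, x - ct)\<close>, \<open>n = \<psi>(x - ct) + w(t, x - ct)\<close>
  and dropping quadratic terms. The \<open>x\<close>-derivatives are weak derivatives at each fixed time, and the
  equations hold for almost every \<open>x\<close>.
\<close>

definition kgz_linearized_solution ::
  "real \<Rightarrow> (real \<Rightarrow> real) \<Rightarrow> (real \<Rightarrow> real) \<Rightarrow>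
   (real \<Rightarrow> real \<Rightarrow> complex) \<Rightarrow> (real \<Rightarrow> real \<Rightarrow> complex) \<Rightarrow> bool" where
  "kgz_linearized_solution c \<phi> \<psi> v w \<longleftrightarrow>
     (\<exists>vt vtt vtx vxx wt wtt wtx wxx qxx.
        has_dt v vt \<and> has_dt vt vtt \<and> has_dt w wt \<and> has_dt wt wtt \<and>
        (\<forall>t\<ge>0.
           weak_deriv (vt t) (vtx t) \<and> weak_deriv2 (v t) (vxx t) \<and>
           weak_deriv (wt t) (wtx t) \<and> weak_deriv2 (w t) (wxx t) \<and>
           weak_deriv2 (\<lambda>x. complex_of_real (\<phi> x) * v t x) (qxx t) \<and>
           (AE x in lborel.
              vtt t x - complex_of_real (2 * c) * vtx t x - complex_of_real (1 - c\<^sup>2) * vxx t x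
                + v t x + complex_of_real (\<psi> x) * v t x + complex_of_real (\<phi> x) * w t x = 0 \<and>
              wtt t x - complex_of_real (2 * c) * wtx t x - complex_of_real (1 - c\<^sup>2) * wxx t x
                - qxx t x = 0)))"

definition kgz_unstable :: "real \<Rightarrow> (real \<Rightarrow> real) \<Rightarrow> (real \<Rightarrow> real) \<Rightarrow> bool" where
  "kgz_unstable c \<phi> \<psi> \<longleftrightarrow>
     (\<exists>(\<mu>::complex) V W. Re \<mu> > 0 \<and> V \<in> H2 \<and> W \<in> H2 \<and>
        \<not> (AE x in lborel. V x = 0 \<and> W x = 0) \<and>
        kgz_linearized_solution c \<phi> \<psi>
          (\<lambda>t x. exp (\<mu> * complex_of_real t) * V x)
          (\<lambda>t x. exp (\<mu> * complex_of_real t) * W x))"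

definition kgz_stable :: "real \<Rightarrow> (real \<Rightarrow> real) \<Rightarrow> (real \<Rightarrow> real) \<Rightarrow> bool" where
  "kgz_stable c \<phi> \<psi> \<longleftrightarrow> \<not> kgz_unstable c \<phi> \<psi>"

end

theory Submission
  imports Defs "HOL-Complex_Analysis.Great_Picard"
begin

text \<open>
  Put \<open>s = sqrt (1 - c\<^sup>2)\<close>, \<open>k = c / s\<close>, \<open>Q = sech\<close>. Rescaling \<open>x = s z\<close> and writing the second
  component as a derivative \<open>q'\<close> turns the eigenvalue problem into \<open>l\<^sup>2 u - 2 k l u' + H u = 0\<close> for
  \<open>u = (V, q)\<close>, where \<open>H\<close> is self-adjoint and its quadratic form is
  \<open>\<integral>(q' + 2 Q V)\<^sup>2 + \<integral>V'\<^sup>2 + (1 - 6 Q\<^sup>2) V\<^sup>2\<close>. The form is nonnegative on \<open>V(0) = 0\<close>; the derivative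
  \<open>\<psi>\<^sub>0\<close> of the wave lies in its kernel, and \<open>\<langle>H u, u\<rangle> + 2 \<langle>u', \<psi>\<^sub>0\<rangle>\<^sup>2 \<ge> 0\<close>.

  If \<open>k\<^sup>2 \<ge> 1\<close>, testing with \<open>u\<close> gives \<open>\<bar>l\<bar>\<^sup>2 \<parallel>u\<parallel>\<^sup>2 = - \<langle>H u, u\<rangle>\<close> when \<open>Re l > 0\<close>, and testing with
  \<open>\<psi>\<^sub>0\<close> gives \<open>l \<langle>u, \<psi>\<^sub>0\<rangle> = 2 k \<langle>u', \<psi>\<^sub>0\<rangle>\<close>; as \<open>\<parallel>\<psi>\<^sub>0\<parallel>\<^sup>2 = 2\<close>, Cauchy-Schwarz forces \<open>u = 0\<close>
  (in its equality case \<open>u\<close> is a multiple of \<open>\<psi>\<^sub>0\<close>, so \<open>\<langle>u', \<psi>\<^sub>0\<rangle> = 0\<close>).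
  If \<open>k\<^sup>2 < 1\<close>, a growing mode with real \<open>l\<close> is a limit of Galerkin solutions. In each of them \<open>l\<close> is
  found by the intermediate value theorem, where the sign at small \<open>l\<close> comes from a test state that
  approximates the velocity derivative of the wave family.
\<close>

text \<open>A growth rate is nonzero, so the second equation, a total derivative, can be divided by
  its square; this is where a square integrable \<open>q\<close> comes from. The threshold
  \<open>k\<^sup>2 = 1\<close>, that is \<open>c\<^sup>2 = 1/2\<close>, has one source for both
  halves: a formal state \<open>z\<close> with \<open>H z = \<psi>\<^sub>0'\<close> and
  \<open>\<langle>H z, z\<rangle> = -1/2\<close>. This value fixes the constant 2 of the rank-one
  term. It also gives \<open>\<langle>z', \<psi>\<^sub>0\<rangle> = 1/2\<close>, so the projection
  of \<open>z'\<close> on \<open>\<psi>\<^sub>0\<close> is \<open>\<psi>\<^sub>0 / 4\<close>; for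
  instability this costs \<open>4 k\<^sup>2 \<parallel>\<psi>\<^sub>0 / 4\<parallel>\<^sup>2 =
  k\<^sup>2 / 2\<close>, which has to stay below 1/2. Three obstacles shape the second half. The
  second component of \<open>z\<close> tends to nonzero constants, so a cutoff at scale
  \<open>1/d\<close> is needed. The first-order term is skew, so no minimization is available;
  reflection parity replaces it. The line is not compact, so only the norm weighted by
  \<open>sech\<^sup>2\<close> is kept, and limits are pointwise, with equations and derivative
  bounds free of derivatives of the unknown.\<close>

subsection \<open>Absolute continuity and square integrability\<close>

text \<open>\<open>f\<close> is locally absolutely continuous with derivative \<open>g\<close>.\<close>

definition AC :: "(real \<Rightarrow> real) \<Rightarrow> (real \<Rightarrow> real) \<Rightarrow> bool" where
  "AC f g \<longleftrightarrow> g \<in> borel_measurable borel \<and> (\<forall>a b. set_integrable lborel {a..b} g) \<and>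
     (\<forall>a b. a \<le> b \<longrightarrow> f b - f a = (LINT x:{a..b}|lborel. g x))"

lemma AC_meas: "AC f g \<Longrightarrow> g \<in> borel_measurable borel"
  and AC_int: "AC f g \<Longrightarrow> set_integrable lborel {a..b} g"
  and AC_eq: "AC f g \<Longrightarrow> a \<le> b \<Longrightarrow> f b - f a = (LINT x:{a..b}|lborel. g x)"
  by (auto simp: AC_def)

lemma AC_cont_on:
  assumes "AC f g" shows "continuous_on S f"
proof -
  have "isCont f x" for x
  proof -
    have i: "set_integrable lborel {x-1..x+1} g" using assms by (rule AC_int)
    have "continuous_on {x-1..x+1} (\<lambda>y. integral {x-1..y} g)"
      using set_borel_integral_eq_integral(1)[OF i] by (rule indefinite_integral_continuous_1)
    moreover have "f y = f (x-1) + integral {x-1..y} g" if "y \<in> {x-1..x+1}" for y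
    proof -
      have "f y - f (x-1) = (LINT x:{x-1..y}|lborel. g x)" using that AC_eq[OF assms] by auto
      also have "\<dots> = integral {x-1..y} g"
        by (rule set_borel_integral_eq_integral(2)[OF AC_int[OF assms]])
      finally show ?thesis by simp
    qed
    moreover have "continuous_on {x-1..x+1} (\<lambda>y. f (x-1) + integral {x-1..y} g)"
      using calculation(1) by (intro continuous_on_add continuous_on_const)
    ultimately have "continuous_on {x-1..x+1} f"
      by (metis (no_types, lifting) continuous_on_eq)
    then show ?thesis by (rule continuous_on_interior) auto
  qed
  then show ?thesis by (simp add: continuous_at_imp_continuous_on)
qed

lemma AC_borel: "AC f g \<Longrightarrow> f \<in> borel_measurable borel"
  using AC_cont_on[of f g UNIV] by (rule borel_measurable_continuous_onI)

lemma set_integrable_cont_mult: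
  fixes f g :: "real \<Rightarrow> real"
  assumes "continuous_on {a..b} f" "f \<in> borel_measurable borel" "set_integrable lborel {a..b} g"
  shows "set_integrable lborel {a..b} (\<lambda>x. f x * g x)"
proof -
  have "bounded (f ` {a..b})" by (intro compact_imp_bounded compact_continuous_image assms) auto
  then obtain B where B: "\<And>x. x \<in> {a..b} \<Longrightarrow> \<bar>f x\<bar> \<le> B" by (auto simp: bounded_iff simp del: atLeastAtMost_iff)
  show ?thesis unfolding set_integrable_def
  proof (rule Bochner_Integration.integrable_bound)
    show "integrable lborel (\<lambda>x. B * \<bar>indicator {a..b} x *\<^sub>R g x\<bar>)"
      using assms(3) unfolding set_integrable_def by (intro integrable_mult_right integrable_abs)
    have "(\<lambda>x. f x * (indicator {a..b} x *\<^sub>R g x)) \<in> borel_measurable lborel"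
      using borel_measurable_integrable[OF assms(3)[unfolded set_integrable_def]] assms(2) by simp
    then show "(\<lambda>x. indicator {a..b} x *\<^sub>R (f x * g x)) \<in> borel_measurable lborel"
      by (simp add: algebra_simps)
    show "AE x in lborel. norm (indicator {a..b} x *\<^sub>R (f x * g x)) \<le> norm (B * \<bar>indicator {a..b} x *\<^sub>R g x\<bar>)"
    proof (rule AE_I2)
      fix x show "norm (indicator {a..b} x *\<^sub>R (f x * g x)) \<le> norm (B * \<bar>indicator {a..b} x *\<^sub>R g x\<bar>)"
        using B[of x] by (cases "x \<in> {a..b}") (auto simp: abs_mult intro!: mult_right_mono)
    qed
  qed
qed

lemma integrable_tensor:
  fixes F G :: "real \<Rightarrow> real"
  assumes F: "integrable lborel F" and G: "integrable lborel G"
  shows "integrable (lborel \<Otimes>\<^sub>M lborel) (\<lambda>(x,y). F x * G y)"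
proof -
  have [measurable]: "F \<in> borel_measurable borel" "G \<in> borel_measurable borel" using F G by auto
  show ?thesis
  proof (rule lborel_pair.Fubini_integrable)
    show "integrable lborel (\<lambda>x. \<integral>y. norm (case (x,y) of (x,y) \<Rightarrow> F x * G y) \<partial>lborel)"
      using F by (simp add: abs_mult)
    show "AE x in lborel. integrable lborel (\<lambda>y. case (x,y) of (x,y) \<Rightarrow> F x * G y)"
      using G by simp
  qed auto
qed

text \<open>The product of the increments is the double integral of \<open>f' x * g' y\<close> over
  the square with side \<open>{a..b}\<close>. Cutting the square along its diagonal and applying
  Fubini to each triangle leaves the two terms on the right.\<close>

lemma AC_mult_aux:
  assumes f: "AC f f'" and g: "AC g g'" and ab: "a \<le> b"
  shows "(f b - f a) * (g b - g a) =
    (LINT x:{a..b}|lborel. (f x - f a) * g' x) + (LINT x:{a..b}|lborel. (g x - g a) * f' x)"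
proof -
  define F where "F x = indicator {a..b} x * f' x" for x
  define G where "G x = indicator {a..b} x * g' x" for x
  have F: "integrable lborel F" and G: "integrable lborel G"
    using AC_int[OF f] AC_int[OF g] by (auto simp: F_def[abs_def] G_def[abs_def] set_integrable_def)
  have [measurable]: "F \<in> borel_measurable borel" "G \<in> borel_measurable borel" using F G by auto
  have K: "integrable (lborel \<Otimes>\<^sub>M lborel) (\<lambda>(x,y). F x * G y)" by (rule integrable_tensor[OF F G])
  have m: "{p. snd p \<le> fst p} \<in> sets (lborel \<Otimes>\<^sub>M (lborel::real measure))"
    "{p. fst p < snd p} \<in> sets (lborel \<Otimes>\<^sub>M (lborel::real measure))"
  proof -
    have "{p \<in> space (lborel \<Otimes>\<^sub>M (lborel::real measure)). snd p \<le> fst p} \<in> sets (lborel \<Otimes>\<^sub>M lborel)"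
      "{p \<in> space (lborel \<Otimes>\<^sub>M (lborel::real measure)). fst p < snd p} \<in> sets (lborel \<Otimes>\<^sub>M lborel)"
      by measurable
    then show "{p. snd p \<le> fst p} \<in> sets (lborel \<Otimes>\<^sub>M (lborel::real measure))"
      "{p. fst p < snd p} \<in> sets (lborel \<Otimes>\<^sub>M (lborel::real measure))"
      by (simp_all add: space_pair_measure)
  qed
  have K1: "integrable (lborel \<Otimes>\<^sub>M lborel) (\<lambda>(x,y). indicator {..x} y * (F x * G y))"
  proof -
    have "integrable (lborel \<Otimes>\<^sub>M lborel) (\<lambda>p. indicator {p. snd p \<le> fst p} p *\<^sub>R (case p of (x,y) \<Rightarrow> F x * G y))"
      by (rule integrable_mult_indicator[OF m(1) K])
    then show ?thesis by (rule Bochner_Integration.integrable_cong[THEN iffD1, rotated -1]) (auto simp: indicator_def)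
  qed
  have K2: "integrable (lborel \<Otimes>\<^sub>M lborel) (\<lambda>(x,y). indicator {..<y} x * (F x * G y))"
  proof -
    have "integrable (lborel \<Otimes>\<^sub>M lborel) (\<lambda>p. indicator {p. fst p < snd p} p *\<^sub>R (case p of (x,y) \<Rightarrow> F x * G y))"
      by (rule integrable_mult_indicator[OF m(2) K])
    then show ?thesis by (rule Bochner_Integration.integrable_cong[THEN iffD1, rotated -1]) (auto simp: indicator_def)
  qed
  have K3: "integrable lborel (\<lambda>y. indicator A y * H y)" if "integrable lborel H" "A \<in> sets borel" for A and H :: "real \<Rightarrow> real"
    using integrable_mult_indicator[of A lborel H] that by simp
  have i1: "(\<integral>y. indicator {..x} y * G y \<partial>lborel) = g x - g a" if "x \<in> {a..b}" for x
  proof -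
    have "(\<integral>y. indicator {..x} y * G y \<partial>lborel) = (LINT y:{a..x}|lborel. g' y)"
      unfolding set_lebesgue_integral_def using that
      by (intro Bochner_Integration.integral_cong) (auto simp: G_def indicator_def)
    also have "\<dots> = g x - g a" using AC_eq[OF g, of a x] that by auto
    finally show ?thesis .
  qed
  have i2: "(\<integral>x. indicator {..<y} x * F x \<partial>lborel) = f y - f a" if "y \<in> {a..b}" for y
  proof -
    have "(\<integral>x. indicator {..<y} x * F x \<partial>lborel) = (LINT x:{a..<y}|lborel. f' x)"
      unfolding set_lebesgue_integral_def using that
      by (intro Bochner_Integration.integral_cong) (auto simp: F_def indicator_def)
    also have "\<dots> = (LINT x:{a..y}|lborel. f' x)"
      by (rule set_integral_discrete_difference[of "{y}"]) auto
    also have "\<dots> = f y - f a" using AC_eq[OF f, of a y] that by auto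
    finally show ?thesis .
  qed
  have "(f b - f a) * (g b - g a) = (\<integral>x. F x \<partial>lborel) * (\<integral>y. G y \<partial>lborel)"
    using AC_eq[OF f ab] AC_eq[OF g ab] by (simp add: set_lebesgue_integral_def F_def[abs_def] G_def[abs_def])
  also have "\<dots> = (\<integral>x. (\<integral>y. F x * G y \<partial>lborel) \<partial>lborel)" by simp
  also have "\<dots> = (\<integral>x. (\<integral>y. indicator {..x} y * (F x * G y) \<partial>lborel) + (\<integral>y. indicator {..<y} x * (F x * G y) \<partial>lborel) \<partial>lborel)"
  proof (rule Bochner_Integration.integral_cong[OF refl])
    fix x
    have "(\<integral>y. F x * G y \<partial>lborel) = (\<integral>y. indicator {..x} y * (F x * G y) + indicator {..<y} x * (F x * G y) \<partial>lborel)"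
      by (intro Bochner_Integration.integral_cong) (auto simp: indicator_def)
    also have "\<dots> = (\<integral>y. indicator {..x} y * (F x * G y) \<partial>lborel) + (\<integral>y. indicator {..<y} x * (F x * G y) \<partial>lborel)"
    proof (rule Bochner_Integration.integral_add)
      show "integrable lborel (\<lambda>y. indicator {..x} y * (F x * G y))" using G by (intro K3) auto
      have "integrable lborel (\<lambda>y. indicator {x<..} y * (F x * G y))" using G by (intro K3) auto
      then show "integrable lborel (\<lambda>y. indicator {..<y} x * (F x * G y))"
        by (rule Bochner_Integration.integrable_cong[THEN iffD1, rotated -1]) (auto simp: indicator_def)
    qed
    finally show "(\<integral>y. F x * G y \<partial>lborel) = (\<integral>y. indicator {..x} y * (F x * G y) \<partial>lborel) + (\<integral>y. indicator {..<y} x * (F x * G y) \<partial>lborel)" .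
  qed
  also have "\<dots> = (\<integral>x. (\<integral>y. indicator {..x} y * (F x * G y) \<partial>lborel) \<partial>lborel) + (\<integral>x. (\<integral>y. indicator {..<y} x * (F x * G y) \<partial>lborel) \<partial>lborel)"
    using lborel_pair.integrable_fst[OF K1] lborel_pair.integrable_fst[OF K2] by (rule Bochner_Integration.integral_add)
  also have "(\<integral>x. (\<integral>y. indicator {..<y} x * (F x * G y) \<partial>lborel) \<partial>lborel) = (\<integral>y. (\<integral>x. indicator {..<y} x * (F x * G y) \<partial>lborel) \<partial>lborel)"
    using lborel_pair.Fubini_integral[OF K2] by simp
  also have "(\<integral>y. (\<integral>x. indicator {..<y} x * (F x * G y) \<partial>lborel) \<partial>lborel) = (\<integral>y. G y * (\<integral>x. indicator {..<y} x * F x \<partial>lborel) \<partial>lborel)"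
    by (subst integral_mult_right_zero[symmetric]) (simp add: mult.commute mult.left_commute)
  also have "\<dots> = (LINT x:{a..b}|lborel. (f x - f a) * g' x)"
    unfolding set_lebesgue_integral_def
  proof (rule Bochner_Integration.integral_cong[OF refl])
    fix y show "G y * (\<integral>x. indicator {..<y} x * F x \<partial>lborel) = indicator {a..b} y *\<^sub>R ((f y - f a) * g' y)"
      by (cases "y \<in> {a..b}") (simp_all add: i2 G_def)
  qed
  also have "(\<integral>x. (\<integral>y. indicator {..x} y * (F x * G y) \<partial>lborel) \<partial>lborel) = (\<integral>x. F x * (\<integral>y. indicator {..x} y * G y \<partial>lborel) \<partial>lborel)"
    by (subst integral_mult_right_zero[symmetric]) (simp add: mult.commute mult.left_commute)
  also have "\<dots> = (LINT x:{a..b}|lborel. (g x - g a) * f' x)"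
    unfolding set_lebesgue_integral_def
  proof (rule Bochner_Integration.integral_cong[OF refl])
    fix y show "F y * (\<integral>x. indicator {..y} x * G x \<partial>lborel) = indicator {a..b} y *\<^sub>R ((g y - g a) * f' y)"
      by (cases "y \<in> {a..b}") (simp_all add: i1 F_def)
  qed
  finally show ?thesis by simp
qed

lemma AC_mult:
  assumes f: "AC f f'" and g: "AC g g'"
  shows "AC (\<lambda>x. f x * g x) (\<lambda>x. f' x * g x + f x * g' x)"
  unfolding AC_def
proof (intro conjI allI impI)
  have [measurable]: "f \<in> borel_measurable borel" "g \<in> borel_measurable borel" "f' \<in> borel_measurable borel" "g' \<in> borel_measurable borel"
    using f g by (auto intro: AC_meas AC_borel)
  show "(\<lambda>x. f' x * g x + f x * g' x) \<in> borel_measurable borel" by measurable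
  fix a b :: real
  have i1: "set_integrable lborel {a..b} (\<lambda>x. (f x - A) * g' x)" for A a b
    by (intro set_integrable_cont_mult AC_int[OF g] continuous_intros AC_cont_on[OF f]) measurable
  have i2: "set_integrable lborel {a..b} (\<lambda>x. (g x - A) * f' x)" for A a b
    by (intro set_integrable_cont_mult AC_int[OF f] continuous_intros AC_cont_on[OF g]) measurable
  show "set_integrable lborel {a..b} (\<lambda>x. f' x * g x + f x * g' x)"
    using set_integral_add(1)[OF i1[of a b 0] i2[of a b 0]] by (simp add: algebra_simps)
  assume ab: "a \<le> b"
  have c: "set_integrable lborel {a..b} (\<lambda>x. A * f' x)" "set_integrable lborel {a..b} (\<lambda>x. A * g' x)" for A
    using AC_int[OF f] AC_int[OF g] by auto
  \<comment> \<open>\<open>AC_mult_aux\<close> speaks of increments only, so the integrand is first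
    expanded about the values at \<open>a\<close>.\<close>
  have "(LINT x:{a..b}|lborel. f' x * g x + f x * g' x)
     = (LINT x:{a..b}|lborel. ((f x - f a) * g' x + (g x - g a) * f' x) + (f a * g' x + g a * f' x))"
    by (simp add: algebra_simps)
  also have "\<dots> = ((LINT x:{a..b}|lborel. (f x - f a) * g' x) + (LINT x:{a..b}|lborel. (g x - g a) * f' x))
     + (f a * (LINT x:{a..b}|lborel. g' x) + g a * (LINT x:{a..b}|lborel. f' x))"
    using i1 i2 c by (simp add: set_integral_add)
  also have "\<dots> = (f b - f a) * (g b - g a) + (f a * (g b - g a) + g a * (f b - f a))"
    using AC_mult_aux[OF f g ab] AC_eq[OF f ab] AC_eq[OF g ab] by simp
  finally show "f b * g b - f a * g a = (LINT x:{a..b}|lborel. f' x * g x + f x * g' x)" by (simp add: algebra_simps)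
qed

lemma AC_add: "AC f f' \<Longrightarrow> AC g g' \<Longrightarrow> AC (\<lambda>x. f x + g x) (\<lambda>x. f' x + g' x)"
  by (simp add: AC_def set_integral_add add_diff_add borel_measurable_add)

lemma AC_cmult: "AC f f' \<Longrightarrow> AC (\<lambda>x. c * f x) (\<lambda>x. c * f' x)"
  by (auto simp: AC_def right_diff_distrib[symmetric])

lemma AC_C1:
  assumes "\<And>x. (f has_real_derivative f' x) (at x)" "continuous_on UNIV f'"
  shows "AC f f'"
  unfolding AC_def
proof (intro conjI allI impI)
  show "f' \<in> borel_measurable borel" using assms(2) by (rule borel_measurable_continuous_onI)
  fix a b :: real
  show "set_integrable lborel {a..b} f'"
    by (rule borel_integrable_atLeastAtMost') (rule continuous_on_subset[OF assms(2)], auto)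
  assume "a \<le> b"
  then have "(\<integral>x. indicator {a..b} x *\<^sub>R f' x \<partial>lborel) = f b - f a"
    using assms(1) continuous_on_subset[OF assms(2) subset_UNIV, of "{a..b}"]
    by (intro integral_FTC_Icc)
      (simp_all add: has_real_derivative_iff_has_vector_derivative has_vector_derivative_at_within)
  then show "f b - f a = (LINT x:{a..b}|lborel. f' x)" by (simp add: set_lebesgue_integral_def)
qed

lemma AC_cong_AE:
  assumes "AC f g" "AE x in lborel. g x = h x" "h \<in> borel_measurable borel"
  shows "AC f h"
proof -
  have "set_integrable lborel {a..b} h \<longleftrightarrow> set_integrable lborel {a..b} g" for a b
    using assms AC_meas[OF assms(1)] by (intro set_integrable_cong_AE) auto
  moreover have "(LINT x:{a..b}|lborel. h x) = (LINT x:{a..b}|lborel. g x)" for a b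
    using assms AC_meas[OF assms(1)] by (intro set_lebesgue_integral_cong_AE) (auto simp: set_borel_measurable_def)
  ultimately show ?thesis using assms by (auto simp: AC_def)
qed

lemma AC_has_deriv:
  assumes "AC f g" "continuous_on UNIV g"
  shows "(f has_real_derivative g x) (at x)"
proof -
  have "((\<lambda>y. integral {x-1..y} g) has_vector_derivative g x) (at x within {x-1..x+1})"
    by (rule integral_has_vector_derivative[OF continuous_on_subset[OF assms(2)]]) auto
  then have 1: "((\<lambda>y. integral {x-1..y} g) has_vector_derivative g x) (at x)"
    by (subst (asm) at_within_interior) simp_all
  have 2: "f y = f (x-1) + integral {x-1..y} g" if "y \<in> {x-1..x+1}" for y
  proof -
    have "f y - f (x-1) = (LINT x:{x-1..y}|lborel. g x)" using that AC_eq[OF assms(1)] by auto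
    also have "\<dots> = integral {x-1..y} g"
      by (rule set_borel_integral_eq_integral(2)[OF AC_int[OF assms(1)]])
    finally show ?thesis by simp
  qed
  have "((\<lambda>y. f (x-1) + integral {x-1..y} g) has_vector_derivative 0 + g x) (at x)"
    by (rule has_vector_derivative_add[OF has_vector_derivative_const 1])
  then have 3: "((\<lambda>y. f (x-1) + integral {x-1..y} g) has_vector_derivative g x) (at x)"
    by (simp only: add_0)
  have "(f has_vector_derivative g x) (at x)"
  proof (rule has_vector_derivative_transform_within_open[OF 3])
    show "open {x-1<..<x+1}" by simp
    show "x \<in> {x-1<..<x+1}" by simp
    fix y assume "y \<in> {x-1<..<x+1}"
    then show "f (x-1) + integral {x-1..y} g = f y" using 2[of y] by auto
  qed
  then show ?thesis by (simp only: has_real_derivative_iff_has_vector_derivative)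
qed

section \<open>Square integrable functions, alone and together with their derivative\<close>

definition sq :: "(real \<Rightarrow> real) \<Rightarrow> bool" where
  "sq f \<longleftrightarrow> f \<in> borel_measurable borel \<and> integrable lborel (\<lambda>x. (f x)\<^sup>2)"

text \<open>The derivative is determined only up to a null set, so it is carried as a second
  argument instead of being chosen; every estimate then names the representative that it
  uses.\<close>

definition H1 :: "(real \<Rightarrow> real) \<Rightarrow> (real \<Rightarrow> real) \<Rightarrow> bool" where
  "H1 f f' \<longleftrightarrow> AC f f' \<and> sq f \<and> sq f'"

lemma sq_meas: "sq f \<Longrightarrow> f \<in> borel_measurable borel"
  and sq_int: "sq f \<Longrightarrow> integrable lborel (\<lambda>x. (f x)\<^sup>2)"
  by (auto simp: sq_def)

lemma H1_AC: "H1 f f' \<Longrightarrow> AC f f'" and H1_sq: "H1 f f' \<Longrightarrow> sq f" and H1_sq': "H1 f f' \<Longrightarrow> sq f'"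
  by (auto simp: H1_def)

lemma sq_bound:
  assumes "g \<in> borel_measurable borel" "sq f" "\<And>x. \<bar>g x\<bar> \<le> C * \<bar>f x\<bar>"
  shows "sq g"
  unfolding sq_def
proof
  show "integrable lborel (\<lambda>x. (g x)\<^sup>2)"
  proof (rule Bochner_Integration.integrable_bound)
    show "integrable lborel (\<lambda>x. C\<^sup>2 * (f x)\<^sup>2)" using assms(2) by (simp add: sq_def)
    show "(\<lambda>x. (g x)\<^sup>2) \<in> borel_measurable lborel" using assms(1) by simp
    show "AE x in lborel. norm ((g x)\<^sup>2) \<le> norm (C\<^sup>2 * (f x)\<^sup>2)"
    proof (rule AE_I2)
      fix x
      have "\<bar>g x\<bar>\<^sup>2 \<le> (C * \<bar>f x\<bar>)\<^sup>2" using assms(3)[of x] by (intro power_mono) auto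
      then show "norm ((g x)\<^sup>2) \<le> norm (C\<^sup>2 * (f x)\<^sup>2)" by (simp add: power_mult_distrib)
    qed
  qed
qed (use assms in auto)

lemma sq_cmult: "sq f \<Longrightarrow> sq (\<lambda>x. c * f x)"
  by (rule sq_bound[of _ f "\<bar>c\<bar>"]) (auto simp: sq_def abs_mult)

lemma sq_minus: "sq f \<Longrightarrow> sq (\<lambda>x. - f x)"
  using sq_cmult[of f "-1"] by simp

lemma sq_zero: "sq (\<lambda>x. 0)" by (simp add: sq_def)

lemma sq_bmult:
  assumes "m \<in> borel_measurable borel" "\<And>x. \<bar>m x\<bar> \<le> C" "sq f"
  shows "sq (\<lambda>x. m x * f x)"
proof (rule sq_bound[OF _ assms(3)])
  show "(\<lambda>x. m x * f x) \<in> borel_measurable borel"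
    by (intro borel_measurable_times assms(1) sq_meas[OF assms(3)])
  show "\<bar>m x * f x\<bar> \<le> C * \<bar>f x\<bar>" for x
    unfolding abs_mult by (rule mult_right_mono[OF assms(2)]) simp
qed

lemma sq_mult:
  assumes "sq f" "sq g" shows "integrable lborel (\<lambda>x. f x * g x)"
proof (rule Bochner_Integration.integrable_bound)
  show "integrable lborel (\<lambda>x. (f x)\<^sup>2 + (g x)\<^sup>2)" using assms by (simp add: sq_def)
  have [measurable]: "f \<in> borel_measurable borel" "g \<in> borel_measurable borel" using assms by (simp_all add: sq_def)
  show "(\<lambda>x. f x * g x) \<in> borel_measurable lborel" by measurable
  show "AE x in lborel. norm (f x * g x) \<le> norm ((f x)\<^sup>2 + (g x)\<^sup>2)"
  proof (rule AE_I2)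
    fix x
    have "0 \<le> (\<bar>f x\<bar> - \<bar>g x\<bar>)\<^sup>2" "0 \<le> \<bar>f x\<bar> * \<bar>g x\<bar>" by simp_all
    then have "\<bar>f x\<bar> * \<bar>g x\<bar> \<le> (f x)\<^sup>2 + (g x)\<^sup>2" unfolding power2_diff power2_abs by linarith
    then show "norm (f x * g x) \<le> norm ((f x)\<^sup>2 + (g x)\<^sup>2)" by (simp add: abs_mult)
  qed
qed

lemma sq_add:
  assumes "sq f" "sq g" shows "sq (\<lambda>x. f x + g x)"
proof -
  have "integrable lborel (\<lambda>x. (f x)\<^sup>2 + (g x)\<^sup>2 + 2 * (f x * g x))"
    using assms sq_mult[OF assms] by (auto simp: sq_def)
  moreover have "(\<lambda>x. f x + g x) \<in> borel_measurable borel"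
    using assms by (intro borel_measurable_add) (simp_all add: sq_def)
  ultimately show ?thesis by (simp add: sq_def power2_sum mult.assoc)
qed

lemma sq_diff: "sq f \<Longrightarrow> sq g \<Longrightarrow> sq (\<lambda>x. f x - g x)"
  using sq_add[of f "\<lambda>x. - g x"] sq_minus by simp

lemma sq_mult_b:
  assumes "sq f" "sq g" "m \<in> borel_measurable borel" "\<And>x. \<bar>m x\<bar> \<le> C"
  shows "integrable lborel (\<lambda>x. m x * f x * g x)"
  using sq_mult[OF sq_bmult[OF assms(3,4,1)] assms(2)] .

text \<open>The integral of \<open>(f + t g)\<^sup>2\<close> is a nonnegative polynomial in
  \<open>t\<close>; the inequality is its value at the minimizer.\<close>

lemma Cauchy_Schwarz_integral:
  assumes f: "sq f" and g: "sq g"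
  shows "(\<integral>x. f x * g x \<partial>lborel)\<^sup>2 \<le> (\<integral>x. (f x)\<^sup>2 \<partial>lborel) * (\<integral>x. (g x)\<^sup>2 \<partial>lborel)"
proof -
  define A where "A = (\<integral>x. (f x)\<^sup>2 \<partial>lborel)"
  define B where "B = (\<integral>x. f x * g x \<partial>lborel)"
  define C where "C = (\<integral>x. (g x)\<^sup>2 \<partial>lborel)"
  have pos: "0 \<le> A + 2 * t * B + t\<^sup>2 * C" for t
  proof -
    have "0 \<le> (\<integral>x. (f x + t * g x)\<^sup>2 \<partial>lborel)" by simp
    also have "\<dots> = (\<integral>x. (f x)\<^sup>2 + (2 * t * (f x * g x) + t\<^sup>2 * (g x)\<^sup>2) \<partial>lborel)"
      by (simp add: power2_sum power_mult_distrib algebra_simps)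
    also have "\<dots> = A + (2 * t * B + t\<^sup>2 * C)"
      using sq_int[OF f] sq_int[OF g] sq_mult[OF f g] by (simp add: A_def B_def C_def)
    finally show ?thesis by simp
  qed
  have C0: "0 \<le> C" by (simp add: C_def)
  show ?thesis unfolding A_def[symmetric] B_def[symmetric] C_def[symmetric]
  proof (cases "C = 0")
    case True
    have "B = 0"
    proof (rule ccontr)
      assume "B \<noteq> 0"
      \<comment> \<open>This \<open>t\<close> makes \<open>A + 2 * t * B\<close> equal to
        -1.\<close>
      with pos[of "- (A + 1) / (2 * B)"] True show False by (simp add: field_simps)
    qed
    then show "B\<^sup>2 \<le> A * C" using True by simp
  next
    case False
    then have "0 < C" using C0 by simp
    moreover have "0 \<le> A + 2 * (-B/C) * B + (-B/C)\<^sup>2 * C" by (rule pos)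
    moreover have "A + 2 * (-B/C) * B + (-B/C)\<^sup>2 * C = A - B\<^sup>2 / C"
      using False by (simp add: field_simps power2_eq_square)
    ultimately have "B\<^sup>2 / C \<le> A" "0 < C" by simp_all
    then show "B\<^sup>2 \<le> A * C" by (simp add: divide_le_eq)
  qed
qed

section \<open>Integrals over the whole line and integration by parts without boundary terms\<close>

lemma set_integral_tendsto_line:
  fixes g :: "real \<Rightarrow> real"
  assumes g: "integrable lborel g" and a: "filterlim a at_bot sequentially" and b: "filterlim b at_top sequentially"
  shows "(\<lambda>n. LINT x:{a n..b n}|lborel. g x) \<longlonglongrightarrow> (\<integral>x. g x \<partial>lborel)"
  unfolding set_lebesgue_integral_def
proof (rule integral_dominated_convergence[where w="\<lambda>x. \<bar>g x\<bar>"])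
  have [measurable]: "g \<in> borel_measurable borel" using g by auto
  show "g \<in> borel_measurable lborel" by simp
  show "(\<lambda>x. indicat_real {a n..b n} x *\<^sub>R g x) \<in> borel_measurable lborel" for n by measurable
  show "integrable lborel (\<lambda>x. \<bar>g x\<bar>)" using g by simp
  show "AE x in lborel. (\<lambda>n. indicat_real {a n..b n} x *\<^sub>R g x) \<longlonglongrightarrow> g x"
  proof (rule AE_I2)
    fix x
    have "eventually (\<lambda>n. a n \<le> x) sequentially" "eventually (\<lambda>n. x \<le> b n) sequentially"
      using a b by (auto simp: filterlim_at_top filterlim_at_bot)
    then have "eventually (\<lambda>n. indicat_real {a n..b n} x *\<^sub>R g x = g x) sequentially"
      by eventually_elim auto
    then show "(\<lambda>n. indicat_real {a n..b n} x *\<^sub>R g x) \<longlonglongrightarrow> g x" by (rule tendsto_eventually)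
  qed
  show "AE x in lborel. norm (indicat_real {a n..b n} x *\<^sub>R g x) \<le> \<bar>g x\<bar>" for n
    by (rule AE_I2) (auto simp: indicator_def)
qed

text \<open>An integrable function need not tend to 0, but the set where its modulus is at least
  \<open>e\<close> has finite measure and so contains no half line.\<close>

lemma integrable_small_values:
  fixes f :: "real \<Rightarrow> real"
  assumes f: "integrable lborel f" and e: "e > 0"
  shows "\<exists>x\<ge>N. \<bar>f x\<bar> < e" and "\<exists>x\<le>N. \<bar>f x\<bar> < e"
proof -
  have *: False if S: "S \<in> sets borel" "emeasure lborel S = \<infinity>" and ge: "\<And>x. x \<in> S \<Longrightarrow> \<bar>f x\<bar> \<ge> e" for S
  proof -
    have "integrable lborel (\<lambda>x. e * indicat_real S x)"
    proof (rule Bochner_Integration.integrable_bound[OF f])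
      show "(\<lambda>x. e * indicat_real S x) \<in> borel_measurable lborel" using S by simp
      show "AE x in lborel. norm (e * indicat_real S x) \<le> norm (f x)"
        using ge e by (intro AE_I2) (auto simp: indicator_def)
    qed
    then have "integrable lborel (indicat_real S)" using e by simp
    then have "emeasure lborel S < \<infinity>" using S by (simp add: integrable_indicator_iff)
    then show False using S by simp
  qed
  have inf: "emeasure lborel S = \<infinity>" if "\<And>n::nat. {N n..N n + real n} \<subseteq> S" "S \<in> sets borel" for N :: "nat \<Rightarrow> real" and S
  proof (rule ccontr)
    assume "emeasure lborel S \<noteq> \<infinity>"
    then have "emeasure lborel S < top" by (simp add: top.not_eq_extremum)
    then obtain n where n: "emeasure lborel S < of_nat n" using ennreal_Ex_less_of_nat by blast
    have "emeasure lborel {N n..N n + real n} \<le> emeasure lborel S"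
      using that by (intro emeasure_mono) auto
    then show False using n by (simp add: ennreal_of_nat_eq_real_of_nat)
  qed
  show "\<exists>x\<ge>N. \<bar>f x\<bar> < e"
  proof (rule ccontr)
    assume "\<not> ?thesis"
    then have "\<And>x. x \<in> {N..} \<Longrightarrow> e \<le> \<bar>f x\<bar>" by auto
    then show False using *[of "{N..}"] inf[of "\<lambda>n. N" "{N..}"] by auto
  qed
  show "\<exists>x\<le>N. \<bar>f x\<bar> < e"
  proof (rule ccontr)
    assume "\<not> ?thesis"
    then have "\<And>x. x \<in> {..N} \<Longrightarrow> e \<le> \<bar>f x\<bar>" by auto
    then show False using *[of "{..N}"] inf[of "\<lambda>n. N - real n" "{..N}"] by auto
  qed
qed

text \<open>Endpoints along which boundary terms disappear; integration by parts over the line is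
  done on such intervals \<open>{a n..b n}\<close>.\<close>

lemma integrable_small_seq:
  fixes f :: "real \<Rightarrow> real"
  assumes f: "integrable lborel f"
  obtains a b where "filterlim a at_bot sequentially" "filterlim b at_top sequentially"
    "(\<lambda>n. f (a n)) \<longlonglongrightarrow> 0" "(\<lambda>n. f (b n)) \<longlonglongrightarrow> 0" "\<And>n. a n \<le> b n" "\<And>n. a n \<le> - real n" "\<And>n. real n \<le> b n"
proof -
  have "\<forall>n. \<exists>x. x \<ge> real n \<and> \<bar>f x\<bar> < 1 / real (Suc n)" using integrable_small_values(1)[OF f] by simp
  then obtain b where b: "\<And>n. b n \<ge> real n" "\<And>n. \<bar>f (b n)\<bar> < 1 / real (Suc n)" by metis
  have "\<forall>n. \<exists>x. x \<le> - real n \<and> \<bar>f x\<bar> < 1 / real (Suc n)" using integrable_small_values(2)[OF f] by simp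
  then obtain a where a: "\<And>n. a n \<le> - real n" "\<And>n. \<bar>f (a n)\<bar> < 1 / real (Suc n)" by metis
  show ?thesis
  proof
    have l: "(\<lambda>n. 1 / real (Suc n)) \<longlonglongrightarrow> 0" by (rule lim_1_over_n[THEN LIMSEQ_Suc])
    show "(\<lambda>n. f (a n)) \<longlonglongrightarrow> 0" by (rule tendsto_rabs_zero_cancel, rule tendsto_sandwich[OF _ _ tendsto_const l])
        (use a(2) less_imp_le in \<open>auto intro!: always_eventually\<close>)
    show "(\<lambda>n. f (b n)) \<longlonglongrightarrow> 0" by (rule tendsto_rabs_zero_cancel, rule tendsto_sandwich[OF _ _ tendsto_const l])
        (use b(2) less_imp_le in \<open>auto intro!: always_eventually\<close>)
    show "filterlim b at_top sequentially"
      by (rule filterlim_at_top_mono[OF filterlim_real_sequentially]) (use b(1) in auto)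
    have "filterlim (\<lambda>n. - a n) at_top sequentially"
      by (rule filterlim_at_top_mono[OF filterlim_real_sequentially]) (use a(1) in \<open>auto intro!: always_eventually simp: le_minus_iff\<close>)
    then show "filterlim a at_bot sequentially" by (simp add: filterlim_uminus_at_top)
    show "a n \<le> - real n" "real n \<le> b n" for n using a b by auto
    show "a n \<le> b n" for n using a(1)[of n] b(1)[of n] by linarith
  qed
qed

lemma AC_integral_zero:
  assumes "AC f g" "integrable lborel f" "integrable lborel g"
  shows "(\<integral>x. g x \<partial>lborel) = 0"
proof -
  obtain a b where ab: "filterlim a at_bot sequentially" "filterlim b at_top sequentially"
    "(\<lambda>n. f (a n)) \<longlonglongrightarrow> 0" "(\<lambda>n. f (b n)) \<longlonglongrightarrow> 0" "\<And>n. a n \<le> b n"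
    using integrable_small_seq[OF assms(2)] by metis
  have "(\<lambda>n. LINT x:{a n..b n}|lborel. g x) \<longlonglongrightarrow> (\<integral>x. g x \<partial>lborel)"
    by (rule set_integral_tendsto_line[OF assms(3) ab(1,2)])
  moreover have "(LINT x:{a n..b n}|lborel. g x) = f (b n) - f (a n)" for n
    using AC_eq[OF assms(1) ab(5)] by simp
  ultimately have "(\<lambda>n. f (b n) - f (a n)) \<longlonglongrightarrow> (\<integral>x. g x \<partial>lborel)" by simp
  moreover have "(\<lambda>n. f (b n) - f (a n)) \<longlonglongrightarrow> 0 - 0" by (intro tendsto_diff ab)
  ultimately show ?thesis using LIMSEQ_unique by fastforce
qed

lemma H1_by_parts:
  assumes "H1 f f'" "H1 g g'"
  shows "(\<integral>x. f' x * g x \<partial>lborel) = - (\<integral>x. f x * g' x \<partial>lborel)"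
proof -
  have i: "integrable lborel (\<lambda>x. f' x * g x)" "integrable lborel (\<lambda>x. f x * g' x)" "integrable lborel (\<lambda>x. f x * g x)"
    using assms by (auto simp: H1_def intro: sq_mult)
  have "(\<integral>x. f' x * g x + f x * g' x \<partial>lborel) = 0"
    using i by (intro AC_integral_zero[OF AC_mult]) (use assms in \<open>auto simp: H1_def\<close>)
  then show ?thesis using i by simp
qed

lemma H1_add: "H1 f f' \<Longrightarrow> H1 g g' \<Longrightarrow> H1 (\<lambda>x. f x + g x) (\<lambda>x. f' x + g' x)"
  by (simp add: H1_def AC_add sq_add)

lemma H1_cmult: "H1 f f' \<Longrightarrow> H1 (\<lambda>x. c * f x) (\<lambda>x. c * f' x)"
  by (simp add: H1_def AC_cmult sq_cmult)

lemma H1_diff: "H1 f f' \<Longrightarrow> H1 g g' \<Longrightarrow> H1 (\<lambda>x. f x - g x) (\<lambda>x. f' x - g' x)"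
  using H1_add[OF _ H1_cmult[of g g' "-1"], of f f'] by simp

lemma H1_zero: "H1 (\<lambda>x. 0) (\<lambda>x. 0)"
  by (simp add: H1_def sq_zero AC_def set_integrable_def)

lemma H1_bmult:
  assumes "AC m m'" "\<And>x. \<bar>m x\<bar> \<le> C" "\<And>x. \<bar>m' x\<bar> \<le> D" "H1 f f'"
  shows "H1 (\<lambda>x. m x * f x) (\<lambda>x. m' x * f x + m x * f' x)"
  unfolding H1_def
proof (intro conjI)
  show "AC (\<lambda>x. m x * f x) (\<lambda>x. m' x * f x + m x * f' x)"
    using assms by (intro AC_mult) (auto simp: H1_def)
  show "sq (\<lambda>x. m x * f x)"
    by (rule sq_bmult[OF AC_borel[OF assms(1)] assms(2) H1_sq[OF assms(4)]])
  show "sq (\<lambda>x. m' x * f x + m x * f' x)"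
    by (intro sq_add sq_bmult[OF AC_borel[OF assms(1)] assms(2) H1_sq'[OF assms(4)]]
        sq_bmult[OF AC_meas[OF assms(1)] assms(3) H1_sq[OF assms(4)]])
qed

text \<open>Integrate \<open>(f\<^sup>2)' = 2 f f' \<le> f\<^sup>2 + f'\<^sup>2\<close> from points
  far to the left at which \<open>f\<close> is almost 0.\<close>

lemma H1_sup_bound:
  assumes f: "H1 f f'"
  shows "(f x)\<^sup>2 \<le> (\<integral>x. (f x)\<^sup>2 \<partial>lborel) + (\<integral>x. (f' x)\<^sup>2 \<partial>lborel)"
proof -
  have A: "AC (\<lambda>x. f x * f x) (\<lambda>x. f' x * f x + f x * f' x)"
    using f by (intro AC_mult) (auto simp: H1_def)
  have i: "integrable lborel (\<lambda>x. (f x)\<^sup>2)" "integrable lborel (\<lambda>x. (f' x)\<^sup>2)"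
    using f by (auto simp: H1_def sq_def)
  obtain a b where ab: "(\<lambda>n. (f (a n))\<^sup>2) \<longlonglongrightarrow> 0" "\<And>n. a n \<le> - real n"
    using integrable_small_seq[OF i(1)] by metis
  obtain N where N: "real N \<ge> - x" using real_arch_simple by blast
  have "(f x)\<^sup>2 \<le> (f (a n))\<^sup>2 + ((\<integral>x. (f x)\<^sup>2 \<partial>lborel) + (\<integral>x. (f' x)\<^sup>2 \<partial>lborel))" if "n \<ge> N" for n
  proof -
    have "real N \<le> real n" using that by simp
    then have le: "a n \<le> x" using ab(2)[of n] N by linarith
    have "(f x)\<^sup>2 - (f (a n))\<^sup>2 = (LINT x:{a n..x}|lborel. f' x * f x + f x * f' x)"
      using AC_eq[OF A le] by (simp add: power2_eq_square)
    also have "\<dots> \<le> (\<integral>x. (f x)\<^sup>2 + (f' x)\<^sup>2 \<partial>lborel)"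
      unfolding set_lebesgue_integral_def
    proof (rule integral_mono)
      show "integrable lborel (\<lambda>xa. indicat_real {a n..x} xa *\<^sub>R (f' xa * f xa + f xa * f' xa))"
        using AC_int[OF A] by (simp add: set_integrable_def)
      show "integrable lborel (\<lambda>x. (f x)\<^sup>2 + (f' x)\<^sup>2)" using i by simp
      fix y
      have "2 * (f y * f' y) \<le> (f y)\<^sup>2 + (f' y)\<^sup>2" using sum_squares_bound[of "f y" "f' y"] by simp
      then show "indicat_real {a n..x} y *\<^sub>R (f' y * f y + f y * f' y) \<le> (f y)\<^sup>2 + (f' y)\<^sup>2"
        by (auto simp: indicator_def)
    qed
    also have "\<dots> = (\<integral>x. (f x)\<^sup>2 \<partial>lborel) + (\<integral>x. (f' x)\<^sup>2 \<partial>lborel)" using i by simp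
    finally show ?thesis by simp
  qed
  then have "(f x)\<^sup>2 \<le> 0 + ((\<integral>x. (f x)\<^sup>2 \<partial>lborel) + (\<integral>x. (f' x)\<^sup>2 \<partial>lborel))"
    by (intro LIMSEQ_le_const[OF tendsto_add[OF ab(1) tendsto_const]]) auto
  then show ?thesis by simp
qed

text \<open>Cauchy-Schwarz for \<open>f'\<close> against the indicator of the interval. It supplies
  the equicontinuity used in the passage to the limit.\<close>

lemma AC_Hoelder:
  assumes f: "AC f f'" and f': "sq f'" and xy: "x \<le> y"
  shows "(f y - f x)\<^sup>2 \<le> (y - x) * (LINT t:{x..y}|lborel. (f' t)\<^sup>2)"
proof -
  have ii: "(indicat_real {x..y} t)\<^sup>2 = indicat_real {x..y} t" for t
    by (simp add: indicator_def)
  have s: "sq (indicat_real {x..y})"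
    using xy by (simp add: sq_def ii)
  have s2: "sq (\<lambda>t. indicat_real {x..y} t * f' t)"
    by (rule sq_bmult[of _ 1]) (use f' in \<open>auto simp: indicator_def\<close>)
  have "f y - f x = (\<integral>t. indicat_real {x..y} t * (indicat_real {x..y} t * f' t) \<partial>lborel)"
    using AC_eq[OF f xy] by (simp add: set_lebesgue_integral_def mult.assoc[symmetric] ii flip: power2_eq_square)
  then have "(f y - f x)\<^sup>2 \<le> (\<integral>t. (indicat_real {x..y} t)\<^sup>2 \<partial>lborel) * (\<integral>t. (indicat_real {x..y} t * f' t)\<^sup>2 \<partial>lborel)"
    using Cauchy_Schwarz_integral[OF s s2] by simp
  also have "(\<integral>t. (indicat_real {x..y} t)\<^sup>2 \<partial>lborel) = y - x"
    using xy by (simp add: ii)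
  also have "(\<integral>t. (indicat_real {x..y} t * f' t)\<^sup>2 \<partial>lborel) = (LINT t:{x..y}|lborel. (f' t)\<^sup>2)"
    by (simp add: set_lebesgue_integral_def power_mult_distrib ii)
  finally show ?thesis .
qed

lemma integral_FTC_line:
  fixes F f :: "real \<Rightarrow> real"
  assumes d: "\<And>x. (F has_real_derivative f x) (at x)" and c: "continuous_on UNIV f" and i: "integrable lborel f"
    and t: "(F \<longlongrightarrow> A) at_top" and b: "(F \<longlongrightarrow> B) at_bot"
  shows "(\<integral>x. f x \<partial>lborel) = A - B"
proof -
  have 1: "filterlim (\<lambda>n. - real n) at_bot sequentially"
    by (rule filterlim_compose[OF filterlim_uminus_at_bot_at_top filterlim_real_sequentially])
  have "(\<lambda>n. LINT x:{- real n..real n}|lborel. f x) \<longlonglongrightarrow> (\<integral>x. f x \<partial>lborel)"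
    by (rule set_integral_tendsto_line[OF i 1 filterlim_real_sequentially])
  moreover have "(LINT x:{- real n..real n}|lborel. f x) = F (real n) - F (- real n)" for n
    using AC_eq[OF AC_C1[OF d c], of "- real n" "real n"] by simp
  ultimately have "(\<lambda>n. F (real n) - F (- real n)) \<longlonglongrightarrow> (\<integral>x. f x \<partial>lborel)" by simp
  moreover have "(\<lambda>n. F (real n) - F (- real n)) \<longlonglongrightarrow> A - B"
    by (intro tendsto_diff filterlim_compose[OF t filterlim_real_sequentially] filterlim_compose[OF b 1])
  ultimately show ?thesis by (rule LIMSEQ_unique)
qed

subsection \<open>The hyperbolic secant\<close>

definition sech :: "real \<Rightarrow> real" where "sech x = 1 / cosh x"

lemma sech_pos: "0 < sech x" and sech_le_1: "sech x \<le> 1"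
  by (simp_all add: sech_def cosh_real_ge_1)

lemma sech_minus [simp]: "sech (- x) = sech x" by (simp add: sech_def)
lemma sech_0 [simp]: "sech 0 = 1" by (simp add: sech_def)

lemma tanh_sq: "(tanh x)\<^sup>2 = 1 - (sech x)\<^sup>2"
proof -
  have h: "(cosh x)\<^sup>2 - (sinh x)\<^sup>2 = 1" by (rule hyperbolic_pythagoras)
  have "cosh x \<noteq> 0" using cosh_real_pos[of x] by simp
  moreover have "(tanh x)\<^sup>2 = ((cosh x)\<^sup>2 - 1) / (cosh x)\<^sup>2" using h by (simp add: tanh_def power_divide)
  ultimately show ?thesis by (simp add: sech_def power_divide diff_divide_distrib)
qed

lemma abs_tanh_le_1: "\<bar>tanh x\<bar> \<le> (1::real)"
  using tanh_real_bounds[of x] by auto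

lemma DERIV_sech [THEN DERIV_chain2, derivative_intros]:
  "(sech has_field_derivative - (sech x * tanh x)) (at x within S)"
proof -
  have "cosh x \<noteq> 0" using cosh_real_pos[of x] by simp
  then show ?thesis unfolding sech_def[abs_def]
    by (auto intro!: derivative_eq_intros simp: tanh_def power2_eq_square)
qed

lemma DERIV_tanh_sech: "(tanh has_field_derivative (sech x)\<^sup>2) (at x within S)"
  using tanh_sq[of x] cosh_real_pos[of x] by (auto intro!: derivative_eq_intros)

text \<open>Derivatives of \<open>tanh\<close> are wanted as \<open>sech\<^sup>2\<close>, so this
  rule takes the place of the one that yields \<open>1 - tanh\<^sup>2\<close>; the later polynomial
  identities would otherwise mix both forms.\<close>

lemmas DERIV_tanh_sech' [derivative_intros] = DERIV_tanh_sech[THEN DERIV_chain2]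
declare has_field_derivative_tanh [THEN DERIV_chain2, derivative_intros del]

lemma continuous_on_sech [continuous_intros]:
  "continuous_on S f \<Longrightarrow> continuous_on S (\<lambda>x. sech (f x))"
  unfolding sech_def by (intro continuous_intros) (auto simp: cosh_real_pos less_imp_neq[THEN not_sym])

lemma continuous_on_tanh_real [continuous_intros]:
  fixes f :: "'a::topological_space \<Rightarrow> real"
  shows "continuous_on S f \<Longrightarrow> continuous_on S (\<lambda>x. tanh (f x))"
  by (intro continuous_on_tanh) (auto simp: cosh_real_pos less_imp_neq[THEN not_sym])

lemma borel_sech [measurable]: "sech \<in> borel_measurable borel"
  by (rule borel_measurable_continuous_onI) (intro continuous_intros)

lemma borel_tanh [measurable]: "(tanh :: real \<Rightarrow> real) \<in> borel_measurable borel"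
  by (rule borel_measurable_continuous_onI) (intro continuous_intros)

lemma integrable_FTC_nonneg:
  fixes F f :: "real \<Rightarrow> real"
  assumes d: "\<And>x. (F has_real_derivative f x) (at x)" and c: "continuous_on UNIV f" and nn: "\<And>x. 0 \<le> f x"
    and t: "(F \<longlongrightarrow> A) at_top" and b: "(F \<longlongrightarrow> B) at_bot"
  shows "integrable lborel f"
proof -
  have "set_integrable lborel (einterval (-\<infinity>) \<infinity>) f"
  proof (rule interval_integral_FTC_nonneg(1)[where F=F and A=B and B=A])
    show "((F \<circ> real_of_ereal) \<longlongrightarrow> B) (at_right (-\<infinity>))" "((F \<circ> real_of_ereal) \<longlongrightarrow> A) (at_left \<infinity>)"
      using t b by (simp_all add: ereal_tendsto_simps)
    show "\<And>x. isCont f x" using c by (simp add: continuous_on_eq_continuous_at)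
  qed (use d nn in auto)
  then show ?thesis by (simp add: set_integrable_def)
qed

lemma sech_le_exp: "sech x \<le> 2 * exp (- \<bar>x\<bar>)"
proof -
  have "exp \<bar>x\<bar> / 2 \<le> cosh \<bar>x\<bar>" by (simp add: cosh_def)
  then have "exp \<bar>x\<bar> \<le> 2 * cosh x" by simp
  then show ?thesis using cosh_real_pos[of x] by (simp add: sech_def exp_minus field_simps)
qed

lemma exp_le_sech: "exp (- \<bar>x\<bar>) \<le> sech x"
proof -
  have "cosh \<bar>x\<bar> \<le> exp \<bar>x\<bar>" by (simp add: cosh_def)
  then have "cosh x \<le> exp \<bar>x\<bar>" by simp
  then show ?thesis using cosh_real_pos[of x] by (simp add: sech_def exp_minus field_simps)
qed

text \<open>Half of the exponential decay pays for the polynomial factor: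
  \<open>x\<^sup>2 \<le> 16 exp (\<bar>x\<bar>/2)\<close> gives 17, and
  \<open>sech x \<le> 2 exp (- \<bar>x\<bar>)\<close> doubles it.\<close>

lemma sech_decay: "(1 + x\<^sup>2) * sech x \<le> 34 * sech (x/2)"
proof -
  have 1: "\<bar>x\<bar> / 4 \<le> exp (\<bar>x\<bar>/4)" using exp_ge_add_one_self[of "\<bar>x\<bar>/4"] by linarith
  have "(\<bar>x\<bar> / 4)\<^sup>2 \<le> (exp (\<bar>x\<bar>/4))\<^sup>2" by (rule power_mono[OF 1]) simp
  also have "(exp (\<bar>x\<bar>/4))\<^sup>2 = exp (\<bar>x\<bar>/2)" by (simp add: power2_eq_square mult_exp_exp)
  finally have 2: "x\<^sup>2 \<le> 16 * exp (\<bar>x\<bar>/2)" by (simp add: power_divide)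
  have "1 \<le> exp (\<bar>x\<bar>/2)" by simp
  with 2 have "1 + x\<^sup>2 \<le> 17 * exp (\<bar>x\<bar>/2)" by linarith
  then have "(1 + x\<^sup>2) * sech x \<le> (17 * exp (\<bar>x\<bar>/2)) * (2 * exp (- \<bar>x\<bar>))"
    using sech_pos[of x] by (intro mult_mono sech_le_exp) auto
  also have "\<dots> = 34 * exp (- \<bar>x/2\<bar>)" by (simp add: mult_exp_exp)
  also have "\<dots> \<le> 34 * sech (x/2)" using exp_le_sech[of "x/2"] by simp
  finally show ?thesis .
qed

lemma tendsto_tanh_scaled:
  assumes "d > (0::real)"
  shows "((\<lambda>x. tanh (d * x)) \<longlongrightarrow> 1) at_top" "((\<lambda>x. tanh (d * x)) \<longlongrightarrow> -1) at_bot"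
proof -
  have "filterlim (\<lambda>x. d * x) at_top at_top" 
    by (rule filterlim_tendsto_pos_mult_at_top[OF tendsto_const assms filterlim_ident])
  then show "((\<lambda>x. tanh (d * x)) \<longlongrightarrow> 1) at_top" by (rule filterlim_compose[OF tanh_real_at_top])
  have "filterlim (\<lambda>x. d * x) at_bot at_bot" 
    by (rule filterlim_tendsto_pos_mult_at_bot[OF tendsto_const assms filterlim_ident])
  then show "((\<lambda>x. tanh (d * x)) \<longlongrightarrow> -1) at_bot" by (rule filterlim_compose[OF tanh_real_at_bot])
qed

lemma sech_scaled:
  assumes d: "d > 0"
  shows "integrable lborel (\<lambda>x. (sech (d * x))\<^sup>2)" "(\<integral>x. (sech (d * x))\<^sup>2 \<partial>lborel) = 2 / d"
proof -
  have D: "((\<lambda>x. tanh (d * x) / d) has_real_derivative (sech (d * x))\<^sup>2) (at x)" for x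
    using d by (auto intro!: derivative_eq_intros)
  have c: "continuous_on UNIV (\<lambda>x. (sech (d * x))\<^sup>2)" by (intro continuous_intros)
  have t: "((\<lambda>x. tanh (d * x) / d) \<longlongrightarrow> 1 / d) at_top" "((\<lambda>x. tanh (d * x) / d) \<longlongrightarrow> -1 / d) at_bot"
    by (intro tendsto_divide tendsto_tanh_scaled[OF d] tendsto_const; use d in simp)+
  show i: "integrable lborel (\<lambda>x. (sech (d * x))\<^sup>2)"
    by (rule integrable_FTC_nonneg[OF D c _ t]) simp
  show "(\<integral>x. (sech (d * x))\<^sup>2 \<partial>lborel) = 2 / d"
    using integral_FTC_line[OF D c i t] by simp
qed

lemma sech2_int: "integrable lborel (\<lambda>x. (sech x)\<^sup>2)" "(\<integral>x. (sech x)\<^sup>2 \<partial>lborel) = 2"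
  using sech_scaled[of 1] by simp_all

lemma sq_sech_scaled: "d > 0 \<Longrightarrow> sq (\<lambda>x. sech (d * x))"
  using sech_scaled(1)[of d] by (simp add: sq_def)

lemma sq_sech_poly:
  assumes "m \<in> borel_measurable borel" "\<And>x. \<bar>m x\<bar> \<le> C * (1 + x\<^sup>2)"
  shows "sq (\<lambda>x. m x * sech x)"
proof (rule sq_bound[OF _ sq_sech_scaled[of "1/2"]])
  show "(\<lambda>x. m x * sech x) \<in> borel_measurable borel" using assms(1) by measurable
  fix x
  have "0 \<le> C" using assms(2)[of 0] by simp
  have "\<bar>m x * sech x\<bar> \<le> C * (1 + x\<^sup>2) * sech x"
    unfolding abs_mult using assms(2)[of x] sech_pos[of x] by (simp add: mult_right_mono)
  also have "\<dots> \<le> C * (34 * sech (x/2))"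
    using mult_left_mono[OF sech_decay[of x] \<open>0 \<le> C\<close>] by (simp add: mult.assoc)
  finally show "\<bar>m x * sech x\<bar> \<le> (C * 34) * \<bar>sech (1/2 * x)\<bar>" using sech_pos[of "x/2"] by simp
qed simp

lemma sech4_int: "integrable lborel (\<lambda>x. (sech x)^4)" "(\<integral>x. (sech x)^4 \<partial>lborel) = 4/3"
proof -
  have D: "((\<lambda>x. tanh x - (tanh x)^3/3) has_real_derivative (sech x)^4) (at x)" for x
  proof -
    have "((\<lambda>x. tanh x - (tanh x)^3/3) has_real_derivative (sech x)\<^sup>2 - (tanh x)\<^sup>2 * (sech x)\<^sup>2) (at x)"
      by (auto intro!: derivative_eq_intros simp: power2_eq_square)
    moreover have "(sech x)\<^sup>2 - (tanh x)\<^sup>2 * (sech x)\<^sup>2 = (sech x)^4"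
      unfolding tanh_sq by (simp add: algebra_simps power2_eq_square eval_nat_numeral)
    ultimately show ?thesis by simp
  qed
  have c: "continuous_on UNIV (\<lambda>x. (sech x)^4)" by (intro continuous_intros)
  have t: "((\<lambda>x. tanh x - (tanh x)^3/3) \<longlongrightarrow> 1 - 1^3/(3::real)) at_top" "((\<lambda>x. tanh x - (tanh x)^3/3) \<longlongrightarrow> -1 - (-1)^3/(3::real)) at_bot"
    by (intro tendsto_intros tanh_real_at_top tanh_real_at_bot; simp)+
  show i: "integrable lborel (\<lambda>x. (sech x)^4)"
    by (rule integrable_FTC_nonneg[OF D c _ t]) simp
  show "(\<integral>x. (sech x)^4 \<partial>lborel) = 4/3"
    using integral_FTC_line[OF D c i t] by simp
qed

subsection \<open>Positivity of the energy form\<close>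

lemma AC_reflect:
  assumes "AC f g" shows "AC (\<lambda>x. f (- x)) (\<lambda>x. - g (- x))"
proof -
  have e: "indicat_real {a..b} x *\<^sub>R g (- x) = (\<lambda>y. indicat_real {-b..-a} y *\<^sub>R g y) (0 + (-1) * x)" for a b x
    by (auto simp: indicator_def)
  have i: "set_integrable lborel {a..b} (\<lambda>x. g (- x))" for a b
    unfolding set_integrable_def e
    by (rule lborel_integrable_real_affine) (use AC_int[OF assms] in \<open>auto simp: set_integrable_def\<close>)
  have v: "(LINT x:{a..b}|lborel. g (- x)) = (LINT x:{-b..-a}|lborel. g x)" for a b
    unfolding set_lebesgue_integral_def e
    by (subst lborel_integral_real_affine[where c="-1" and t=0 and f="\<lambda>y. indicat_real {-b..-a} y *\<^sub>R g y"]) simp_all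
  have [measurable]: "g \<in> borel_measurable borel" by (rule AC_meas[OF assms])
  show ?thesis unfolding AC_def
  proof (intro conjI allI impI)
    show "(\<lambda>x. - g (- x)) \<in> borel_measurable borel" by measurable
    show "set_integrable lborel {a..b} (\<lambda>x. - g (- x))" for a b
      using i set_integrable_mult_right[of "-1", OF i] by simp
    fix a b :: real assume "a \<le> b"
    then show "f (- b) - f (- a) = (LINT x:{a..b}|lborel. - g (- x))"
      using AC_eq[OF assms, of "-b" "-a"] by (simp add: set_integral_uminus[OF i] v)
  qed
qed

lemma integral_reflect_UNIV:
  fixes f :: "real \<Rightarrow> real"
  shows "(\<integral>x. f (- x) \<partial>lborel) = (\<integral>x. f x \<partial>lborel)"
  using lborel_integral_real_affine[of "-1" f 0] by simp

lemma integrable_reflect_UNIV: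
  fixes f :: "real \<Rightarrow> real"
  shows "integrable lborel f \<Longrightarrow> integrable lborel (\<lambda>x. f (- x))"
  using lborel_integrable_real_affine[of f "-1" 0] by simp

lemma integral_odd:
  fixes f :: "real \<Rightarrow> real"
  shows "(\<And>x. f (- x) = - f x) \<Longrightarrow> (\<integral>x. f x \<partial>lborel) = 0"
  using integral_reflect_UNIV[of f] by simp

lemma sq_reflect: "sq f \<Longrightarrow> sq (\<lambda>x. f (- x))"
  using integrable_reflect_UNIV[of "\<lambda>x. (f x)\<^sup>2"] by (auto simp: sq_def)

lemma H1_reflect: "H1 f g \<Longrightarrow> H1 (\<lambda>x. f (- x)) (\<lambda>x. - g (- x))"
  unfolding H1_def by (auto intro: AC_reflect sq_reflect sq_minus)

lemma antiderivative_UNIV: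
  fixes f :: "real \<Rightarrow> real"
  assumes "continuous_on UNIV f"
  obtains F where "\<And>x. (F has_real_derivative f x) (at x)"
proof -
  have "\<exists>F. \<forall>x :: real. (-\<infinity>::ereal) < x \<longrightarrow> x < (\<infinity>::ereal) \<longrightarrow> (F has_vector_derivative f x) (at x)"
    by (rule einterval_antiderivative) (use assms in \<open>auto simp: continuous_on_eq_continuous_at\<close>)
  then show ?thesis using that by (auto simp: has_real_derivative_iff_has_vector_derivative)
qed

text \<open>The product rule for \<open>AC\<close> lives on the whole line, whereas the weight
  needed on the half line has a pole to its left. Freezing the derivative at its value at 0 gives an
  extension that agrees for nonnegative arguments.\<close>

lemma AC_extend:
  fixes w w' :: "real \<Rightarrow> real"
  assumes d: "\<And>x. 0 \<le> x \<Longrightarrow> (w has_real_derivative w' x) (at x)" and c: "continuous_on {0..} w'"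
  obtains W W' where "AC W W'" "\<And>x. 0 \<le> x \<Longrightarrow> W x = w x" "\<And>x. 0 \<le> x \<Longrightarrow> W' x = w' x"
proof -
  define W' where "W' x = w' (max 0 x)" for x
  have cW: "continuous_on UNIV W'" unfolding W'_def
    by (rule continuous_on_compose2[OF c]) (auto intro!: continuous_intros)
  obtain F where F: "\<And>x. (F has_real_derivative W' x) (at x)" using antiderivative_UNIV[OF cW] by blast
  define W where "W x = F x - F 0 + w 0" for x
  have W: "(W has_real_derivative W' x) (at x)" for x
    unfolding W_def[abs_def] by (auto intro!: derivative_eq_intros F)
  have "W x = w x" if "0 \<le> x" for x
  proof (cases "x = 0")
    case False
    with that have "0 < x" by simp
    have "((\<lambda>x. W x - w x) has_real_derivative 0) (at y)" if "0 \<le> y" for y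
      using DERIV_diff[OF W[of y] d[OF that]] that by (simp add: W'_def)
    then have "W x - w x = W 0 - w 0"
      using \<open>0 < x\<close> by (intro DERIV_isconst_end[where f="\<lambda>x. W x - w x"])
        (auto intro!: continuous_at_imp_continuous_on DERIV_isCont[where D=0] simp: less_imp_le)
    then show ?thesis by (simp add: W_def)
  qed (simp add: W_def)
  then show ?thesis using that[of W W'] AC_C1[OF W cW] by (simp add: W'_def)
qed

text \<open>The function is the logarithmic derivative of \<open>sech'\<close>, which solves
  \<open>f'' = (1 - 6 sech\<^sup>2) f\<close>; this is the associated Riccati equation.\<close>

lemma coth_Riccati:
  assumes "(0::real) < y"
  shows "((\<lambda>y. 1 / tanh y - 2 * tanh y) has_real_derivative 1 - 6 * (sech y)\<^sup>2 - (1 / tanh y - 2 * tanh y)\<^sup>2) (at y)"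
proof -
  have t: "tanh y \<noteq> 0" using assms by simp
  have s: "(sech y)\<^sup>2 = 1 - (tanh y)\<^sup>2" by (simp add: tanh_sq)
  have "((\<lambda>y. 1 / tanh y - 2 * tanh y) has_real_derivative - (sech y)\<^sup>2 / (tanh y)\<^sup>2 - 2 * (sech y)\<^sup>2) (at y)"
    using t by (auto intro!: derivative_eq_intros simp: power2_eq_square)
  also have "- (sech y)\<^sup>2 / (tanh y)\<^sup>2 - 2 * (sech y)\<^sup>2 = 1 - 6 * (sech y)\<^sup>2 - (1 / tanh y - 2 * tanh y)\<^sup>2"
    unfolding s using t by (simp add: field_simps power2_eq_square)
  finally show ?thesis .
qed

text \<open>The kernel element \<open>sech'\<close> of \<open>- \<partial>\<^sup>2 + 1 - 6 sech\<^sup>2\<close> has no zero on the half line, so its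
  logarithmic derivative completes the square there; the shift by \<open>e\<close> avoids the pole at \<open>0\<close>.\<close>

lemma half_line_nonneg:
  assumes f: "H1 f f'" and f0: "f 0 = 0"
  shows "0 \<le> (LINT x:{0..}|lborel. (f' x)\<^sup>2 + (1 - 6 * (sech x)\<^sup>2) * (f x)\<^sup>2)"
proof -
  have i: "integrable lborel (\<lambda>x. (f x)\<^sup>2)" "integrable lborel (\<lambda>x. (f' x)\<^sup>2)"
    using f by (auto simp: H1_def sq_def)
  have [measurable]: "f \<in> borel_measurable borel" "f' \<in> borel_measurable borel" using f by (auto simp: H1_def sq_def)
  define E where "E x = (f' x)\<^sup>2 + (1 - 6 * (sech x)\<^sup>2) * (f x)\<^sup>2" for x
  have iE: "integrable lborel E"
  proof -
    have "integrable lborel (\<lambda>x. (1 - 6 * (sech x)\<^sup>2) * f x * f x)"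
    proof (rule sq_mult_b[where C=7])
      show "\<bar>1 - 6 * (sech x)\<^sup>2\<bar> \<le> 7" for x
        using power_mono[OF sech_le_1[of x] less_imp_le[OF sech_pos], of 2] zero_le_power2[of "sech x"]
        unfolding abs_le_iff one_power2 by (intro conjI; linarith)
    qed (use f in \<open>auto simp: H1_def\<close>)
    then show ?thesis unfolding E_def using i by (simp add: power2_eq_square mult.assoc)
  qed
  define E0 where "E0 x = indicat_real {0..} x * E x" for x
  have iE0: "integrable lborel E0"
    unfolding E0_def using integrable_mult_indicator[of "{0..}" lborel E] iE by simp
  \<comment> \<open>The shift costs \<open>6 * 2 * e\<close>: the potential carries the factor 6 and
    \<open>sech\<^sup>2\<close> is Lipschitz with constant 2.\<close>
  have key: "- 12 * e * (\<integral>x. (f x)\<^sup>2 \<partial>lborel) \<le> (\<integral>x. E0 x \<partial>lborel)" if e: "e > 0" for e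
  proof -
    define w where "w x = 1 / tanh (x + e) - 2 * tanh (x + e)" for x
    define w' where "w' x = 1 - 6 * (sech (x + e))\<^sup>2 - (w x)\<^sup>2" for x
    have dw: "(w has_real_derivative w' x) (at x)" if "0 \<le> x" for x
      using DERIV_shift[THEN iffD1, OF coth_Riccati, of x e] that e by (simp add: w_def[abs_def] w'_def)
    have cw': "continuous_on {0..} w'" unfolding w'_def w_def using e
      by (intro continuous_intros) auto
    obtain W W' where W: "AC W W'" "\<And>x. 0 \<le> x \<Longrightarrow> W x = w x" "\<And>x. 0 \<le> x \<Longrightarrow> W' x = w' x"
      using AC_extend[OF dw cw'] by blast
    have A: "AC (\<lambda>x. W x * (f x * f x)) (\<lambda>x. W' x * (f x * f x) + W x * (f' x * f x + f x * f' x))"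
      using f by (intro AC_mult W) (auto simp: H1_def)
    define C where "C = 1 / tanh e + 2"
    have wC: "\<bar>w x\<bar> \<le> C" if "0 \<le> x" for x
    proof -
      have "1 / tanh (x + e) \<le> 1 / tanh e" using that e by (intro divide_left_mono) auto
      moreover have "0 < 1 / tanh (x + e)" "0 < 1 / tanh e" using that e by simp_all
      ultimately show ?thesis using abs_tanh_le_1[of "x + e"] unfolding w_def C_def by linarith
    qed
    have pw: "W' x * (f x * f x) + W x * (f' x * f x + f x * f' x) \<le> E x + 12 * e * (f x)\<^sup>2" if "0 \<le> x" for x
    proof -
      have d: "\<bar>(sech (x + e))\<^sup>2 - (sech x)\<^sup>2\<bar> \<le> 2 * e"
      proof -
        have "\<exists>z. x < z \<and> z < x + e \<and> (sech (x + e))\<^sup>2 - (sech x)\<^sup>2 = (x + e - x) * (- 2 * (sech z)\<^sup>2 * tanh z)"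
          using e by (intro MVT2) (auto intro!: derivative_eq_intros simp: power2_eq_square)
        then obtain z where z: "(sech (x + e))\<^sup>2 - (sech x)\<^sup>2 = e * (- 2 * (sech z)\<^sup>2 * tanh z)" by auto
        have "(sech z)\<^sup>2 * \<bar>tanh z\<bar> \<le> 1 * 1"
          using power_mono[OF sech_le_1[of z] less_imp_le[OF sech_pos], of 2] by (intro mult_mono abs_tanh_le_1) auto
        then have "e * (2 * ((sech z)\<^sup>2 * \<bar>tanh z\<bar>)) \<le> e * 2" using e by (intro mult_left_mono) auto
        then show ?thesis unfolding z using e by (simp add: abs_mult mult_ac)
      qed
      \<comment> \<open>By the Riccati equation the derivative of \<open>w f\<^sup>2\<close> falls
        short of the shifted energy density by the square \<open>(f' - w f)\<^sup>2\<close>.\<close>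
      have "W' x * (f x * f x) + W x * (f' x * f x + f x * f' x)
          = (f' x)\<^sup>2 + (1 - 6 * (sech (x + e))\<^sup>2) * (f x)\<^sup>2 - (f' x - w x * f x)\<^sup>2"
        using that by (simp add: W w'_def power2_eq_square algebra_simps)
      also have "\<dots> \<le> (f' x)\<^sup>2 + (1 - 6 * (sech (x + e))\<^sup>2) * (f x)\<^sup>2" by simp
      also have "(1 - 6 * (sech (x + e))\<^sup>2) * (f x)\<^sup>2 \<le> (1 - 6 * (sech x)\<^sup>2 + 12 * e) * (f x)\<^sup>2"
        using d by (intro mult_right_mono) (auto simp: abs_le_iff)
      finally show ?thesis by (simp add: E_def algebra_simps)
    qed
    obtain b where b: "filterlim b at_top sequentially" "(\<lambda>n. (f (b n))\<^sup>2) \<longlonglongrightarrow> 0" "\<And>n. real n \<le> b n"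
      using integrable_small_seq[OF i(1)] by metis
    have l: "filterlim (\<lambda>n. - real n) at_bot sequentially"
      by (rule filterlim_compose[OF filterlim_uminus_at_bot_at_top filterlim_real_sequentially])
    have i12: "integrable lborel (\<lambda>x. E0 x + 12 * e * (f x)\<^sup>2)" using iE0 i by simp
    have "(\<lambda>n. LINT x:{- real n..b n}|lborel. E0 x + 12 * e * (f x)\<^sup>2) \<longlonglongrightarrow> (\<integral>x. E0 x + 12 * e * (f x)\<^sup>2 \<partial>lborel)"
      by (rule set_integral_tendsto_line[OF i12 l b(1)])
    moreover have "- (C * (f (b n))\<^sup>2) \<le> (LINT x:{- real n..b n}|lborel. E0 x + 12 * e * (f x)\<^sup>2)" for n
    proof -
      have bn: "0 \<le> b n" using b(3)[of n] by linarith
      \<comment> \<open>The contribution at 0 vanishes because \<open>f 0 = 0\<close>; the one at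
        \<open>b n\<close> tends to 0 because \<open>w\<close> is bounded by
        \<open>C\<close>.\<close>
      have "- (C * (f (b n))\<^sup>2) \<le> W (b n) * (f (b n) * f (b n)) - W 0 * (f 0 * f 0)"
        using mult_right_mono[of "-C" "w (b n)" "(f (b n))\<^sup>2"] wC[OF bn] bn by (simp add: W f0 power2_eq_square abs_le_iff)
      also have "\<dots> = (LINT x:{0..b n}|lborel. W' x * (f x * f x) + W x * (f' x * f x + f x * f' x))"
        by (rule AC_eq[OF A bn])
      \<comment> \<open>To the left of 0 the new integrand is \<open>12 * e * (f x)\<^sup>2\<close>,
        so enlarging the interval only increases the integral.\<close>
      also have "\<dots> \<le> (LINT x:{- real n..b n}|lborel. E0 x + 12 * e * (f x)\<^sup>2)"
        unfolding set_lebesgue_integral_def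
      proof (rule integral_mono)
        show "integrable lborel (\<lambda>x. indicat_real {0..b n} x *\<^sub>R (W' x * (f x * f x) + W x * (f' x * f x + f x * f' x)))"
          using AC_int[OF A] by (simp add: set_integrable_def)
        show "integrable lborel (\<lambda>x. indicat_real {- real n..b n} x *\<^sub>R (E0 x + 12 * e * (f x)\<^sup>2))"
          by (rule integrable_mult_indicator[OF _ i12]) simp
        show "indicat_real {0..b n} x *\<^sub>R (W' x * (f x * f x) + W x * (f' x * f x + f x * f' x))
            \<le> indicat_real {- real n..b n} x *\<^sub>R (E0 x + 12 * e * (f x)\<^sup>2)" for x
          using pw[of x] e by (auto simp: indicator_def E0_def)
      qed
      finally show ?thesis .
    qed
    ultimately have "- (C * 0) \<le> (\<integral>x. E0 x + 12 * e * (f x)\<^sup>2 \<partial>lborel)"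
      by (intro LIMSEQ_le[OF tendsto_minus[OF tendsto_mult[OF tendsto_const b(2)]]]) auto
    then show ?thesis using iE0 i by simp
  qed
  have "0 \<le> (\<integral>x. E0 x \<partial>lborel)"
  proof (rule field_le_epsilon)
    fix e :: real assume e: "e > 0"
    define N where "N = (\<integral>x. (f x)\<^sup>2 \<partial>lborel)"
    have N: "0 \<le> N" by (simp add: N_def)
    have "- 12 * (e / (12 * (N + 1))) * N \<le> (\<integral>x. E0 x \<partial>lborel)"
      using key[OF divide_pos_pos[OF e, of "12 * (N + 1)"]] N by (simp add: N_def[symmetric])
    moreover have "12 * (e / (12 * (N + 1))) * N \<le> e"
      using e N by (simp add: field_simps)
    ultimately show "0 \<le> (\<integral>x. E0 x \<partial>lborel) + e" by linarith
  qed
  then show ?thesis by (simp add: set_lebesgue_integral_def E0_def E_def)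
qed

lemma integrable_sech_form:
  assumes "sq f" "sq g"
  shows "integrable lborel (\<lambda>x. (sech x)\<^sup>2 * f x * g x)" "integrable lborel (\<lambda>x. sech x * f x * g x)"
    "integrable lborel (\<lambda>x. (1 - 6 * (sech x)\<^sup>2) * f x * g x)"
proof -
  have s: "\<bar>(sech x)\<^sup>2\<bar> \<le> 1" "\<bar>sech x\<bar> \<le> 1" for x
    using power_mono[OF sech_le_1[of x] less_imp_le[OF sech_pos], of 2] sech_le_1[of x] sech_pos[of x] by simp_all
  show 1: "integrable lborel (\<lambda>x. (sech x)\<^sup>2 * f x * g x)" "integrable lborel (\<lambda>x. sech x * f x * g x)"
    by (rule sq_mult_b[OF assms _ s(1)], measurable) (rule sq_mult_b[OF assms _ s(2)], measurable)
  have "integrable lborel (\<lambda>x. f x * g x - 6 * ((sech x)\<^sup>2 * f x * g x))"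
    using sq_mult[OF assms] 1 by simp
  then show "integrable lborel (\<lambda>x. (1 - 6 * (sech x)\<^sup>2) * f x * g x)" by (simp add: algebra_simps)
qed

text \<open>A function vanishing at 0 is made of two half-line functions, and the left one is
  treated by reflection. One condition is enough because the operator has a single negative
  direction.\<close>

lemma H1_vanishing_nonneg:
  assumes f: "H1 f f'" and f0: "f 0 = 0"
  shows "0 \<le> (\<integral>x. (f' x)\<^sup>2 + (1 - 6 * (sech x)\<^sup>2) * (f x)\<^sup>2 \<partial>lborel)"
proof -
  define E where "E x = (f' x)\<^sup>2 + (1 - 6 * (sech x)\<^sup>2) * (f x)\<^sup>2" for x
  have iE: "integrable lborel E"
    unfolding E_def using integrable_sech_form(3)[of f f] f
    by (simp add: H1_def sq_def power2_eq_square mult.assoc)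
  have "0 \<le> (\<integral>x. indicat_real {0..} x * E x \<partial>lborel)"
    using half_line_nonneg[OF f f0] by (simp add: set_lebesgue_integral_def E_def)
  moreover have "0 \<le> (\<integral>x. indicat_real {0..} x * E (- x) \<partial>lborel)"
    using half_line_nonneg[OF H1_reflect[OF f]] f0 by (simp add: set_lebesgue_integral_def E_def)
  moreover have "(\<integral>x. indicat_real {0..} x * E (- x) \<partial>lborel) = (\<integral>x. indicat_real {..0} x * E x \<partial>lborel)"
    by (subst integral_reflect_UNIV[symmetric]) (simp add: indicator_def)
  moreover have "(\<integral>x. indicat_real {..0} x * E x \<partial>lborel) = (\<integral>x. indicat_real {..<0} x * E x \<partial>lborel)"
    by (rule integral_discrete_difference[where X="{0}"]) (auto simp: indicator_def)
  moreover have "(\<integral>x. E x \<partial>lborel) = (\<integral>x. indicat_real {..<0} x * E x + indicat_real {0..} x * E x \<partial>lborel)"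
    by (intro Bochner_Integration.integral_cong) (auto simp: indicator_def)
  moreover have "\<dots> = (\<integral>x. indicat_real {..<0} x * E x \<partial>lborel) + (\<integral>x. indicat_real {0..} x * E x \<partial>lborel)"
    using integrable_mult_indicator[of _ lborel E] iE by (intro Bochner_Integration.integral_add) auto
  ultimately show ?thesis by (simp add: E_def)
qed

text \<open>Half the derivative of \<open>s * sech (x / s)\<close> with respect to \<open>s\<close>
  at \<open>s = 1\<close>, hence, up to a factor, the velocity derivative of the first component of
  the wave in rescaled variables. In \<open>chi'\<close> and \<open>chi''\<close> below,
  \<open>tanh\<^sup>2\<close> has been eliminated.\<close>

definition chi :: "real \<Rightarrow> real" where "chi x = (sech x + x * sech x * tanh x) / 2"
definition chi' :: "real \<Rightarrow> real" where "chi' x = - (x * (sech x - 2 * (sech x)^3)) / 2"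
definition chi'' :: "real \<Rightarrow> real" where
  "chi'' x = - (sech x - 2 * (sech x)^3) / 2 + x * sech x * tanh x * (1 - 6 * (sech x)\<^sup>2) / 2"

lemma abs_le_poly: "\<bar>x\<bar> \<le> 1 + x\<^sup>2" for x :: real
  using sum_squares_bound[of "\<bar>x\<bar>" 1] zero_le_power2[of x] by simp

lemma sech_sq_le_1: "(sech x)\<^sup>2 \<le> 1"
  using power_mono[OF sech_le_1[of x] less_imp_le[OF sech_pos], of 2] by simp

lemma DERIV_chi: "(chi has_real_derivative chi' x) (at x)"
proof -
  have "(chi has_real_derivative (- (sech x * tanh x) + ((sech x + x * - (sech x * tanh x)) * tanh x + x * sech x * (sech x)\<^sup>2)) / 2) (at x)"
    unfolding chi_def[abs_def] by (auto intro!: derivative_eq_intros)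
  also have "(- (sech x * tanh x) + ((sech x + x * - (sech x * tanh x)) * tanh x + x * sech x * (sech x)\<^sup>2)) / 2
     = (- x * sech x * (tanh x)\<^sup>2 + x * (sech x)^3) / 2"
    by (simp add: algebra_simps power2_eq_square eval_nat_numeral)
  also have "\<dots> = chi' x" unfolding tanh_sq chi'_def by (simp add: algebra_simps power2_eq_square eval_nat_numeral)
  finally show ?thesis .
qed

lemma DERIV_chi': "(chi' has_real_derivative chi'' x) (at x)"
proof -
  have "(chi' has_real_derivative - ((sech x - 2 * (sech x)^3) + x * (- (sech x * tanh x) - 2 * (3 * (sech x)\<^sup>2 * - (sech x * tanh x)))) / 2) (at x)"
    unfolding chi'_def[abs_def] by (auto intro!: derivative_eq_intros simp: field_simps)
  also have "- ((sech x - 2 * (sech x)^3) + x * (- (sech x * tanh x) - 2 * (3 * (sech x)\<^sup>2 * - (sech x * tanh x)))) / 2 = chi'' x"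
    unfolding chi''_def by (simp add: algebra_simps add_divide_distrib diff_divide_distrib power2_eq_square eval_nat_numeral)
  finally show ?thesis .
qed

lemma sq_chi: "sq chi" and sq_chi': "sq chi'" and sq_chi'': "sq chi''"
proof -
  have a: "\<bar>x * tanh x\<bar> \<le> 1 + x\<^sup>2" for x :: real
    using mult_mono[OF abs_le_poly[of x] abs_tanh_le_1[of x]] by (simp add: abs_mult)
  have b: "\<bar>1 - 2 * (sech x)\<^sup>2\<bar> \<le> 1" for x
    using sech_sq_le_1[of x] zero_le_power2[of "sech x"] unfolding abs_le_iff by linarith
  have c: "\<bar>1 - 6 * (sech x)\<^sup>2\<bar> \<le> 5" for x
    using sech_sq_le_1[of x] zero_le_power2[of "sech x"] unfolding abs_le_iff by linarith
  have h: "\<bar>- p / 2 + q / 2\<bar> \<le> (\<bar>p\<bar> + \<bar>q\<bar>) / 2" for p q :: real by (simp add: abs_if)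
  have "sq (\<lambda>x. ((1 + x * tanh x) / 2) * sech x)"
  proof (rule sq_sech_poly[where C=1])
    show "\<bar>(1 + x * tanh x) / 2\<bar> \<le> 1 * (1 + x\<^sup>2)" for x :: real
    proof -
      have "\<bar>1 + x * tanh x\<bar> \<le> 1 + \<bar>x * tanh x\<bar>" using abs_triangle_ineq[of 1 "x * tanh x"] by simp
      also have "\<dots> \<le> 2 * (1 + x\<^sup>2)" using a[of x] zero_le_power2[of x] by argo
      finally show ?thesis by simp
    qed
  qed measurable
  then show "sq chi" by (rule back_subst[of sq]) (auto simp: chi_def[abs_def] fun_eq_iff algebra_simps)
  have "sq (\<lambda>x. (- x * (1 - 2 * (sech x)\<^sup>2) / 2) * sech x)"
  proof (rule sq_sech_poly[where C=1])
    show "\<bar>- x * (1 - 2 * (sech x)\<^sup>2) / 2\<bar> \<le> 1 * (1 + x\<^sup>2)" for x :: real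
    proof -
      have "\<bar>x\<bar> * \<bar>1 - 2 * (sech x)\<^sup>2\<bar> \<le> (1 + x\<^sup>2) * 1" by (rule mult_mono[OF abs_le_poly b]) auto
      moreover have "\<bar>- x * (1 - 2 * (sech x)\<^sup>2) / 2\<bar> = \<bar>x\<bar> * \<bar>1 - 2 * (sech x)\<^sup>2\<bar> / 2" by (simp add: abs_mult)
      ultimately show ?thesis using zero_le_power2[of x] by argo
    qed
  qed measurable
  then show "sq chi'" by (rule back_subst[of sq]) (auto simp: chi'_def[abs_def] fun_eq_iff algebra_simps power2_eq_square power3_eq_cube)
  have "sq (\<lambda>x. (- (1 - 2 * (sech x)\<^sup>2) / 2 + x * tanh x * (1 - 6 * (sech x)\<^sup>2) / 2) * sech x)"
  proof (rule sq_sech_poly[where C=3])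
    show "\<bar>- (1 - 2 * (sech x)\<^sup>2) / 2 + x * tanh x * (1 - 6 * (sech x)\<^sup>2) / 2\<bar> \<le> 3 * (1 + x\<^sup>2)" for x :: real
    proof -
      have "\<bar>x * tanh x * (1 - 6 * (sech x)\<^sup>2)\<bar> \<le> (1 + x\<^sup>2) * 5"
        unfolding abs_mult[of "x * tanh x"] by (rule mult_mono[OF a c]) auto
      moreover have "\<bar>- (1 - 2 * (sech x)\<^sup>2) / 2 + x * tanh x * (1 - 6 * (sech x)\<^sup>2) / 2\<bar>
          \<le> (\<bar>1 - 2 * (sech x)\<^sup>2\<bar> + \<bar>x * tanh x * (1 - 6 * (sech x)\<^sup>2)\<bar>) / 2"
        by (rule h)
      ultimately show ?thesis using b[of x] zero_le_power2[of x] by argo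
    qed
  qed measurable
  then show "sq chi''" by (rule back_subst[of sq]) (auto simp: chi''_def[abs_def] fun_eq_iff algebra_simps power2_eq_square power3_eq_cube)
qed

lemma continuous_on_chi'': "continuous_on S chi''"
  unfolding chi''_def[abs_def] by (intro continuous_intros)  auto

lemma continuous_on_chi': "continuous_on S chi'"
  unfolding chi'_def[abs_def] by (intro continuous_intros)  auto

lemma H1_chi: "H1 chi chi'" and H1_chi': "H1 chi' chi''"
  by (auto simp: H1_def sq_chi sq_chi' sq_chi'' intro!: AC_C1 DERIV_chi DERIV_chi' continuous_on_chi' continuous_on_chi'')

lemma chi_equation: "- chi'' x + (1 - 6 * (sech x)\<^sup>2) * chi x = sech x - 4 * (sech x)^3"
  unfolding chi_def chi''_def by (simp add: field_simps power2_eq_square eval_nat_numeral)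

lemma sq_sech: "sq sech" using sq_sech_scaled[of 1] by simp

lemma sq_sech_bounded:
  assumes "m \<in> borel_measurable borel" "\<And>x. \<bar>m x\<bar> \<le> C" shows "sq (\<lambda>x. m x * sech x)"
  by (rule sq_bmult[OF assms sq_sech])

lemma sq_sech_weight: "sq (\<lambda>x. sech x - 4 * (sech x)^3)" "sq (\<lambda>x. (sech x)\<^sup>2)" "sq (\<lambda>x. (sech x)^3)"
proof -
  show 1: "sq (\<lambda>x. (sech x)\<^sup>2)"
    using sq_sech_bounded[of sech 1] sech_le_1 sech_pos by (simp add: power2_eq_square less_imp_le)
  have "sq (\<lambda>x. (sech x)\<^sup>2 * sech x)"
    by (rule sq_sech_bounded[where C=1]) (use sech_sq_le_1 in auto)
  then show 3: "sq (\<lambda>x. (sech x)^3)" by (simp add: power2_eq_square power3_eq_cube)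
  show "sq (\<lambda>x. sech x - 4 * (sech x)^3)" by (intro sq_diff sq_cmult sq_sech 3)
qed

text \<open>Integration by parts moves both derivatives to \<open>chi\<close>, where
  \<open>chi_equation\<close> applies.\<close>

lemma form_chi:
  assumes f: "H1 f f'"
  shows "(\<integral>x. f' x * chi' x + (1 - 6 * (sech x)\<^sup>2) * f x * chi x \<partial>lborel) = (\<integral>x. f x * (sech x - 4 * (sech x)^3) \<partial>lborel)"
proof -
  have i: "integrable lborel (\<lambda>x. f' x * chi' x)" "integrable lborel (\<lambda>x. f x * chi'' x)"
    "integrable lborel (\<lambda>x. (1 - 6 * (sech x)\<^sup>2) * f x * chi x)"
    using f by (auto simp: H1_def intro!: sq_mult sq_chi sq_chi' sq_chi'' integrable_sech_form)
  have "(\<integral>x. f' x * chi' x + (1 - 6 * (sech x)\<^sup>2) * f x * chi x \<partial>lborel)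
      = (\<integral>x. (1 - 6 * (sech x)\<^sup>2) * f x * chi x - f x * chi'' x \<partial>lborel)"
    using H1_by_parts[OF f H1_chi'] i by simp
  also have "\<dots> = (\<integral>x. f x * (sech x - 4 * (sech x)^3) \<partial>lborel)"
    unfolding chi_equation[symmetric] by (simp add: algebra_simps)
  finally show ?thesis .
qed

text \<open>Adding multiples of \<open>sech\<^sup>2\<close> and \<open>sech^4\<close> turns the
  integrand into the exact derivative \<open>D'\<close>, whose antiderivative \<open>D\<close>
  decays; what is left is \<open>3/4 * 2 - 5/2 * 4/3\<close>.\<close>

lemma integral_chi: "(\<integral>x. chi x * (sech x - 4 * (sech x)^3) \<partial>lborel) = -11/6"
proof -
  define D where "D x = - x * (sech x)\<^sup>2 / 4 + x * (sech x)^4 / 2" for x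
  define D' where "D' x = chi x * (sech x - 4 * (sech x)^3) - 3/4 * (sech x)\<^sup>2 + 5/2 * (sech x)^4" for x
  have d: "(D has_real_derivative D' x) (at x)" for x
  proof -
    have "(D has_real_derivative - (sech x)\<^sup>2 / 4 - x * (2 * sech x * - (sech x * tanh x)) / 4
       + ((sech x)^4 / 2 + x * (4 * (sech x)^3 * - (sech x * tanh x)) / 2)) (at x)"
      unfolding D_def[abs_def] by (auto intro!: derivative_eq_intros simp: field_simps)
    also have "- (sech x)\<^sup>2 / 4 - x * (2 * sech x * - (sech x * tanh x)) / 4
       + ((sech x)^4 / 2 + x * (4 * (sech x)^3 * - (sech x * tanh x)) / 2) = D' x"
      unfolding D'_def chi_def by (simp add: algebra_simps add_divide_distrib diff_divide_distrib power2_eq_square eval_nat_numeral)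
    finally show ?thesis .
  qed
  have c: "continuous_on UNIV D'" unfolding D'_def chi_def by (intro continuous_intros) auto
  have i: "integrable lborel (\<lambda>x. chi x * (sech x - 4 * (sech x)^3))"
    by (intro sq_mult sq_chi sq_sech_weight)
  have "sq (\<lambda>x. x * sech x)" by (rule sq_sech_poly[of _ 1]) (auto simp: abs_le_poly)
  then have "integrable lborel (\<lambda>x. (x * sech x) * sech x)" "integrable lborel (\<lambda>x. (x * sech x) * (sech x)^3)"
    by (auto intro!: sq_mult sq_sech sq_sech_weight)
  then have "integrable lborel (\<lambda>x. - 1/4 * (x * sech x * sech x) + 1/2 * ((x * sech x) * (sech x)^3))" by simp
  then have iD: "integrable lborel D"
    by (rule back_subst[of "integrable lborel"]) (auto simp: fun_eq_iff D_def field_simps power2_eq_square eval_nat_numeral)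
  have iD': "integrable lborel D'" unfolding D'_def using i sech2_int(1) sech4_int(1) by simp
  have "(\<integral>x. D' x \<partial>lborel) = 0" by (rule AC_integral_zero[OF AC_C1[OF d c] iD iD'])
  moreover have "(\<integral>x. D' x \<partial>lborel) = (\<integral>x. chi x * (sech x - 4 * (sech x)^3) \<partial>lborel) - 3/4 * 2 + 5/2 * (4/3)"
    unfolding D'_def using i sech2_int sech4_int by simp
  ultimately show ?thesis by simp
qed

text \<open>One positive rank-one term removes the single negative direction: \<open>y = f - 2 f(0) chi\<close> vanishes
  at \<open>0\<close>, and what remains is a nonnegative quadratic form in three numbers.\<close>

lemma rank_one_nonneg:
  assumes f: "H1 f f'" and G: "sq G"
  shows "0 \<le> (\<integral>x. (G x)\<^sup>2 \<partial>lborel) + (\<integral>x. (f' x)\<^sup>2 + (1 - 6 * (sech x)\<^sup>2) * (f x)\<^sup>2 \<partial>lborel)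
     + 2 * (\<integral>x. f x * (sech x - 4 * (sech x)^3) + G x * (sech x)\<^sup>2 \<partial>lborel)\<^sup>2"
proof -
  \<comment> \<open>\<open>chi 0 = 1/2\<close>, so subtracting \<open>a\<close> times
    \<open>chi\<close> removes the value at 0.\<close>
  define a where "a = 2 * f 0"
  define y where "y x = f x - a * chi x" for x
  define y' where "y' x = f' x - a * chi' x" for x
  have y: "H1 y y'" unfolding y_def y'_def by (intro H1_diff H1_cmult f H1_chi)
  have y0: "y 0 = 0" by (simp add: y_def a_def chi_def)
  define w where "w x = sech x - 4 * (sech x)^3" for x
  define \<beta> where "\<beta> = (\<integral>x. y x * w x \<partial>lborel)"
  define \<gamma> where "\<gamma> = (\<integral>x. G x * (sech x)\<^sup>2 \<partial>lborel)"
  have w: "sq w" unfolding w_def by (rule sq_sech_weight)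
  have yw: "integrable lborel (\<lambda>x. y x * w x)" "integrable lborel (\<lambda>x. chi x * w x)"
    using y w by (auto simp: H1_def intro!: sq_mult sq_chi)
  have chiw: "(\<integral>x. chi x * w x \<partial>lborel) = -11/6" unfolding w_def by (rule integral_chi)
  have i: "integrable lborel (\<lambda>x. (y' x)\<^sup>2 + (1 - 6 * (sech x)\<^sup>2) * (y x)\<^sup>2)"
    "integrable lborel (\<lambda>x. y' x * chi' x + (1 - 6 * (sech x)\<^sup>2) * y x * chi x)"
    "integrable lborel (\<lambda>x. chi' x * chi' x + (1 - 6 * (sech x)\<^sup>2) * chi x * chi x)"
    using H1_sq[OF y] H1_sq'[OF y] unfolding power2_eq_square[of "y' _"] power2_eq_square[of "y _"] mult.assoc[symmetric]
    by (auto intro!: Bochner_Integration.integrable_add integrable_sech_form(3) sq_mult[of y'] sq_mult[of chi'] sq_chi sq_chi')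
  have "(\<integral>x. (f' x)\<^sup>2 + (1 - 6 * (sech x)\<^sup>2) * (f x)\<^sup>2 \<partial>lborel)
     = (\<integral>x. ((y' x)\<^sup>2 + (1 - 6 * (sech x)\<^sup>2) * (y x)\<^sup>2) + (2 * a * (y' x * chi' x + (1 - 6 * (sech x)\<^sup>2) * y x * chi x)
         + a\<^sup>2 * (chi' x * chi' x + (1 - 6 * (sech x)\<^sup>2) * chi x * chi x)) \<partial>lborel)"
    by (rule Bochner_Integration.integral_cong[OF refl]) (simp add: y_def y'_def algebra_simps power2_eq_square)
  also have "\<dots> = (\<integral>x. (y' x)\<^sup>2 + (1 - 6 * (sech x)\<^sup>2) * (y x)\<^sup>2 \<partial>lborel)
      + (2 * a * (\<integral>x. y' x * chi' x + (1 - 6 * (sech x)\<^sup>2) * y x * chi x \<partial>lborel)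
        + a\<^sup>2 * (\<integral>x. chi' x * chi' x + (1 - 6 * (sech x)\<^sup>2) * chi x * chi x \<partial>lborel))"
    using i by simp
  also have "\<dots> = (\<integral>x. (y' x)\<^sup>2 + (1 - 6 * (sech x)\<^sup>2) * (y x)\<^sup>2 \<partial>lborel) + (2 * a * \<beta> + a\<^sup>2 * (-11/6))"
    using form_chi[OF y] form_chi[OF H1_chi] chiw by (simp add: \<beta>_def w_def)
  finally have A: "(\<integral>x. (f' x)\<^sup>2 + (1 - 6 * (sech x)\<^sup>2) * (f x)\<^sup>2 \<partial>lborel) \<ge> 2 * a * \<beta> + a\<^sup>2 * (-11/6)"
    using H1_vanishing_nonneg[OF y y0] by simp
  have "\<gamma>\<^sup>2 \<le> (\<integral>x. (G x)\<^sup>2 \<partial>lborel) * (\<integral>x. ((sech x)\<^sup>2)\<^sup>2 \<partial>lborel)"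
    unfolding \<gamma>_def by (rule Cauchy_Schwarz_integral[OF G sq_sech_weight(2)])
  \<comment> \<open>The factor 3/4 is the reciprocal of
    \<open>\<integral>sech^4 = 4/3\<close>.\<close>
  then have B: "(\<integral>x. (G x)\<^sup>2 \<partial>lborel) \<ge> 3/4 * \<gamma>\<^sup>2" using sech4_int by (simp add: power_mult[symmetric])
  have "(\<integral>x. f x * w x + G x * (sech x)\<^sup>2 \<partial>lborel) = (\<integral>x. (y x * w x + a * (chi x * w x)) + G x * (sech x)\<^sup>2 \<partial>lborel)"
    by (simp add: y_def algebra_simps)
  also have "\<dots> = \<beta> - 11/6 * a + \<gamma>"
    using yw chiw sq_mult[OF G sq_sech_weight(2)] by (simp add: \<beta>_def \<gamma>_def)
  finally have C: "(\<integral>x. f x * w x + G x * (sech x)\<^sup>2 \<partial>lborel) = \<beta> - 11/6 * a + \<gamma>" .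
  \<comment> \<open>In the variables \<open>\<beta>\<close>, \<open>\<beta> - 11/6 * a\<close> and
    \<open>\<gamma>\<close> the form is a sum of two squares. It has a null direction along which
    the last square is not 0, so no constant below 2 would do here.\<close>
  have "3/4 * \<gamma>\<^sup>2 + (2 * a * \<beta> + a\<^sup>2 * (-11/6)) + 2 * (\<beta> - 11/6 * a + \<gamma>)\<^sup>2
     = 6/11 * \<beta>\<^sup>2 + 11/4 * (\<gamma> + 8/11 * (\<beta> - 11/6 * a))\<^sup>2"
    by (simp add: field_simps power2_eq_square)
  moreover have "0 \<le> 6/11 * \<beta>\<^sup>2 + 11/4 * (\<gamma> + 8/11 * (\<beta> - 11/6 * a))\<^sup>2" by simp
  ultimately show ?thesis using A B unfolding C[unfolded w_def] by linarith
qed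

subsection \<open>The forms of the reduced system\<close>

text \<open>A state \<open>(V, q)\<close> of the reduced system is stored together with its derivative, as the vector
  \<open>(V, V', q, q')\<close>.\<close>

definition H1_pairs :: "(real \<Rightarrow> real^4) set" where
  "H1_pairs = {u. H1 (\<lambda>x. u x $ 1) (\<lambda>x. u x $ 2) \<and> H1 (\<lambda>x. u x $ 3) (\<lambda>x. u x $ 4)}"

definition vec4 :: "real \<Rightarrow> real \<Rightarrow> real \<Rightarrow> real \<Rightarrow> real^4" where
  "vec4 a b c d = (\<chi> i. if i = 1 then a else if i = 2 then b else if i = 3 then c else d)"

lemma vec4_nth [simp]: "vec4 a b c d $ 1 = a" "vec4 a b c d $ 2 = b" "vec4 a b c d $ 3 = c" "vec4 a b c d $ 4 = d"
  by (simp_all add: vec4_def)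

lemma H1_pairs_H1:
  assumes "u \<in> H1_pairs"
  shows "H1 (\<lambda>x. u x $ 1) (\<lambda>x. u x $ 2)" "H1 (\<lambda>x. u x $ 3) (\<lambda>x. u x $ 4)"
  using assms by (auto simp: H1_pairs_def)

lemma H1_pairs_sq:
  assumes "u \<in> H1_pairs"
  shows "sq (\<lambda>x. u x $ 1)" "sq (\<lambda>x. u x $ 2)" "sq (\<lambda>x. u x $ 3)" "sq (\<lambda>x. u x $ 4)"
  using assms by (auto simp: H1_pairs_def H1_def)

lemma H1_pairs_add: "u \<in> H1_pairs \<Longrightarrow> v \<in> H1_pairs \<Longrightarrow> (\<lambda>x. u x + v x) \<in> H1_pairs"
  by (simp add: H1_pairs_def H1_add)

lemma H1_pairs_scale: "u \<in> H1_pairs \<Longrightarrow> (\<lambda>x. a *\<^sub>R u x) \<in> H1_pairs"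
  by (simp add: H1_pairs_def H1_cmult)

lemma H1_pairs_diff: "u \<in> H1_pairs \<Longrightarrow> v \<in> H1_pairs \<Longrightarrow> (\<lambda>x. u x - v x) \<in> H1_pairs"
  by (simp add: H1_pairs_def H1_diff)

lemma H1_pairs_zero: "(\<lambda>x. 0) \<in> H1_pairs"
  by (simp add: H1_pairs_def H1_zero)

lemma H1_pairs_sum: "finite S \<Longrightarrow> (\<And>j. j \<in> S \<Longrightarrow> b j \<in> H1_pairs) \<Longrightarrow> (\<lambda>x. \<Sum>j\<in>S. a j *\<^sub>R b j x) \<in> H1_pairs"
  by (induction S rule: finite_induct) (simp_all add: H1_pairs_zero H1_pairs_add H1_pairs_scale)

definition form :: "(real \<Rightarrow> real^4 \<Rightarrow> real^4 \<Rightarrow> real) \<Rightarrow> (real \<Rightarrow> real^4) \<Rightarrow> (real \<Rightarrow> real^4) \<Rightarrow> real" where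
  "form K u v = (\<integral>x. K x (u x) (v x) \<partial>lborel)"

text \<open>Bilinearity at each point and integrability on states are all that the linear algebra
  needs, so the rules for sums, multiples and differences are proved once for \<open>mass\<close>,
  \<open>shift\<close> and \<open>energy\<close>.\<close>

definition form_kernel :: "(real \<Rightarrow> real^4 \<Rightarrow> real^4 \<Rightarrow> real) \<Rightarrow> bool" where
  "form_kernel K \<longleftrightarrow> (\<forall>x. bilinear (K x)) \<and> (\<forall>u\<in>H1_pairs. \<forall>v\<in>H1_pairs. integrable lborel (\<lambda>x. K x (u x) (v x)))"

lemma form_kernel_integrable: "form_kernel K \<Longrightarrow> u \<in> H1_pairs \<Longrightarrow> v \<in> H1_pairs \<Longrightarrow> integrable lborel (\<lambda>x. K x (u x) (v x))"
  by (simp add: form_kernel_def)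

lemma form_add_left:
  assumes "form_kernel K" "u \<in> H1_pairs" "u' \<in> H1_pairs" "v \<in> H1_pairs"
  shows "form K (\<lambda>x. u x + u' x) v = form K u v + form K u' v"
  using assms by (simp add: form_def form_kernel_def bilinear_ladd)

lemma form_add_right:
  assumes "form_kernel K" "u \<in> H1_pairs" "u' \<in> H1_pairs" "v \<in> H1_pairs"
  shows "form K v (\<lambda>x. u x + u' x) = form K v u + form K v u'"
  using assms by (simp add: form_def form_kernel_def bilinear_radd)

lemma form_scale_left: "form_kernel K \<Longrightarrow> form K (\<lambda>x. a *\<^sub>R u x) v = a * form K u v"
  by (simp add: form_def form_kernel_def bilinear_lmul)

lemma form_scale_right: "form_kernel K \<Longrightarrow> form K v (\<lambda>x. a *\<^sub>R u x) = a * form K v u"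
  by (simp add: form_def form_kernel_def bilinear_rmul)

lemma form_diff_left:
  assumes "form_kernel K" "u \<in> H1_pairs" "u' \<in> H1_pairs" "v \<in> H1_pairs"
  shows "form K (\<lambda>x. u x - u' x) v = form K u v - form K u' v"
  using assms by (simp add: form_def form_kernel_def bilinear_lsub)

lemma form_diff_right:
  assumes "form_kernel K" "u \<in> H1_pairs" "u' \<in> H1_pairs" "v \<in> H1_pairs"
  shows "form K v (\<lambda>x. u x - u' x) = form K v u - form K v u'"
  using assms by (simp add: form_def form_kernel_def bilinear_rsub)

lemma form_sum_left:
  assumes K: "form_kernel K" and v: "v \<in> H1_pairs"
  shows "finite S \<Longrightarrow> (\<And>j. j \<in> S \<Longrightarrow> b j \<in> H1_pairs) \<Longrightarrow>
    form K (\<lambda>x. \<Sum>j\<in>S. a j *\<^sub>R b j x) v = (\<Sum>j\<in>S. a j * form K (b j) v)"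
proof (induction S rule: finite_induct)
  case empty
  then show ?case using K by (simp add: form_def form_kernel_def bilinear_lzero)
next
  case (insert j S)
  then show ?case using K v
    by (simp add: form_add_left form_scale_left H1_pairs_scale H1_pairs_sum)
qed

lemma form_sum_right:
  assumes K: "form_kernel K" and v: "v \<in> H1_pairs"
  shows "finite S \<Longrightarrow> (\<And>j. j \<in> S \<Longrightarrow> b j \<in> H1_pairs) \<Longrightarrow>
    form K v (\<lambda>x. \<Sum>j\<in>S. a j *\<^sub>R b j x) = (\<Sum>j\<in>S. a j * form K v (b j))"
proof (induction S rule: finite_induct)
  case empty
  then show ?case using K by (simp add: form_def form_kernel_def bilinear_rzero)
next
  case (insert j S)
  then show ?case using K v
    by (simp add: form_add_right form_scale_right H1_pairs_scale H1_pairs_sum)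
qed

text \<open>A mode with growth rate \<open>l\<close> satisfies \<open>l\<^sup>2 mass u v - 2 k l shift u v + energy u v = 0\<close> for all
  states \<open>v\<close>, where \<open>shift\<close> is the form of \<open>d/dx\<close>.\<close>

definition mass_kernel :: "real \<Rightarrow> real^4 \<Rightarrow> real^4 \<Rightarrow> real" where
  "mass_kernel x p q = p$1 * q$1 + p$3 * q$3"
definition shift_kernel :: "real \<Rightarrow> real^4 \<Rightarrow> real^4 \<Rightarrow> real" where
  "shift_kernel x p q = p$2 * q$1 + p$4 * q$3"
definition energy_kernel :: "real \<Rightarrow> real^4 \<Rightarrow> real^4 \<Rightarrow> real" where
  "energy_kernel x p q = p$2 * q$2 + p$1 * q$1 - 2 * ((sech x)\<^sup>2 * p$1 * q$1) + p$4 * q$4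
     + 2 * (sech x * p$4 * q$1 + sech x * p$1 * q$4)"

abbreviation "mass \<equiv> form mass_kernel"
abbreviation "shift \<equiv> form shift_kernel"
abbreviation "energy \<equiv> form energy_kernel"

lemma form_kernel_mass: "form_kernel mass_kernel"
  unfolding form_kernel_def
proof (intro conjI ballI allI)
  show "bilinear (mass_kernel x)" for x
    unfolding bilinear_def by (intro conjI allI linearI) (simp_all add: mass_kernel_def algebra_simps)
  fix u v assume "u \<in> H1_pairs" "v \<in> H1_pairs"
  then show "integrable lborel (\<lambda>x. mass_kernel x (u x) (v x))"
    unfolding mass_kernel_def by (intro Bochner_Integration.integrable_add sq_mult H1_pairs_sq)
qed

lemma form_kernel_shift: "form_kernel shift_kernel"
  unfolding form_kernel_def
proof (intro conjI ballI allI)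
  show "bilinear (shift_kernel x)" for x
    unfolding bilinear_def by (intro conjI allI linearI) (simp_all add: shift_kernel_def algebra_simps)
  fix u v assume "u \<in> H1_pairs" "v \<in> H1_pairs"
  then show "integrable lborel (\<lambda>x. shift_kernel x (u x) (v x))"
    unfolding shift_kernel_def by (intro Bochner_Integration.integrable_add sq_mult H1_pairs_sq)
qed

lemma form_kernel_energy: "form_kernel energy_kernel"
  unfolding form_kernel_def
proof (intro conjI ballI allI)
  show "bilinear (energy_kernel x)" for x
    unfolding bilinear_def by (intro conjI allI linearI) (simp_all add: energy_kernel_def algebra_simps)
  fix u v assume "u \<in> H1_pairs" "v \<in> H1_pairs"
  then show "integrable lborel (\<lambda>x. energy_kernel x (u x) (v x))"
    unfolding energy_kernel_def
    by (intro Bochner_Integration.integrable_add Bochner_Integration.integrable_diff integrable_mult_right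
        sq_mult integrable_sech_form H1_pairs_sq)
qed

lemmas form_kernels = form_kernel_mass form_kernel_shift form_kernel_energy

lemma mass_sym: "mass u v = mass v u" and energy_sym: "energy u v = energy v u"
  by (simp_all add: form_def mass_kernel_def energy_kernel_def algebra_simps)

lemma mass_nonneg: "0 \<le> mass u u"
  by (simp add: form_def mass_kernel_def)

lemma shift_skew:
  assumes "u \<in> H1_pairs" "v \<in> H1_pairs"
  shows "shift u v = - shift v u"
proof -
  note i = sq_mult[OF H1_pairs_sq(2)[OF assms(1)] H1_pairs_sq(1)[OF assms(2)]]
    sq_mult[OF H1_pairs_sq(4)[OF assms(1)] H1_pairs_sq(3)[OF assms(2)]]
    sq_mult[OF H1_pairs_sq(2)[OF assms(2)] H1_pairs_sq(1)[OF assms(1)]]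
    sq_mult[OF H1_pairs_sq(4)[OF assms(2)] H1_pairs_sq(3)[OF assms(1)]]
  show ?thesis
    using H1_by_parts[OF H1_pairs_H1(1)[OF assms(1)] H1_pairs_H1(1)[OF assms(2)]]
      H1_by_parts[OF H1_pairs_H1(2)[OF assms(1)] H1_pairs_H1(2)[OF assms(2)]] i
    by (simp add: form_def shift_kernel_def mult.commute)
qed

lemma shift_self: "u \<in> H1_pairs \<Longrightarrow> shift u u = 0"
  using shift_skew[of u u] by simp

lemma sq_flux: "u \<in> H1_pairs \<Longrightarrow> sq (\<lambda>x. u x $ 4 + 2 * (sech x * u x $ 1))"
  by (intro sq_add sq_cmult H1_pairs_sq sq_bmult[where C=1]) (auto simp: sech_le_1 abs_le_iff intro: order_trans[OF _ less_imp_le[OF sech_pos]])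

text \<open>Completing the square in \<open>q'\<close> turns the potential
  \<open>1 - 2 sech\<^sup>2\<close> into \<open>1 - 6 sech\<^sup>2\<close>, which is the
  linearization of \<open>- Q'' + Q - 2 Q^3\<close> at \<open>Q = sech\<close>.\<close>

lemma energy_split:
  assumes u: "u \<in> H1_pairs"
  shows "energy u u = (\<integral>x. (u x $ 4 + 2 * (sech x * u x $ 1))\<^sup>2 \<partial>lborel)
    + (\<integral>x. (u x $ 2)\<^sup>2 + (1 - 6 * (sech x)\<^sup>2) * (u x $ 1)\<^sup>2 \<partial>lborel)"
proof -
  have "integrable lborel (\<lambda>x. (u x $ 2)\<^sup>2 + (1 - 6 * (sech x)\<^sup>2) * u x $ 1 * u x $ 1)"
    by (intro Bochner_Integration.integrable_add integrable_sech_form sq_int H1_pairs_sq u)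
  then have "integrable lborel (\<lambda>x. (u x $ 2)\<^sup>2 + (1 - 6 * (sech x)\<^sup>2) * (u x $ 1)\<^sup>2)"
    by (simp add: power2_eq_square mult.assoc)
  then show ?thesis
    unfolding form_def energy_kernel_def
    by (subst Bochner_Integration.integral_add[symmetric, OF sq_int[OF sq_flux[OF u]]])
      (auto intro!: Bochner_Integration.integral_cong simp: power2_eq_square algebra_simps)
qed

lemma energy_vanishing_nonneg:
  assumes "u \<in> H1_pairs" "u 0 $ 1 = 0" shows "0 \<le> energy u u"
  unfolding energy_split[OF assms(1)]
  using H1_vanishing_nonneg[OF H1_pairs_H1(1)[OF assms(1)] assms(2)] by simp

text \<open>The derivative of the wave, which generates translations.\<close>

definition psi0 :: "real \<Rightarrow> real^4" where
  "psi0 x = vec4 (- (sech x * tanh x)) (sech x - 2 * (sech x)^3) (- (sech x)\<^sup>2) (2 * (sech x)\<^sup>2 * tanh x)"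

lemma sq_sech_tanh: "sq (\<lambda>x. sech x * tanh x)" "sq (\<lambda>x. (sech x)\<^sup>2 * tanh x)" "sq (\<lambda>x. (sech x)^3 * tanh x)"
proof -
  have *: "sq (\<lambda>x. f x * tanh x)" if "sq f" for f
    using sq_bmult[of tanh 1 f] that abs_tanh_le_1 by (simp add: mult.commute)
  show "sq (\<lambda>x. sech x * tanh x)" "sq (\<lambda>x. (sech x)\<^sup>2 * tanh x)" "sq (\<lambda>x. (sech x)^3 * tanh x)"
    by (intro * sq_sech sq_sech_weight)+
qed

lemma H1_sech: "H1 sech (\<lambda>x. - (sech x * tanh x))"
  unfolding H1_def
  by (intro conjI AC_C1 sq_sech sq_minus sq_sech_tanh DERIV_sech[THEN DERIV_cong] continuous_intros)
    (auto intro!: derivative_eq_intros)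

lemma H1_sech': "H1 (\<lambda>x. - (sech x * tanh x)) (\<lambda>x. sech x - 2 * (sech x)^3)"
  unfolding H1_def
proof (intro conjI AC_C1)
  show "((\<lambda>x. - (sech x * tanh x)) has_real_derivative sech x - 2 * (sech x)^3) (at x)" for x
  proof -
    have "((\<lambda>x. - (sech x * tanh x)) has_real_derivative - (- (sech x * tanh x) * tanh x + sech x * (sech x)\<^sup>2)) (at x)"
      by (auto intro!: derivative_eq_intros)
    also have "- (- (sech x * tanh x) * tanh x + sech x * (sech x)\<^sup>2) = sech x * (tanh x)\<^sup>2 - (sech x)^3"
      by (simp add: power2_eq_square power3_eq_cube algebra_simps)
    also have "\<dots> = sech x - 2 * (sech x)^3" unfolding tanh_sq by (simp add: power2_eq_square power3_eq_cube algebra_simps)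
    finally show ?thesis .
  qed
  show "continuous_on UNIV (\<lambda>x. sech x - 2 * (sech x)^3)" by (intro continuous_intros)
  show "sq (\<lambda>x. - (sech x * tanh x))" by (intro sq_minus sq_sech_tanh)
  show "sq (\<lambda>x. sech x - 2 * (sech x)^3)" by (intro sq_diff sq_cmult sq_sech sq_sech_weight)
qed

lemma H1_sech'': "H1 (\<lambda>x. sech x - 2 * (sech x)^3) (\<lambda>x. - (sech x * tanh x) + 6 * ((sech x)^3 * tanh x))"
  unfolding H1_def
proof (intro conjI AC_C1)
  show "((\<lambda>x. sech x - 2 * (sech x)^3) has_real_derivative - (sech x * tanh x) + 6 * ((sech x)^3 * tanh x)) (at x)" for x
    by (auto intro!: derivative_eq_intros simp: power2_eq_square power3_eq_cube)
  show "continuous_on UNIV (\<lambda>x. - (sech x * tanh x) + 6 * ((sech x)^3 * tanh x))" by (intro continuous_intros)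
qed (intro sq_diff sq_add sq_minus sq_cmult sq_sech sq_sech_weight sq_sech_tanh)+

lemma H1_sech_sq: "H1 (\<lambda>x. - (sech x)\<^sup>2) (\<lambda>x. 2 * (sech x)\<^sup>2 * tanh x)"
  unfolding H1_def
proof (intro conjI AC_C1)
  show "((\<lambda>x. - (sech x)\<^sup>2) has_real_derivative 2 * (sech x)\<^sup>2 * tanh x) (at x)" for x
    by (auto intro!: derivative_eq_intros simp: power2_eq_square)
  show "continuous_on UNIV (\<lambda>x. 2 * (sech x)\<^sup>2 * tanh x)" by (intro continuous_intros)
  show "sq (\<lambda>x. 2 * (sech x)\<^sup>2 * tanh x)" using sq_cmult[OF sq_sech_tanh(2), of 2] by (simp add: mult.assoc)
qed (intro sq_minus sq_sech_weight)

lemma psi0_H1_pairs: "psi0 \<in> H1_pairs"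
  by (simp add: H1_pairs_def psi0_def H1_sech' H1_sech_sq)

lemma mass_psi0: "mass psi0 psi0 = 2"
proof -
  have "mass psi0 psi0 = (\<integral>x. (sech x)\<^sup>2 \<partial>lborel)"
    unfolding form_def mass_kernel_def
  proof (rule Bochner_Integration.integral_cong[OF refl])
    fix x
    have "psi0 x $ 1 * psi0 x $ 1 + psi0 x $ 3 * psi0 x $ 3 = (sech x)\<^sup>2 * (tanh x)\<^sup>2 + (sech x)\<^sup>2 * (sech x)\<^sup>2"
      by (simp add: psi0_def power2_eq_square)
    then show "psi0 x $ 1 * psi0 x $ 1 + psi0 x $ 3 * psi0 x $ 3 = (sech x)\<^sup>2"
      unfolding tanh_sq by (simp add: algebra_simps)
  qed
  then show ?thesis using sech2_int by simp
qed

text \<open>The flux \<open>q' + 2 sech V\<close> of \<open>psi0\<close> vanishes, and its first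
  component \<open>sech'\<close> lies in the kernel of
  \<open>- \<partial>\<^sup>2 + 1 - 6 sech\<^sup>2\<close>; \<open>w\<close> is the third derivative
  of \<open>sech\<close>.\<close>

lemma energy_psi0:
  assumes u: "u \<in> H1_pairs" shows "energy u psi0 = 0"
proof -
  define w where "w x = - (sech x * tanh x) + 6 * ((sech x)^3 * tanh x)" for x
  have w: "H1 (\<lambda>x. sech x - 2 * (sech x)^3) w" unfolding w_def by (rule H1_sech'')
  note u1 = H1_pairs_H1(1)[OF u]
  have "energy u psi0 = (\<integral>x. u x $ 2 * (sech x - 2 * (sech x)^3) + u x $ 1 * w x \<partial>lborel)"
    unfolding form_def energy_kernel_def
    by (rule Bochner_Integration.integral_cong[OF refl]) (simp add: psi0_def w_def algebra_simps power2_eq_square power3_eq_cube)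
  also have "\<dots> = 0"
    using H1_by_parts[OF u1 w] sq_mult[OF H1_sq'[OF u1] H1_sq[OF w]] sq_mult[OF H1_sq[OF u1] H1_sq'[OF w]] by simp
  finally show ?thesis .
qed

text \<open>Brings the pairing into the variables of \<open>rank_one_nonneg\<close>:
  \<open>q\<close> is integrated by parts and \<open>q'\<close> is replaced by the flux, which turns
  \<open>sech - 2 sech^3\<close> into \<open>sech - 4 sech^3\<close>.\<close>

lemma shift_psi0:
  assumes u: "u \<in> H1_pairs"
  shows "shift psi0 u = (\<integral>x. u x $ 1 * (sech x - 4 * (sech x)^3) + (u x $ 4 + 2 * (sech x * u x $ 1)) * (sech x)\<^sup>2 \<partial>lborel)"
proof -
  note u1 = H1_pairs_sq[OF u] and u2 = H1_pairs_H1(2)[OF u]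
  have i: "integrable lborel (\<lambda>x. (sech x - 2 * (sech x)^3) * u x $ 1)"
    "integrable lborel (\<lambda>x. (2 * (sech x)\<^sup>2 * tanh x) * u x $ 3)"
    "integrable lborel (\<lambda>x. - (sech x)\<^sup>2 * u x $ 4)"
    using sq_mult[OF H1_sq'[OF H1_sech'] u1(1)] sq_mult[OF H1_sq'[OF H1_sech_sq] u1(3)] sq_mult[OF H1_sq[OF H1_sech_sq] u1(4)]
    by blast+
  have "shift psi0 u = (\<integral>x. (sech x - 2 * (sech x)^3) * u x $ 1 + (2 * (sech x)\<^sup>2 * tanh x) * u x $ 3 \<partial>lborel)"
    by (simp add: form_def shift_kernel_def psi0_def)
  also have "\<dots> = (\<integral>x. (sech x - 2 * (sech x)^3) * u x $ 1 - (- (sech x)\<^sup>2 * u x $ 4) \<partial>lborel)"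
    by (subst Bochner_Integration.integral_add[OF i(1,2)], subst Bochner_Integration.integral_diff[OF i(1,3)])
       (use H1_by_parts[OF H1_sech_sq u2] in simp)
  also have "\<dots> = (\<integral>x. u x $ 1 * (sech x - 4 * (sech x)^3) + (u x $ 4 + 2 * (sech x * u x $ 1)) * (sech x)\<^sup>2 \<partial>lborel)"
    by (rule Bochner_Integration.integral_cong[OF refl]) (simp add: algebra_simps power2_eq_square power3_eq_cube)
  finally show ?thesis .
qed

lemma energy_rank_one_nonneg:
  assumes u: "u \<in> H1_pairs" shows "0 \<le> energy u u + 2 * (shift psi0 u)\<^sup>2"
  unfolding energy_split[OF u] shift_psi0[OF u]
  by (rule rank_one_nonneg[OF H1_pairs_H1(1)[OF u] sq_flux[OF u]])

text \<open>Pythagoras for the projection on \<open>psi0\<close>, where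
  \<open>mass psi0 psi0 = 2\<close>. It gives access to the equality case of Cauchy-Schwarz.\<close>

lemma mass_projection:
  assumes u: "u \<in> H1_pairs"
  shows "mass (\<lambda>x. u x - (mass u psi0 / 2) *\<^sub>R psi0 x) (\<lambda>x. u x - (mass u psi0 / 2) *\<^sub>R psi0 x) = mass u u - (mass u psi0)\<^sup>2 / 2"
proof -
  note F = form_kernel_mass
  let ?p = "\<lambda>x. (mass u psi0 / 2) *\<^sub>R psi0 x"
  have p: "?p \<in> H1_pairs" by (intro H1_pairs_scale psi0_H1_pairs)
  have "mass (\<lambda>x. u x - ?p x) (\<lambda>x. u x - ?p x) = mass u u - mass u ?p - (mass ?p u - mass ?p ?p)"
    using form_diff_left[OF F u p H1_pairs_diff[OF u p]] form_diff_right[OF F u p u] form_diff_right[OF F u p p] by simp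
  then show ?thesis
    by (simp add: form_scale_left[OF F] form_scale_right[OF F] mass_psi0 mass_sym[of psi0 u] power2_eq_square)
qed

text \<open>In \<open>shift v u\<close> only the undifferentiated components of \<open>u\<close>
  occur, and these are 0 in the mean square.\<close>

lemma shift_zero_if_mass_zero:
  assumes u: "u \<in> H1_pairs" and v: "v \<in> H1_pairs" and z: "mass u u = 0"
  shows "shift v u = 0"
proof -
  note s = H1_pairs_sq[OF u] and t = H1_pairs_sq[OF v]
  have "(\<integral>x. (u x $ 1)\<^sup>2 \<partial>lborel) + (\<integral>x. (u x $ 3)\<^sup>2 \<partial>lborel) = 0"
    using z sq_int[OF s(1)] sq_int[OF s(3)] by (simp add: form_def mass_kernel_def power2_eq_square)
  moreover have "0 \<le> (\<integral>x. (u x $ 1)\<^sup>2 \<partial>lborel)" "0 \<le> (\<integral>x. (u x $ 3)\<^sup>2 \<partial>lborel)" by simp_all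
  ultimately have 0: "(\<integral>x. (u x $ 1)\<^sup>2 \<partial>lborel) = 0" "(\<integral>x. (u x $ 3)\<^sup>2 \<partial>lborel) = 0" by linarith+
  have "(\<integral>x. v x $ 2 * u x $ 1 \<partial>lborel)\<^sup>2 \<le> 0" "(\<integral>x. v x $ 4 * u x $ 3 \<partial>lborel)\<^sup>2 \<le> 0"
    using Cauchy_Schwarz_integral[OF t(2) s(1)] Cauchy_Schwarz_integral[OF t(4) s(3)] 0 by simp_all
  then show ?thesis
    using sq_mult[OF t(2) s(1)] sq_mult[OF t(4) s(3)] by (simp add: form_def shift_kernel_def)
qed

text \<open>The real and imaginary parts of the weak eigenvalue equation for \<open>a + i b\<close>.\<close>

lemma no_unstable_mode:
  fixes k a b :: real
  assumes k: "1 \<le> k\<^sup>2" and a: "0 < a" and u: "u \<in> H1_pairs" and w: "w \<in> H1_pairs"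
    and R: "\<And>v. v \<in> H1_pairs \<Longrightarrow> (a\<^sup>2 - b\<^sup>2) * mass u v - 2 * a * b * mass w v - 2 * k * (a * shift u v - b * shift w v) + energy u v = 0"
    and I: "\<And>v. v \<in> H1_pairs \<Longrightarrow> (a\<^sup>2 - b\<^sup>2) * mass w v + 2 * a * b * mass u v - 2 * k * (a * shift w v + b * shift u v) + energy w v = 0"
  shows "mass u u = 0" "mass w w = 0"
proof -
  define N where "N = mass u u + mass w w"
  define m where "m = shift u w"
  have m: "shift w u = - m" using shift_skew[OF w u] by (simp add: m_def)
  \<comment> \<open>Real part of the equation paired with the conjugate of \<open>u + i w\<close>:
    the first identity tested with \<open>u\<close> plus the second tested with
    \<open>w\<close>.\<close>
  have E1: "(a\<^sup>2 - b\<^sup>2) * N - 4 * k * b * m + (energy u u + energy w w) = 0"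
    using R[OF u] I[OF w] shift_self[OF u] shift_self[OF w] m mass_sym[of w u]
    by (simp add: N_def m_def[symmetric] algebra_simps)
  \<comment> \<open>Imaginary part of the same pairing; the energy terms cancel because the form is
    symmetric.\<close>
  have "2 * a * b * N + 4 * k * a * m = 0"
    using I[OF u] R[OF w] shift_self[OF u] shift_self[OF w] m mass_sym[of w u] energy_sym[of w u]
    by (simp add: N_def m_def[symmetric] algebra_simps)
  then have "2 * a * (b * N + 2 * k * m) = 0" by (simp add: algebra_simps)
  then have km: "2 * k * m = - (b * N)" using a by simp
  have E1': "(a\<^sup>2 - b\<^sup>2) * N - 2 * b * (2 * k * m) + (energy u u + energy w w) = 0" using E1 by (simp add: algebra_simps)
  have E: "(a\<^sup>2 + b\<^sup>2) * N + (energy u u + energy w w) = 0"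
    using E1' unfolding km by (simp add: algebra_simps power2_eq_square)
  define s where "s = mass u psi0"
  define t where "t = mass w psi0"
  define p where "p = shift psi0 u"
  define q where "q = shift psi0 w"
  have pq: "shift u psi0 = - p" "shift w psi0 = - q"
    using shift_skew[OF u psi0_H1_pairs] shift_skew[OF w psi0_H1_pairs] by (simp_all add: p_def q_def)
  \<comment> \<open>\<open>X + i Y\<close> is \<open>(a + i b) (s + i t) + 2 k (p + i q)\<close>.
    Testing with \<open>psi0\<close> kills the energy term and leaves \<open>a + i b\<close> times
    this number equal to 0.\<close>
  define X where "X = a * s - b * t + 2 * k * p"
  define Y where "Y = a * t + b * s + 2 * k * q"
  have "a * X - b * Y = 0" using R[OF psi0_H1_pairs] energy_psi0[OF u] pq
    by (simp add: X_def Y_def s_def[symmetric] t_def[symmetric] algebra_simps power2_eq_square)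
  moreover have "a * Y + b * X = 0" using I[OF psi0_H1_pairs] energy_psi0[OF w] pq
    by (simp add: X_def Y_def s_def[symmetric] t_def[symmetric] algebra_simps power2_eq_square)
  moreover have "(a\<^sup>2 + b\<^sup>2) * X = a * (a * X - b * Y) + b * (a * Y + b * X)" "(a\<^sup>2 + b\<^sup>2) * Y = a * (a * Y + b * X) - b * (a * X - b * Y)"
    by (simp_all add: algebra_simps power2_eq_square)
  ultimately have "(a\<^sup>2 + b\<^sup>2) * X = 0" "(a\<^sup>2 + b\<^sup>2) * Y = 0" by simp_all
  moreover have ab: "a\<^sup>2 + b\<^sup>2 > 0" using a by (simp add: sum_power2_gt_zero_iff)
  ultimately have "X = 0" "Y = 0" by auto
  then have "2 * k * p = - (a * s - b * t)" "2 * k * q = - (a * t + b * s)" by (simp_all add: X_def Y_def)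
  then have "(2 * k * p)\<^sup>2 + (2 * k * q)\<^sup>2 = (a * s - b * t)\<^sup>2 + (a * t + b * s)\<^sup>2" by (simp only: power2_minus)
  then have st: "4 * k\<^sup>2 * (p\<^sup>2 + q\<^sup>2) = (a\<^sup>2 + b\<^sup>2) * (s\<^sup>2 + t\<^sup>2)"
    by (simp add: algebra_simps power2_eq_square)
  have en: "energy u u + energy w w \<ge> - 2 * (p\<^sup>2 + q\<^sup>2)"
    using energy_rank_one_nonneg[OF u] energy_rank_one_nonneg[OF w] by (simp add: p_def q_def)
  \<comment> \<open>Here \<open>1 \<le> k\<^sup>2\<close> enters: it trades the bound by
    \<open>p\<close> and \<open>q\<close> for one by \<open>s\<close> and \<open>t\<close>.\<close>
  have "(p\<^sup>2 + q\<^sup>2) * 1 \<le> (p\<^sup>2 + q\<^sup>2) * k\<^sup>2" using k by (intro mult_left_mono) auto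
  then have "(a\<^sup>2 + b\<^sup>2) * N \<le> (a\<^sup>2 + b\<^sup>2) * ((s\<^sup>2 + t\<^sup>2) / 2)"
  proof -
    have "(a\<^sup>2 + b\<^sup>2) * N \<le> 2 * (p\<^sup>2 + q\<^sup>2)" using E en by argo
    also have "\<dots> \<le> 2 * ((p\<^sup>2 + q\<^sup>2) * k\<^sup>2)" using \<open>(p\<^sup>2 + q\<^sup>2) * 1 \<le> (p\<^sup>2 + q\<^sup>2) * k\<^sup>2\<close> by argo
    also have "\<dots> = 4 * k\<^sup>2 * (p\<^sup>2 + q\<^sup>2) / 2" by (simp add: mult.commute)
    finally show ?thesis unfolding st by simp
  qed
  then have NN: "N \<le> (s\<^sup>2 + t\<^sup>2) / 2" using ab by simp
  \<comment> \<open>\<open>NN\<close> is the reverse of Cauchy-Schwarz, so \<open>u\<close> and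
    \<open>w\<close> are multiples of \<open>psi0\<close> up to null states. As \<open>shift\<close>
    is skew, \<open>p\<close> and \<open>q\<close> vanish, and \<open>E\<close> then leaves
    \<open>N \<le> 0\<close>.\<close>
  define u' where "u' x = u x - (s / 2) *\<^sub>R psi0 x" for x
  define w' where "w' x = w x - (t / 2) *\<^sub>R psi0 x" for x
  have X': "u' \<in> H1_pairs" "w' \<in> H1_pairs"
    unfolding u'_def[abs_def] w'_def[abs_def] by (intro H1_pairs_diff H1_pairs_scale psi0_H1_pairs u w)+
  have "mass u' u' = mass u u - s\<^sup>2 / 2" "mass w' w' = mass w w - t\<^sup>2 / 2"
    using mass_projection[OF u] mass_projection[OF w] by (simp_all add: s_def t_def u'_def[abs_def] w'_def[abs_def])
  then have "mass u' u' = 0" "mass w' w' = 0"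
    using mass_nonneg[of u'] mass_nonneg[of w'] NN by (simp_all add: N_def)
  then have z: "shift psi0 u' = 0" "shift psi0 w' = 0" using shift_zero_if_mass_zero psi0_H1_pairs X' by blast+
  have "p = 0" "q = 0"
    using z form_diff_right[OF form_kernel_shift u H1_pairs_scale[OF psi0_H1_pairs] psi0_H1_pairs, of "s/2"]
      form_diff_right[OF form_kernel_shift w H1_pairs_scale[OF psi0_H1_pairs] psi0_H1_pairs, of "t/2"]
      shift_self[OF psi0_H1_pairs]
    by (simp_all add: p_def q_def u'_def[abs_def] w'_def[abs_def] form_scale_right[OF form_kernel_shift])
  with en E have "(a\<^sup>2 + b\<^sup>2) * N \<le> 0" by simp
  then have "N \<le> 0" using ab by (simp add: mult_le_0_iff)
  then show "mass u u = 0" "mass w w = 0"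
    using mass_nonneg[of u] mass_nonneg[of w] by (simp_all add: N_def)
qed

subsection \<open>Weak derivatives\<close>

text \<open>Coinduction: iterated derivatives never leave a set that is closed under
  differentiation.\<close>

lemma smoothI:
  assumes S: "\<And>g. g \<in> S \<Longrightarrow> \<exists>g'\<in>S. \<forall>x. (g has_real_derivative g' x) (at x)" and f: "f \<in> S"
  shows "smooth f"
proof -
  have d: "deriv g \<in> S" if g: "g \<in> S" for g
  proof -
    obtain g' where g': "g' \<in> S" "\<And>x. (g has_real_derivative g' x) (at x)" using S[OF g] by blast
    then have "deriv g = g'" by (intro ext DERIV_imp_deriv)
    then show ?thesis using g' by simp
  qed
  have "(deriv ^^ k) f \<in> S" for k by (induction k) (auto simp: f d)
  then show ?thesis unfolding smooth_def using S real_differentiable_def by blast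
qed

text \<open>The polynomial is a parameter because differentiation only changes it, to
  \<open>y\<^sup>2 (p - p')\<close> in the variable \<open>y = 1/x\<close>; the whole family is thus
  closed under derivatives.\<close>

definition flat :: "real poly \<Rightarrow> real \<Rightarrow> real" where
  "flat p x = (if x > 0 then poly p (1 / x) * exp (- 1 / x) else 0)"

lemma poly_times_exp_minus: "((\<lambda>y. poly p y * exp (- y)) \<longlongrightarrow> (0::real)) at_top"
proof -
  have "((\<lambda>y. \<Sum>i\<le>degree p. coeff p i * (y ^ i / exp y)) \<longlongrightarrow> (\<Sum>i\<le>degree p. coeff p i * 0)) at_top"
    by (intro tendsto_sum tendsto_mult tendsto_const tendsto_power_div_exp_0)
  then show ?thesis
    by (simp add: poly_altdef sum_distrib_right sum_distrib_left exp_minus divide_inverse mult.assoc)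
qed

lemma DERIV_flat: "(flat p has_real_derivative flat (monom 1 2 * (p - pderiv p)) x) (at x)"
proof -
  consider "x > 0" | "x < 0" | "x = 0" by linarith
  then show ?thesis
  proof cases
    case 1
    have "((\<lambda>x. poly p (1 / x) * exp (- 1 / x)) has_real_derivative flat (monom 1 2 * (p - pderiv p)) x) (at x)"
      using 1 by (auto intro!: derivative_eq_intros DERIV_chain2[OF poly_DERIV] simp: flat_def poly_monom field_simps power2_eq_square)
    then show ?thesis
      by (rule DERIV_cong_ev[OF refl _ refl, THEN iffD1, rotated])
         (use 1 eventually_nhds_in_open[of "{0<..}" x] in \<open>auto elim!: eventually_mono simp: flat_def\<close>)
  next
    case 2
    have "((\<lambda>x. 0) has_real_derivative 0) (at x)" by simp
    then have "(flat p has_real_derivative 0) (at x)"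
      by (rule DERIV_cong_ev[OF refl _ refl, THEN iffD1, rotated])
         (use 2 eventually_nhds_in_open[of "{..<0}" x] in \<open>auto elim!: eventually_mono simp: flat_def\<close>)
    then show ?thesis using 2 by (simp add: flat_def)
  next
    case 3
    \<comment> \<open>The difference quotient at 0 is \<open>y p(y) exp (- y)\<close> with
      \<open>y = 1/h\<close>, hence the extra factor from \<open>pCons 0\<close>.\<close>
    have "((\<lambda>h. flat p h / h) \<longlongrightarrow> 0) (at_right 0)"
    proof -
      have "((\<lambda>h. poly (pCons 0 p) (1 / h) * exp (- (1 / h))) \<longlongrightarrow> 0) (at_right (0::real))"
        by (rule filterlim_compose[OF poly_times_exp_minus]) (simp add: divide_inverse filterlim_inverse_at_top_right)
      moreover have "eventually (\<lambda>h. poly (pCons 0 p) (1 / h) * exp (- (1 / h)) = flat p h / h) (at_right 0)"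
        by (rule eventually_at_rightI[of 0 1]) (auto simp: flat_def)
      ultimately show ?thesis by (rule Lim_transform_eventually)
    qed
    moreover have "((\<lambda>h. flat p h / h) \<longlongrightarrow> 0) (at_left 0)"
      by (rule tendsto_eventually, rule eventually_at_leftI[of "-1"]) (auto simp: flat_def)
    ultimately have "((\<lambda>h. flat p h / h) \<longlongrightarrow> 0) (at 0)" by (simp add: filterlim_split_at)
    then show ?thesis using 3 by (simp add: has_field_derivative_iff flat_def)
  qed
qed

text \<open>Meant as the set in \<open>smoothI\<close>: the constructors suffice for the product
  rule, and affine arguments give shifted, reflected and dilated copies.\<close>

inductive_set flat_algebra :: "(real \<Rightarrow> real) set" where
  flat: "(\<lambda>x. flat p (a * x + b)) \<in> flat_algebra"
| add: "f \<in> flat_algebra \<Longrightarrow> g \<in> flat_algebra \<Longrightarrow> (\<lambda>x. f x + g x) \<in> flat_algebra"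
| mult: "f \<in> flat_algebra \<Longrightarrow> g \<in> flat_algebra \<Longrightarrow> (\<lambda>x. f x * g x) \<in> flat_algebra"

lemma flat_smult: "flat (smult c p) x = c * flat p x" by (simp add: flat_def)

lemma flat_algebra_deriv: "f \<in> flat_algebra \<Longrightarrow> \<exists>f'\<in>flat_algebra. \<forall>x. (f has_real_derivative f' x) (at x)"
proof (induction f rule: flat_algebra.induct)
  case (flat p a b)
  have "((\<lambda>x. flat p (a * x + b)) has_real_derivative flat (smult a (monom 1 2 * (p - pderiv p))) (a * x + b)) (at x)" for x
    unfolding flat_smult by (rule DERIV_chain2[OF DERIV_flat, THEN DERIV_cong]) (auto intro!: derivative_eq_intros)
  then show ?case
    by (intro bexI[OF _ flat_algebra.flat[of "smult a (monom 1 2 * (p - pderiv p))" a b]] allI)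
next
  case (add f g)
  then obtain f' g' where *: "f' \<in> flat_algebra" "g' \<in> flat_algebra" "\<And>x. (f has_real_derivative f' x) (at x)" "\<And>x. (g has_real_derivative g' x) (at x)"
    by blast
  then have "(\<lambda>x. f' x + g' x) \<in> flat_algebra" "\<forall>x. ((\<lambda>x. f x + g x) has_real_derivative f' x + g' x) (at x)"
    by (auto intro: flat_algebra.add DERIV_add)
  then show ?case by (intro bexI[of _ "\<lambda>x. f' x + g' x"])
next
  case (mult f g)
  then obtain f' g' where *: "f' \<in> flat_algebra" "g' \<in> flat_algebra" "\<And>x. (f has_real_derivative f' x) (at x)" "\<And>x. (g has_real_derivative g' x) (at x)"
    by blast
  then have "(\<lambda>x. f' x * g x + g' x * f x) \<in> flat_algebra" "\<forall>x. ((\<lambda>x. f x * g x) has_real_derivative f' x * g x + g' x * f x) (at x)"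
    using mult.hyps by (auto intro!: flat_algebra.add flat_algebra.mult DERIV_mult)
  then show ?case by (intro bexI[of _ "\<lambda>x. f' x * g x + g' x * f x"])
qed

lemma flat_algebra_cont: "f \<in> flat_algebra \<Longrightarrow> continuous_on S f"
  using flat_algebra_deriv[of f] by (metis DERIV_isCont continuous_at_imp_continuous_on)

text \<open>For \<open>n > 0\<close> this vanishes off \<open>{a<..<b}\<close>, and it tends to
  \<open>c\<close> times the indicator as \<open>n\<close> grows. The factor \<open>c\<close> sits
  inside a polynomial because multiplication by constants is not a constructor of
  \<open>flat_algebra\<close>.\<close>

definition bump :: "real \<Rightarrow> real \<Rightarrow> real \<Rightarrow> real \<Rightarrow> real \<Rightarrow> real" where
  "bump c n a b x = flat [:c:] (n * x + (- n * a)) * flat [:1:] (- n * x + n * b)"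

lemma bump_in: "bump c n a b \<in> flat_algebra"
  unfolding bump_def[abs_def] by (intro flat_algebra.intros)

lemma bump_outside: "n > 0 \<Longrightarrow> x \<notin> {a<..<b} \<Longrightarrow> bump c n a b x = 0"
proof -
  assume n: "n > 0" and x: "x \<notin> {a<..<b}"
  then have "x \<le> a \<or> b \<le> x" by auto
  then have "n * x \<le> n * a \<or> n * b \<le> n * x" using n by auto
  then show ?thesis by (auto simp: bump_def flat_def)
qed

lemma bump_inside:
  assumes "n > 0" "x \<in> {a<..<b}"
  shows "bump c n a b x = c * exp (- 1 / (n * (x - a))) * exp (- 1 / (n * (b - x)))"
proof -
  have "n * a < n * x" "n * x < n * b" using assms by auto
  then show ?thesis by (simp add: bump_def flat_def algebra_simps)
qed

lemma bump_smult: "bump c n a b x = c * bump 1 n a b x"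
  by (simp add: bump_def flat_def)

lemma bump_bounds:
  assumes "n > 0" shows "0 \<le> bump 1 n a b x" "bump 1 n a b x \<le> 1"
proof -
  have "0 \<le> bump 1 n a b x \<and> bump 1 n a b x \<le> 1"
  proof (cases "x \<in> {a<..<b}")
    case True
    then have "0 < n * (x - a)" "0 < n * (b - x)" using assms by auto
    then have "exp (- 1 / (n * (x - a))) * exp (- 1 / (n * (b - x))) \<le> 1 * 1"
      by (intro mult_mono) auto
    then show ?thesis using bump_inside[OF assms True, of 1] by simp
  qed (simp add: bump_outside[OF assms])
  then show "0 \<le> bump 1 n a b x" "bump 1 n a b x \<le> 1" by auto
qed

lemma bump_limit: "(\<lambda>n. bump 1 (real (Suc n)) a b x) \<longlonglongrightarrow> indicat_real {a<..<b} x"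
proof (cases "x \<in> {a<..<b}")
  case True
  have l: "(\<lambda>n. exp (- 1 / (real (Suc n) * y))) \<longlonglongrightarrow> 1" if "y > 0" for y :: real
  proof -
    have "(\<lambda>n. exp (- (1 / y) * (1 / real (Suc n)))) \<longlonglongrightarrow> exp (- (1 / y) * 0)"
      by (intro tendsto_intros lim_1_over_n[THEN LIMSEQ_Suc])
    then show ?thesis by (simp add: mult.commute)
  qed
  have "(\<lambda>n. exp (- 1 / (real (Suc n) * (x - a))) * exp (- 1 / (real (Suc n) * (b - x)))) \<longlonglongrightarrow> 1 * 1"
    using True by (intro tendsto_mult l) auto
  then show ?thesis using True by (simp add: bump_inside del: of_nat_Suc)
qed (simp add: bump_outside)

lemma bump_integral_pos: "a < b \<Longrightarrow> 0 < (\<integral>x. bump 1 1 a b x \<partial>lborel)"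
proof -
  assume ab: "a < b"
  have e: "bump 1 1 a b x = bump 1 1 a b x * indicat_real {a..b} x" for x
    by (cases "x \<in> {a..b}") (auto intro!: bump_outside)
  have i: "integrable lborel (bump 1 1 a b)"
    using borel_integrable_atLeastAtMost'[OF flat_algebra_cont[OF bump_in[of 1 1 a b], of "{a..b}"]]
    by (subst e[abs_def]) (simp add: set_integrable_def mult.commute)
  have "(\<integral>x. bump 1 1 a b x \<partial>lborel) \<noteq> 0"
  proof
    assume "(\<integral>x. bump 1 1 a b x \<partial>lborel) = 0"
    then have "AE x in lborel. bump 1 1 a b x = 0"
      using integral_nonneg_eq_0_iff_AE[OF i] bump_bounds(1)[of 1] by simp
    moreover have "bump 1 1 a b x \<noteq> 0" if "x \<in> {a<..<b}" for x
      using bump_inside[of 1 x a b 1] that by simp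
    ultimately have "AE x in lborel. x \<notin> {a<..<b}" by (auto elim!: eventually_mono)
    then have "{a<..<b} \<in> null_sets lborel" by (simp add: AE_iff_null_sets)
    then have "emeasure lborel {a<..<b} = 0" by (rule null_setsD1)
    then show False using ab by simp
  qed
  then show ?thesis using integral_nonneg_AE[of "bump 1 1 a b" lborel] bump_bounds(1)[of 1 a b] by (simp add: less_le)
qed

section \<open>Functions determined by their integrals, and vanishing weak derivatives\<close>

definition local_int :: "(real \<Rightarrow> real) \<Rightarrow> bool" where
  "local_int g \<longleftrightarrow> g \<in> borel_measurable borel \<and> (\<forall>a b. set_integrable lborel {a..b} g)"

lemma AC_antiderivative:
  assumes "local_int g" obtains G where "AC G g"
proof
  define G where "G x = (LBINT t=0..x. g t)" for x :: real
  have ii: "interval_lebesgue_integrable lborel (ereal a) (ereal b) g" if "a \<le> b" for a b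
  proof -
    have e: "einterval (ereal a) (ereal b) = {a<..<b}" by (auto simp: einterval_def)
    have "set_integrable lborel {a<..<b} g"
      by (rule set_integrable_subset[of lborel "{a..b}" g]) (use assms in \<open>auto simp: local_int_def\<close>)
    then show ?thesis unfolding interval_lebesgue_integrable_def e using that by simp
  qed
  have "G b - G a = (LINT t:{a..b}|lborel. g t)" if "a \<le> b" for a b
  proof -
    have m: "min (ereal 0) (min (ereal a) (ereal b)) = ereal (min 0 (min a b))"
      "max (ereal 0) (max (ereal a) (ereal b)) = ereal (max 0 (max a b))"
      by (simp_all only: ereal_min ereal_max)
    have "min 0 (min a b) \<le> max 0 (max a b)" by linarith
    then have "interval_lebesgue_integrable lborel (min (ereal 0) (min (ereal a) (ereal b))) (max (ereal 0) (max (ereal a) (ereal b))) g"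
      unfolding m by (rule ii)
    then have "G a + (LBINT t=a..b. g t) = G b" unfolding G_def zero_ereal_def by (rule interval_integral_sum)
    then show ?thesis using that by (simp add: interval_integral_Icc)
  qed
  then show "AC G g" using assms by (simp add: AC_def local_int_def)
qed

lemma AC_local_int: "AC f g \<Longrightarrow> local_int g" "AC f g \<Longrightarrow> local_int f"
proof -
  assume f: "AC f g"
  then show "local_int g" by (simp add: AC_def local_int_def)
  have "set_integrable lborel {a..b} f" for a b
    by (rule borel_integrable_atLeastAtMost') (rule AC_cont_on[OF f])
  then show "local_int f" using AC_borel[OF f] by (simp add: local_int_def)
qed

lemma local_int_diff: "local_int f \<Longrightarrow> local_int g \<Longrightarrow> local_int (\<lambda>x. f x - g x)"
  by (simp add: local_int_def set_integral_diff borel_measurable_diff)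

text \<open>The sets on which the truncated function has integral 0 form a Dynkin system containing
  the half lines, so every Borel set is one of them, and a density is determined by its integrals.
  Truncation makes the function integrable.\<close>

lemma AE_zero_if_intervals:
  assumes g: "local_int g" and z: "\<And>a b. a < b \<Longrightarrow> (LINT x:{a..b}|lborel. g x) = 0"
  shows "AE x in lborel. g x = 0"
proof -
  have "AE x in lborel. x \<in> {- real N..real N} \<longrightarrow> g x = 0" for N
  proof -
    define h where "h x = indicat_real {- real N..real N} x * g x" for x
    have ih: "integrable lborel h" using g by (simp add: local_int_def h_def[abs_def] set_integrable_def)
    have si: "set_integrable lborel A h" if "A \<in> sets borel" for A
      unfolding set_integrable_def using integrable_mult_indicator[of A lborel h] ih that by simp
    have z': "(LINT x:{a..b}|lborel. g x) = 0" for a b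
    proof -
      consider "a < b" | "b < a" | "a = b" by linarith
      then show ?thesis
      proof cases
        case 1
        then show ?thesis by (rule z)
      next
        case 3
        then have "(LINT x:{a..b}|lborel. g x) = (LINT x:{}|lborel. g x)"
          by (intro set_integral_discrete_difference[of "{a}"]) auto
        then show ?thesis by (simp add: set_lebesgue_integral_def)
      qed (simp add: set_lebesgue_integral_def)
    qed
    have tot: "(\<integral>x. h x \<partial>lborel) = 0" using z' by (simp add: h_def set_lebesgue_integral_def)
    have P: "(LINT x:A|lborel. h x) = 0" if "A \<in> sets borel" for A
    proof -
      have A: "A \<in> sigma_sets UNIV (range (\<lambda>a. {..a::real}))" using that by (simp add: borel_eq_atMost)
      have sb: "B \<in> sets borel" if "B \<in> sigma_sets UNIV (range (\<lambda>a. {..a::real}))" for B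
        using that by (simp add: borel_eq_atMost)
      have "Int_stable (range (\<lambda>a. {..a::real}))" by (auto simp: Int_stable_def)
      moreover have "range (\<lambda>a. {..a::real}) \<subseteq> Pow UNIV" by simp
      ultimately show ?thesis using A
      proof (induction rule: sigma_sets_induct_disjoint)
        case (basic B)
        then obtain a where B: "B = {..a}" by auto
        have "(LINT x:B|lborel. h x) = (LINT x:{- real N..min a (real N)}|lborel. g x)"
          unfolding B set_lebesgue_integral_def h_def
          by (rule Bochner_Integration.integral_cong) (auto simp: indicator_def)
        then show ?case using z' by simp
      next
        case empty
        show ?case by (simp add: set_lebesgue_integral_def)
      next
        case (compl B)
        have "(LINT x:UNIV - B|lborel. h x) = (\<integral>x. h x - indicat_real B x * h x \<partial>lborel)"
          unfolding set_lebesgue_integral_def by (rule Bochner_Integration.integral_cong) (auto simp: indicator_def)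
        also have "\<dots> = (\<integral>x. h x \<partial>lborel) - (LINT x:B|lborel. h x)"
          using ih si[OF sb[OF compl(1)]] by (simp add: set_lebesgue_integral_def set_integrable_def)
        finally show ?case using tot compl by simp
      next
        case (union B)
        have "(LINT x:(\<Union>i. B i)|lborel. h x) = (\<Sum>i. (LINT x:(B i)|lborel. h x))"
        proof (rule lebesgue_integral_countable_add)
          have B: "B i \<in> sets borel" for i using union(2) by (intro sb) auto
          show "B i \<in> sets lborel" for i using B by simp
          show "B i \<inter> B j = {}" if "i \<noteq> j" for i j
            using union(1) that by (auto simp: disjoint_family_on_def)
          show "set_integrable lborel (\<Union>i. B i) h" by (rule si) (use B in auto)
        qed
        then show ?case using union(3) by simp
      qed
    qed
    have "AE x in lborel. h x = 0"
      by (rule density_unique_real[OF ih]) (simp_all add: P)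
    then show ?thesis by (auto simp: h_def elim!: eventually_mono)
  qed
  then have "AE x in lborel. \<forall>N::nat. x \<in> {- real N..real N} \<longrightarrow> g x = 0"
    by (intro AE_all_countable[THEN iffD2] allI)
  then show ?thesis
  proof (rule eventually_mono)
    fix x :: real assume *: "\<forall>N::nat. x \<in> {- real N..real N} \<longrightarrow> g x = 0"
    obtain N :: nat where "\<bar>x\<bar> \<le> real N" using real_arch_simple by blast
    then show "g x = 0" using *[rule_format, of N] by (auto simp: abs_le_iff)
  qed
qed

lemma AC_unique_deriv:
  assumes "AC f g" "AC f h" shows "AE x in lborel. g x = h x"
proof -
  have "AE x in lborel. g x - h x = 0"
  proof (rule AE_zero_if_intervals)
    show "local_int (\<lambda>x. g x - h x)" by (intro local_int_diff AC_local_int[OF assms(1)] AC_local_int[OF assms(2)])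
    show "(LINT x:{a..b}|lborel. g x - h x) = 0" if "a < b" for a b
      using AC_eq[OF assms(1), of a b] AC_eq[OF assms(2), of a b] that
      by (simp add: set_integral_diff(2)[OF AC_int[OF assms(1)] AC_int[OF assms(2)]])
  qed
  then show ?thesis by simp
qed

lemma AC_by_parts_compact:
  assumes t: "AC t t'" and G: "AC G g" and o: "\<And>x. x \<notin> {A..B} \<Longrightarrow> t x = 0 \<and> t' x = 0"
  shows "integrable lborel (\<lambda>x. t' x * G x)" "integrable lborel (\<lambda>x. t x * g x)"
    "(\<integral>x. t' x * G x \<partial>lborel) = - (\<integral>x. t x * g x \<partial>lborel)"
proof -
  have [measurable]: "t \<in> borel_measurable borel" "G \<in> borel_measurable borel" using t G by (auto intro: AC_borel)
  \<comment> \<open>The interval is one unit longer on both sides, so that its endpoints lie outside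
    \<open>{A..B}\<close> and the boundary terms are 0.\<close>
  have e: "t' x * G x = indicat_real {A-1..B+1} x * (G x * t' x)" "t x * g x = indicat_real {A-1..B+1} x * (t x * g x)" for x
    using o[of x] by (cases "x \<in> {A..B}"; auto simp: indicator_def)+
  have "set_integrable lborel {A-1..B+1} (\<lambda>x. G x * t' x)" "set_integrable lborel {A-1..B+1} (\<lambda>x. t x * g x)"
    by (intro set_integrable_cont_mult AC_cont_on[OF G] AC_cont_on[OF t] AC_int[OF t] AC_int[OF G]; measurable)+
  then show i: "integrable lborel (\<lambda>x. t' x * G x)" "integrable lborel (\<lambda>x. t x * g x)"
    by (subst e, simp add: set_integrable_def)+
  have "(\<integral>x. t' x * G x \<partial>lborel) + (\<integral>x. t x * g x \<partial>lborel) = (\<integral>x. t' x * G x + t x * g x \<partial>lborel)"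
    using i by simp
  also have "\<dots> = 0"
  proof (cases "A \<le> B")
    case True
    have "(\<integral>x. t' x * G x + t x * g x \<partial>lborel) = (LINT x:{A-1..B+1}|lborel. t' x * G x + t x * g x)"
      unfolding set_lebesgue_integral_def
    proof (rule Bochner_Integration.integral_cong[OF refl])
      fix x show "t' x * G x + t x * g x = indicat_real {A-1..B+1} x *\<^sub>R (t' x * G x + t x * g x)"
        using o[of x] by (cases "x \<in> {A..B}") (auto simp: indicator_def)
    qed
    also have "\<dots> = t (B+1) * G (B+1) - t (A-1) * G (A-1)"
      using AC_eq[OF AC_mult[OF t G], of "A-1" "B+1"] True by simp
    finally show ?thesis using o[of "B+1"] o[of "A-1"] by simp
  next
    case False
    then have "t x = 0 \<and> t' x = 0" for x using o[of x] by auto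
    then show ?thesis by simp
  qed
  finally show "(\<integral>x. t' x * G x \<partial>lborel) = - (\<integral>x. t x * g x \<partial>lborel)" by linarith
qed

lemma test_function_AC:
  assumes "test_function \<theta>"
  obtains A B where "AC \<theta> (deriv \<theta>)" "AC (deriv \<theta>) (deriv (deriv \<theta>))" "\<And>x. x \<notin> {A..B} \<Longrightarrow> \<theta> x = 0 \<and> deriv \<theta> x = 0"
proof -
  have sm: "smooth \<theta>" and cp: "compact (closure {x. \<theta> x \<noteq> 0})" using assms by (auto simp: test_function_def)
  have 0: "\<theta> differentiable (at x)" and 1: "deriv \<theta> differentiable (at x)"
    and 2: "deriv (deriv \<theta>) differentiable (at x)" for x
    using sm[unfolded smooth_def, rule_format, of 0 x] sm[unfolded smooth_def, rule_format, of 1 x]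
      sm[unfolded smooth_def, rule_format, of 2 x] by (simp_all add: eval_nat_numeral)
  have AC2: "AC (deriv \<theta>) (deriv (deriv \<theta>))"
  proof (rule AC_C1)
    show "(deriv \<theta> has_real_derivative deriv (deriv \<theta>) x) (at x)" for x
      using 1[of x] by (simp add: real_differentiable_def) (metis DERIV_imp_deriv)
    show "continuous_on UNIV (deriv (deriv \<theta>))"
      using 2 by (intro continuous_at_imp_continuous_on ballI differentiable_imp_continuous_within) simp
  qed
  have d: "(\<theta> has_real_derivative deriv \<theta> x) (at x)" for x
    using 0[of x] by (simp add: real_differentiable_def) (metis DERIV_imp_deriv)
  have c: "continuous_on UNIV (deriv \<theta>)"
    using 1 by (intro continuous_at_imp_continuous_on ballI differentiable_imp_continuous_within) simp
  obtain R where R: "\<And>x. x \<in> closure {x. \<theta> x \<noteq> 0} \<Longrightarrow> \<bar>x\<bar> \<le> R"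
    using compact_imp_bounded[OF cp] by (auto simp: bounded_iff)
  have z: "\<theta> x = 0" if "x \<notin> {-R..R}" for x
    using R[of x] that closure_subset[of "{x. \<theta> x \<noteq> 0}"] by (force simp: abs_le_iff)
  have "deriv \<theta> x = 0" if "x \<notin> {-R..R}" for x
  proof -
    have "eventually (\<lambda>y. y \<in> - {-R..R}) (nhds x)"
      using that by (intro eventually_nhds_in_open) auto
    then have ev: "eventually (\<lambda>y. 0 = \<theta> y) (nhds x)" by (rule eventually_mono) (use z in auto)
    have "((\<lambda>x. 0) has_real_derivative 0) (at x)" by simp
    then have "(\<theta> has_real_derivative 0) (at x)"
      by (rule DERIV_cong_ev[OF refl ev refl, THEN iffD1])
    then show ?thesis by (rule DERIV_imp_deriv)
  qed
  then show ?thesis using that[of "-R" R] AC_C1[OF d c] AC2 z by blast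
qed

text \<open>A bump minus the multiple of one fixed bump with the same integral is the derivative of
  a test function. Hence \<open>f\<close> integrates against every bump like the constant
  \<open>C\<close>, and letting the bumps grow to indicators carries this over to intervals.\<close>

lemma du_Bois_Reymond:
  assumes f: "local_int f" and z: "\<And>\<theta>. test_function \<theta> \<Longrightarrow> (\<integral>x. deriv \<theta> x * f x \<partial>lborel) = 0"
  obtains C where "AE x in lborel. f x = C"
proof -
  have [measurable]: "f \<in> borel_measurable borel" using f by (simp add: local_int_def)
  have bm: "bump c n a b \<in> borel_measurable borel" for c n a b
    by (rule borel_measurable_continuous_onI) (rule flat_algebra_cont[OF bump_in])
  have ib: "integrable lborel (\<lambda>x. bump c n a b x * g x)" if n: "n > 0" and g: "local_int g" for c n a b g
  proof -
    have "set_integrable lborel {a..b} (\<lambda>x. bump c n a b x * g x)"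
      using g by (intro set_integrable_cont_mult flat_algebra_cont[OF bump_in] bm) (auto simp: local_int_def)
    then show ?thesis unfolding set_integrable_def
    proof (rule Bochner_Integration.integrable_cong[THEN iffD1, rotated -1, OF _ refl])
      show "indicat_real {a..b} x *\<^sub>R (bump c n a b x * g x) = bump c n a b x * g x" for x
        using n by (cases "x \<in> {a..b}") (auto intro!: bump_outside)
    qed
  qed
  have lc: "local_int (\<lambda>x. c)" for c :: real
    by (simp add: local_int_def borel_integrable_atLeastAtMost'[OF continuous_on_const])
  note l1 = lc[of 1]
  define r where "r = (\<integral>x. bump 1 1 0 1 x \<partial>lborel)"
  have r: "r > 0" unfolding r_def by (rule bump_integral_pos) simp
  define C where "C = (\<integral>x. bump 1 1 0 1 x * f x \<partial>lborel) / r"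
  have key: "(\<integral>x. bump 1 n a b x * f x \<partial>lborel) = C * (\<integral>x. bump 1 n a b x \<partial>lborel)" if n: "n > 0" for n a b
  proof -
    define s where "s = (\<integral>x. bump 1 n a b x \<partial>lborel)"
    define h where "h x = bump 1 n a b x + bump (- (s / r)) 1 0 1 x" for x
    have h: "h \<in> flat_algebra" unfolding h_def[abs_def] by (intro flat_algebra.add bump_in)
    have he: "h x = bump 1 n a b x - (s / r) * bump 1 1 0 1 x" for x
      unfolding h_def bump_smult[of "- (s / r)"] by simp
    have ih: "integrable lborel h" and h0: "(\<integral>x. h x \<partial>lborel) = 0"
      using ib[OF n l1, of 1 a b] ib[OF _ l1, of 1 1 0 1] r unfolding he[abs_def] by (simp_all add: s_def r_def)
    obtain F where F: "\<And>x. (F has_real_derivative h x) (at x)"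
      using antiderivative_UNIV[OF flat_algebra_cont[OF h]] by blast
    define A where "A = min a 0"
    define B where "B = max b 1"
    have ho: "h x = 0" if "x \<notin> {A<..<B}" for x
      using that bump_outside[OF n, of x a b 1] bump_outside[of 1 x 0 1 1] unfolding he A_def B_def by fastforce
    have AF: "AC F h" by (rule AC_C1[OF F flat_algebra_cont[OF h]])
    have Fl: "F x = F A" if "x \<le> A" for x
    proof -
      have "F A - F x = (LINT t:{x..A}|lborel. h t)" by (rule AC_eq[OF AF that])
      also have "\<dots> = 0" unfolding set_lebesgue_integral_def
        by (rule integral_eq_zero_AE, rule AE_I2) (simp add: ho indicator_def)
      finally show ?thesis by simp
    qed
    have Fr: "F x = F A" if "B \<le> x" for x
    proof -
      have "A \<le> x" using that unfolding A_def B_def by linarith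
      then have "F x - F A = (LINT t:{A..x}|lborel. h t)" by (rule AC_eq[OF AF])
      also have "\<dots> = (\<integral>x. h x \<partial>lborel)" unfolding set_lebesgue_integral_def
      proof (rule Bochner_Integration.integral_cong[OF refl])
        show "indicat_real {A..x} y *\<^sub>R h y = h y" for y
          using ho[of y] that by (cases "y \<in> {A<..<B}") auto
      qed
      finally show ?thesis using h0 by simp
    qed
    \<comment> \<open>Because \<open>h\<close> has integral 0, its antiderivative is constant, with
      the same value, on both sides of the supports.\<close>
    define \<theta> where "\<theta> x = F x - F A" for x
    have d: "(\<theta> has_real_derivative h x) (at x)" for x
      unfolding \<theta>_def[abs_def] by (auto intro!: derivative_eq_intros F)
    have "smooth \<theta>"
    \<comment> \<open>The antiderivative itself need not lie in \<open>flat_algebra\<close>, but its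
      derivative does.\<close>
    proof (rule smoothI[of "insert \<theta> flat_algebra"])
      fix g assume "g \<in> insert \<theta> flat_algebra"
      then show "\<exists>g'\<in>insert \<theta> flat_algebra. \<forall>x. (g has_real_derivative g' x) (at x)"
      proof
        assume "g = \<theta>"
        then show ?thesis using d h by (intro bexI[of _ h]) auto
      next
        assume "g \<in> flat_algebra"
        then obtain g' where "g' \<in> flat_algebra" "\<forall>x. (g has_real_derivative g' x) (at x)"
          using flat_algebra_deriv by blast
        then show ?thesis by (intro bexI[of _ g']) auto
      qed
    qed simp
    moreover have "{x. \<theta> x \<noteq> 0} \<subseteq> {A..B}"
    proof
      fix x assume "x \<in> {x. \<theta> x \<noteq> 0}"
      then have "\<not> x \<le> A" "\<not> B \<le> x" using Fl[of x] Fr[of x] by (auto simp: \<theta>_def)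
      then show "x \<in> {A..B}" by simp
    qed
    then have "compact (closure {x. \<theta> x \<noteq> 0})" using bounded_subset[of "{A..B}"] by auto
    ultimately have "test_function \<theta>" by (simp add: test_function_def)
    then have "(\<integral>x. deriv \<theta> x * f x \<partial>lborel) = 0" by (rule z)
    moreover have "deriv \<theta> = h" using d by (intro ext DERIV_imp_deriv)
    ultimately have "(\<integral>x. h x * f x \<partial>lborel) = 0" by simp
    then have "(\<integral>x. bump 1 n a b x * f x - (s / r) * (bump 1 1 0 1 x * f x) \<partial>lborel) = 0" by (simp add: he algebra_simps)
    then have "(\<integral>x. bump 1 n a b x * f x \<partial>lborel) - (s / r) * (\<integral>x. bump 1 1 0 1 x * f x \<partial>lborel) = 0"
      using ib[OF n f, of 1 a b] ib[OF _ f, of 1 1 0 1] by simp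
    then show ?thesis by (simp add: C_def s_def)
  qed
  have lim: "(\<lambda>n. \<integral>x. bump 1 (real (Suc n)) a b x * g x \<partial>lborel) \<longlonglongrightarrow> (\<integral>x. indicat_real {a<..<b} x * g x \<partial>lborel)"
    if g: "local_int g" for a b g
  proof (rule integral_dominated_convergence[where w="\<lambda>x. \<bar>indicat_real {a..b} x * g x\<bar>"])
    have gi: "integrable lborel (\<lambda>x. indicat_real {a..b} x * g x)" and [measurable]: "g \<in> borel_measurable borel"
      using g by (auto simp: local_int_def set_integrable_def)
    show "integrable lborel (\<lambda>x. \<bar>indicat_real {a..b} x * g x\<bar>)" using gi by simp
    show "(\<lambda>x. indicat_real {a<..<b} x * g x) \<in> borel_measurable lborel" by measurable
    show "(\<lambda>x. bump 1 (real (Suc n)) a b x * g x) \<in> borel_measurable lborel" for n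
      using bm[of 1 "real (Suc n)" a b] by measurable
    show "AE x in lborel. (\<lambda>n. bump 1 (real (Suc n)) a b x * g x) \<longlonglongrightarrow> indicat_real {a<..<b} x * g x"
      by (intro AE_I2 tendsto_mult bump_limit tendsto_const)
    show "AE x in lborel. norm (bump 1 (real (Suc n)) a b x * g x) \<le> \<bar>indicat_real {a..b} x * g x\<bar>" for n
    proof (rule AE_I2)
      fix x show "norm (bump 1 (real (Suc n)) a b x * g x) \<le> \<bar>indicat_real {a..b} x * g x\<bar>"
      proof (cases "x \<in> {a<..<b}")
        case True
        then show ?thesis using bump_bounds[of "real (Suc n)" a b x]
          by (simp add: abs_mult mult_left_le_one_le del: of_nat_Suc)
      qed (simp add: bump_outside del: of_nat_Suc)
    qed
  qed
  have "(\<integral>x. indicat_real {a<..<b} x * f x \<partial>lborel) = C * (\<integral>x. indicat_real {a<..<b} x * 1 \<partial>lborel)" for a b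
  proof (rule LIMSEQ_unique)
    show "(\<lambda>n. \<integral>x. bump 1 (real (Suc n)) a b x * f x \<partial>lborel) \<longlonglongrightarrow> (\<integral>x. indicat_real {a<..<b} x * f x \<partial>lborel)"
      by (rule lim[OF f])
    show "(\<lambda>n. \<integral>x. bump 1 (real (Suc n)) a b x * f x \<partial>lborel) \<longlonglongrightarrow> C * (\<integral>x. indicat_real {a<..<b} x * 1 \<partial>lborel)"
      using tendsto_mult[OF tendsto_const[of C] lim[OF l1, of a b]] key by (simp del: of_nat_Suc)
  qed
  then have o: "(LINT x:{a<..<b}|lborel. f x) = (LINT x:{a<..<b}|lborel. C)" for a b
    by (simp add: set_lebesgue_integral_def mult.commute)
  have "AE x in lborel. f x - C = 0"
  proof (rule AE_zero_if_intervals)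
    note lC = lc[of C]
    show "local_int (\<lambda>x. f x - C)" by (intro local_int_diff f lC)
    fix a b :: real assume "a < b"
    have c: "(LINT x:{a..b}|lborel. g x) = (LINT x:{a<..<b}|lborel. g x)" for g :: "real \<Rightarrow> real"
      by (rule set_integral_discrete_difference[of "{a,b}"]) auto
    have "(LINT x:{a..b}|lborel. f x - C) = (LINT x:{a..b}|lborel. f x) - (LINT x:{a..b}|lborel. C)"
      using f lC by (intro set_integral_diff) (auto simp: local_int_def)
    then show "(LINT x:{a..b}|lborel. f x - C) = 0" unfolding c o by simp
  qed
  then show ?thesis using that[of C] by simp
qed

section \<open>Complex valued functions, null sets and rescaling\<close>

definition cAC :: "(real \<Rightarrow> complex) \<Rightarrow> (real \<Rightarrow> complex) \<Rightarrow> bool" where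
  "cAC f g \<longleftrightarrow> AC (\<lambda>x. Re (f x)) (\<lambda>x. Re (g x)) \<and> AC (\<lambda>x. Im (f x)) (\<lambda>x. Im (g x))"

definition csq :: "(real \<Rightarrow> complex) \<Rightarrow> bool" where
  "csq f \<longleftrightarrow> sq (\<lambda>x. Re (f x)) \<and> sq (\<lambda>x. Im (f x))"

lemma AC_diff: "AC f f' \<Longrightarrow> AC g g' \<Longrightarrow> AC (\<lambda>x. f x - g x) (\<lambda>x. f' x - g' x)"
  using AC_add[OF _ AC_cmult[of g g' "-1"], of f f'] by simp

lemma cAC_cmult: "cAC f g \<Longrightarrow> cAC (\<lambda>x. m * f x) (\<lambda>x. m * g x)"
  by (simp add: cAC_def AC_add AC_diff AC_cmult)

lemma cAC_add: "cAC f f' \<Longrightarrow> cAC g g' \<Longrightarrow> cAC (\<lambda>x. f x + g x) (\<lambda>x. f' x + g' x)"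
  by (simp add: cAC_def AC_add)

lemma cAC_real_mult:
  "AC m m' \<Longrightarrow> cAC f g \<Longrightarrow> cAC (\<lambda>x. of_real (m x) * f x) (\<lambda>x. of_real (m' x) * f x + of_real (m x) * g x)"
  by (auto simp: cAC_def intro: AC_mult)

lemma csq_cmult: "csq f \<Longrightarrow> csq (\<lambda>x. m * f x)"
  by (simp add: csq_def sq_add sq_diff sq_cmult)

lemma csq_add: "csq f \<Longrightarrow> csq g \<Longrightarrow> csq (\<lambda>x. f x + g x)"
  by (simp add: csq_def sq_add)

lemma csq_real_mult:
  "m \<in> borel_measurable borel \<Longrightarrow> (\<And>x. \<bar>m x\<bar> \<le> C) \<Longrightarrow> csq f \<Longrightarrow> csq (\<lambda>x. of_real (m x) * f x)"
  by (auto simp: csq_def intro: sq_bmult[of m C])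

lemma AE_eq_imp_eq:
  fixes f g :: "real \<Rightarrow> real"
  assumes "continuous_on UNIV f" "continuous_on UNIV g" "AE x in lborel. f x = g x"
  shows "f x = g x"
proof (rule ccontr)
  assume ne: "f x \<noteq> g x"
  have "open {x. f x \<noteq> g x}" by (rule open_Collect_neq) (use assms in auto)
  then obtain e where e: "e > 0" "\<And>y. \<bar>y - x\<bar> < e \<Longrightarrow> f y \<noteq> g y"
    using ne by (auto simp: open_dist dist_real_def)
  have "AE y in lborel. y \<notin> {x<..<x+e}"
    using assms(3) by (rule eventually_mono) (use e(2) in force)
  then have "{x<..<x+e} \<in> null_sets lborel" by (simp add: AE_iff_null_sets)
  then have "emeasure lborel {x<..<x+e} = 0" by (rule null_setsD1)
  then show False using e(1) by simp
qed

lemma AE_scale: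
  assumes s: "(s::real) \<noteq> 0" and P: "AE x in lborel. P x"
  shows "AE x in lborel. P (s * x)"
proof -
  obtain N where N: "N \<in> null_sets lborel" "{x \<in> space lborel. \<not> P x} \<subseteq> N"
    using P by (auto simp: eventually_ae_filter)
  have "N \<in> sets borel" using N(1) by (auto simp: null_sets_def)
  then have "Measurable.pred borel (\<lambda>x. x \<notin> N)" by measurable
  then have "AE x in lborel. 0 + s * x \<notin> N"
    using AE_borel_affine[OF s, of "\<lambda>x. x \<notin> N" 0] AE_not_in[OF N(1)] by simp
  then show ?thesis by (rule eventually_mono) (use N(2) in auto)
qed

lemma AC_scale:
  assumes s: "(s::real) > 0" and f: "AC f g"
  shows "AC (\<lambda>x. f (s * x)) (\<lambda>x. s * g (s * x))"
proof -
  have e: "indicat_real {a..b} x *\<^sub>R (s * g (s * x)) = s * (\<lambda>y. indicat_real {s * a..s * b} y *\<^sub>R g y) (0 + s * x)" for a b x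
    using s by (auto simp: indicator_def)
  have i: "integrable lborel (\<lambda>x. (\<lambda>y. indicat_real {s * a..s * b} y *\<^sub>R g y) (0 + s * x))" for a b
    by (rule lborel_integrable_real_affine) (use AC_int[OF f] s in \<open>auto simp: set_integrable_def\<close>)
  have v: "(LINT x:{a..b}|lborel. s * g (s * x)) = (LINT x:{s * a..s * b}|lborel. g x)" for a b
    unfolding set_lebesgue_integral_def e
    using s by (subst lborel_integral_real_affine[where c=s and t=0 and f="\<lambda>y. indicat_real {s * a..s * b} y *\<^sub>R g y"]) simp_all
  have [measurable]: "g \<in> borel_measurable borel" by (rule AC_meas[OF f])
  show ?thesis unfolding AC_def
  proof (intro conjI allI impI)
    show "(\<lambda>x. s * g (s * x)) \<in> borel_measurable borel" by measurable
    show "set_integrable lborel {a..b} (\<lambda>x. s * g (s * x))" for a b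
      unfolding set_integrable_def e using i[of a b] by (rule integrable_mult_right)
    fix a b :: real assume "a \<le> b"
    then show "f (s * b) - f (s * a) = (LINT x:{a..b}|lborel. s * g (s * x))"
      unfolding v using AC_eq[OF f, of "s * a" "s * b"] s by simp
  qed
qed

lemma sq_scale: "(s::real) \<noteq> 0 \<Longrightarrow> sq f \<Longrightarrow> sq (\<lambda>x. f (s * x))"
  using lborel_integrable_real_affine[of "\<lambda>x. (f x)\<^sup>2" s 0] by (auto simp: sq_def)

lemma cAC_scale: "s > 0 \<Longrightarrow> cAC f g \<Longrightarrow> cAC (\<lambda>x. f (s * x)) (\<lambda>x. of_real s * g (s * x))"
  using AC_scale[of s "\<lambda>x. Re (f x)" "\<lambda>x. Re (g x)"] AC_scale[of s "\<lambda>x. Im (f x)" "\<lambda>x. Im (g x)"] by (simp add: cAC_def)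

lemma csq_scale: "s > 0 \<Longrightarrow> csq f \<Longrightarrow> csq (\<lambda>x. f (s * x))"
  using sq_scale[of s "\<lambda>x. Re (f x)"] sq_scale[of s "\<lambda>x. Im (f x)"] by (simp add: csq_def)

text \<open>Local integrability says nothing directly about measurability of \<open>f\<close>, which
  is recovered as the pointwise limit of truncations to growing intervals.\<close>

lemma locally_integrable_Re_Im:
  assumes "locally_integrable f"
  shows "local_int (\<lambda>x. Re (f x))" "local_int (\<lambda>x. Im (f x))" "f \<in> borel_measurable borel"
proof -
  have i: "integrable lborel (\<lambda>x. indicat_real {a..b} x *\<^sub>R f x)" for a b
    using assms by (simp add: locally_integrable_def set_integrable_def)
  have m: "(\<lambda>x. indicat_real {- real n..real n} x *\<^sub>R f x) \<in> borel_measurable borel" for n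
    using borel_measurable_integrable[OF i] by simp
  have "(\<lambda>n. indicat_real {- real n..real n} x *\<^sub>R f x) \<longlonglongrightarrow> f x" for x
  proof (rule tendsto_eventually)
    obtain N :: nat where N: "\<bar>x\<bar> \<le> real N" using real_arch_simple by blast
    have "\<forall>n\<ge>N. indicat_real {- real n..real n} x *\<^sub>R f x = f x"
    proof (intro allI impI)
      fix n assume "N \<le> n"
      then have "\<bar>x\<bar> \<le> real n" using N by (meson of_nat_mono order_trans)
      then show "indicat_real {- real n..real n} x *\<^sub>R f x = f x" by (simp add: abs_le_iff)
    qed
    then show "eventually (\<lambda>n. indicat_real {- real n..real n} x *\<^sub>R f x = f x) sequentially"
      unfolding eventually_sequentially by blast
  qed
  then show f: "f \<in> borel_measurable borel" by (rule borel_measurable_LIMSEQ_metric[OF m])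
  have "(\<lambda>x. Re (f x)) \<in> borel_measurable borel" "(\<lambda>x. Im (f x)) \<in> borel_measurable borel" using f by measurable
  then show "local_int (\<lambda>x. Re (f x))" "local_int (\<lambda>x. Im (f x))"
    using integrable_Re[OF i] integrable_Im[OF i] by (simp_all add: local_int_def set_integrable_def)
qed

lemma local_int_test_integrable:
  assumes t: "AC t t'" and o: "\<And>x. x \<notin> {A..B} \<Longrightarrow> t x = 0" and g: "local_int g"
  shows "integrable lborel (\<lambda>x. t x * g x)"
proof -
  have "set_integrable lborel {A..B} (\<lambda>x. t x * g x)"
    using g by (intro set_integrable_cont_mult AC_cont_on[OF t] AC_borel[OF t]) (auto simp: local_int_def)
  moreover have "indicat_real {A..B} x *\<^sub>R (t x * g x) = t x * g x" for x
    using o[of x] by (cases "x \<in> {A..B}") auto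
  ultimately show ?thesis by (simp only: set_integrable_def)
qed

text \<open>The difference of \<open>f\<close> and any antiderivative of \<open>g\<close> has weak
  derivative 0 and is therefore almost everywhere constant.\<close>

lemma weak_deriv_real_part:
  assumes f: "local_int f" and g: "local_int g"
    and w: "\<And>\<theta>. test_function \<theta> \<Longrightarrow> (\<integral>x. deriv \<theta> x * f x \<partial>lborel) = - (\<integral>x. \<theta> x * g x \<partial>lborel)"
  obtains F where "AC F g" "AE x in lborel. f x = F x"
proof -
  obtain G where G: "AC G g" using AC_antiderivative[OF g] by blast
  have l: "local_int (\<lambda>x. f x - G x)" by (intro local_int_diff f AC_local_int(2)[OF G])
  obtain C where C: "AE x in lborel. f x - G x = C"
  proof (rule du_Bois_Reymond[OF l])
    fix \<theta> assume t: "test_function \<theta>"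
    obtain A B where AB: "AC \<theta> (deriv \<theta>)" "AC (deriv \<theta>) (deriv (deriv \<theta>))"
      "\<And>x. x \<notin> {A..B} \<Longrightarrow> \<theta> x = 0 \<and> deriv \<theta> x = 0"
      using test_function_AC[OF t] by metis
    have i: "integrable lborel (\<lambda>x. deriv \<theta> x * f x)"
      by (rule local_int_test_integrable[OF AB(2) _ f]) (use AB(3) in blast)
    note p = AC_by_parts_compact[OF AB(1) G AB(3)]
    have "(\<integral>x. deriv \<theta> x * (f x - G x) \<partial>lborel) = (\<integral>x. deriv \<theta> x * f x \<partial>lborel) - (\<integral>x. deriv \<theta> x * G x \<partial>lborel)"
      using i p(1) by (simp add: right_diff_distrib)
    then show "(\<integral>x. deriv \<theta> x * (f x - G x) \<partial>lborel) = 0" using p(3) w[OF t] by simp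
  qed
  have "AC (\<lambda>x. 0 + 1 * C) (\<lambda>x. 0)" by (rule AC_C1) (auto intro!: derivative_eq_intros)
  then have "AC (\<lambda>x. G x + C) g" using AC_add[OF G, of "\<lambda>x. C" "\<lambda>x. 0"] by simp
  moreover have "AE x in lborel. f x = G x + C" using C by (rule eventually_mono) (simp add: algebra_simps)
  ultimately show ?thesis using that by blast
qed

lemma weak_deriv_cAC:
  assumes "weak_deriv f g"
  obtains F where "cAC F g" "AE x in lborel. f x = F x"
proof -
  have lf: "locally_integrable f" and lg: "locally_integrable g" using assms by (auto simp: weak_deriv_def)
  note f = locally_integrable_Re_Im[OF lf] and g = locally_integrable_Re_Im[OF lg]
  have key: "(\<integral>x. deriv \<theta> x * Re (f x) \<partial>lborel) = - (\<integral>x. \<theta> x * Re (g x) \<partial>lborel)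
      \<and> (\<integral>x. deriv \<theta> x * Im (f x) \<partial>lborel) = - (\<integral>x. \<theta> x * Im (g x) \<partial>lborel)" if t: "test_function \<theta>" for \<theta>
  proof -
    obtain A B where AB: "AC \<theta> (deriv \<theta>)" "AC (deriv \<theta>) (deriv (deriv \<theta>))"
      "\<And>x. x \<notin> {A..B} \<Longrightarrow> \<theta> x = 0 \<and> deriv \<theta> x = 0"
      using test_function_AC[OF t] by metis
    have c: "integrable lborel (\<lambda>x. t x *\<^sub>R h x)"
      if "AC t t'" "\<And>x. x \<notin> {A..B} \<Longrightarrow> t x = 0" "local_int (\<lambda>x. Re (h x))" "local_int (\<lambda>x. Im (h x))" for t t' and h :: "real \<Rightarrow> complex"
    proof -
      have "integrable lborel (\<lambda>x. complex_of_real (t x * Re (h x)) + \<i> * complex_of_real (t x * Im (h x)))"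
        by (intro Bochner_Integration.integrable_add integrable_mult_right integrable_of_real
            local_int_test_integrable[OF that(1) _ that(3), of A B] local_int_test_integrable[OF that(1) _ that(4), of A B] that(2)) auto
      moreover have "complex_of_real (t x * Re (h x)) + \<i> * complex_of_real (t x * Im (h x)) = t x *\<^sub>R h x" for x
        by (simp add: complex_eq_iff)
      ultimately show ?thesis by (simp only:)
    qed
    have i1: "integrable lborel (\<lambda>x. deriv \<theta> x *\<^sub>R f x)" by (rule c[OF AB(2)]) (use AB(3) f in auto)
    have i2: "integrable lborel (\<lambda>x. \<theta> x *\<^sub>R g x)" by (rule c[OF AB(1)]) (use AB(3) g in auto)
    have w: "(LINT x|lborel. deriv \<theta> x *\<^sub>R f x) = - (LINT x|lborel. \<theta> x *\<^sub>R g x)"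
      using assms t by (auto simp: weak_deriv_def)
    show ?thesis using arg_cong[OF w, of Re] arg_cong[OF w, of Im] i1 i2
      by (simp add: integral_Re[symmetric] integral_Im[symmetric])
  qed
  obtain F1 where F1: "AC F1 (\<lambda>x. Re (g x))" "AE x in lborel. Re (f x) = F1 x"
    by (rule weak_deriv_real_part[OF f(1) g(1)]) (use key in auto)
  obtain F2 where F2: "AC F2 (\<lambda>x. Im (g x))" "AE x in lborel. Im (f x) = F2 x"
    by (rule weak_deriv_real_part[OF f(2) g(2)]) (use key in auto)
  have "AE x in lborel. f x = Complex (F1 x) (F2 x)" using F1(2) F2(2) by eventually_elim (simp add: complex_eq_iff)
  then show ?thesis using that[of "\<lambda>x. Complex (F1 x) (F2 x)"] F1(1) F2(1) by (simp add: cAC_def)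
qed

lemma cAC_AE_unique:
  assumes f: "cAC f f'" and g: "cAC g g'" and e: "AE x in lborel. f x = g x"
  shows "f = g" "AE x in lborel. f' x = g' x"
proof -
  have r: "Re (f x) = Re (g x)" "Im (f x) = Im (g x)" for x
    using f g e by (auto intro!: AE_eq_imp_eq[of "\<lambda>x. Re (f x)"] AE_eq_imp_eq[of "\<lambda>x. Im (f x)"] AC_cont_on simp: cAC_def elim: eventually_mono)
  then show fg: "f = g" by (auto simp: complex_eq_iff)
  have "AE x in lborel. Re (f' x) = Re (g' x)" "AE x in lborel. Im (f' x) = Im (g' x)"
    using f g unfolding fg cAC_def by (auto intro: AC_unique_deriv)
  then show "AE x in lborel. f' x = g' x" by eventually_elim (simp add: complex_eq_iff)
qed

text \<open>The derivatives in \<open>kgz_linearized_solution\<close> are given only by existence;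
  this identifies them with those of absolutely continuous representatives.\<close>

lemma weak_deriv_unique:
  assumes "cAC f0 f1" "AE x in lborel. f x = f0 x" "weak_deriv f g"
  shows "AE x in lborel. g x = f1 x"
proof -
  obtain F where F: "cAC F g" "AE x in lborel. f x = F x" using weak_deriv_cAC[OF assms(3)] by blast
  have "AE x in lborel. F x = f0 x" using assms(2) F(2) by eventually_elim simp
  then show ?thesis using cAC_AE_unique[OF F(1) assms(1)] by blast
qed

lemma weak_deriv2_unique:
  assumes "cAC f0 f1" "cAC f1 f2" "AE x in lborel. f x = f0 x" "weak_deriv2 f h"
  shows "AE x in lborel. h x = f2 x"
proof -
  obtain g where g: "weak_deriv f g" "weak_deriv g h" using assms(4) by (auto simp: weak_deriv2_def)
  show ?thesis by (rule weak_deriv_unique[OF assms(2) weak_deriv_unique[OF assms(1,3) g(1)] g(2)])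
qed

lemma sq_cong_AE:
  assumes "sq f" "AE x in lborel. f x = g x" "g \<in> borel_measurable borel"
  shows "sq g"
proof -
  have "integrable lborel (\<lambda>x. (f x)\<^sup>2) \<longleftrightarrow> integrable lborel (\<lambda>x. (g x)\<^sup>2)"
    using assms by (intro Bochner_Integration.integrable_cong_AE) (auto simp: sq_def elim: eventually_mono)
  then show ?thesis using assms by (simp add: sq_def)
qed

lemma cAC_meas:
  assumes "cAC f g"
  shows "(\<lambda>x. Re (f x)) \<in> borel_measurable borel" "(\<lambda>x. Im (f x)) \<in> borel_measurable borel"
    "(\<lambda>x. Re (g x)) \<in> borel_measurable borel" "(\<lambda>x. Im (g x)) \<in> borel_measurable borel"
  using assms unfolding cAC_def by (blast intro: AC_borel AC_meas)+

lemma cAC_cong_AE: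
  assumes f: "cAC f g" and e: "AE x in lborel. g x = h x"
    and "(\<lambda>x. Re (h x)) \<in> borel_measurable borel" "(\<lambda>x. Im (h x)) \<in> borel_measurable borel"
  shows "cAC f h"
  unfolding cAC_def
proof
  show "AC (\<lambda>x. Re (f x)) (\<lambda>x. Re (h x))"
    by (rule AC_cong_AE[of _ "\<lambda>x. Re (g x)"]) (use assms in \<open>auto simp: cAC_def elim: eventually_mono\<close>)
  show "AC (\<lambda>x. Im (f x)) (\<lambda>x. Im (h x))"
    by (rule AC_cong_AE[of _ "\<lambda>x. Im (g x)"]) (use assms in \<open>auto simp: cAC_def elim: eventually_mono\<close>)
qed

lemma csq_cong_AE:
  assumes "csq f" "AE x in lborel. f x = g x"
    and "(\<lambda>x. Re (g x)) \<in> borel_measurable borel" "(\<lambda>x. Im (g x)) \<in> borel_measurable borel"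
  shows "csq g"
  unfolding csq_def
proof
  show "sq (\<lambda>x. Re (g x))"
    by (rule sq_cong_AE[of "\<lambda>x. Re (f x)"]) (use assms in \<open>auto simp: csq_def elim: eventually_mono\<close>)
  show "sq (\<lambda>x. Im (g x))"
    by (rule sq_cong_AE[of "\<lambda>x. Im (f x)"]) (use assms in \<open>auto simp: csq_def elim: eventually_mono\<close>)
qed

lemma L2_csq: assumes "f \<in> L2" shows "csq f"
proof -
  have f: "f \<in> borel_measurable borel" "integrable lborel (\<lambda>x. (cmod (f x))\<^sup>2)" using assms by (auto simp: L2_def)
  have m: "(\<lambda>x. Re (f x)) \<in> borel_measurable borel" "(\<lambda>x. Im (f x)) \<in> borel_measurable borel"
    using f(1) by measurable
  have c: "sq (\<lambda>x. cmod (f x))" using f by (simp add: sq_def)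
  show ?thesis unfolding csq_def
    by (intro conjI sq_bound[OF m(1) c, of 1] sq_bound[OF m(2) c, of 1]) (simp_all add: abs_Re_le_cmod abs_Im_le_cmod)
qed

text \<open>\<open>weak_deriv_cAC\<close> for each order yields a derivative of the first function
  and a second function that agree almost everywhere; exchanging one for the other makes the chain
  of derivatives fit.\<close>

lemma H2_representative:
  assumes "V \<in> H2"
  obtains V0 V1 V2 where "cAC V0 V1" "cAC V1 V2" "csq V0" "csq V1" "csq V2" "AE x in lborel. V x = V0 x"
proof -
  obtain g h where gh: "V \<in> L2" "g \<in> L2" "h \<in> L2" "weak_deriv V g" "weak_deriv g h"
    using assms by (auto simp: H2_def)
  obtain V0 where V0: "cAC V0 g" "AE x in lborel. V x = V0 x" using weak_deriv_cAC[OF gh(4)] by blast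
  obtain V1 where V1: "cAC V1 h" "AE x in lborel. g x = V1 x" using weak_deriv_cAC[OF gh(5)] by blast
  note m0 = cAC_meas[OF V0(1)] and m1 = cAC_meas[OF V1(1)]
  have "cAC V0 V1" by (rule cAC_cong_AE[OF V0(1) V1(2) m1(1,2)])
  moreover have "csq V0" by (rule csq_cong_AE[OF L2_csq[OF gh(1)] V0(2) m0(1,2)])
  moreover have "csq V1" by (rule csq_cong_AE[OF L2_csq[OF gh(2)] V1(2) m1(1,2)])
  ultimately show ?thesis using that[of V0 V1 h] V0(2) V1(1) L2_csq[OF gh(3)] by blast
qed

text \<open>The time derivatives too are given only by existence; uniqueness forces them to be the
  expected ones.\<close>

lemma has_dt_exp:
  assumes d: "has_dt f f'" and f: "\<And>t x. 0 \<le> t \<Longrightarrow> f t x = exp (\<mu> * complex_of_real t) * F x" and t: "0 \<le> t"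
  shows "f' t x = exp (\<mu> * complex_of_real t) * (\<mu> * F x)"
proof -
  have 1: "((\<lambda>s. f s x) has_vector_derivative f' t x) (at t within {0..})" using d t by (simp add: has_dt_def)
  have "((\<lambda>z. exp (\<mu> * z) * F x) has_field_derivative \<mu> * exp (\<mu> * of_real t) * F x) (at (of_real t))"
    by (auto intro!: derivative_eq_intros)
  then have "((\<lambda>s. exp (\<mu> * complex_of_real s) * F x) has_vector_derivative \<mu> * exp (\<mu> * of_real t) * F x) (at t within {0..})"
    by (intro has_vector_derivative_real_field has_vector_derivative_at_within[of _ _ t])
  then have 2: "((\<lambda>s. f s x) has_vector_derivative \<mu> * exp (\<mu> * of_real t) * F x) (at t within {0..})"
    by (rule has_vector_derivative_transform[rotated -1]) (use f t in auto)
  \<comment> \<open>Uniqueness needs a limit point, and at \<open>t = 0\<close> there are only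
    points to the right.\<close>
  have "at t within {0..} \<noteq> bot"
  proof -
    have "at_right t \<noteq> bot" by simp
    moreover have "at_right t \<le> at t within {0..}" by (rule at_le) (use t in auto)
    ultimately show ?thesis by (metis bot.extremum_unique)
  qed
  then have "f' t x = \<mu> * exp (\<mu> * of_real t) * F x" using 1 2 by (rule vector_derivative_unique_within)
  then show ?thesis by (simp add: mult_ac)
qed

subsection \<open>Stability\<close>

text \<open>The strong equations tested with \<open>y\<close>. \<open>A\<close> and \<open>B\<close>
  are derivatives of \<open>V'\<close> and of the flux \<open>q' + 2 sech V\<close>, so integration
  by parts moves them to \<open>y\<close> and reproduces the energy form.\<close>

lemma weak_form:
  assumes u: "u \<in> H1_pairs" and A: "H1 (\<lambda>x. u x $ 2) A" and B: "H1 (\<lambda>x. u x $ 4 + 2 * (sech x * u x $ 1)) B"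
    and m: "sq m1" "sq m3"
    and e1: "AE x in lborel. m1 x + u x $ 1 - 2 * ((sech x)\<^sup>2 * u x $ 1) + 2 * (sech x * u x $ 4) = A x"
    and e3: "AE x in lborel. m3 x = B x"
    and y: "y \<in> H1_pairs"
  shows "(\<integral>x. m1 x * y x $ 1 + m3 x * y x $ 3 \<partial>lborel) + energy u y = 0"
proof -
  note y1 = H1_pairs_H1(1)[OF y] and y3 = H1_pairs_H1(2)[OF y] and sy = H1_pairs_sq[OF y]
  have i: "integrable lborel (\<lambda>x. m1 x * y x $ 1 + m3 x * y x $ 3)" using m sy by (intro Bochner_Integration.integrable_add sq_mult)
  have j: "integrable lborel (\<lambda>x. energy_kernel x (u x) (y x))" by (rule form_kernel_integrable[OF form_kernel_energy u y])
  have k: "integrable lborel (\<lambda>x. A x * y x $ 1)" "integrable lborel (\<lambda>x. u x $ 2 * y x $ 2)"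
    "integrable lborel (\<lambda>x. B x * y x $ 3)" "integrable lborel (\<lambda>x. (u x $ 4 + 2 * (sech x * u x $ 1)) * y x $ 4)"
    by (rule sq_mult[OF H1_sq'[OF A] sy(1)] sq_mult[OF H1_sq[OF A] sy(2)] sq_mult[OF H1_sq'[OF B] sy(3)] sq_mult[OF H1_sq[OF B] sy(4)])+
  have "(\<integral>x. m1 x * y x $ 1 + m3 x * y x $ 3 \<partial>lborel) + energy u y
     = (\<integral>x. (m1 x * y x $ 1 + m3 x * y x $ 3) + energy_kernel x (u x) (y x) \<partial>lborel)"
    unfolding form_def using i j by simp
  also have "\<dots> = (\<integral>x. (A x * y x $ 1 + u x $ 2 * y x $ 2) + (B x * y x $ 3 + (u x $ 4 + 2 * (sech x * u x $ 1)) * y x $ 4) \<partial>lborel)"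
  proof (rule integral_cong_AE)
    show "(\<lambda>x. (m1 x * y x $ 1 + m3 x * y x $ 3) + energy_kernel x (u x) (y x)) \<in> borel_measurable lborel"
      using i j by (intro borel_measurable_add borel_measurable_integrable)
    show "(\<lambda>x. (A x * y x $ 1 + u x $ 2 * y x $ 2) + (B x * y x $ 3 + (u x $ 4 + 2 * (sech x * u x $ 1)) * y x $ 4)) \<in> borel_measurable lborel"
      using k by (intro borel_measurable_add borel_measurable_integrable)
    show "AE x in lborel. (m1 x * y x $ 1 + m3 x * y x $ 3) + energy_kernel x (u x) (y x)
       = (A x * y x $ 1 + u x $ 2 * y x $ 2) + (B x * y x $ 3 + (u x $ 4 + 2 * (sech x * u x $ 1)) * y x $ 4)"
      using e1 e3
    proof eventually_elim
      case (elim x)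
      show ?case unfolding elim(1)[symmetric] elim(2)[symmetric] energy_kernel_def by (simp add: algebra_simps)
    qed
  qed
  also have "\<dots> = 0" using H1_by_parts[OF A y1] H1_by_parts[OF B y3] k by simp
  finally show ?thesis .
qed

lemma reduced_mode_trivial:
  fixes k :: real and \<mu> :: complex
  assumes k: "1 \<le> k\<^sup>2" and mu: "0 < Re \<mu>"
    and v: "cAC v0 v1" "cAC v1 v2" "csq v0" "csq v1" "csq v2"
    and w: "cAC w0 w1" "cAC w1 w2" "csq w0" "csq w1" "csq w2"
    and p: "cAC p1 p2" "csq p1" "cAC (\<lambda>x. of_real (sech x) * v0 x) p1"
    and e1: "AE x in lborel. \<mu>\<^sup>2 * v0 x - 2 * of_real k * \<mu> * v1 x - v2 x + v0 x - 2 * of_real ((sech x)\<^sup>2) * v0 x + 2 * of_real (sech x) * w0 x = 0"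
    and e2: "AE x in lborel. \<mu>\<^sup>2 * w0 x - 2 * of_real k * \<mu> * w1 x - w2 x - 2 * p2 x = 0"
  shows "AE x in lborel. v0 x = 0" "AE x in lborel. w0 x = 0"
proof -
  have mu0: "\<mu> \<noteq> 0" using mu by auto
  define a where "a = Re \<mu>"
  define b where "b = Im \<mu>"
  have mu2: "\<mu>\<^sup>2 = Complex (a\<^sup>2 - b\<^sup>2) (2 * a * b)" by (simp add: complex_eq_iff a_def b_def power2_eq_square)
  \<comment> \<open>The second equation says that \<open>\<mu>\<^sup>2 * w0\<close> is the
    derivative of this numerator, so \<open>q\<close> is an antiderivative of \<open>w0\<close>, and
    it is square integrable by construction.\<close>
  define q where "q x = (2 * of_real k * \<mu> * w0 x + w1 x + 2 * p1 x) / \<mu>\<^sup>2" for x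
  have qe: "\<mu>\<^sup>2 * q x = 2 * of_real k * \<mu> * w0 x + w1 x + 2 * p1 x" for x using mu0 by (simp add: q_def)
  have cq: "csq q"
    using csq_cmult[OF csq_add[OF csq_add[OF csq_cmult[OF w(3), of "2 * of_real k * \<mu>"] w(4)] csq_cmult[OF p(2), of 2]], of "1/\<mu>\<^sup>2"]
    by (simp add: q_def[abs_def])
  have "cAC q (\<lambda>x. 1/\<mu>\<^sup>2 * (2 * of_real k * \<mu> * w1 x + w2 x + 2 * p2 x))"
    using cAC_cmult[OF cAC_add[OF cAC_add[OF cAC_cmult[OF w(1), of "2 * of_real k * \<mu>"] w(2)] cAC_cmult[OF p(1), of 2]], of "1/\<mu>\<^sup>2"]
    by (simp add: q_def[abs_def])
  moreover have "AE x in lborel. 1/\<mu>\<^sup>2 * (2 * of_real k * \<mu> * w1 x + w2 x + 2 * p2 x) = w0 x"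
    using e2
  proof eventually_elim
    case (elim x)
    then have "2 * of_real k * \<mu> * w1 x + w2 x + 2 * p2 x = \<mu>\<^sup>2 * w0 x" by (simp add: algebra_simps)
    then show ?case using mu0 by simp
  qed
  ultimately have q: "cAC q w0" using cAC_meas(1,2)[OF w(1)] by (rule cAC_cong_AE)
  define ur where "ur x = vec4 (Re (v0 x)) (Re (v1 x)) (Re (q x)) (Re (w0 x))" for x
  define ui where "ui x = vec4 (Im (v0 x)) (Im (v1 x)) (Im (q x)) (Im (w0 x))" for x
  have U: "ur \<in> H1_pairs" "ui \<in> H1_pairs"
    using v w q cq by (auto simp: H1_pairs_def ur_def ui_def H1_def cAC_def csq_def)
  have sp: "cAC (\<lambda>x. w0 x + 2 * (of_real (sech x) * v0 x)) (\<lambda>x. w1 x + 2 * p1 x)"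
    by (intro cAC_add cAC_cmult w p)
  have ssech: "csq (\<lambda>x. of_real (sech x) * v0 x)"
    using sech_le_1 sech_pos by (intro csq_real_mult[of sech 1] v) (auto simp: less_imp_le)
  have ssp: "csq (\<lambda>x. w0 x + 2 * (of_real (sech x) * v0 x))" "csq (\<lambda>x. w1 x + 2 * p1 x)"
    by (intro csq_add csq_cmult w p ssech)+
  have eq: "v2 x = \<mu>\<^sup>2 * v0 x - 2 * of_real k * \<mu> * v1 x + v0 x - 2 * of_real ((sech x)\<^sup>2) * v0 x + 2 * of_real (sech x) * w0 x"
    if "\<mu>\<^sup>2 * v0 x - 2 * of_real k * \<mu> * v1 x - v2 x + v0 x - 2 * of_real ((sech x)\<^sup>2) * v0 x + 2 * of_real (sech x) * w0 x = 0" for x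
    using that by (simp add: algebra_simps)
  \<comment> \<open>\<open>no_unstable_mode\<close> is about real states, so real and imaginary
    parts are treated apart; \<open>m1\<close> and \<open>m3\<close> collect the terms with
    \<open>\<mu>\<close>.\<close>
  have R: "(a\<^sup>2 - b\<^sup>2) * mass ur y - 2 * a * b * mass ui y - 2 * k * (a * shift ur y - b * shift ui y) + energy ur y = 0" if y: "y \<in> H1_pairs" for y
  proof -
    define m1 where "m1 x = Re (\<mu>\<^sup>2 * v0 x - 2 * of_real k * \<mu> * v1 x)" for x
    define m3 where "m3 x = Re (\<mu>\<^sup>2 * q x - 2 * of_real k * \<mu> * w0 x)" for x
    have m: "sq m1" "sq m3"
      using csq_add[OF csq_cmult[OF v(3), of "\<mu>\<^sup>2"] csq_cmult[OF v(4), of "- 2 * of_real k * \<mu>"]]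
        csq_add[OF csq_cmult[OF cq, of "\<mu>\<^sup>2"] csq_cmult[OF w(3), of "- 2 * of_real k * \<mu>"]]
      unfolding csq_def m1_def[abs_def] m3_def[abs_def] by (simp_all add: algebra_simps)
    have "(\<integral>x. m1 x * y x $ 1 + m3 x * y x $ 3 \<partial>lborel) + energy ur y = 0"
    proof (rule weak_form[OF U(1) _ _ m _ _ y])
      show "H1 (\<lambda>x. ur x $ 2) (\<lambda>x. Re (v2 x))" using v by (simp add: ur_def H1_def cAC_def csq_def)
      show "H1 (\<lambda>x. ur x $ 4 + 2 * (sech x * ur x $ 1)) (\<lambda>x. Re (w1 x) + 2 * Re (p1 x))"
        using sp ssp by (simp add: ur_def H1_def cAC_def csq_def)
      show "AE x in lborel. m1 x + ur x $ 1 - 2 * ((sech x)\<^sup>2 * ur x $ 1) + 2 * (sech x * ur x $ 4) = Re (v2 x)"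
        using e1 by eventually_elim (simp add: eq m1_def ur_def)
      show "AE x in lborel. m3 x = Re (w1 x) + 2 * Re (p1 x)"
        by (rule AE_I2) (simp add: m3_def qe)
    qed
    moreover have "(\<integral>x. m1 x * y x $ 1 + m3 x * y x $ 3 \<partial>lborel)
       = (a\<^sup>2 - b\<^sup>2) * mass ur y - 2 * a * b * mass ui y - 2 * k * (a * shift ur y - b * shift ui y)"
    proof -
      have "(\<integral>x. m1 x * y x $ 1 + m3 x * y x $ 3 \<partial>lborel) = (\<integral>x. (a\<^sup>2 - b\<^sup>2) * mass_kernel x (ur x) (y x) - 2 * a * b * mass_kernel x (ui x) (y x)
          - 2 * k * (a * shift_kernel x (ur x) (y x) - b * shift_kernel x (ui x) (y x)) \<partial>lborel)"
        by (rule Bochner_Integration.integral_cong[OF refl])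
          (simp add: m1_def m3_def mu2 mass_kernel_def shift_kernel_def ur_def ui_def a_def b_def algebra_simps)
      then show ?thesis
        using form_kernel_integrable[OF form_kernel_mass U(1) y] form_kernel_integrable[OF form_kernel_mass U(2) y]
          form_kernel_integrable[OF form_kernel_shift U(1) y] form_kernel_integrable[OF form_kernel_shift U(2) y]
        by (simp add: form_def)
    qed
    ultimately show ?thesis by simp
  qed
  have I: "(a\<^sup>2 - b\<^sup>2) * mass ui y + 2 * a * b * mass ur y - 2 * k * (a * shift ui y + b * shift ur y) + energy ui y = 0" if y: "y \<in> H1_pairs" for y
  proof -
    define m1 where "m1 x = Im (\<mu>\<^sup>2 * v0 x - 2 * of_real k * \<mu> * v1 x)" for x
    define m3 where "m3 x = Im (\<mu>\<^sup>2 * q x - 2 * of_real k * \<mu> * w0 x)" for x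
    have m: "sq m1" "sq m3"
      using csq_add[OF csq_cmult[OF v(3), of "\<mu>\<^sup>2"] csq_cmult[OF v(4), of "- 2 * of_real k * \<mu>"]]
        csq_add[OF csq_cmult[OF cq, of "\<mu>\<^sup>2"] csq_cmult[OF w(3), of "- 2 * of_real k * \<mu>"]]
      unfolding csq_def m1_def[abs_def] m3_def[abs_def] by (simp_all add: algebra_simps)
    have "(\<integral>x. m1 x * y x $ 1 + m3 x * y x $ 3 \<partial>lborel) + energy ui y = 0"
    proof (rule weak_form[OF U(2) _ _ m _ _ y])
      show "H1 (\<lambda>x. ui x $ 2) (\<lambda>x. Im (v2 x))" using v by (simp add: ui_def H1_def cAC_def csq_def)
      show "H1 (\<lambda>x. ui x $ 4 + 2 * (sech x * ui x $ 1)) (\<lambda>x. Im (w1 x) + 2 * Im (p1 x))"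
        using sp ssp by (simp add: ui_def H1_def cAC_def csq_def)
      show "AE x in lborel. m1 x + ui x $ 1 - 2 * ((sech x)\<^sup>2 * ui x $ 1) + 2 * (sech x * ui x $ 4) = Im (v2 x)"
        using e1 by eventually_elim (simp add: eq m1_def ui_def)
      show "AE x in lborel. m3 x = Im (w1 x) + 2 * Im (p1 x)"
        by (rule AE_I2) (simp add: m3_def qe)
    qed
    moreover have "(\<integral>x. m1 x * y x $ 1 + m3 x * y x $ 3 \<partial>lborel)
       = (a\<^sup>2 - b\<^sup>2) * mass ui y + 2 * a * b * mass ur y - 2 * k * (a * shift ui y + b * shift ur y)"
    proof -
      have "(\<integral>x. m1 x * y x $ 1 + m3 x * y x $ 3 \<partial>lborel) = (\<integral>x. (a\<^sup>2 - b\<^sup>2) * mass_kernel x (ui x) (y x) + 2 * a * b * mass_kernel x (ur x) (y x)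
          - 2 * k * (a * shift_kernel x (ui x) (y x) + b * shift_kernel x (ur x) (y x)) \<partial>lborel)"
        by (rule Bochner_Integration.integral_cong[OF refl])
          (simp add: m1_def m3_def mu2 mass_kernel_def shift_kernel_def ur_def ui_def a_def b_def algebra_simps)
      then show ?thesis
        using form_kernel_integrable[OF form_kernel_mass U(1) y] form_kernel_integrable[OF form_kernel_mass U(2) y]
          form_kernel_integrable[OF form_kernel_shift U(1) y] form_kernel_integrable[OF form_kernel_shift U(2) y]
        by (simp add: form_def)
    qed
    ultimately show ?thesis by simp
  qed
  have a0: "0 < a" using mu by (simp add: a_def)
  have z: "mass ur ur = 0" "mass ui ui = 0" using no_unstable_mode[OF k a0 U R I] by blast+
  have zero: "AE x in lborel. u x $ 1 = 0 \<and> u x $ 3 = 0" if "u \<in> H1_pairs" "mass u u = 0" for u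
  proof -
    have "AE x in lborel. mass_kernel x (u x) (u x) = 0"
      using form_kernel_integrable[OF form_kernel_mass that(1,1)] that(2)
      by (intro integral_nonneg_eq_0_iff_AE[THEN iffD1]) (auto simp: form_def mass_kernel_def)
    then show ?thesis by (rule eventually_mono) (auto simp: mass_kernel_def sum_squares_eq_zero_iff)
  qed
  have "AE x in lborel. v0 x = 0 \<and> q x = 0"
    using zero[OF U(1) z(1)] zero[OF U(2) z(2)] by eventually_elim (simp add: ur_def ui_def complex_eq_iff)
  then have v0: "AE x in lborel. v0 x = 0" and q0: "AE x in lborel. q x = 0" by (auto elim: eventually_mono)
  show "AE x in lborel. v0 x = 0" by (rule v0)
  \<comment> \<open>\<open>q\<close> and 0 agree almost everywhere, hence so do their derivatives
    \<open>w0\<close> and 0.\<close>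
  have "cAC (\<lambda>x. 0) (\<lambda>x. 0)" using H1_zero by (simp add: cAC_def H1_def)
  then show "AE x in lborel. w0 x = 0" using cAC_AE_unique(2)[OF q] q0 by blast
qed

section \<open>Return from the reduced system to the original variables\<close>

definition sech' :: "real \<Rightarrow> real" where "sech' x = - (sech x * tanh x)"
definition sech'' :: "real \<Rightarrow> real" where "sech'' x = sech x - 2 * (sech x)^3"

lemma AC_sech: "AC sech sech'" "AC sech' sech''"
  using H1_AC[OF H1_sech] H1_AC[OF H1_sech'] by (simp_all add: sech'_def[abs_def] sech''_def[abs_def])

lemma sech_deriv_bounds: "\<bar>sech x\<bar> \<le> 1" "\<bar>sech' x\<bar> \<le> 1" "\<bar>sech'' x\<bar> \<le> 3"
proof -
  have s: "0 < sech x" "sech x \<le> 1" by (simp_all add: sech_pos sech_le_1)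
  show "\<bar>sech x\<bar> \<le> 1" using s by simp
  have "sech x * \<bar>tanh x\<bar> \<le> 1 * 1" using s abs_tanh_le_1 by (intro mult_mono) auto
  then show "\<bar>sech' x\<bar> \<le> 1" using s by (simp add: sech'_def abs_mult)
  have "0 < (sech x)^3" "(sech x)^3 \<le> 1" using s by (simp_all add: power_le_one)
  then show "\<bar>sech'' x\<bar> \<le> 3" using s unfolding sech''_def abs_le_iff by argo
qed

lemma kgz_profiles:
  assumes "s = sqrt (1 - c\<^sup>2)"
  shows "kgz_\<phi> c y = 2 * s * sech (y / s)" "kgz_\<psi> c y = - 2 * (sech (y / s))\<^sup>2"
  by (simp_all add: kgz_\<phi>_def kgz_\<psi>_def sech_def assms)

lemma sech_product_derivatives:
  assumes v: "cAC v0 v1" "cAC v1 v2"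
  shows "cAC (\<lambda>x. of_real (sech x) * v0 x) (\<lambda>x. of_real (sech' x) * v0 x + of_real (sech x) * v1 x)"
    "cAC (\<lambda>x. of_real (sech' x) * v0 x + of_real (sech x) * v1 x)
       (\<lambda>x. (of_real (sech'' x) * v0 x + of_real (sech' x) * v1 x) + (of_real (sech' x) * v1 x + of_real (sech x) * v2 x))"
  by (intro cAC_add cAC_real_mult AC_sech v)+

lemma kgz_stability_range:
  assumes c: "-1 < c" "c < 1" and k: "1 - c\<^sup>2 \<le> c\<^sup>2"
  shows "kgz_stable c (kgz_\<phi> c) (kgz_\<psi> c)"
  unfolding kgz_stable_def
proof
  assume "kgz_unstable c (kgz_\<phi> c) (kgz_\<psi> c)"
  then obtain \<mu> :: complex and V W where mu: "Re \<mu> > 0" and VW: "V \<in> H2" "W \<in> H2"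
    and nz: "\<not> (AE x in lborel. V x = 0 \<and> W x = 0)"
    and lin: "kgz_linearized_solution c (kgz_\<phi> c) (kgz_\<psi> c)
       (\<lambda>t x. exp (\<mu> * complex_of_real t) * V x) (\<lambda>t x. exp (\<mu> * complex_of_real t) * W x)"
    unfolding kgz_unstable_def by blast
  have c1: "c\<^sup>2 < 1" using c by (simp add: abs_square_less_1)
  define s where "s = sqrt (1 - c\<^sup>2)"
  have s: "s > 0" "s\<^sup>2 = 1 - c\<^sup>2" using c1 by (simp_all add: s_def)
  define k where "k = c / s"
  have ck: "c = k * s" using s by (simp add: k_def)
  have k2: "1 \<le> k\<^sup>2" using k s c1 by (simp add: k_def power_divide le_divide_eq)
  obtain vt vtt vtx vxx wt wtt wtx wxx qxx where
    dt: "has_dt (\<lambda>t x. exp (\<mu> * complex_of_real t) * V x) vt" "has_dt vt vtt"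
      "has_dt (\<lambda>t x. exp (\<mu> * complex_of_real t) * W x) wt" "has_dt wt wtt"
    and eqs: "\<And>t. 0 \<le> t \<Longrightarrow>
           weak_deriv (vt t) (vtx t) \<and> weak_deriv2 (\<lambda>x. exp (\<mu> * complex_of_real t) * V x) (vxx t) \<and>
           weak_deriv (wt t) (wtx t) \<and> weak_deriv2 (\<lambda>x. exp (\<mu> * complex_of_real t) * W x) (wxx t) \<and>
           weak_deriv2 (\<lambda>x. complex_of_real (kgz_\<phi> c x) * (exp (\<mu> * complex_of_real t) * V x)) (qxx t) \<and>
           (AE x in lborel.
              vtt t x - complex_of_real (2 * c) * vtx t x - complex_of_real (1 - c\<^sup>2) * vxx t x
                + exp (\<mu> * complex_of_real t) * V x + complex_of_real (kgz_\<psi> c x) * (exp (\<mu> * complex_of_real t) * V x)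
                + complex_of_real (kgz_\<phi> c x) * (exp (\<mu> * complex_of_real t) * W x) = 0 \<and>
              wtt t x - complex_of_real (2 * c) * wtx t x - complex_of_real (1 - c\<^sup>2) * wxx t x
                - qxx t x = 0)"
    using lin unfolding kgz_linearized_solution_def by blast
  have vt: "vt t x = exp (\<mu> * complex_of_real t) * (\<mu> * V x)" if "0 \<le> t" for t x
    by (rule has_dt_exp[OF dt(1) refl that])
  have wt: "wt t x = exp (\<mu> * complex_of_real t) * (\<mu> * W x)" if "0 \<le> t" for t x
    by (rule has_dt_exp[OF dt(3) refl that])
  have vtt: "vtt 0 x = \<mu>\<^sup>2 * V x" for x
    using has_dt_exp[OF dt(2) vt, of 0 x] by (simp add: power2_eq_square)
  have wtt: "wtt 0 x = \<mu>\<^sup>2 * W x" for x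
    using has_dt_exp[OF dt(4) wt, of 0 x] by (simp add: power2_eq_square)
  \<comment> \<open>The equations are used only at \<open>t = 0\<close>, where the exponential
    factor is 1.\<close>
  have "vt 0 = (\<lambda>x. \<mu> * V x)" "wt 0 = (\<lambda>x. \<mu> * W x)" using vt[of 0] wt[of 0] by (auto simp: fun_eq_iff)
  then have w: "weak_deriv (\<lambda>x. \<mu> * V x) (vtx 0)" "weak_deriv2 V (vxx 0)"
    "weak_deriv (\<lambda>x. \<mu> * W x) (wtx 0)" "weak_deriv2 W (wxx 0)"
    "weak_deriv2 (\<lambda>x. complex_of_real (kgz_\<phi> c x) * V x) (qxx 0)"
    and ae: "AE x in lborel. \<mu>\<^sup>2 * V x - complex_of_real (2 * c) * vtx 0 x - complex_of_real (1 - c\<^sup>2) * vxx 0 x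
                + V x + complex_of_real (kgz_\<psi> c x) * V x + complex_of_real (kgz_\<phi> c x) * W x = 0 \<and>
              \<mu>\<^sup>2 * W x - complex_of_real (2 * c) * wtx 0 x - complex_of_real (1 - c\<^sup>2) * wxx 0 x - qxx 0 x = 0"
    using eqs[of 0] by (simp_all add: vtt wtt)
  obtain V0 V1 V2 where V: "cAC V0 V1" "cAC V1 V2" "csq V0" "csq V1" "csq V2" "AE x in lborel. V x = V0 x"
    using H2_representative[OF VW(1)] by metis
  obtain W0 W1 W2 where W: "cAC W0 W1" "cAC W1 W2" "csq W0" "csq W1" "csq W2" "AE x in lborel. W x = W0 x"
    using H2_representative[OF VW(2)] by metis
  define v0 v1 v2 where "v0 z = V0 (s * z)" and "v1 z = of_real s * V1 (s * z)" and "v2 z = of_real s * (of_real s * V2 (s * z))" for z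
  \<comment> \<open>The extra factor \<open>s\<close> comes from \<open>kgz_\<phi> c\<close>: its
    product with \<open>W\<close> becomes \<open>2 * sech z * w0 z\<close>.\<close>
  define w0 w1 w2 where "w0 z = of_real s * W0 (s * z)" and "w1 z = of_real s * (of_real s * W1 (s * z))"
    and "w2 z = of_real s * (of_real s * (of_real s * W2 (s * z)))" for z
  have v: "cAC v0 v1" "cAC v1 v2" "csq v0" "csq v1" "csq v2"
    unfolding v0_def[abs_def] v1_def[abs_def] v2_def[abs_def]
    by (intro cAC_scale cAC_cmult csq_scale csq_cmult V s)+
  have ww: "cAC w0 w1" "cAC w1 w2" "csq w0" "csq w1" "csq w2"
    unfolding w0_def[abs_def] w1_def[abs_def] w2_def[abs_def]
    by (intro cAC_scale cAC_cmult csq_scale csq_cmult W s)+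
  define p1 where "p1 x = of_real (sech' x) * v0 x + of_real (sech x) * v1 x" for x
  define p2 where "p2 x = (of_real (sech'' x) * v0 x + of_real (sech' x) * v1 x) + (of_real (sech' x) * v1 x + of_real (sech x) * v2 x)" for x
  have p: "cAC (\<lambda>x. of_real (sech x) * v0 x) p1" "cAC p1 p2"
    using sech_product_derivatives[OF v(1,2)] by (simp_all add: p1_def[abs_def] p2_def[abs_def])
  have sm: "sech \<in> borel_measurable borel" "sech' \<in> borel_measurable borel"
    using AC_sech by (auto intro: AC_borel)
  have sp: "csq p1" unfolding p1_def[abs_def]
    by (intro csq_add csq_real_mult[OF sm(1) sech_deriv_bounds(1)] csq_real_mult[OF sm(2) sech_deriv_bounds(2)] v)
  have s1: "1 / s > 0" using s by simp
  \<comment> \<open>The product \<open>kgz_\<phi> c * V\<close> in the original variable; each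
    derivative brings a factor \<open>1/s\<close>.\<close>
  have P: "cAC (\<lambda>x. of_real (2 * s) * (of_real (sech (1/s * x)) * v0 (1/s * x))) (\<lambda>x. of_real (2 * s) * (of_real (1/s) * p1 (1/s * x)))"
    "cAC (\<lambda>x. of_real (2 * s) * (of_real (1/s) * p1 (1/s * x))) (\<lambda>x. of_real (2 * s) * (of_real (1/s) * (of_real (1/s) * p2 (1/s * x))))"
    by (intro cAC_cmult cAC_scale[OF s1 p(1)] cAC_scale[OF s1 p(2)])+
  have e: "AE x in lborel. vtx 0 x = \<mu> * V1 x" "AE x in lborel. vxx 0 x = V2 x"
    "AE x in lborel. wtx 0 x = \<mu> * W1 x" "AE x in lborel. wxx 0 x = W2 x"
    "AE x in lborel. qxx 0 x = of_real (2 * s) * (of_real (1/s) * (of_real (1/s) * p2 (1/s * x)))"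
  proof -
    show "AE x in lborel. vtx 0 x = \<mu> * V1 x"
      by (rule weak_deriv_unique[OF cAC_cmult[OF V(1)] _ w(1)]) (use V(6) in \<open>auto elim: eventually_mono\<close>)
    show "AE x in lborel. wtx 0 x = \<mu> * W1 x"
      by (rule weak_deriv_unique[OF cAC_cmult[OF W(1)] _ w(3)]) (use W(6) in \<open>auto elim: eventually_mono\<close>)
    show "AE x in lborel. vxx 0 x = V2 x" by (rule weak_deriv2_unique[OF V(1,2,6) w(2)])
    show "AE x in lborel. wxx 0 x = W2 x" by (rule weak_deriv2_unique[OF W(1,2,6) w(4)])
    show "AE x in lborel. qxx 0 x = of_real (2 * s) * (of_real (1/s) * (of_real (1/s) * p2 (1/s * x)))"
    proof (rule weak_deriv2_unique[OF P _ w(5)])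
      show "AE x in lborel. complex_of_real (kgz_\<phi> c x) * V x = of_real (2 * s) * (of_real (sech (1/s * x)) * v0 (1/s * x))"
        using V(6) by (rule eventually_mono) (use s in \<open>simp add: kgz_profiles[OF s_def] v0_def\<close>)
    qed
  qed
  have main: "AE x in lborel. (\<mu>\<^sup>2 * V0 x - complex_of_real (2 * c) * (\<mu> * V1 x) - complex_of_real (1 - c\<^sup>2) * V2 x
                + V0 x + complex_of_real (kgz_\<psi> c x) * V0 x + complex_of_real (kgz_\<phi> c x) * W0 x = 0) \<and>
              (\<mu>\<^sup>2 * W0 x - complex_of_real (2 * c) * (\<mu> * W1 x) - complex_of_real (1 - c\<^sup>2) * W2 x
                - of_real (2 * s) * (of_real (1/s) * (of_real (1/s) * p2 (1/s * x))) = 0)"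
    using ae e V(6) W(6)
  proof eventually_elim
    case (elim x)
    show ?case using elim(1) unfolding elim(2-8) by simp
  qed
  note main' = AE_scale[OF _ main, of s]
  have e1: "AE x in lborel. \<mu>\<^sup>2 * v0 x - 2 * of_real k * \<mu> * v1 x - v2 x + v0 x - 2 * of_real ((sech x)\<^sup>2) * v0 x + 2 * of_real (sech x) * w0 x = 0"
    using main'[OF less_imp_neq[OF s(1), THEN not_sym]]
  proof eventually_elim
    case (elim x)
    have h: "\<mu>\<^sup>2 * V0 (s * x) - complex_of_real (2 * c) * (\<mu> * V1 (s * x)) - complex_of_real (s\<^sup>2) * V2 (s * x)
                + V0 (s * x) + complex_of_real (kgz_\<psi> c (s * x)) * V0 (s * x) + complex_of_real (kgz_\<phi> c (s * x)) * W0 (s * x) = 0"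
      using elim by (simp add: s(2))
    have h1: "complex_of_real (2 * c) * (\<mu> * V1 (s * x)) = 2 * of_real k * \<mu> * v1 x"
      by (simp add: ck v1_def)
    have h2: "complex_of_real (s\<^sup>2) * V2 (s * x) = v2 x" by (simp add: v2_def power2_eq_square)
    have h3: "complex_of_real (kgz_\<psi> c (s * x)) * V0 (s * x) = - 2 * of_real ((sech x)\<^sup>2) * v0 x"
      using s by (simp add: kgz_profiles[OF s_def] v0_def)
    have h4: "complex_of_real (kgz_\<phi> c (s * x)) * W0 (s * x) = 2 * of_real (sech x) * w0 x"
      using s by (simp add: kgz_profiles[OF s_def] w0_def)
    show ?case using h unfolding h1 h2 h3 h4 unfolding v0_def[symmetric] by (simp add: algebra_simps)
  qed
  have e2: "AE x in lborel. \<mu>\<^sup>2 * w0 x - 2 * of_real k * \<mu> * w1 x - w2 x - 2 * p2 x = 0"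
    using main'[OF less_imp_neq[OF s(1), THEN not_sym]]
  proof eventually_elim
    case (elim x)
    have "\<mu>\<^sup>2 * W0 (s * x) - complex_of_real (2 * c) * (\<mu> * W1 (s * x)) - complex_of_real (s\<^sup>2) * W2 (s * x)
                - of_real (2 * s) * (of_real (1/s) * (of_real (1/s) * p2 x)) = 0"
      using elim s(1) by (simp add: s(2))
    \<comment> \<open>Multiplication by \<open>s\<close> passes from \<open>W0\<close> to
      \<open>w0\<close>.\<close>
    then have "of_real s * (\<mu>\<^sup>2 * W0 (s * x) - complex_of_real (2 * c) * (\<mu> * W1 (s * x)) - complex_of_real (s\<^sup>2) * W2 (s * x)
                - of_real (2 * s) * (of_real (1/s) * (of_real (1/s) * p2 x))) = 0" by simp
    moreover have "of_real s * (complex_of_real (2 * c) * (\<mu> * W1 (s * x))) = 2 * of_real k * \<mu> * w1 x"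
      by (simp add: ck w1_def)
    moreover have "of_real s * (complex_of_real (s\<^sup>2) * W2 (s * x)) = w2 x" by (simp add: w2_def power2_eq_square)
    moreover have "of_real s * (of_real (2 * s) * (of_real (1/s) * (of_real (1/s) * p2 x))) = 2 * p2 x"
      using s(1) by simp
    moreover have "of_real s * (\<mu>\<^sup>2 * W0 (s * x)) = \<mu>\<^sup>2 * w0 x" by (simp add: w0_def)
    ultimately show ?case by (simp only: right_diff_distrib)
  qed
  have z: "AE x in lborel. v0 x = 0" "AE x in lborel. w0 x = 0"
    using reduced_mode_trivial[OF k2 mu v ww p(2) sp p(1) e1 e2] by blast+
  have "1/s \<noteq> 0" using s1 by linarith
  then have "AE x in lborel. v0 (1/s * x) = 0" "AE x in lborel. w0 (1/s * x) = 0"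
    by (rule AE_scale[OF _ z(1)], rule AE_scale[OF _ z(2)])
  then have "AE x in lborel. V0 x = 0" "AE x in lborel. W0 x = 0" using s by (simp_all add: v0_def w0_def)
  with V(6) W(6) have "AE x in lborel. V x = 0 \<and> W x = 0" by eventually_elim simp
  with nz show False by contradiction
qed

lemma kgz_wave_solution:
  assumes c: "-1 < c" "c < 1"
  shows "kgz_solution (\<lambda>t x. complex_of_real (kgz_\<phi> c (x - c * t))) (\<lambda>t x. kgz_\<psi> c (x - c * t))"
proof -
  have c1: "c\<^sup>2 < 1" using c by (simp add: abs_square_less_1)
  define s where "s = sqrt (1 - c\<^sup>2)"
  have s: "s > 0" "s\<^sup>2 = 1 - c\<^sup>2" using c1 by (simp_all add: s_def)
  define y where "y t x = (x - c * t) / s" for t x :: real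
  have yt: "((\<lambda>t. y t x) has_real_derivative - c / s) (at t within S)" for t x S
    unfolding y_def using s by (auto intro!: derivative_eq_intros)
  have yx: "((\<lambda>x. y t x) has_real_derivative 1 / s) (at x within S)" for t x S
    unfolding y_def using s by (auto intro!: derivative_eq_intros)
  have d0: "(sech has_real_derivative sech' z) (at z within S)" for z S
    by (rule DERIV_cong[OF DERIV_sech[OF DERIV_ident]]) (simp add: sech'_def)
  have d1: "(sech' has_real_derivative sech'' z) (at z within S)" for z S
    by (rule has_field_derivative_at_within, rule AC_has_deriv[OF AC_sech(2)])
       (auto simp: sech''_def[abs_def] intro!: continuous_intros)
  define S1 where "S1 z = 2 * sech z * sech' z" for z
  define S2 where "S2 z = 2 * (sech' z)\<^sup>2 + 2 * sech z * sech'' z" for z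
  have e0: "((\<lambda>z. (sech z)\<^sup>2) has_real_derivative S1 z) (at z within S)" for z S
    unfolding S1_def by (auto intro!: derivative_eq_intros simp: power2_eq_square sech'_def)
  have e1: "(S1 has_real_derivative S2 z) (at z within S)" for z S
  proof -
    have "(S1 has_real_derivative (2 * sech' z) * sech' z + sech'' z * (2 * sech z)) (at z within S)"
      unfolding S1_def[abs_def] by (rule DERIV_mult[OF DERIV_cmult[OF d0] d1])
    then show ?thesis by (rule DERIV_cong) (simp add: S2_def power2_eq_square)
  qed
  \<comment> \<open>Chain rule for real and complex valued profiles at once; \<open>a\<close>
    accumulates the factors \<open>- c / s\<close> and \<open>1 / s\<close>.\<close>
  have T: "has_dt (\<lambda>t x. a * f (y t x)) (\<lambda>t x. a * (- c / s) * f' (y t x))"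
    "has_dt (\<lambda>t x. complex_of_real (a * f (y t x))) (\<lambda>t x. complex_of_real (a * (- c / s) * f' (y t x)))"
    "has_dx (\<lambda>t x. a * f (y t x)) (\<lambda>t x. a * (1 / s) * f' (y t x))"
    "has_dx (\<lambda>t x. complex_of_real (a * f (y t x))) (\<lambda>t x. complex_of_real (a * (1 / s) * f' (y t x)))"
    if "\<And>z S. (f has_real_derivative f' z) (at z within S)" for a :: real and f f'
  proof -
    have "((\<lambda>t. a * f (y t x)) has_real_derivative a * (- c / s) * f' (y t x)) (at t within S)" for t x S
    proof -
      have "((\<lambda>t. f (y t x)) has_real_derivative f' (y t x) * (- c / s)) (at t within S)"
        by (rule DERIV_chain2[OF that yt])
      then have "((\<lambda>t. a * f (y t x)) has_real_derivative a * (f' (y t x) * (- c / s))) (at t within S)"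
        by (rule DERIV_cmult)
      moreover have "a * (f' (y t x) * (- c / s)) = a * (- c / s) * f' (y t x)" by (simp only: mult_ac)
      ultimately show ?thesis by (simp only:)
    qed
    note 1 = has_vector_derivative_of_real[OF this] this[unfolded has_real_derivative_iff_has_vector_derivative]
    have "((\<lambda>x. a * f (y t x)) has_real_derivative a * (1 / s) * f' (y t x)) (at x within S)" for t x S
    proof -
      have "((\<lambda>x. f (y t x)) has_real_derivative f' (y t x) * (1 / s)) (at x within S)"
        by (rule DERIV_chain2[OF that yx])
      then have "((\<lambda>x. a * f (y t x)) has_real_derivative a * (f' (y t x) * (1 / s))) (at x within S)"
        by (rule DERIV_cmult)
      moreover have "a * (f' (y t x) * (1 / s)) = a * (1 / s) * f' (y t x)" by (simp only: mult_ac)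
      ultimately show ?thesis by (simp only:)
    qed
    note 2 = has_vector_derivative_of_real[OF this] this[unfolded has_real_derivative_iff_has_vector_derivative]
    show "has_dt (\<lambda>t x. a * f (y t x)) (\<lambda>t x. a * (- c / s) * f' (y t x))"
      "has_dx (\<lambda>t x. a * f (y t x)) (\<lambda>t x. a * (1 / s) * f' (y t x))"
      unfolding has_dt_def has_dx_def using 1 2 by blast+
    show "has_dt (\<lambda>t x. complex_of_real (a * f (y t x))) (\<lambda>t x. complex_of_real (a * (- c / s) * f' (y t x)))"
      "has_dx (\<lambda>t x. complex_of_real (a * f (y t x))) (\<lambda>t x. complex_of_real (a * (1 / s) * f' (y t x)))"
      unfolding has_dt_def has_dx_def using 1 2 by blast+
  qed
  have phi: "(\<lambda>t x. complex_of_real (kgz_\<phi> c (x - c * t))) = (\<lambda>t x. complex_of_real ((2 * s) * sech (y t x)))"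
    and psi: "(\<lambda>t x. kgz_\<psi> c (x - c * t)) = (\<lambda>t x. - 2 * (sech (y t x))\<^sup>2)"
    and sqr: "(\<lambda>t x. (cmod (complex_of_real ((2 * s) * sech (y t x))))\<^sup>2) = (\<lambda>t x. (4 * s\<^sup>2) * (sech (y t x))\<^sup>2)"
    by (auto simp: fun_eq_iff kgz_profiles[OF s_def] y_def norm_of_real power_mult_distrib simp del: of_real_mult)
  have D2: "sech'' z = sech z - 2 * (sech z)^3" for z by (simp add: sech''_def)
  show ?thesis
    unfolding kgz_solution_def phi psi sqr
  proof (intro exI conjI)
    show "has_dt (\<lambda>t x. complex_of_real ((2 * s) * sech (y t x))) (\<lambda>t x. complex_of_real ((2 * s) * (- c / s) * sech' (y t x)))"
      "has_dt (\<lambda>t x. complex_of_real ((2 * s) * (- c / s) * sech' (y t x))) (\<lambda>t x. complex_of_real ((2 * s) * (- c / s) * (- c / s) * sech'' (y t x)))"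
      "has_dx (\<lambda>t x. complex_of_real ((2 * s) * sech (y t x))) (\<lambda>t x. complex_of_real ((2 * s) * (1 / s) * sech' (y t x)))"
      "has_dx (\<lambda>t x. complex_of_real ((2 * s) * (1 / s) * sech' (y t x))) (\<lambda>t x. complex_of_real ((2 * s) * (1 / s) * (1 / s) * sech'' (y t x)))"
      by (rule T[OF d0] T[OF d1])+
    show "has_dt (\<lambda>t x. - 2 * (sech (y t x))\<^sup>2) (\<lambda>t x. - 2 * (- c / s) * S1 (y t x))"
      "has_dt (\<lambda>t x. - 2 * (- c / s) * S1 (y t x)) (\<lambda>t x. - 2 * (- c / s) * (- c / s) * S2 (y t x))"
      "has_dx (\<lambda>t x. - 2 * (sech (y t x))\<^sup>2) (\<lambda>t x. - 2 * (1 / s) * S1 (y t x))"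
      "has_dx (\<lambda>t x. - 2 * (1 / s) * S1 (y t x)) (\<lambda>t x. - 2 * (1 / s) * (1 / s) * S2 (y t x))"
      "has_dx (\<lambda>t x. (4 * s\<^sup>2) * (sech (y t x))\<^sup>2) (\<lambda>t x. (4 * s\<^sup>2) * (1 / s) * S1 (y t x))"
      "has_dx (\<lambda>t x. (4 * s\<^sup>2) * (1 / s) * S1 (y t x)) (\<lambda>t x. (4 * s\<^sup>2) * (1 / s) * (1 / s) * S2 (y t x))"
      by (rule T(1,3)[OF e0] T(1,3)[OF e1])+
    have cs: "c\<^sup>2 = 1 - s\<^sup>2" using s by simp
    show "\<forall>t\<ge>0. \<forall>x. complex_of_real ((2 * s) * (- c / s) * (- c / s) * sech'' (y t x)) - complex_of_real ((2 * s) * (1 / s) * (1 / s) * sech'' (y t x))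
         + complex_of_real ((2 * s) * sech (y t x)) + complex_of_real (- 2 * (sech (y t x))\<^sup>2) * complex_of_real ((2 * s) * sech (y t x)) = 0 \<and>
       - 2 * (- c / s) * (- c / s) * S2 (y t x) - - 2 * (1 / s) * (1 / s) * S2 (y t x) - 1 / 2 * ((4 * s\<^sup>2) * (1 / s) * (1 / s) * S2 (y t x)) = 0"
    proof (intro allI impI conjI)
      fix t x :: real
      define z where "z = y t x"
      have "(2 * s) * (- c / s) * (- c / s) * sech'' z - (2 * s) * (1 / s) * (1 / s) * sech'' z + (2 * s) * sech z + - 2 * (sech z)\<^sup>2 * ((2 * s) * sech z)
          = (2 / s) * (c\<^sup>2 - 1) * sech'' z + 2 * s * (sech z - 2 * (sech z)^3)"
        using s(1) by (simp add: field_simps power2_eq_square power3_eq_cube)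
      also have "\<dots> = 0" unfolding cs D2 using s(1) by (simp add: field_simps power2_eq_square)
      finally show "complex_of_real ((2 * s) * (- c / s) * (- c / s) * sech'' (y t x)) - complex_of_real ((2 * s) * (1 / s) * (1 / s) * sech'' (y t x))
         + complex_of_real ((2 * s) * sech (y t x)) + complex_of_real (- 2 * (sech (y t x))\<^sup>2) * complex_of_real ((2 * s) * sech (y t x)) = 0"
        unfolding z_def[symmetric] of_real_mult[symmetric] of_real_add[symmetric] of_real_diff[symmetric] of_real_eq_0_iff .
      have "- 2 * (- c / s) * (- c / s) * S2 z - - 2 * (1 / s) * (1 / s) * S2 z - 1 / 2 * ((4 * s\<^sup>2) * (1 / s) * (1 / s) * S2 z)
         = (2 * (1 - c\<^sup>2) / s\<^sup>2 - 2) * S2 z"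
        using s(1) by (simp add: field_simps power2_eq_square)
      also have "\<dots> = 0" unfolding cs using s(1) by simp
      finally show "- 2 * (- c / s) * (- c / s) * S2 (y t x) - - 2 * (1 / s) * (1 / s) * S2 (y t x) - 1 / 2 * ((4 * s\<^sup>2) * (1 / s) * (1 / s) * S2 (y t x)) = 0"
        unfolding z_def .
    qed
  qed
qed

text \<open>The direction needed for instability: the constructed mode has classical derivatives,
  which must be presented as weak ones.\<close>

lemma cAC_weak_deriv:
  assumes "cAC f g" shows "weak_deriv f g"
proof -
  note fr = cAC_def[THEN iffD1, OF assms, THEN conjunct1] and fi = cAC_def[THEN iffD1, OF assms, THEN conjunct2]
  have li: "locally_integrable h" if "local_int (\<lambda>x. Re (h x))" "local_int (\<lambda>x. Im (h x))" for h
    unfolding locally_integrable_def set_integrable_def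
  proof (intro allI)
    fix a b
    have "integrable lborel (\<lambda>x. complex_of_real (indicat_real {a..b} x *\<^sub>R Re (h x)) + \<i> * complex_of_real (indicat_real {a..b} x *\<^sub>R Im (h x)))"
      using that unfolding local_int_def set_integrable_def
      by (intro Bochner_Integration.integrable_add integrable_mult_right integrable_of_real) auto
    moreover have "complex_of_real (indicat_real {a..b} x *\<^sub>R Re (h x)) + \<i> * complex_of_real (indicat_real {a..b} x *\<^sub>R Im (h x)) = indicat_real {a..b} x *\<^sub>R h x" for x
      by (simp add: complex_eq_iff)
    ultimately show "integrable lborel (\<lambda>x. indicat_real {a..b} x *\<^sub>R h x)" by (simp only:)
  qed
  have cint: "integrable lborel (\<lambda>x. t x *\<^sub>R h x)" "(LINT x|lborel. t x *\<^sub>R h x) = Complex (LINT x|lborel. t x * Re (h x)) (LINT x|lborel. t x * Im (h x))"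
    if "integrable lborel (\<lambda>x. t x * Re (h x))" "integrable lborel (\<lambda>x. t x * Im (h x))" for t :: "real \<Rightarrow> real" and h :: "real \<Rightarrow> complex"
  proof -
    have "integrable lborel (\<lambda>x. complex_of_real (t x * Re (h x)) + \<i> * complex_of_real (t x * Im (h x)))"
      using that by (intro Bochner_Integration.integrable_add integrable_mult_right integrable_of_real)
    moreover have "complex_of_real (t x * Re (h x)) + \<i> * complex_of_real (t x * Im (h x)) = t x *\<^sub>R h x" for x
      by (simp add: complex_eq_iff)
    ultimately show i: "integrable lborel (\<lambda>x. t x *\<^sub>R h x)" by (simp only:)
    show "(LINT x|lborel. t x *\<^sub>R h x) = Complex (LINT x|lborel. t x * Re (h x)) (LINT x|lborel. t x * Im (h x))"
      using i by (simp add: complex_eq_iff integral_Re[symmetric] integral_Im[symmetric])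
  qed
  show ?thesis unfolding weak_deriv_def
  proof (intro conjI allI impI)
    show "locally_integrable f" "locally_integrable g"
      by (intro li AC_local_int(2)[OF fr] AC_local_int(2)[OF fi] AC_local_int(1)[OF fr] AC_local_int(1)[OF fi])+
    fix \<theta> assume t: "test_function \<theta>"
    obtain A B where AB: "AC \<theta> (deriv \<theta>)" "AC (deriv \<theta>) (deriv (deriv \<theta>))"
      "\<And>x. x \<notin> {A..B} \<Longrightarrow> \<theta> x = 0 \<and> deriv \<theta> x = 0"
      using test_function_AC[OF t] by metis
    note r = AC_by_parts_compact[OF AB(1) fr AB(3)] and i = AC_by_parts_compact[OF AB(1) fi AB(3)]
    show "(LINT x|lborel. deriv \<theta> x *\<^sub>R f x) = - (LINT x|lborel. \<theta> x *\<^sub>R g x)"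
    proof -
      have 1: "(LINT x|lborel. deriv \<theta> x *\<^sub>R f x) = Complex (LINT x|lborel. deriv \<theta> x * Re (f x)) (LINT x|lborel. deriv \<theta> x * Im (f x))"
        by (rule cint(2)[OF r(1) i(1)])
      have 2: "(LINT x|lborel. \<theta> x *\<^sub>R g x) = Complex (LINT x|lborel. \<theta> x * Re (g x)) (LINT x|lborel. \<theta> x * Im (g x))"
        by (rule cint(2)[OF r(2) i(2)])
      have "Complex (LINT x|lborel. deriv \<theta> x * Re (f x)) (LINT x|lborel. deriv \<theta> x * Im (f x))
          = - Complex (LINT x|lborel. \<theta> x * Re (g x)) (LINT x|lborel. \<theta> x * Im (g x))"
        using r(3) i(3) by (intro complex_eqI) (simp_all only: uminus_complex.sel complex.sel)
      then show ?thesis using 1 2 by (simp only:)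
    qed
  qed
qed

subsection \<open>Galerkin approximation\<close>

text \<open>Positivity of the form on vectors with entry 0 equal to 0 makes every pivot positive for
  all \<open>t\<close> at once, so no pivot search disturbs continuity. The last unknown is
  eliminated, and the Schur complement inherits the positivity.\<close>

lemma gaussian_elimination:
  fixes M :: "nat \<Rightarrow> nat \<Rightarrow> real \<Rightarrow> real"
  assumes "\<And>i j. i \<le> n \<Longrightarrow> j \<le> n \<Longrightarrow> continuous_on T (M i j)"
    and "\<And>t x. t \<in> T \<Longrightarrow> x 0 = 0 \<Longrightarrow> \<exists>i\<in>{1..n}. x i \<noteq> 0 \<Longrightarrow> 0 < (\<Sum>i\<le>n. \<Sum>j\<le>n. M i j t * x i * x j)"
  shows "\<exists>X. (\<forall>j\<le>n. continuous_on T (X j)) \<and> (\<forall>t\<in>T. X 0 t = 1 \<and> (\<forall>i\<in>{1..n}. (\<Sum>j\<le>n. M i j t * X j t) = 0))"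
  using assms
proof (induction n arbitrary: M)
  case 0
  show ?case by (rule exI[of _ "\<lambda>j t. 1"]) auto
next
  case (Suc n)
  let ?m = "Suc n"
  define p where "p t = M ?m ?m t" for t
  have p: "p t > 0" if "t \<in> T" for t
  proof -
    define x where "x j = (if j = ?m then 1 else 0 :: real)" for j
    have "0 < (\<Sum>i\<le>?m. \<Sum>j\<le>?m. M i j t * x i * x j)"
      by (rule Suc.prems(2)[OF that]) (auto simp: x_def intro!: bexI[of _ ?m])
    also have "\<dots> = p t" by (simp add: x_def p_def)
    finally show ?thesis .
  qed
  define M' where "M' i j t = M i j t - M i ?m t * M ?m j t / p t" for i j t
  have "\<exists>X. (\<forall>j\<le>n. continuous_on T (X j)) \<and> (\<forall>t\<in>T. X 0 t = 1 \<and> (\<forall>i\<in>{1..n}. (\<Sum>j\<le>n. M' i j t * X j t) = 0))"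
  proof (rule Suc.IH)
    show "continuous_on T (M' i j)" if "i \<le> n" "j \<le> n" for i j
      unfolding M'_def p_def using that p
      by (intro continuous_intros Suc.prems(1)) (auto simp: p_def less_imp_neq[THEN not_sym])
    fix t and x :: "nat \<Rightarrow> real" assume t: "t \<in> T" and x: "x 0 = 0" "\<exists>i\<in>{1..n}. x i \<noteq> 0"
    define R where "R = (\<Sum>j\<le>n. M ?m j t * x j)"
    define C where "C = (\<Sum>i\<le>n. M i ?m t * x i)"
    \<comment> \<open>With this last entry the last row of \<open>M\<close> vanishes on
      \<open>y\<close>, so the form of the Schur complement at \<open>x\<close> is the form of
      \<open>M\<close> at \<open>y\<close>.\<close>
    define r where "r = - R / p t"
    define y where "y = x(?m := r)"
    have "0 < (\<Sum>i\<le>?m. \<Sum>j\<le>?m. M i j t * y i * y j)"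
    proof (rule Suc.prems(2)[OF t])
      show "y 0 = 0" using x(1) by (simp add: y_def)
      obtain i where "i \<in> {1..n}" "x i \<noteq> 0" using x(2) by blast
      then show "\<exists>i\<in>{1..?m}. y i \<noteq> 0" by (intro bexI[of _ i]) (auto simp: y_def)
    qed
    also have "\<dots> = (\<Sum>i\<le>n. (\<Sum>j\<le>n. M i j t * x i * x j) + r * (M i ?m t * x i)) + (r * R + r * r * p t)"
      by (simp add: y_def R_def sum_distrib_left p_def mult_ac cong: sum.cong_simp)
    also have "\<dots> = (\<Sum>i\<le>n. \<Sum>j\<le>n. M i j t * x i * x j) + r * C + (r * R + r * r * p t)"
      by (simp add: sum.distrib C_def sum_distrib_left)
    also have "r * R + r * r * p t = 0" using p[OF t] by (simp add: r_def field_simps)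
    also have "r * C = - (\<Sum>i\<le>n. \<Sum>j\<le>n. (M i ?m t * M ?m j t / p t) * x i * x j)"
    proof -
      have "(\<Sum>i\<le>n. \<Sum>j\<le>n. (M i ?m t * M ?m j t / p t) * x i * x j) = (\<Sum>i\<le>n. \<Sum>j\<le>n. (M i ?m t * x i) * (M ?m j t * x j)) / p t"
        by (simp add: sum_divide_distrib mult_ac)
      also have "\<dots> = C * R / p t" by (simp only: C_def R_def sum_product)
      finally show ?thesis by (simp add: r_def)
    qed
    finally show "0 < (\<Sum>i\<le>n. \<Sum>j\<le>n. M' i j t * x i * x j)"
      by (simp add: M'_def left_diff_distrib sum_subtractf)
  qed
  then obtain X where X: "\<And>j. j \<le> n \<Longrightarrow> continuous_on T (X j)" "\<And>t. t \<in> T \<Longrightarrow> X 0 t = 1"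
    "\<And>t i. t \<in> T \<Longrightarrow> i \<in> {1..n} \<Longrightarrow> (\<Sum>j\<le>n. M' i j t * X j t) = 0" by blast
  define Y where "Y = X(?m := \<lambda>t. - (\<Sum>j\<le>n. M ?m j t * X j t) / p t)"
  have cY: "continuous_on T (Y j)" if "j \<le> ?m" for j
  proof (cases "j = ?m")
    case True
    have "continuous_on T (\<lambda>t. - (\<Sum>j\<le>n. M ?m j t * X j t) / p t)"
      unfolding p_def using p by (intro continuous_intros X Suc.prems(1)) (auto simp: p_def less_imp_neq[THEN not_sym])
    then show ?thesis using True by (simp add: Y_def)
  qed (use that X(1)[of j] in \<open>auto simp: Y_def\<close>)
  have sY: "(\<Sum>j\<le>?m. M i j t * Y j t) = (\<Sum>j\<le>n. M i j t * X j t) - M i ?m t * (\<Sum>j\<le>n. M ?m j t * X j t) / p t" for i t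
    by (simp add: Y_def cong: sum.cong_simp)
  have "(\<Sum>j\<le>?m. M i j t * Y j t) = 0" if t: "t \<in> T" and i: "i \<in> {1..?m}" for t i
  proof (cases "i = ?m")
    case True
    then show ?thesis unfolding sY using p[OF t] by (simp add: p_def)
  next
    case False
    then have "(\<Sum>j\<le>n. M' i j t * X j t) = 0" using X(3)[OF t, of i] i by auto
    then show ?thesis unfolding sY by (simp add: M'_def left_diff_distrib sum_subtractf sum_distrib_left sum_divide_distrib mult.assoc)
  qed
  moreover have "Y 0 t = 1" if "t \<in> T" for t using X(2)[OF that] by (simp add: Y_def)
  ultimately show ?case using cY by (intro exI[of _ Y]) auto
qed

text \<open>Reflection acts with opposite signs on \<open>V\<close> and \<open>q\<close>. Then
  \<open>mass\<close> and \<open>energy\<close> do not couple the two parities, while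
  \<open>shift\<close> couples only opposite ones; changing the sign of one parity in the test slot
  makes the pencil symmetric.\<close>

definition parity :: "real \<Rightarrow> (real \<Rightarrow> real^4) \<Rightarrow> bool" where
  "parity s u \<longleftrightarrow> (\<forall>x. u (- x) $ 1 = s * u x $ 1 \<and> u (- x) $ 2 = - s * u x $ 2 \<and>
     u (- x) $ 3 = - s * u x $ 3 \<and> u (- x) $ 4 = s * u x $ 4)"

lemma parity_scale: "parity s u \<Longrightarrow> parity s (\<lambda>x. a *\<^sub>R u x)"
  by (simp add: parity_def)

lemma parity_diff: "parity s u \<Longrightarrow> parity s v \<Longrightarrow> parity s (\<lambda>x. u x - v x)"
  by (simp add: parity_def algebra_simps)

lemma parity_sum: "finite S \<Longrightarrow> (\<And>j. j \<in> S \<Longrightarrow> parity s (b j)) \<Longrightarrow> parity s (\<lambda>x. \<Sum>j\<in>S. a j *\<^sub>R b j x)"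
  by (simp add: parity_def sum_distrib_left mult_ac)

lemma parity_mass_energy:
  assumes "parity 1 u" "parity (-1) v"
  shows "mass u v = 0" "energy u v = 0"
  unfolding form_def by (rule integral_odd; use assms in \<open>simp add: parity_def mass_kernel_def energy_kernel_def\<close>)+

lemma parity_shift:
  assumes "parity s u" "parity s v" "s * s = 1"
  shows "shift u v = 0"
  unfolding form_def
proof (rule integral_odd)
  fix x
  have "shift_kernel (- x) (u (- x)) (v (- x)) = - (s * s) * shift_kernel x (u x) (v x)"
    using assms(1,2) by (simp add: parity_def shift_kernel_def algebra_simps)
  then show "shift_kernel (- x) (u (- x)) (v (- x)) = - shift_kernel x (u x) (v x)" using assms(3) by simp
qed

section \<open>The quadratic pencil and its coercivity\<close>

definition pencil :: "real \<Rightarrow> real \<Rightarrow> (real \<Rightarrow> real^4) \<Rightarrow> (real \<Rightarrow> real^4) \<Rightarrow> real" where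
  "pencil k l u v = l\<^sup>2 * mass u v - 2 * k * l * shift u v + energy u v"

lemma pencil_add_left:
  "u \<in> H1_pairs \<Longrightarrow> u' \<in> H1_pairs \<Longrightarrow> v \<in> H1_pairs \<Longrightarrow> pencil k l (\<lambda>x. u x + u' x) v = pencil k l u v + pencil k l u' v"
  by (simp add: pencil_def form_add_left form_kernels algebra_simps)

lemma pencil_scale_left: "pencil k l (\<lambda>x. a *\<^sub>R u x) v = a * pencil k l u v"
  by (simp add: pencil_def form_scale_left form_kernels algebra_simps)

lemma pencil_scale_right: "pencil k l u (\<lambda>x. a *\<^sub>R v x) = a * pencil k l u v"
  by (simp add: pencil_def form_scale_right form_kernels algebra_simps)

lemma pencil_add_right:
  "u \<in> H1_pairs \<Longrightarrow> v \<in> H1_pairs \<Longrightarrow> v' \<in> H1_pairs \<Longrightarrow> pencil k l u (\<lambda>x. v x + v' x) = pencil k l u v + pencil k l u v'"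
  by (simp add: pencil_def form_add_right form_kernels algebra_simps)

lemma pencil_sum_left:
  assumes "finite S" "\<And>j. j \<in> S \<Longrightarrow> b j \<in> H1_pairs" "v \<in> H1_pairs"
  shows "pencil k l (\<lambda>x. \<Sum>j\<in>S. a j *\<^sub>R b j x) v = (\<Sum>j\<in>S. a j * pencil k l (b j) v)"
  using assms by (simp add: pencil_def form_sum_left form_kernels sum.distrib sum_subtractf sum_distrib_left algebra_simps)

lemma pencil_sum_right:
  assumes "finite S" "\<And>j. j \<in> S \<Longrightarrow> b j \<in> H1_pairs" "v \<in> H1_pairs"
  shows "pencil k l v (\<lambda>x. \<Sum>j\<in>S. a j *\<^sub>R b j x) = (\<Sum>j\<in>S. a j * pencil k l v (b j))"
  using assms by (simp add: pencil_def form_sum_right form_kernels sum.distrib sum_subtractf sum_distrib_left algebra_simps)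

lemma pencil_self: "u \<in> H1_pairs \<Longrightarrow> pencil k l u u = l\<^sup>2 * mass u u + energy u u"
  by (simp add: pencil_def shift_self)

lemma energy_expand:
  assumes u: "u \<in> H1_pairs"
  shows "energy u u = (\<integral>x. (u x $ 4 + 2 * (sech x * u x $ 1))\<^sup>2 \<partial>lborel) + (\<integral>x. (u x $ 2)\<^sup>2 \<partial>lborel)
    + (\<integral>x. (u x $ 1)\<^sup>2 \<partial>lborel) - 6 * (\<integral>x. (sech x)\<^sup>2 * (u x $ 1)\<^sup>2 \<partial>lborel)"
proof -
  note s = H1_pairs_sq[OF u]
  have i: "integrable lborel (\<lambda>x. (sech x)\<^sup>2 * (u x $ 1)\<^sup>2)"
    using integrable_sech_form(1)[OF s(1) s(1)] by (simp add: power2_eq_square mult.assoc)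
  have "(\<integral>x. (u x $ 2)\<^sup>2 + (1 - 6 * (sech x)\<^sup>2) * (u x $ 1)\<^sup>2 \<partial>lborel)
      = (\<integral>x. (u x $ 2)\<^sup>2 + (u x $ 1)\<^sup>2 - 6 * ((sech x)\<^sup>2 * (u x $ 1)\<^sup>2) \<partial>lborel)"
    by (simp add: algebra_simps)
  also have "\<dots> = (\<integral>x. (u x $ 2)\<^sup>2 \<partial>lborel) + (\<integral>x. (u x $ 1)\<^sup>2 \<partial>lborel) - 6 * (\<integral>x. (sech x)\<^sup>2 * (u x $ 1)\<^sup>2 \<partial>lborel)"
    using i sq_int[OF s(1)] sq_int[OF s(2)] by simp
  finally show ?thesis using energy_split[OF u] by simp
qed

lemma mass_expand:
  assumes u: "u \<in> H1_pairs"
  shows "mass u u = (\<integral>x. (u x $ 1)\<^sup>2 \<partial>lborel) + (\<integral>x. (u x $ 3)\<^sup>2 \<partial>lborel)"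
  using sq_int[OF H1_pairs_sq(1)[OF u]] sq_int[OF H1_pairs_sq(3)[OF u]]
  by (simp add: form_def mass_kernel_def power2_eq_square)

text \<open>Source of the upper end 3 of the range of \<open>l\<close>: since
  \<open>3\<^sup>2 > 6\<close>, the form of the pencil is nonnegative there.\<close>

lemma energy_lower_bound:
  assumes u: "u \<in> H1_pairs" shows "- 6 * mass u u \<le> energy u u"
proof -
  note s = H1_pairs_sq[OF u]
  have i: "integrable lborel (\<lambda>x. (sech x)\<^sup>2 * (u x $ 1)\<^sup>2)"
    using integrable_sech_form(1)[OF s(1) s(1)] by (simp add: power2_eq_square mult.assoc)
  have "(\<integral>x. (sech x)\<^sup>2 * (u x $ 1)\<^sup>2 \<partial>lborel) \<le> (\<integral>x. (u x $ 1)\<^sup>2 \<partial>lborel)"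
    by (intro integral_mono i sq_int s) (simp add: mult_left_le_one_le sech_sq_le_1)
  moreover have "0 \<le> (\<integral>x. (u x $ 4 + 2 * (sech x * u x $ 1))\<^sup>2 \<partial>lborel)" "0 \<le> (\<integral>x. (u x $ 2)\<^sup>2 \<partial>lborel)"
    "0 \<le> (\<integral>x. (u x $ 1)\<^sup>2 \<partial>lborel)" "0 \<le> (\<integral>x. (u x $ 3)\<^sup>2 \<partial>lborel)" by simp_all
  ultimately show ?thesis unfolding energy_expand[OF u] mass_expand[OF u] by argo
qed

text \<open>Galerkin approximation with regularization \<open>e\<close>, which makes linear independence of the family
  \<open>b\<close> unnecessary. On states with \<open>V(0) = 0\<close> the pencil is coercive, so all rows but the first can be
  solved; the residual of row \<open>0\<close> is continuous in \<open>l\<close> and changes sign. At \<open>l0\<close> the sign comes from a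
  saddle point argument: with respect to the reflection parity the pencil is, up to sign, symmetric.\<close>

lemma galerkin_root:
  fixes b :: "nat \<Rightarrow> real \<Rightarrow> real^4"
  assumes X: "\<And>j. b j \<in> H1_pairs" and par: "\<And>j. parity (\<sigma> j) (b j)" and sg: "\<And>j. \<sigma> j = 1 \<or> \<sigma> j = -1" and s0: "\<sigma> 0 = 1"
    and b0: "\<And>j. j \<ge> 1 \<Longrightarrow> b j 0 $ 1 = 0" and e: "e > 0" and l0: "0 < l0" "l0 \<le> 3"
    and trial: "\<And>o'. o' \<in> H1_pairs \<Longrightarrow> parity (-1) o' \<Longrightarrow>
       l0\<^sup>2 * mass (b 0) (b 0) + energy (b 0) (b 0) \<le> l0\<^sup>2 * mass o' o' + energy o' o' - 4 * k * l0 * shift (b 0) o'"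
  obtains l x where "l \<in> {l0..3}" "x 0 = 1"
    "pencil k l (\<lambda>t. \<Sum>j\<le>n. x j *\<^sub>R b j t) (b 0) = 0"
    "\<And>i. i \<in> {1..n} \<Longrightarrow> pencil k l (\<lambda>t. \<Sum>j\<le>n. x j *\<^sub>R b j t) (b i) + e * x i = (0::real)"
proof -
  \<comment> \<open>Row \<open>i\<close> belongs to the test state and column \<open>j\<close> to
    the unknown. Row 0 is not regularized, so that its residual \<open>D\<close> is the exact
    pairing with \<open>b 0\<close>.\<close>
  define M where "M i j l = pencil k l (b j) (b i) + (if i = j \<and> i \<ge> 1 then e else 0)" for i j l
  define U where "U x t = (\<Sum>j\<le>n. x j *\<^sub>R b j t)" for x :: "nat \<Rightarrow> real" and t
  have UX: "U x \<in> H1_pairs" for x unfolding U_def[abs_def] by (intro H1_pairs_sum X) auto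
  have U0: "U x 0 $ 1 = x 0 * b 0 0 $ 1" for x
  proof -
    have "U x 0 $ 1 = (\<Sum>j\<le>n. x j * b j 0 $ 1)" by (simp add: U_def)
    also have "\<dots> = (\<Sum>j\<le>n. if j = 0 then x 0 * b 0 0 $ 1 else 0)" by (rule sum.cong) (auto simp: b0)
    finally show ?thesis by simp
  qed
  have row: "(\<Sum>j\<le>n. M i j l * x j) = pencil k l (U x) (b i) + (if i \<ge> 1 then e * x i else 0)" if "i \<le> n" for i l x
  proof -
    have "(\<Sum>j\<le>n. M i j l * x j) = (\<Sum>j\<le>n. x j * pencil k l (b j) (b i)) + (\<Sum>j\<le>n. if i = j \<and> i \<ge> 1 then e * x j else 0)"
      unfolding sum.distrib[symmetric] by (rule sum.cong) (auto simp: M_def algebra_simps)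
    also have "(\<Sum>j\<le>n. if i = j \<and> i \<ge> 1 then e * x j else 0) = (if i \<ge> 1 then e * x i else 0)"
      using that by (cases "i \<ge> 1") auto
    also have "(\<Sum>j\<le>n. x j * pencil k l (b j) (b i)) = pencil k l (U x) (b i)"
      unfolding U_def[abs_def] by (rule pencil_sum_left[symmetric]) (auto simp: X)
    finally show ?thesis .
  qed
  have quad: "(\<Sum>i\<le>n. x i * (\<Sum>j\<le>n. M i j l * x j)) = pencil k l (U x) (U x) + e * (\<Sum>i\<in>{1..n}. (x i)\<^sup>2)" for x l
  proof -
    have "(\<Sum>i\<le>n. x i * (\<Sum>j\<le>n. M i j l * x j)) = (\<Sum>i\<le>n. x i * pencil k l (U x) (b i) + (if i \<ge> 1 then e * (x i)\<^sup>2 else 0))"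
    proof (rule sum.cong[OF refl])
      fix i assume "i \<in> {..n}"
      then have "i \<le> n" by simp
      then show "x i * (\<Sum>j\<le>n. M i j l * x j) = x i * pencil k l (U x) (b i) + (if i \<ge> 1 then e * (x i)\<^sup>2 else 0)"
        unfolding row[OF \<open>i \<le> n\<close>] by (auto simp: power2_eq_square algebra_simps)
    qed
    also have "\<dots> = (\<Sum>i\<le>n. x i * pencil k l (U x) (b i)) + (\<Sum>i\<le>n. if i \<ge> 1 then e * (x i)\<^sup>2 else 0)" by (simp add: sum.distrib)
    also have "(\<Sum>i\<le>n. x i * pencil k l (U x) (b i)) = pencil k l (U x) (\<lambda>t. \<Sum>j\<le>n. x j *\<^sub>R b j t)"
      by (rule pencil_sum_right[symmetric]) (auto simp: X UX)
    also have "(\<lambda>t. \<Sum>j\<le>n. x j *\<^sub>R b j t) = U x" by (simp add: U_def[abs_def])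
    also have "(\<Sum>i\<le>n. if i \<ge> 1 then e * (x i)\<^sup>2 else 0) = (\<Sum>i\<in>{1..n}. e * (x i)\<^sup>2)"
      by (rule sum.mono_neutral_cong_right) auto
    finally show ?thesis by (simp add: sum_distrib_left)
  qed
  have "\<exists>X. (\<forall>j\<le>n. continuous_on {l0..3} (X j)) \<and> (\<forall>l\<in>{l0..3}. X 0 l = 1 \<and> (\<forall>i\<in>{1..n}. (\<Sum>j\<le>n. M i j l * X j l) = 0))"
  proof (rule gaussian_elimination)
    show "continuous_on {l0..3} (M i j)" for i j
      unfolding M_def[abs_def] pencil_def by (intro continuous_intros)
    fix l and x :: "nat \<Rightarrow> real" assume l: "l \<in> {l0..3}" and x: "x 0 = 0" "\<exists>i\<in>{1..n}. x i \<noteq> 0"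
    \<comment> \<open>\<open>x 0 = 0\<close> puts the state into the subspace
      \<open>V(0) = 0\<close>; strictness comes from the regularization.\<close>
    have "0 \<le> pencil k l (U x) (U x)"
      using energy_vanishing_nonneg[OF UX, of x] x(1) by (simp add: pencil_self[OF UX] U0 mass_nonneg)
    moreover have "0 < (\<Sum>i\<in>{1..n}. (x i)\<^sup>2)"
      using x(2) by (auto intro!: sum_pos2)
    then have "0 < e * (\<Sum>i\<in>{1..n}. (x i)\<^sup>2)" using e by simp
    ultimately have "0 < (\<Sum>i\<le>n. x i * (\<Sum>j\<le>n. M i j l * x j))" unfolding quad by simp
    then show "0 < (\<Sum>i\<le>n. \<Sum>j\<le>n. M i j l * x i * x j)" by (simp add: sum_distrib_left mult_ac)
  qed
  then obtain Z where Z: "\<And>j. j \<le> n \<Longrightarrow> continuous_on {l0..3} (Z j)" "\<And>l. l \<in> {l0..3} \<Longrightarrow> Z 0 l = 1"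
    "\<And>l i. l \<in> {l0..3} \<Longrightarrow> i \<in> {1..n} \<Longrightarrow> (\<Sum>j\<le>n. M i j l * Z j l) = 0" by blast
  define x where "x l j = Z j l" for l j
  define D where "D l = (\<Sum>j\<le>n. M 0 j l * Z j l)" for l
  have cD: "continuous_on {l0..3} D"
    unfolding D_def M_def[abs_def] pencil_def by (intro continuous_intros Z) auto
  have Dl: "D l = pencil k l (U (x l)) (b 0)" for l using row[of 0 l "x l"] by (simp add: D_def x_def)
  have eqs: "pencil k l (U (x l)) (b i) + e * x l i = 0" if "l \<in> {l0..3}" "i \<in> {1..n}" for l i
    using row[of i l "x l"] Z(3)[OF that] that by (simp add: x_def)
  have x0: "x l 0 = 1" if "l \<in> {l0..3}" for l using Z(2)[OF that] by (simp add: x_def)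
  \<comment> \<open>All rows but the first vanish and \<open>x 0 = 1\<close>, so \<open>D 3\<close>
    is the full regularized quadratic form.\<close>
  have "0 \<le> D 3"
  proof -
    have l: "(3::real) \<in> {l0..3}" using l0 by simp
    have "(\<Sum>i\<le>n. x 3 i * (\<Sum>j\<le>n. M i j 3 * x 3 j)) = (\<Sum>i\<le>n. if i = 0 then D 3 else 0)"
      by (rule sum.cong) (use Z(3)[OF l] x0[OF l] in \<open>auto simp: x_def D_def\<close>)
    then have "D 3 = pencil k 3 (U (x 3)) (U (x 3)) + e * (\<Sum>i\<in>{1..n}. (x 3 i)\<^sup>2)" using quad[of "x 3" 3] by simp
    moreover have "0 \<le> pencil k 3 (U (x 3)) (U (x 3))"
      using energy_lower_bound[OF UX, of "x 3"] mass_nonneg[of "U (x 3)"] unfolding pencil_self[OF UX] by simp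
    moreover have "0 \<le> e * (\<Sum>i\<in>{1..n}. (x 3 i)\<^sup>2)" using e by (simp add: sum_nonneg)
    ultimately show ?thesis by linarith
  qed
  moreover have "D l0 \<le> 0"
  proof -
    have l: "l0 \<in> {l0..3}" using l0 by simp
    define y where "y = x l0"
    define P where "P = {j \<in> {1..n}. \<sigma> j = 1}"
    define N where "N = {j \<in> {1..n}. \<sigma> j = -1}"
    have fin: "finite P" "finite N" by (auto simp: P_def N_def)
    define z where "z = b 0"
    \<comment> \<open>The solution is \<open>b 0\<close> plus an even part \<open>d\<close> and an
      odd part \<open>o'\<close>; since \<open>d\<close> vanishes at 0 in the first component, its
      energy is nonnegative.\<close>
    define d where "d t = (\<Sum>j\<in>P. y j *\<^sub>R b j t)" for t
    define o' where "o' t = (\<Sum>j\<in>N. y j *\<^sub>R b j t)" for t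
    have inX: "z \<in> H1_pairs" "d \<in> H1_pairs" "o' \<in> H1_pairs"
      unfolding z_def d_def[abs_def] o'_def[abs_def] by (intro X H1_pairs_sum fin)+
    have dX: "(\<lambda>t. d t + o' t) \<in> H1_pairs" by (intro H1_pairs_add inX)
    have prt: "parity 1 z" "parity 1 d" "parity (-1) o'"
    proof -
      show "parity 1 z" using par[of 0] s0 by (simp add: z_def)
      show "parity 1 d" unfolding d_def[abs_def] 
      proof (rule parity_sum[OF fin(1)])
        show "parity 1 (b j)" if "j \<in> P" for j using par[of j] that by (simp add: P_def)
      qed
      show "parity (-1) o'" unfolding o'_def[abs_def] 
      proof (rule parity_sum[OF fin(2)])
        show "parity (-1) (b j)" if "j \<in> N" for j using par[of j] that by (simp add: N_def)
      qed
    qed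
    have Ue: "U y t = z t + (d t + o' t)" for t
    proof -
      have "{..n} = insert 0 (P \<union> N)"
      proof (rule set_eqI)
        fix j show "j \<in> {..n} \<longleftrightarrow> j \<in> insert 0 (P \<union> N)" using sg[of j] by (cases "j = 0") (auto simp: P_def N_def)
      qed
      moreover have "0 \<notin> P \<union> N" "P \<inter> N = {}" by (auto simp: P_def N_def)
      ultimately show ?thesis using fin x0[OF l] by (simp add: U_def d_def o'_def z_def y_def sum.union_disjoint)
    qed
    have d0: "d 0 $ 1 = 0" by (simp add: d_def) (rule sum.neutral, auto simp: P_def b0)
    have Uy: "U y = (\<lambda>t. z t + (d t + o' t))" by (auto simp: Ue)
    have E: "pencil k l0 (U y) d = - e * (\<Sum>j\<in>P. (y j)\<^sup>2)" "pencil k l0 (U y) o' = - e * (\<Sum>j\<in>N. (y j)\<^sup>2)"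
    proof -
      have q: "y j * pencil k l0 (U y) (b j) = - e * (y j)\<^sup>2" if "j \<in> {1..n}" for j
      proof -
        have "pencil k l0 (U y) (b j) = - e * y j" using eqs[OF l that] by (simp add: y_def)
        then show ?thesis by (simp add: power2_eq_square)
      qed
      show "pencil k l0 (U y) d = - e * (\<Sum>j\<in>P. (y j)\<^sup>2)"
        unfolding d_def[abs_def] by (subst pencil_sum_right[OF fin(1) X UX], subst sum_distrib_left, rule sum.cong) (use q in \<open>auto simp: P_def\<close>)
      show "pencil k l0 (U y) o' = - e * (\<Sum>j\<in>N. (y j)\<^sup>2)"
        unfolding o'_def[abs_def] by (subst pencil_sum_right[OF fin(2) X UX], subst sum_distrib_left, rule sum.cong) (use q in \<open>auto simp: N_def\<close>)
    qed
    have split: "pencil k l0 (U y) v = pencil k l0 z v + pencil k l0 d v + pencil k l0 o' v" if "v \<in> H1_pairs" for v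
      unfolding Uy using inX dX that by (simp add: pencil_add_left)
    have zero: "mass z o' = 0" "energy z o' = 0" "mass d o' = 0" "energy d o' = 0"
      "mass o' z = 0" "energy o' z = 0" "mass o' d = 0" "energy o' d = 0" "shift z d = 0" "shift d d = 0" "shift z z = 0" "shift o' o' = 0" "shift d z = 0"
      using parity_mass_energy[OF prt(1,3)] parity_mass_energy[OF prt(2,3)]
        mass_sym[of o'] energy_sym[of o'] shift_self inX parity_shift[OF prt(1,2)] parity_shift[OF prt(2,1)] by auto
    have 1: "pencil k l0 (U y) o' = l0\<^sup>2 * mass o' o' + energy o' o' - 2 * k * l0 * (shift z o' + shift d o')"
      unfolding split[OF inX(3)] by (simp add: pencil_def zero algebra_simps)
    have 2: "pencil k l0 (U y) d = l0\<^sup>2 * mass z d + energy z d + (l0\<^sup>2 * mass d d + energy d d) + 2 * k * l0 * shift d o'"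
      unfolding split[OF inX(2)] using shift_skew[OF inX(3,2)] by (simp add: pencil_def zero algebra_simps)
    have 3: "D l0 = l0\<^sup>2 * mass z z + energy z z + (l0\<^sup>2 * mass z d + energy z d) + 2 * k * l0 * shift z o'"
      unfolding Dl y_def[symmetric] z_def[symmetric] split[OF inX(1)] using shift_skew[OF inX(3,1)]
      by (simp add: pencil_def zero mass_sym[of d z] energy_sym[of d z] algebra_simps)
    have "0 \<le> e * (\<Sum>j\<in>P. (y j)\<^sup>2)" "0 \<le> e * (\<Sum>j\<in>N. (y j)\<^sup>2)" using e by (simp_all add: sum_nonneg)
    moreover have "0 \<le> l0\<^sup>2 * mass d d + energy d d"
      using energy_vanishing_nonneg[OF inX(2) d0] mass_nonneg[of d] by simp
    moreover have "l0\<^sup>2 * mass z z + energy z z \<le> l0\<^sup>2 * mass o' o' + energy o' o' - 4 * k * l0 * shift z o'"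
      unfolding z_def by (rule trial[OF inX(3) prt(3)])
    moreover have "2 * k * l0 * (shift z o' + shift d o') = 2 * k * l0 * shift z o' + 2 * k * l0 * shift d o'" by (simp add: algebra_simps)
    moreover have "4 * k * l0 * shift z o' = 2 * (2 * k * l0 * shift z o')" by simp
    \<comment> \<open>Write \<open>L\<close> for \<open>l0\<^sup>2 * mass + energy\<close> on the
      diagonal. The trial inequality bounds \<open>L z\<close> through \<open>L o'\<close>, equation
      1 replaces \<open>L o'\<close>, and equation 2 replaces the remaining mixed terms. The result
      is \<open>D l0 \<le> - L d\<close> minus the regularization of both parities.\<close>
    ultimately show ?thesis using 1 2 3 E by linarith
  qed
  ultimately have "\<exists>l\<ge>l0. l \<le> 3 \<and> D l = 0" using l0 cD by (intro IVT') auto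
  then obtain l where l: "l \<in> {l0..3}" "D l = 0" by auto
  show ?thesis
    by (rule that[of l "x l"]) (use l x0[OF l(1)] Dl[of l] eqs[OF l(1)] in \<open>auto simp: U_def[abs_def]\<close>)
qed

subsection \<open>The test state\<close>

text \<open>For the cutoff \<open>tanh (d * x)\<close> of the test state: the first bound makes
  \<open>tanh x - tanh (d * x)\<close> square integrable, the second gives the cutoff error in the
  mass bound a favourable sign. Both rest on
  \<open>\<bar>tanh (d * x)\<bar> \<le> \<bar>tanh x\<bar> < 1\<close>.\<close>

lemma tanh_scaled:
  fixes x d :: real
  assumes d: "0 < d" "d \<le> 1"
  shows "\<bar>tanh x - tanh (d * x)\<bar> \<le> (sech (d * x))\<^sup>2" "tanh (d * x) * (tanh (d * x) - tanh x) \<le> 0"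
proof -
  have pos: "0 \<le> tanh (d * y) \<and> tanh (d * y) \<le> tanh y \<and> tanh y - tanh (d * y) \<le> (sech (d * y))\<^sup>2" if "0 \<le> y" for y
  proof -
    have "d * y \<le> 1 * y" using d that by (intro mult_right_mono) auto
    then have le: "tanh (d * y) \<le> tanh y" by simp
    have t: "0 \<le> tanh (d * y)" using d that by simp
    have "tanh (d * y) * tanh (d * y) \<le> tanh (d * y) * 1" using t tanh_real_lt_1[of "d * y"] by (intro mult_left_mono) auto
    then have "1 - tanh (d * y) \<le> (sech (d * y))\<^sup>2" using tanh_sq[of "d * y"] by (simp add: power2_eq_square)
    then show ?thesis using le t tanh_real_lt_1[of y] by auto
  qed
  have "\<bar>tanh x - tanh (d * x)\<bar> \<le> (sech (d * x))\<^sup>2 \<and> tanh (d * x) * (tanh (d * x) - tanh x) \<le> 0"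
  proof (cases "0 \<le> x")
    case True
    then show ?thesis using pos[OF True] by (auto intro: mult_nonneg_nonpos)
  next
    case False
    then have "0 \<le> - x" by simp
    from pos[OF this] have p: "tanh (d * x) \<le> 0" "tanh x \<le> tanh (d * x)" "tanh (d * x) - tanh x \<le> (sech (d * x))\<^sup>2" by simp_all
    then show ?thesis by (auto intro: mult_nonpos_nonneg)
  qed
  then show "\<bar>tanh x - tanh (d * x)\<bar> \<le> (sech (d * x))\<^sup>2" "tanh (d * x) * (tanh (d * x) - tanh x) \<le> 0" by auto
qed

text \<open>The test state \<open>z = (chi, z2)\<close> approximates, at scale \<open>1/d\<close>, the derivative of the wave family with
  respect to the velocity. Its derivative is \<open>psi0 / 4\<close> plus \<open>H (g1, g2)\<close> plus a remainder that is small
  in \<open>L\<^sup>2\<close>; of \<open>g2\<close> only the combination \<open>gG = g2' + 2 sech g1\<close> is needed.\<close>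

definition g1 :: "real \<Rightarrow> real" where "g1 x = - (x * sech x) / 4 - x\<^sup>2 * sech x * tanh x / 8"
definition g1' :: "real \<Rightarrow> real" where "g1' x = - sech x / 4 + x\<^sup>2 * (sech x - 2 * (sech x)^3) / 8"
definition g1'' :: "real \<Rightarrow> real" where
  "g1'' x = sech x * tanh x / 4 + x * (sech x - 2 * (sech x)^3) / 4 + x\<^sup>2 * (- (sech x * tanh x) + 6 * ((sech x)^3 * tanh x)) / 8"

lemma DERIV_g1: "(g1 has_real_derivative g1' x) (at x)"
proof -
  have "(g1 has_real_derivative - (sech x + x * - (sech x * tanh x)) / 4
      - (((2 * x) * sech x + x\<^sup>2 * - (sech x * tanh x)) * tanh x + x\<^sup>2 * sech x * (sech x)\<^sup>2) / 8) (at x)"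
    unfolding g1_def[abs_def] by (auto intro!: derivative_eq_intros simp: field_simps)
  also have "- (sech x + x * - (sech x * tanh x)) / 4
      - (((2 * x) * sech x + x\<^sup>2 * - (sech x * tanh x)) * tanh x + x\<^sup>2 * sech x * (sech x)\<^sup>2) / 8
      = - sech x / 4 + x\<^sup>2 * sech x * ((tanh x)\<^sup>2 - (sech x)\<^sup>2) / 8"
    by (simp add: field_simps power2_eq_square)
  also have "\<dots> = g1' x" unfolding tanh_sq g1'_def by (simp add: field_simps power2_eq_square power3_eq_cube)
  finally show ?thesis .
qed

lemma DERIV_g1': "(g1' has_real_derivative g1'' x) (at x)"
proof -
  have "(g1' has_real_derivative sech x * tanh x / 4 + ((2 * x) * (sech x - 2 * (sech x)^3)
     + x\<^sup>2 * (- (sech x * tanh x) - 2 * (3 * (sech x)\<^sup>2 * - (sech x * tanh x)))) / 8) (at x)"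
    unfolding g1'_def[abs_def] by (auto intro!: derivative_eq_intros simp: field_simps)
  also have "sech x * tanh x / 4 + ((2 * x) * (sech x - 2 * (sech x)^3)
     + x\<^sup>2 * (- (sech x * tanh x) - 2 * (3 * (sech x)\<^sup>2 * - (sech x * tanh x)))) / 8 = g1'' x"
    unfolding g1''_def by (simp add: field_simps power2_eq_square power3_eq_cube)
  finally show ?thesis .
qed

text \<open>The right-hand side is such that adding \<open>2 * sech * gG\<close> and the remainder
  \<open>r1\<close> of \<open>trial_bound\<close> gives back \<open>chi'\<close>.\<close>

lemma g1_equation: "- g1'' x + (1 - 6 * (sech x)\<^sup>2) * g1 x = - (x * sech x) / 2 + 2 * x * (sech x)^3 - sech x * tanh x / 4"
  unfolding g1_def g1''_def by (simp add: field_simps power2_eq_square power3_eq_cube)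

lemma sq_poly_sech: "sq (\<lambda>x. x * sech x)" "sq (\<lambda>x. x\<^sup>2 * sech x)"
  by (rule sq_sech_poly[of _ 1]; simp add: abs_le_poly)+

lemma sq_mult_tanh: "sq f \<Longrightarrow> sq (\<lambda>x. f x * tanh x)"
  using sq_bmult[of tanh 1 f] abs_tanh_le_1 by (simp add: mult.commute)

lemma sq_mult_sech_sq: "sq f \<Longrightarrow> sq (\<lambda>x. f x * (sech x)\<^sup>2)"
  using sq_bmult[of "\<lambda>x. (sech x)\<^sup>2" 1 f] sech_sq_le_1 by (simp add: mult.commute)

lemma H1_g1: "H1 g1 g1'" and H1_g1': "H1 g1' g1''"
proof -
  note a = sq_poly_sech and s = sq_sech
  have 0: "sq g1"
    using sq_add[OF sq_cmult[OF a(1), of "-1/4"] sq_cmult[OF sq_mult_tanh[OF a(2)], of "-1/8"]]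
    by (simp add: g1_def[abs_def])
  have 1: "sq g1'"
    using sq_add[OF sq_cmult[OF s, of "-1/4"] sq_cmult[OF sq_diff[OF a(2) sq_cmult[OF sq_mult_sech_sq[OF a(2)], of 2]], of "1/8"]]
    by (rule back_subst[of sq]) (simp add: g1'_def[abs_def] fun_eq_iff field_simps power2_eq_square power3_eq_cube)
  have 2: "sq g1''"
    using sq_add[OF sq_add[OF sq_cmult[OF sq_mult_tanh[OF s], of "1/4"] sq_cmult[OF sq_diff[OF a(1) sq_cmult[OF sq_mult_sech_sq[OF a(1)], of 2]], of "1/4"]]
      sq_cmult[OF sq_mult_tanh[OF sq_diff[OF sq_cmult[OF sq_mult_sech_sq[OF a(2)], of 6] a(2)]], of "1/8"]]
    by (rule back_subst[of sq]) (simp add: g1''_def[abs_def] fun_eq_iff field_simps power2_eq_square power3_eq_cube)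
  have c: "continuous_on UNIV g1'" "continuous_on UNIV g1''"
    unfolding g1'_def[abs_def] g1''_def[abs_def] by (intro continuous_intros; simp)+
  show "H1 g1 g1'" "H1 g1' g1''"
    unfolding H1_def using AC_C1[OF DERIV_g1 c(1)] AC_C1[OF DERIV_g1' c(2)] 0 1 2 by blast+
qed

text \<open>Without the last term, \<open>z2' + 2 sech chi\<close> would be exactly
  \<open>sech\<^sup>2\<close>, but \<open>z2\<close> would tend to nonzero constants at both ends.
  The term with \<open>tanh (d * x)\<close> cancels these constants on the long scale
  \<open>1/d\<close> at the price of a small flux.\<close>

definition z2 :: "real \<Rightarrow> real \<Rightarrow> real" where "z2 d x = (x * (sech x)\<^sup>2 - tanh x + tanh (d * x)) / 2"
definition z2' :: "real \<Rightarrow> real \<Rightarrow> real" where "z2' d x = - (x * (sech x)\<^sup>2 * tanh x) + d * (sech (d * x))\<^sup>2 / 2"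
definition gG :: "real \<Rightarrow> real \<Rightarrow> real" where "gG d x = - (x * (sech x)\<^sup>2) / 2 + (tanh x - tanh (d * x)) / 4"
definition gG' :: "real \<Rightarrow> real \<Rightarrow> real" where
  "gG' d x = - (sech x)\<^sup>2 / 4 + x * (sech x)\<^sup>2 * tanh x - d * (sech (d * x))\<^sup>2 / 4"

lemma sq_sech_scaled_sq: "d > 0 \<Longrightarrow> sq (\<lambda>x. (sech (d * x))\<^sup>2)"
proof -
  assume d: "d > 0"
  have "sq (\<lambda>x. sech (d * x) * sech (d * x))"
    by (rule sq_bmult[OF _ _ sq_sech_scaled[OF d]]) (use sech_deriv_bounds(1) in auto)
  then show ?thesis by (simp add: power2_eq_square)
qed

lemma H1_trial:
  assumes d: "0 < d" "d \<le> 1"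
  shows "H1 (z2 d) (z2' d)" "H1 (gG d) (gG' d)"
proof -
  have a: "sq (\<lambda>x. x * (sech x)\<^sup>2)"
  proof -
    have "sq (\<lambda>x. sech x * (x * sech x))" by (rule sq_bmult[OF _ sech_deriv_bounds(1) sq_poly_sech(1)]) simp
    then show ?thesis by (simp add: power2_eq_square mult_ac)
  qed
  have t: "sq (\<lambda>x. tanh x - tanh (d * x))"
    by (rule sq_bound[OF _ sq_sech_scaled_sq[OF d(1)], of _ 1]) (use tanh_scaled(1)[OF d] in auto)
  note S = sq_sech_scaled_sq[OF d(1)]
  have "sq (z2 d)" using sq_cmult[OF sq_diff[OF a t], of "1/2"]
    by (rule back_subst[of sq]) (simp add: z2_def[abs_def] fun_eq_iff field_simps)
  moreover have "sq (z2' d)" using sq_diff[OF sq_cmult[OF S, of "d/2"] sq_mult_tanh[OF a]]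
    by (rule back_subst[of sq]) (simp add: z2'_def[abs_def] fun_eq_iff field_simps)
  moreover have "(z2 d has_real_derivative z2' d x) (at x)" for x
    unfolding z2_def[abs_def] z2'_def using d by (auto intro!: derivative_eq_intros simp: field_simps power2_eq_square)
  moreover have "continuous_on UNIV (z2' d)" unfolding z2'_def by (intro continuous_intros) auto
  ultimately show "H1 (z2 d) (z2' d)" unfolding H1_def using AC_C1 by blast
  have "sq (gG d)" using sq_add[OF sq_cmult[OF a, of "-1/2"] sq_cmult[OF t, of "1/4"]]
    by (rule back_subst[of sq]) (simp add: gG_def[abs_def] fun_eq_iff field_simps)
  moreover have "sq (gG' d)" using sq_diff[OF sq_add[OF sq_cmult[OF sq_sech_weight(2), of "-1/4"] sq_mult_tanh[OF a]] sq_cmult[OF S, of "d/4"]]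
    by (rule back_subst[of sq]) (simp add: gG'_def[abs_def] fun_eq_iff field_simps)
  moreover have "(gG d has_real_derivative gG' d x) (at x)" for x
    unfolding gG_def[abs_def] gG'_def using d by (auto intro!: derivative_eq_intros simp: field_simps power2_eq_square)
  moreover have "continuous_on UNIV (gG' d)" unfolding gG'_def by (intro continuous_intros) auto
  ultimately show "H1 (gG d) (gG' d)" unfolding H1_def using AC_C1 by blast
qed

definition trial_state :: "real \<Rightarrow> real \<Rightarrow> real^4" where
  "trial_state d x = vec4 (chi x) (chi' x) (z2 d x) (z2' d x)"

lemma trial_state_props:
  assumes d: "0 < d" "d \<le> 1"
  shows "trial_state d \<in> H1_pairs" "parity 1 (trial_state d)" "trial_state d 0 $ 1 = 1/2"
proof -
  show "trial_state d \<in> H1_pairs" using H1_chi H1_trial[OF d] by (simp add: H1_pairs_def trial_state_def)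
  show "parity 1 (trial_state d)"
    by (simp add: parity_def trial_state_def chi_def chi'_def z2_def z2'_def field_simps)
  show "trial_state d 0 $ 1 = 1/2" by (simp add: trial_state_def chi_def)
qed

text \<open>The flux is \<open>(sech x)\<^sup>2 + d / 2 * (sech (d * x))\<^sup>2\<close> and
  contributes at most \<open>4/3 + 5/2 * d\<close>; \<open>chi\<close> contributes -11/6.\<close>

lemma energy_trial:
  assumes d: "0 < d" "d \<le> 1"
  shows "energy (trial_state d) (trial_state d) \<le> -1/2 + 5/2 * d"
proof -
  define S where "S x = (sech (d * x))\<^sup>2" for x
  have S: "sq S" "integrable lborel S" "(\<integral>x. S x \<partial>lborel) = 2 / d" "\<And>x. 0 \<le> S x" "\<And>x. S x \<le> 1"
    using sq_sech_scaled_sq[OF d(1)] sech_scaled[OF d(1)] sech_sq_le_1 by (simp_all add: S_def[abs_def])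
  have "(\<integral>x. (trial_state d x $ 4 + 2 * (sech x * trial_state d x $ 1))\<^sup>2 \<partial>lborel)
     = (\<integral>x. ((sech x)\<^sup>2 + d / 2 * S x)\<^sup>2 \<partial>lborel)"
    by (rule Bochner_Integration.integral_cong[OF refl]) (simp add: trial_state_def z2'_def chi_def S_def field_simps power2_eq_square)
  also have "\<dots> \<le> (\<integral>x. (sech x)^4 + (d * (sech x)\<^sup>2 + d\<^sup>2 / 4 * S x) \<partial>lborel)"
  proof (rule integral_mono)
    show "integrable lborel (\<lambda>x. ((sech x)\<^sup>2 + d / 2 * S x)\<^sup>2)"
      by (rule sq_int[OF sq_add[OF sq_sech_weight(2) sq_cmult[OF S(1)]]])
    show "integrable lborel (\<lambda>x. (sech x)^4 + (d * (sech x)\<^sup>2 + d\<^sup>2 / 4 * S x))"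
      using sech4_int sech2_int S by simp
    fix x
    have "(sech x)\<^sup>2 * S x \<le> (sech x)\<^sup>2 * 1" using S by (intro mult_left_mono) auto
    then have "d * ((sech x)\<^sup>2 * S x) \<le> d * (sech x)\<^sup>2" using d by simp
    moreover have "S x * S x \<le> S x * 1" using S by (intro mult_left_mono) auto
    then have "d\<^sup>2 / 4 * (S x * S x) \<le> d\<^sup>2 / 4 * S x" by (intro mult_left_mono) auto
    moreover have "((sech x)\<^sup>2 + d / 2 * S x)\<^sup>2 = (sech x)^4 + d * ((sech x)\<^sup>2 * S x) + d\<^sup>2 / 4 * (S x * S x)"
      by (simp add: power2_eq_square eval_nat_numeral field_simps)
    ultimately show "((sech x)\<^sup>2 + d / 2 * S x)\<^sup>2 \<le> (sech x)^4 + (d * (sech x)\<^sup>2 + d\<^sup>2 / 4 * S x)" by linarith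
  qed
  also have "\<dots> = 4/3 + (d * 2 + d\<^sup>2 / 4 * (2 / d))"
    using sech4_int sech2_int S(2,3) by simp
  also have "\<dots> = 4/3 + 5/2 * d" using d by (simp add: field_simps power2_eq_square)
  finally have 1: "(\<integral>x. (trial_state d x $ 4 + 2 * (sech x * trial_state d x $ 1))\<^sup>2 \<partial>lborel) \<le> 4/3 + 5/2 * d" .
  have "(\<integral>x. (trial_state d x $ 2)\<^sup>2 + (1 - 6 * (sech x)\<^sup>2) * (trial_state d x $ 1)\<^sup>2 \<partial>lborel) = -11/6"
    using form_chi[OF H1_chi] integral_chi by (simp add: trial_state_def power2_eq_square mult.assoc)
  then show ?thesis using 1 unfolding energy_split[OF trial_state_props(1)[OF d]] by simp
qed

lemma sech_tanh_sq_int: "(\<integral>x. (sech x)\<^sup>2 * (tanh x)\<^sup>2 \<partial>lborel) = 2/3" "integrable lborel (\<lambda>x. (sech x)\<^sup>2 * (tanh x)\<^sup>2)"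
proof -
  have e: "(sech x)\<^sup>2 * (tanh x)\<^sup>2 = (sech x)\<^sup>2 - (sech x)^4" for x
    unfolding tanh_sq by (simp add: algebra_simps power2_eq_square eval_nat_numeral)
  show "(\<integral>x. (sech x)\<^sup>2 * (tanh x)\<^sup>2 \<partial>lborel) = 2/3" "integrable lborel (\<lambda>x. (sech x)\<^sup>2 * (tanh x)\<^sup>2)"
    unfolding e using sech4_int sech2_int by simp_all
qed

text \<open>\<open>shift\<close> of the test state is a mass pairing with \<open>(r1, r3)\<close>
  plus an energy pairing with \<open>g\<close>; completing the square in \<open>mass\<close> and in
  \<open>energy\<close> separately bounds the linear term. The number 1/8 is the mass of
  \<open>psi0 / 4\<close>.\<close>

lemma trial_bound:
  fixes k l d :: real
  assumes d: "0 < d" "d \<le> 1" and o: "w \<in> H1_pairs" "w 0 $ 1 = 0"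
  shows "l\<^sup>2 * mass w w + energy w w - 4 * k * l * shift (trial_state d) w
     \<ge> - 4 * k\<^sup>2 * (1/8 + d/8) - 4 * k\<^sup>2 * l\<^sup>2 * ((\<integral>x. (g1' x)\<^sup>2 + (1 - 6 * (sech x)\<^sup>2) * (g1 x)\<^sup>2 \<partial>lborel) + (\<integral>x. (gG d x)\<^sup>2 \<partial>lborel))"
proof -
  note w = H1_pairs_sq[OF o(1)] and w1 = H1_pairs_H1(1)[OF o(1)] and w3 = H1_pairs_H1(2)[OF o(1)]
  define S where "S x = (sech (d * x))\<^sup>2" for x
  define F where "F x = w x $ 4 + 2 * (sech x * w x $ 1)" for x
  have F: "sq F" unfolding F_def[abs_def] by (rule sq_flux[OF o(1)])
  have S: "sq S" "integrable lborel S" "(\<integral>x. S x \<partial>lborel) = 2 / d" "\<And>x. 0 \<le> S x" "\<And>x. S x \<le> 1"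
    using sq_sech_scaled_sq[OF d(1)] sech_scaled[OF d(1)] sech_sq_le_1 by (simp_all add: S_def[abs_def])
  \<comment> \<open>\<open>r1\<close> and \<open>r3\<close> are the components of
    \<open>psi0 / 4\<close> plus cutoff errors.\<close>
  define r1 where "r1 x = (tanh (d * x) / 2 - tanh x / 4) * sech x" for x
  define r3 where "r3 x = (d * S x - (sech x)\<^sup>2) / 4" for x
  have r: "sq r1" "sq r3"
  proof -
    show "sq r1" unfolding r1_def[abs_def]
    proof (rule sq_bmult[where C=1, OF _ _ sq_sech])
      show "(\<lambda>x. tanh (d * x) / 2 - tanh x / 4) \<in> borel_measurable borel" by measurable
      show "\<bar>tanh (d * x) / 2 - tanh x / 4\<bar> \<le> 1" for x
        using abs_tanh_le_1[of "d * x"] abs_tanh_le_1[of x] unfolding abs_le_iff by argo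
    qed
    show "sq r3" using sq_cmult[OF sq_diff[OF sq_cmult[OF S(1), of d] sq_sech_weight(2)], of "1/4"]
      by (simp add: r3_def[abs_def])
  qed
  have R: "(\<integral>x. (r1 x)\<^sup>2 \<partial>lborel) \<le> 1/24" "(\<integral>x. (r3 x)\<^sup>2 \<partial>lborel) \<le> 1/12 + d/8"
  proof -
    have "(\<integral>x. (r1 x)\<^sup>2 \<partial>lborel) \<le> (\<integral>x. 1/16 * ((sech x)\<^sup>2 * (tanh x)\<^sup>2) \<partial>lborel)"
    proof (rule integral_mono)
      show "integrable lborel (\<lambda>x. (r1 x)\<^sup>2)" by (rule sq_int[OF r(1)])
      show "integrable lborel (\<lambda>x. 1/16 * ((sech x)\<^sup>2 * (tanh x)\<^sup>2))" using sech_tanh_sq_int by simp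
      fix x
      define t where "t = tanh (d * x)"
      have "t * (t - tanh x) \<le> 0" unfolding t_def by (rule tanh_scaled(2)[OF d])
      moreover have "(t / 2 - tanh x / 4)\<^sup>2 = (tanh x)\<^sup>2 / 16 + t * (t - tanh x) / 4"
        by (simp add: power2_eq_square field_simps)
      ultimately have "(t / 2 - tanh x / 4)\<^sup>2 \<le> (tanh x)\<^sup>2 / 16" by simp
      then have "(t / 2 - tanh x / 4)\<^sup>2 * (sech x)\<^sup>2 \<le> (tanh x)\<^sup>2 / 16 * (sech x)\<^sup>2" by (intro mult_right_mono) auto
      then show "(r1 x)\<^sup>2 \<le> 1/16 * ((sech x)\<^sup>2 * (tanh x)\<^sup>2)" by (simp add: r1_def t_def power_mult_distrib mult.commute)
    qed
    then show "(\<integral>x. (r1 x)\<^sup>2 \<partial>lborel) \<le> 1/24" using sech_tanh_sq_int by simp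
    have "(\<integral>x. (r3 x)\<^sup>2 \<partial>lborel) \<le> (\<integral>x. 1/16 * (sech x)^4 + d\<^sup>2 / 16 * S x \<partial>lborel)"
    proof (rule integral_mono)
      show "integrable lborel (\<lambda>x. (r3 x)\<^sup>2)" by (rule sq_int[OF r(2)])
      show "integrable lborel (\<lambda>x. 1/16 * (sech x)^4 + d\<^sup>2 / 16 * S x)" using sech4_int S by simp
      fix x
      have "S x * S x \<le> S x * 1" using S by (intro mult_left_mono) auto
      then have "d\<^sup>2 / 16 * (S x * S x) \<le> d\<^sup>2 / 16 * S x" by (intro mult_left_mono) auto
      moreover have "0 \<le> d / 8 * (S x * (sech x)\<^sup>2)" using d S by simp
      moreover have "(r3 x)\<^sup>2 = 1/16 * (sech x)^4 + d\<^sup>2 / 16 * (S x * S x) - d / 8 * (S x * (sech x)\<^sup>2)"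
        by (simp add: r3_def power2_eq_square eval_nat_numeral field_simps)
      ultimately show "(r3 x)\<^sup>2 \<le> 1/16 * (sech x)^4 + d\<^sup>2 / 16 * S x" by linarith
    qed
    also have "\<dots> = 1/12 + d/8" using sech4_int S d by (simp add: field_simps power2_eq_square)
    finally show "(\<integral>x. (r3 x)\<^sup>2 \<partial>lborel) \<le> 1/12 + d/8" .
  qed
  define P where "P = (\<integral>x. r1 x * w x $ 1 \<partial>lborel) + (\<integral>x. r3 x * w x $ 3 \<partial>lborel)"
  define Eg where "Eg = (\<integral>x. g1' x * w x $ 2 + (1 - 6 * (sech x)\<^sup>2) * g1 x * w x $ 1 \<partial>lborel) + (\<integral>x. gG d x * F x \<partial>lborel)"
  note gG = H1_trial(2)[OF d]
  have ii: "integrable lborel (\<lambda>x. g1' x * w x $ 2)" "integrable lborel (\<lambda>x. g1'' x * w x $ 1)"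
    "integrable lborel (\<lambda>x. (1 - 6 * (sech x)\<^sup>2) * g1 x * w x $ 1)"
    "integrable lborel (\<lambda>x. gG d x * w x $ 4)" "integrable lborel (\<lambda>x. gG' d x * w x $ 3)"
    "integrable lborel (\<lambda>x. sech x * gG d x * w x $ 1)"
    "integrable lborel (\<lambda>x. r1 x * w x $ 1)" "integrable lborel (\<lambda>x. r3 x * w x $ 3)" "integrable lborel (\<lambda>x. gG d x * F x)"
    by (rule sq_mult[OF H1_sq'[OF H1_g1] w(2)] sq_mult[OF H1_sq'[OF H1_g1'] w(1)] integrable_sech_form(3)[OF H1_sq[OF H1_g1] w(1)]
      sq_mult[OF H1_sq[OF gG] w(4)] sq_mult[OF H1_sq'[OF gG] w(3)] integrable_sech_form(2)[OF H1_sq[OF gG] w(1)]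
      sq_mult[OF r(1) w(1)] sq_mult[OF r(2) w(3)] sq_mult[OF H1_sq[OF gG] F])+
  have sh: "shift (trial_state d) w = P + Eg"
  proof -
    have "shift (trial_state d) w = (\<integral>x. (r1 x * w x $ 1 + r3 x * w x $ 3) +
       (((1 - 6 * (sech x)\<^sup>2) * g1 x * w x $ 1 - g1'' x * w x $ 1) + (2 * (sech x * gG d x * w x $ 1) - gG' d x * w x $ 3)) \<partial>lborel)"
      unfolding form_def
    proof (rule Bochner_Integration.integral_cong[OF refl])
      fix x
      have e1: "chi' x = r1 x + ((- g1'' x + (1 - 6 * (sech x)\<^sup>2) * g1 x) + 2 * (sech x * gG d x))"
        unfolding g1_equation chi'_def r1_def gG_def by (simp add: field_simps power2_eq_square power3_eq_cube)
      have e3: "z2' d x = r3 x - gG' d x"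
        unfolding z2'_def r3_def gG'_def S_def by (simp add: field_simps)
      show "shift_kernel x (trial_state d x) (w x) = (r1 x * w x $ 1 + r3 x * w x $ 3) +
       (((1 - 6 * (sech x)\<^sup>2) * g1 x * w x $ 1 - g1'' x * w x $ 1) + (2 * (sech x * gG d x * w x $ 1) - gG' d x * w x $ 3))"
        unfolding shift_kernel_def trial_state_def vec4_nth e1 e3 by (simp add: algebra_simps)
    qed
    also have "\<dots> = P + (((\<integral>x. (1 - 6 * (sech x)\<^sup>2) * g1 x * w x $ 1 \<partial>lborel) - (\<integral>x. g1'' x * w x $ 1 \<partial>lborel))
        + (2 * (\<integral>x. sech x * gG d x * w x $ 1 \<partial>lborel) - (\<integral>x. gG' d x * w x $ 3 \<partial>lborel)))"
      using ii by (simp add: P_def)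
    also have "\<dots> = P + (((\<integral>x. (1 - 6 * (sech x)\<^sup>2) * g1 x * w x $ 1 \<partial>lborel) + (\<integral>x. g1' x * w x $ 2 \<partial>lborel))
        + (2 * (\<integral>x. sech x * gG d x * w x $ 1 \<partial>lborel) + (\<integral>x. gG d x * w x $ 4 \<partial>lborel)))"
      using H1_by_parts[OF H1_g1' w1] H1_by_parts[OF gG w3] by simp
    also have "\<dots> = P + Eg"
    proof -
      have "(\<integral>x. gG d x * F x \<partial>lborel) = (\<integral>x. 2 * (sech x * gG d x * w x $ 1) + gG d x * w x $ 4 \<partial>lborel)"
        by (rule Bochner_Integration.integral_cong[OF refl]) (simp add: F_def algebra_simps)
      then show ?thesis using ii by (simp add: Eg_def)
    qed
    finally show ?thesis .
  qed
  define h where "h = (\<integral>x. (g1' x)\<^sup>2 + (1 - 6 * (sech x)\<^sup>2) * (g1 x)\<^sup>2 \<partial>lborel) + (\<integral>x. (gG d x)\<^sup>2 \<partial>lborel)"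
  define t where "t = 2 * k * l"
  \<comment> \<open>Only the flux of \<open>g\<close> matters, so the square is completed with
    \<open>w - t g1\<close> in the first component and with \<open>F - t gG\<close> in the flux. As
    \<open>g1\<close> vanishes at 0, \<open>H1_vanishing_nonneg\<close> stays applicable.\<close>
  have E: "0 \<le> energy w w - 2 * t * Eg + t\<^sup>2 * h"
  proof -
    define y where "y x = w x $ 1 - t * g1 x" for x
    define y' where "y' x = w x $ 2 - t * g1' x" for x
    have y: "H1 y y'" unfolding y_def[abs_def] y'_def[abs_def] by (intro H1_diff H1_cmult w1 H1_g1)
    have y0: "y 0 = 0" using o(2) by (simp add: y_def g1_def)
    have q: "integrable lborel (\<lambda>x. (1 - 6 * (sech x)\<^sup>2) * (w x $ 1)\<^sup>2)" "integrable lborel (\<lambda>x. (1 - 6 * (sech x)\<^sup>2) * (g1 x)\<^sup>2)"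
      using integrable_sech_form(3)[OF w(1) w(1)] integrable_sech_form(3)[OF H1_sq[OF H1_g1] H1_sq[OF H1_g1]]
      by (simp_all add: power2_eq_square mult.assoc)
    note sqi = sq_int[OF w(2)] sq_int[OF H1_sq'[OF H1_g1]] sq_int[OF F] sq_int[OF H1_sq[OF gG]]
    have "(\<integral>x. (y' x)\<^sup>2 + (1 - 6 * (sech x)\<^sup>2) * (y x)\<^sup>2 \<partial>lborel)
       = (\<integral>x. ((w x $ 2)\<^sup>2 + (1 - 6 * (sech x)\<^sup>2) * (w x $ 1)\<^sup>2) - 2 * t * (g1' x * w x $ 2 + (1 - 6 * (sech x)\<^sup>2) * g1 x * w x $ 1)
          + t\<^sup>2 * ((g1' x)\<^sup>2 + (1 - 6 * (sech x)\<^sup>2) * (g1 x)\<^sup>2) \<partial>lborel)"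
      by (rule Bochner_Integration.integral_cong[OF refl]) (simp add: y_def y'_def algebra_simps power2_eq_square)
    also have "\<dots> = (\<integral>x. (w x $ 2)\<^sup>2 + (1 - 6 * (sech x)\<^sup>2) * (w x $ 1)\<^sup>2 \<partial>lborel)
        - 2 * t * (\<integral>x. g1' x * w x $ 2 + (1 - 6 * (sech x)\<^sup>2) * g1 x * w x $ 1 \<partial>lborel)
        + t\<^sup>2 * (\<integral>x. (g1' x)\<^sup>2 + (1 - 6 * (sech x)\<^sup>2) * (g1 x)\<^sup>2 \<partial>lborel)"
      using ii q sqi by simp
    finally have 1: "0 \<le> \<dots>" using H1_vanishing_nonneg[OF y y0] by simp
    have "0 \<le> (\<integral>x. (F x - t * gG d x)\<^sup>2 \<partial>lborel)" by simp
    also have "\<dots> = (\<integral>x. (F x)\<^sup>2 - 2 * t * (gG d x * F x) + t\<^sup>2 * (gG d x)\<^sup>2 \<partial>lborel)"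
      by (rule Bochner_Integration.integral_cong[OF refl]) (simp add: algebra_simps power2_eq_square)
    also have "\<dots> = (\<integral>x. (F x)\<^sup>2 \<partial>lborel) - 2 * t * (\<integral>x. gG d x * F x \<partial>lborel) + t\<^sup>2 * (\<integral>x. (gG d x)\<^sup>2 \<partial>lborel)"
      using ii sqi by simp
    finally have 2: "0 \<le> \<dots>" .
    show ?thesis using add_mono[OF 1 2] unfolding energy_split[OF o(1)] F_def[symmetric] Eg_def h_def
      by (simp add: algebra_simps)
  qed
  \<comment> \<open>Here the square is that of \<open>l w - 2 k r\<close>: its cross term is
    \<open>2 t P\<close>, and its constant term is free of \<open>l\<close>, whereas the one in
    \<open>E\<close> carries \<open>l\<^sup>2\<close>. So this constant decides the sign for small
    \<open>l\<close>.\<close>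
  have Mb: "0 \<le> l\<^sup>2 * mass w w - 2 * t * P + 4 * k\<^sup>2 * (1/8 + d/8)"
  proof -
    have a: "0 \<le> l\<^sup>2 * (\<integral>x. (f x)\<^sup>2 \<partial>lborel) - 2 * t * (\<integral>x. q x * f x \<partial>lborel) + 4 * k\<^sup>2 * (\<integral>x. (q x)\<^sup>2 \<partial>lborel)" if "sq f" "sq q" for f q
    proof -
      have "0 \<le> (\<integral>x. (l * f x - 2 * k * q x)\<^sup>2 \<partial>lborel)" by simp
      also have "\<dots> = (\<integral>x. l\<^sup>2 * (f x)\<^sup>2 - 2 * t * (q x * f x) + 4 * k\<^sup>2 * (q x)\<^sup>2 \<partial>lborel)"
        by (rule Bochner_Integration.integral_cong[OF refl]) (simp add: t_def algebra_simps power2_eq_square)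
      also have "\<dots> = l\<^sup>2 * (\<integral>x. (f x)\<^sup>2 \<partial>lborel) - 2 * t * (\<integral>x. q x * f x \<partial>lborel) + 4 * k\<^sup>2 * (\<integral>x. (q x)\<^sup>2 \<partial>lborel)"
        using sq_int[OF that(1)] sq_int[OF that(2)] sq_mult[OF that(2,1)] by simp
      finally show ?thesis .
    qed
    have "4 * k\<^sup>2 * ((\<integral>x. (r1 x)\<^sup>2 \<partial>lborel) + (\<integral>x. (r3 x)\<^sup>2 \<partial>lborel)) \<le> 4 * k\<^sup>2 * (1/8 + d/8)"
      using R by (intro mult_left_mono) auto
    then show ?thesis using add_mono[OF a[OF w(1) r(1)] a[OF w(3) r(2)]] unfolding mass_expand[OF o(1)] P_def
      by (simp add: algebra_simps)
  qed
  have "4 * k * l * shift (trial_state d) w = 2 * t * P + 2 * t * Eg" unfolding sh t_def by (simp add: algebra_simps)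
  moreover have "t\<^sup>2 * h = 4 * k\<^sup>2 * l\<^sup>2 * h" by (simp add: t_def power_mult_distrib)
  ultimately show ?thesis using E Mb unfolding h_def[symmetric] by linarith
qed

lemma trial_exists:
  fixes k :: real
  assumes k: "k\<^sup>2 < 1"
  obtains z l0 where "z \<in> H1_pairs" "parity 1 z" "z 0 $ 1 = 1/2" "0 < l0" "l0 \<le> 3"
    "\<And>w. w \<in> H1_pairs \<Longrightarrow> parity (-1) w \<Longrightarrow>
       l0\<^sup>2 * mass z z + energy z z \<le> l0\<^sup>2 * mass w w + energy w w - 4 * k * l0 * shift z w"
proof -
  \<comment> \<open>The available gap is \<open>(1 - k\<^sup>2) / 2 = 6 * d\<close>: the terms with
    \<open>l0\<^sup>2\<close> may use \<open>3 * d\<close>, the energy of the test state exceeds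
    -1/2 by at most \<open>5/2 * d\<close>, and the mass bound uses at most
    \<open>d / 2\<close>.\<close>
  define d where "d = (1 - k\<^sup>2) / 12"
  have d: "0 < d" "d \<le> 1" 
  proof -
    show "0 < d" using k by (simp add: d_def)
    have "1 - k\<^sup>2 \<le> 12" using zero_le_power2[of k] by linarith
    then show "d \<le> 1" by (simp add: d_def)
  qed
  define z where "z = trial_state d"
  define h where "h = (\<integral>x. (g1' x)\<^sup>2 + (1 - 6 * (sech x)\<^sup>2) * (g1 x)\<^sup>2 \<partial>lborel) + (\<integral>x. (gG d x)\<^sup>2 \<partial>lborel)"
  define C where "C = mass z z + 4 * k\<^sup>2 * \<bar>h\<bar>"
  have C: "0 \<le> C" using mass_nonneg[of z] by (simp add: C_def)
  define l0 where "l0 = sqrt ((1 - k\<^sup>2) / (4 * (C + 1)))"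
  have q: "0 < (1 - k\<^sup>2) / (4 * (C + 1))" using k C by simp
  have l2: "l0\<^sup>2 = (1 - k\<^sup>2) / (4 * (C + 1))" using q by (simp add: l0_def)
  have l0: "0 < l0" using q by (simp add: l0_def)
  have "1 - k\<^sup>2 \<le> 4 * (C + 1)" using C zero_le_power2[of k] by argo
  then have "l0\<^sup>2 \<le> 1" unfolding l2 using C by (simp add: divide_le_eq)
  then have "l0 \<le> 1" using l0 by (simp add: abs_square_le_1)
  have lC: "l0\<^sup>2 * C \<le> (1 - k\<^sup>2) / 4"
  proof -
    have "l0\<^sup>2 * C \<le> l0\<^sup>2 * (C + 1)" by (intro mult_left_mono) auto
    also have "\<dots> = (1 - k\<^sup>2) / 4" unfolding l2 using C by (simp add: field_simps)
    finally show ?thesis .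
  qed
  show ?thesis
  proof (rule that[of z l0])
    show "z \<in> H1_pairs" "parity 1 z" "z 0 $ 1 = 1/2" unfolding z_def by (rule trial_state_props[OF d])+
    show "0 < l0" by (rule l0)
    show "l0 \<le> 3" using \<open>l0 \<le> 1\<close> by simp
    fix w assume w: "w \<in> H1_pairs" "parity (-1) w"
    have "w (- 0) $ 1 = - 1 * w 0 $ 1" using w(2) unfolding parity_def by blast
    then have w0: "w 0 $ 1 = 0" by simp
    have "l0\<^sup>2 * mass z z + 4 * k\<^sup>2 * l0\<^sup>2 * h \<le> l0\<^sup>2 * mass z z + 4 * k\<^sup>2 * l0\<^sup>2 * \<bar>h\<bar>"
      by (intro add_left_mono mult_left_mono) auto
    also have "\<dots> = l0\<^sup>2 * C" by (simp add: C_def algebra_simps)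
    finally have 1: "l0\<^sup>2 * mass z z + 4 * k\<^sup>2 * l0\<^sup>2 * h \<le> (1 - k\<^sup>2) / 4" using lC by simp
    have "k\<^sup>2 * d \<le> 1 * d" using k d by (intro mult_right_mono) auto
    then have 2: "4 * k\<^sup>2 * (1/8 + d/8) \<le> k\<^sup>2 / 2 + d / 2" by (simp add: algebra_simps)
    have 3: "energy z z \<le> -1/2 + 5/2 * d" unfolding z_def by (rule energy_trial[OF d])
    have 4: "(1 - k\<^sup>2) / 4 = 3 * d" by (simp add: d_def)
    have 5: "1 - k\<^sup>2 = 12 * d" by (simp add: d_def)
    show "l0\<^sup>2 * mass z z + energy z z \<le> l0\<^sup>2 * mass w w + energy w w - 4 * k * l0 * shift z w"
      using trial_bound[OF d w(1) w0, of k l0] 1 2 3 5 unfolding 4 h_def[symmetric] z_def[symmetric] by argo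
  qed
qed

subsection \<open>Hat functions\<close>

definition ramp :: "real \<Rightarrow> real \<Rightarrow> real" where "ramp c x = max 0 (x - c)"

lemma AC_ramp: "AC (ramp c) (indicat_real {c..})"
  unfolding AC_def
proof (intro conjI allI impI)
  have m: "indicat_real {a..b} x *\<^sub>R indicat_real {c..} x = indicat_real {max a c..b} x" for a b x
    by (auto simp: indicator_def)
  show "indicat_real {c..} \<in> borel_measurable borel" by measurable
  have fin: "integrable lborel (indicat_real {a..b})" for a b :: real
  proof (cases "a \<le> b")
    case False
    then have "{a..b} = {}" by simp
    then show ?thesis by simp
  qed simp
  show "set_integrable lborel {a..b} (indicat_real {c..})" for a b
    unfolding set_integrable_def m by (rule fin)
  fix a b :: real assume ab: "a \<le> b"
  show "ramp c b - ramp c a = (LINT x:{a..b}|lborel. indicat_real {c..} x)"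
  proof (cases "max a c \<le> b")
    case True
    then show ?thesis using ab unfolding set_lebesgue_integral_def m by (auto simp: ramp_def)
  next
    case False
    then have "{max a c..b} = {}" by simp
    then show ?thesis using ab False unfolding set_lebesgue_integral_def m by (auto simp: ramp_def)
  qed
qed

text \<open>Hats serve as test functions because their derivative is a step function: paired with a
  derivative it leaves point values (\<open>hat'_integral\<close>), which pass to pointwise limits.
  Rational centres and widths make the family countable.\<close>

definition hat :: "real \<Rightarrow> real \<Rightarrow> real \<Rightarrow> real" where
  "hat y d x = (1/d) * (ramp (y - d) x + (-2) * ramp y x + ramp (y + d) x)"
definition hat' :: "real \<Rightarrow> real \<Rightarrow> real \<Rightarrow> real" where
  "hat' y d x = (1/d) * (indicat_real {y - d..} x + (-2) * indicat_real {y..} x + indicat_real {y + d..} x)"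

lemma AC_hat: "AC (hat y d) (hat' y d)"
  unfolding hat_def[abs_def] hat'_def[abs_def] by (intro AC_cmult AC_add AC_ramp)

lemma hat_outside:
  assumes "d > 0" "x \<notin> {y - d..y + d}"
  shows "hat y d x = 0" "hat' y d x = 0"
  using assms by (auto simp: hat_def hat'_def ramp_def indicator_def)

lemma hat_bounds:
  assumes d: "d > 0"
  shows "\<bar>hat y d x\<bar> \<le> 1" "\<bar>hat' y d x\<bar> \<le> 1/d"
proof -
  have "\<bar>ramp (y - d) x + (-2) * ramp y x + ramp (y + d) x\<bar> \<le> d" using d by (auto simp: ramp_def max_def abs_if)
  then have "(1/d) * \<bar>ramp (y - d) x + (-2) * ramp y x + ramp (y + d) x\<bar> \<le> (1/d) * d" using d by (intro mult_left_mono) auto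
  then show "\<bar>hat y d x\<bar> \<le> 1" using d by (simp add: hat_def abs_mult)
  have "\<bar>indicat_real {y - d..} x + (-2) * indicat_real {y..} x + indicat_real {y + d..} x\<bar> \<le> 1"
    using d by (auto simp: indicator_def)
  then have "(1/d) * \<bar>indicat_real {y - d..} x + (-2) * indicat_real {y..} x + indicat_real {y + d..} x\<bar> \<le> (1/d) * 1"
    using d by (intro mult_left_mono) auto
  then show "\<bar>hat' y d x\<bar> \<le> 1/d" using d by (simp add: hat'_def abs_mult)
qed

lemma sq_indicator: "sq (indicat_real {a..b})"
proof -
  have "(indicat_real {a..b} x)\<^sup>2 = indicat_real {a..b} x" for x by (simp add: indicator_def)
  moreover have "integrable lborel (indicat_real {a..b})"
  proof (cases "a \<le> b")
    case False
    then have "{a..b} = {}" by simp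
    then show ?thesis by simp
  qed simp
  ultimately show ?thesis by (simp add: sq_def)
qed

lemma H1_hat:
  assumes d: "d > 0" shows "H1 (hat y d) (hat' y d)"
proof -
  have "sq (hat y d)"
  proof (rule sq_bound[OF AC_borel[OF AC_hat] sq_indicator[of "y - d" "y + d"]])
    show "\<bar>hat y d x\<bar> \<le> 1 * \<bar>indicat_real {y - d..y + d} x\<bar>" for x
      using hat_outside(1)[OF d, of x y] hat_bounds(1)[OF d, of y x] by (cases "x \<in> {y - d..y + d}") auto
  qed
  moreover have "sq (hat' y d)"
  proof (rule sq_bound[OF AC_meas[OF AC_hat] sq_indicator[of "y - d" "y + d"]])
    show "\<bar>hat' y d x\<bar> \<le> (1/d) * \<bar>indicat_real {y - d..y + d} x\<bar>" for x
      using hat_outside(2)[OF d, of x y] hat_bounds(2)[OF d, of y x] by (cases "x \<in> {y - d..y + d}") auto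
  qed
  ultimately show ?thesis using AC_hat by (simp add: H1_def)
qed

lemma hat'_integral:
  assumes d: "d > 0" and F: "AC F f"
  shows "(\<integral>x. hat' y d x * f x \<partial>lborel) = - (F (y + d) + F (y - d) - 2 * F y) / d"
proof -
  have e: "hat' y d x * f x = (1/d) * (indicat_real {y - d..<y} x *\<^sub>R f x - indicat_real {y..<y + d} x *\<^sub>R f x)" for x
    using d by (auto simp: hat'_def indicator_def)
  have i: "set_integrable lborel {a..<b} f" for a b
    by (rule set_integrable_subset[OF AC_int[OF F, of a b]]) auto
  have v: "(LINT x:{a..<b}|lborel. f x) = F b - F a" if "a \<le> b" for a b
  proof -
    have "(LINT x:{a..<b}|lborel. f x) = (LINT x:{a..b}|lborel. f x)"
      by (rule set_integral_discrete_difference[of "{b}"]) auto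
    then show ?thesis using AC_eq[OF F that] by simp
  qed
  have "(\<integral>x. hat' y d x * f x \<partial>lborel) = (1/d) * ((LINT x:{y - d..<y}|lborel. f x) - (LINT x:{y..<y + d}|lborel. f x))"
    unfolding e using i by (simp add: set_lebesgue_integral_def set_integrable_def)
  also have "\<dots> = (1/d) * ((F y - F (y - d)) - (F (y + d) - F y))" using d by (simp add: v)
  also have "\<dots> = - (F (y + d) + F (y - d) - 2 * F y) / d" using d by (simp add: field_simps)
  finally show ?thesis .
qed

section \<open>A countable family of test states with definite parity\<close>

definition reflect :: "(real \<Rightarrow> real^4) \<Rightarrow> real \<Rightarrow> real^4" where
  "reflect w x = vec4 (w (- x) $ 1) (- w (- x) $ 2) (- w (- x) $ 3) (w (- x) $ 4)"

text \<open>For \<open>s = 1\<close> or \<open>s = -1\<close>, twice the part of \<open>w\<close>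
  with this parity; the factor 1/2 is restored in \<open>pencil_base\<close>.\<close>

definition symm :: "real \<Rightarrow> (real \<Rightarrow> real^4) \<Rightarrow> real \<Rightarrow> real^4" where
  "symm s w x = w x + s *\<^sub>R reflect w x"

lemma reflect_H1_pairs:
  assumes "w \<in> H1_pairs" shows "reflect w \<in> H1_pairs"
proof -
  have "H1 (\<lambda>x. (-1) * w (- x) $ 3) (\<lambda>x. (-1) * - w (- x) $ 4)"
    by (rule H1_cmult[OF H1_reflect[OF H1_pairs_H1(2)[OF assms]]])
  then show ?thesis using H1_reflect[OF H1_pairs_H1(1)[OF assms]] by (simp add: H1_pairs_def reflect_def)
qed

lemma symm_H1_pairs: "w \<in> H1_pairs \<Longrightarrow> symm s w \<in> H1_pairs"
  unfolding symm_def[abs_def] by (intro H1_pairs_add H1_pairs_scale reflect_H1_pairs)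

lemma symm_parity: "s = 1 \<or> s = -1 \<Longrightarrow> parity s (symm s w)"
  by (auto simp: parity_def symm_def reflect_def)

definition base :: "bool \<Rightarrow> real \<Rightarrow> real \<Rightarrow> real \<Rightarrow> real^4" where
  "base p y d x = (if p then vec4 (hat y d x) (hat' y d x) 0 0 else vec4 0 0 (hat y d x) (hat' y d x))"

lemma base_H1_pairs: "d > 0 \<Longrightarrow> base p y d \<in> H1_pairs"
  using H1_hat[of d y] H1_zero by (cases p) (simp_all add: H1_pairs_def base_def)

text \<open>The index consists of component, parity, centre and width. Its type is countable, so
  \<open>from_nat\<close> enumerates the family; indices with nonpositive width are given the zero
  state below.\<close>

definition fsign :: "bool \<times> bool \<times> rat \<times> rat \<Rightarrow> real" where
  "fsign a = (case a of (p, s, y, d) \<Rightarrow> if s then 1 else -1)"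

text \<open>Subtracting a multiple of \<open>z\<close>, for which \<open>V(0) = 1/2\<close>, achieves \<open>V(0) = 0\<close>, the subspace on which
  the energy form is nonnegative.\<close>

definition family :: "(real \<Rightarrow> real^4) \<Rightarrow> bool \<times> bool \<times> rat \<times> rat \<Rightarrow> real \<Rightarrow> real^4" where
  "family z a = (case a of (p, s, y, d) \<Rightarrow> if d > 0 then
      (\<lambda>x. symm (fsign a) (base p (of_rat y) (of_rat d)) x - (2 * symm (fsign a) (base p (of_rat y) (of_rat d)) 0 $ 1) *\<^sub>R z x)
    else (\<lambda>x. 0))"

lemma fsign_cases: "fsign a = 1 \<or> fsign a = -1" by (auto simp: fsign_def split: prod.splits)

lemma family_props:
  assumes z: "z \<in> H1_pairs" "parity 1 z" "z 0 $ 1 = 1/2"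
  shows "family z a \<in> H1_pairs" "parity (fsign a) (family z a)" "family z a 0 $ 1 = 0"
proof -
  obtain p s y d where a: "a = (p, s, y, d)" by (cases a) auto
  define w where "w = symm (fsign a) (base p (of_rat y) (of_rat d))"
  have "family z a \<in> H1_pairs \<and> parity (fsign a) (family z a) \<and> family z a 0 $ 1 = 0"
  proof (cases "d > 0")
    case False
    then show ?thesis by (simp add: family_def a H1_pairs_zero parity_def)
  next
    case True
    have f: "family z a = (\<lambda>x. w x - (2 * w 0 $ 1) *\<^sub>R z x)" using True by (simp add: family_def a w_def)
    have wX: "w \<in> H1_pairs" unfolding w_def using True by (intro symm_H1_pairs base_H1_pairs) simp
    have wp: "parity (fsign a) w" unfolding w_def by (rule symm_parity[OF fsign_cases])
    have "parity (fsign a) (family z a)"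
    proof (cases "fsign a = 1")
      case True
      then show ?thesis using wp z(2) unfolding f by (intro parity_diff parity_scale) simp_all
    next
      case False
      then have m: "fsign a = -1" using fsign_cases by blast
      have "w (- 0) $ 1 = fsign a * w 0 $ 1" using wp unfolding parity_def by blast
      then have "w 0 $ 1 = 0" using m by simp
      then show ?thesis using wp unfolding f by simp
    qed
    then show ?thesis using wX z unfolding f by (auto intro: H1_pairs_diff H1_pairs_scale)
  qed
  then show "family z a \<in> H1_pairs" "parity (fsign a) (family z a)" "family z a 0 $ 1 = 0" by auto
qed

text \<open>The multiple of \<open>z\<close> inside \<open>family\<close> is invisible when the
  pairing with \<open>z\<close> is 0, and the two parities add up to twice the hat.\<close>

lemma pencil_base:
  assumes u: "u \<in> H1_pairs" and z: "z \<in> H1_pairs" and d: "d > 0" and pz: "pencil k l u z = 0"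
  shows "pencil k l u (base p (of_rat y) (of_rat d)) = (pencil k l u (family z (p, True, y, d)) + pencil k l u (family z (p, False, y, d))) / 2"
proof -
  define w where "w = base p (of_rat y) (of_rat d)"
  have wX: "w \<in> H1_pairs" unfolding w_def using d by (intro base_H1_pairs) simp
  have f: "pencil k l u (family z (p, s, y, d)) = pencil k l u (symm (fsign (p, s, y, d)) w)" for s
  proof -
    have f: "family z (p, s, y, d) = (\<lambda>x. symm (fsign (p, s, y, d)) w x + (- 2 * symm (fsign (p, s, y, d)) w 0 $ 1) *\<^sub>R z x)"
      using d by (simp add: family_def w_def)
    have "pencil k l u (family z (p, s, y, d)) = pencil k l u (symm (fsign (p, s, y, d)) w)
        + pencil k l u (\<lambda>x. (- 2 * symm (fsign (p, s, y, d)) w 0 $ 1) *\<^sub>R z x)"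
      unfolding f by (rule pencil_add_right[OF u symm_H1_pairs[OF wX] H1_pairs_scale[OF z]])
    then show ?thesis by (simp only: pencil_scale_right pz mult_zero_right add_0_right)
  qed
  have "pencil k l u (\<lambda>x. symm 1 w x + symm (-1) w x) = pencil k l u (symm 1 w) + pencil k l u (symm (-1) w)"
    by (rule pencil_add_right[OF u symm_H1_pairs[OF wX] symm_H1_pairs[OF wX]])
  moreover have "(\<lambda>x. symm 1 w x + symm (-1) w x) = (\<lambda>x. 2 *\<^sub>R w x)" by (auto simp: symm_def scaleR_2)
  ultimately show ?thesis unfolding f by (simp add: fsign_def w_def pencil_scale_right)
qed

text \<open>Integration by parts takes every derivative off \<open>u\<close>, so the right-hand side
  passes to the limit when \<open>u\<close> converges boundedly and pointwise.\<close>

lemma pencil_base_V: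
  assumes u: "u \<in> H1_pairs" and d: "d > 0"
  shows "pencil k l u (base True y d) = (\<integral>x. u x $ 1 * ((l\<^sup>2 + 1 - 2 * (sech x)\<^sup>2) * hat y d x + 2 * k * l * hat' y d x) \<partial>lborel)
    - (u (y + d) $ 1 + u (y - d) $ 1 - 2 * u y $ 1) / d - 2 * (\<integral>x. u x $ 3 * (sech' x * hat y d x + sech x * hat' y d x) \<partial>lborel)"
proof -
  note s = H1_pairs_sq[OF u] and h = H1_hat[OF d, of y]
  note hs = H1_sq[OF h] H1_sq'[OF h]
  have sh: "H1 (\<lambda>x. sech x * hat y d x) (\<lambda>x. sech' x * hat y d x + sech x * hat' y d x)"
    by (rule H1_bmult[OF AC_sech(1) sech_deriv_bounds(1,2) h])
  have i: "integrable lborel (\<lambda>x. u x $ 1 * hat y d x)" "integrable lborel (\<lambda>x. u x $ 2 * hat y d x)"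
    "integrable lborel (\<lambda>x. u x $ 1 * hat' y d x)" "integrable lborel (\<lambda>x. hat' y d x * u x $ 2)"
    "integrable lborel (\<lambda>x. (sech x)\<^sup>2 * u x $ 1 * hat y d x)" "integrable lborel (\<lambda>x. sech x * u x $ 4 * hat y d x)"
    by (rule sq_mult[OF s(1) hs(1)] sq_mult[OF s(2) hs(1)] sq_mult[OF s(1) hs(2)] sq_mult[OF hs(2) s(2)]
        integrable_sech_form(1)[OF s(1) hs(1)] integrable_sech_form(2)[OF s(4) hs(1)])+
  have p1: "(\<integral>x. u x $ 2 * hat y d x \<partial>lborel) = - (\<integral>x. u x $ 1 * hat' y d x \<partial>lborel)"
    by (rule H1_by_parts[OF H1_pairs_H1(1)[OF u] h])
  have p2: "(\<integral>x. hat' y d x * u x $ 2 \<partial>lborel) = - (u (y + d) $ 1 + u (y - d) $ 1 - 2 * u y $ 1) / d"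
    by (rule hat'_integral[OF d H1_AC[OF H1_pairs_H1(1)[OF u]]])
  have p3: "(\<integral>x. sech x * u x $ 4 * hat y d x \<partial>lborel) = - (\<integral>x. u x $ 3 * (sech' x * hat y d x + sech x * hat' y d x) \<partial>lborel)"
    using H1_by_parts[OF H1_pairs_H1(2)[OF u] sh] by (simp add: mult_ac)
  have "pencil k l u (base True y d) = l\<^sup>2 * (\<integral>x. u x $ 1 * hat y d x \<partial>lborel) - 2 * k * l * (\<integral>x. u x $ 2 * hat y d x \<partial>lborel)
     + ((\<integral>x. hat' y d x * u x $ 2 \<partial>lborel) + (\<integral>x. u x $ 1 * hat y d x \<partial>lborel) - 2 * (\<integral>x. (sech x)\<^sup>2 * u x $ 1 * hat y d x \<partial>lborel)
       + 2 * (\<integral>x. sech x * u x $ 4 * hat y d x \<partial>lborel))"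
    using i by (simp add: pencil_def form_def mass_kernel_def shift_kernel_def energy_kernel_def base_def mult.commute[of "u _ $ 2" "hat' y d _"])
  also have "\<dots> = (l\<^sup>2 * (\<integral>x. u x $ 1 * hat y d x \<partial>lborel) + 2 * k * l * (\<integral>x. u x $ 1 * hat' y d x \<partial>lborel)
     + (\<integral>x. u x $ 1 * hat y d x \<partial>lborel) - 2 * (\<integral>x. (sech x)\<^sup>2 * u x $ 1 * hat y d x \<partial>lborel))
     - (u (y + d) $ 1 + u (y - d) $ 1 - 2 * u y $ 1) / d - 2 * (\<integral>x. u x $ 3 * (sech' x * hat y d x + sech x * hat' y d x) \<partial>lborel)"
    unfolding p1 p2 p3 by (simp add: algebra_simps diff_divide_distrib add_divide_distrib)
  also have "l\<^sup>2 * (\<integral>x. u x $ 1 * hat y d x \<partial>lborel) + 2 * k * l * (\<integral>x. u x $ 1 * hat' y d x \<partial>lborel)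
     + (\<integral>x. u x $ 1 * hat y d x \<partial>lborel) - 2 * (\<integral>x. (sech x)\<^sup>2 * u x $ 1 * hat y d x \<partial>lborel)
     = (\<integral>x. l\<^sup>2 * (u x $ 1 * hat y d x) + 2 * k * l * (u x $ 1 * hat' y d x) + u x $ 1 * hat y d x - 2 * ((sech x)\<^sup>2 * u x $ 1 * hat y d x) \<partial>lborel)"
    using i by simp
  also have "\<dots> = (\<integral>x. u x $ 1 * ((l\<^sup>2 + 1 - 2 * (sech x)\<^sup>2) * hat y d x + 2 * k * l * hat' y d x) \<partial>lborel)"
    by (rule Bochner_Integration.integral_cong[OF refl]) (simp add: algebra_simps)
  finally show ?thesis .
qed

lemma pencil_base_q:
  assumes u: "u \<in> H1_pairs" and d: "d > 0"
  shows "pencil k l u (base False y d) = (\<integral>x. u x $ 3 * (l\<^sup>2 * hat y d x + 2 * k * l * hat' y d x) \<partial>lborel)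
    - (u (y + d) $ 3 + u (y - d) $ 3 - 2 * u y $ 3) / d + 2 * (\<integral>x. u x $ 1 * (sech x * hat' y d x) \<partial>lborel)"
proof -
  note s = H1_pairs_sq[OF u] and h = H1_hat[OF d, of y]
  note hs = H1_sq[OF h] H1_sq'[OF h]
  have i: "integrable lborel (\<lambda>x. u x $ 3 * hat y d x)" "integrable lborel (\<lambda>x. u x $ 4 * hat y d x)"
    "integrable lborel (\<lambda>x. u x $ 3 * hat' y d x)" "integrable lborel (\<lambda>x. hat' y d x * u x $ 4)"
    "integrable lborel (\<lambda>x. sech x * u x $ 1 * hat' y d x)"
    by (rule sq_mult[OF s(3) hs(1)] sq_mult[OF s(4) hs(1)] sq_mult[OF s(3) hs(2)] sq_mult[OF hs(2) s(4)]
        integrable_sech_form(2)[OF s(1) hs(2)])+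
  have p1: "(\<integral>x. u x $ 4 * hat y d x \<partial>lborel) = - (\<integral>x. u x $ 3 * hat' y d x \<partial>lborel)"
    by (rule H1_by_parts[OF H1_pairs_H1(2)[OF u] h])
  have p2: "(\<integral>x. hat' y d x * u x $ 4 \<partial>lborel) = - (u (y + d) $ 3 + u (y - d) $ 3 - 2 * u y $ 3) / d"
    by (rule hat'_integral[OF d H1_AC[OF H1_pairs_H1(2)[OF u]]])
  have "pencil k l u (base False y d) = l\<^sup>2 * (\<integral>x. u x $ 3 * hat y d x \<partial>lborel) - 2 * k * l * (\<integral>x. u x $ 4 * hat y d x \<partial>lborel)
     + ((\<integral>x. hat' y d x * u x $ 4 \<partial>lborel) + 2 * (\<integral>x. sech x * u x $ 1 * hat' y d x \<partial>lborel))"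
    using i by (simp add: pencil_def form_def mass_kernel_def shift_kernel_def energy_kernel_def base_def mult.commute[of "u _ $ 4" "hat' y d _"])
  also have "\<dots> = (l\<^sup>2 * (\<integral>x. u x $ 3 * hat y d x \<partial>lborel) + 2 * k * l * (\<integral>x. u x $ 3 * hat' y d x \<partial>lborel))
     - (u (y + d) $ 3 + u (y - d) $ 3 - 2 * u y $ 3) / d + 2 * (\<integral>x. u x $ 1 * (sech x * hat' y d x) \<partial>lborel)"
    unfolding p1 p2 by (simp add: algebra_simps diff_divide_distrib add_divide_distrib)
  also have "l\<^sup>2 * (\<integral>x. u x $ 3 * hat y d x \<partial>lborel) + 2 * k * l * (\<integral>x. u x $ 3 * hat' y d x \<partial>lborel)
     = (\<integral>x. l\<^sup>2 * (u x $ 3 * hat y d x) + 2 * k * l * (u x $ 3 * hat' y d x) \<partial>lborel)"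
    using i by simp
  also have "\<dots> = (\<integral>x. u x $ 3 * (l\<^sup>2 * hat y d x + 2 * k * l * hat' y d x) \<partial>lborel)"
    by (rule Bochner_Integration.integral_cong[OF refl]) (simp add: algebra_simps)
  finally show ?thesis .
qed

text \<open>The integral of \<open>sech\<^sup>2 V\<^sup>2\<close> is normalized rather than the mass
  because, up to the factor -6, it is the only negative term of the energy: the self pairing bounds
  everything else by 6 times it. The decaying weight also keeps the normalization in a pointwise
  limit, so the limit is not 0.\<close>

lemma approximate_modes:
  fixes k :: real
  assumes z: "z \<in> H1_pairs" "parity 1 z" "z 0 $ 1 = 1/2" and l0: "0 < l0" "l0 \<le> 3"
    and trial: "\<And>w. w \<in> H1_pairs \<Longrightarrow> parity (-1) w \<Longrightarrow>
       l0\<^sup>2 * mass z z + energy z z \<le> l0\<^sup>2 * mass w w + energy w w - 4 * k * l0 * shift z w"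
  shows "\<exists>u l. u \<in> H1_pairs \<and> l \<in> {l0..3} \<and> (\<integral>x. (sech x)\<^sup>2 * (u x $ 1)\<^sup>2 \<partial>lborel) = 1 \<and>
     (\<integral>x. (u x $ 1)\<^sup>2 \<partial>lborel) \<le> 6 \<and> (\<integral>x. (u x $ 2)\<^sup>2 \<partial>lborel) \<le> 6 \<and> (\<integral>x. (u x $ 3)\<^sup>2 \<partial>lborel) \<le> 6 / l0\<^sup>2 \<and>
     (\<integral>x. (u x $ 4)\<^sup>2 \<partial>lborel) \<le> 60 \<and> pencil k l u z = 0 \<and>
     (\<forall>i<n. \<bar>pencil k l u (family z (from_nat i))\<bar> \<le> sqrt (6 / real (Suc n)))"
proof -
  define b where "b j = (case j of 0 \<Rightarrow> z | Suc i \<Rightarrow> family z (from_nat i))" for j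
  define \<sigma> where "\<sigma> j = (case j of 0 \<Rightarrow> 1 | Suc i \<Rightarrow> fsign (from_nat i))" for j
  \<comment> \<open>The regularization tends to 0 as the number of rows grows, so the rows hold in
    the limit.\<close>
  define e where "e = 1 / real (Suc n)"
  have e: "e > 0" by (simp add: e_def)
  have bX: "b j \<in> H1_pairs" for j using z family_props(1)[OF z] by (cases j) (simp_all add: b_def)
  obtain l x where lx: "l \<in> {l0..3}" "x 0 = 1"
    "pencil k l (\<lambda>t. \<Sum>j\<le>n. x j *\<^sub>R b j t) (b 0) = 0"
    "\<And>i. i \<in> {1..n} \<Longrightarrow> pencil k l (\<lambda>t. \<Sum>j\<le>n. x j *\<^sub>R b j t) (b i) + e * x i = (0::real)"
  proof (rule galerkin_root[of b \<sigma> e l0 k n])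
    show "parity (\<sigma> j) (b j)" for j using z family_props(2)[OF z] by (cases j) (simp_all add: b_def \<sigma>_def)
    show "\<sigma> j = 1 \<or> \<sigma> j = - 1" for j using fsign_cases by (cases j) (simp_all add: \<sigma>_def)
    show "b j 0 $ 1 = 0" if "1 \<le> j" for j using that family_props(3)[OF z] by (cases j) (simp_all add: b_def)
    show "l0\<^sup>2 * mass (b 0) (b 0) + energy (b 0) (b 0) \<le> l0\<^sup>2 * mass w w + energy w w - 4 * k * l0 * shift (b 0) w"
      if "w \<in> H1_pairs" "parity (-1) w" for w using trial[OF that] by (simp add: b_def)
  qed (use bX l0 e in \<open>auto simp: \<sigma>_def\<close>)
  define U where "U t = (\<Sum>j\<le>n. x j *\<^sub>R b j t)" for t
  have U: "U \<in> H1_pairs" unfolding U_def[abs_def] by (intro H1_pairs_sum bX) simp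
  have rows: "pencil k l U (b 0) = 0" "\<And>i. i \<in> {1..n} \<Longrightarrow> pencil k l U (b i) = - e * x i"
    using lx(3,4) by (simp_all add: U_def[abs_def] eq_neg_iff_add_eq_0)
  have U0: "U 0 $ 1 = 1/2"
  proof -
    have "U 0 $ 1 = (\<Sum>j\<le>n. x j * b j 0 $ 1)" by (simp add: U_def)
    also have "\<dots> = (\<Sum>j\<le>n. if j = 0 then 1/2 else 0)"
      by (rule sum.cong[OF refl]) (use lx(2) z(3) family_props(3)[OF z] in \<open>auto simp: b_def split: nat.splits\<close>)
    finally show ?thesis by simp
  qed
  define X where "X = (\<Sum>i\<in>{1..n}. (x i)\<^sup>2)"
  have "pencil k l U U = (\<Sum>j\<le>n. x j * pencil k l U (b j))"
  proof -
    have "pencil k l U (\<lambda>t. \<Sum>j\<le>n. x j *\<^sub>R b j t) = (\<Sum>j\<le>n. x j * pencil k l U (b j))"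
      by (rule pencil_sum_right) (auto simp: bX U)
    then show ?thesis by (simp add: U_def[abs_def])
  qed
  also have "\<dots> = (\<Sum>j\<in>{1..n}. - e * (x j)\<^sup>2)"
    by (rule sum.mono_neutral_cong_right) (use rows in \<open>auto simp: power2_eq_square not_less_eq_eq\<close>)
  also have "\<dots> = - e * X" by (simp add: X_def sum_distrib_left)
  finally have self: "l\<^sup>2 * mass U U + energy U U + e * X = 0" unfolding pencil_self[OF U] by simp
  define I1 I2 I3 G N where "I1 = (\<integral>t. (U t $ 1)\<^sup>2 \<partial>lborel)" and "I2 = (\<integral>t. (U t $ 2)\<^sup>2 \<partial>lborel)"
    and "I3 = (\<integral>t. (U t $ 3)\<^sup>2 \<partial>lborel)" and "G = (\<integral>t. (U t $ 4 + 2 * (sech t * U t $ 1))\<^sup>2 \<partial>lborel)"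
    and "N = (\<integral>t. (sech t)\<^sup>2 * (U t $ 1)\<^sup>2 \<partial>lborel)"
  have nn: "0 \<le> I1" "0 \<le> I2" "0 \<le> I3" "0 \<le> G" "0 \<le> N" by (simp_all add: I1_def I2_def I3_def G_def N_def)
  have X0: "0 \<le> e * X" using e by (simp add: X_def sum_nonneg)
  have id: "l\<^sup>2 * I1 + l\<^sup>2 * I3 + G + I2 + I1 + e * X = 6 * N"
    using self unfolding mass_expand[OF U] energy_expand[OF U] I1_def[symmetric] I2_def[symmetric] I3_def[symmetric] G_def[symmetric] N_def[symmetric]
    by (simp add: algebra_simps)
  have l2: "0 \<le> l\<^sup>2 * I1" "0 \<le> l\<^sup>2 * I3" using nn by simp_all
  \<comment> \<open>Otherwise \<open>id\<close> would force \<open>V = 0\<close>, but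
    \<open>x 0 = 1\<close> fixes \<open>V(0) = 1/2\<close>.\<close>
  have Npos: "N > 0"
  proof (rule ccontr)
    assume "\<not> N > 0"
    then have "I1 + I2 \<le> 0" using id nn l2 X0 by linarith
    moreover have "(U 0 $ 1)\<^sup>2 \<le> I1 + I2" using H1_sup_bound[OF H1_pairs_H1(1)[OF U], of 0] by (simp add: I1_def I2_def)
    ultimately show False using U0 by (simp add: power2_eq_square)
  qed
  define c where "c = 1 / sqrt N"
  have c: "c\<^sup>2 = 1 / N" "0 < c" using Npos by (simp_all add: c_def power_divide)
  define u where "u t = c *\<^sub>R U t" for t
  have u: "u \<in> H1_pairs" unfolding u_def[abs_def] by (rule H1_pairs_scale[OF U])
  have l: "0 < l\<^sup>2" "l0\<^sup>2 \<le> l\<^sup>2" using lx(1) l0 by (auto intro: power_mono)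
  have uint: "(\<integral>t. (u t $ i)\<^sup>2 \<partial>lborel) = (\<integral>t. (U t $ i)\<^sup>2 \<partial>lborel) / N" for i
    by (simp add: u_def power_mult_distrib c)
  have b0: "I1 \<le> 6 * N" "I2 \<le> 6 * N" "G \<le> 6 * N" "l\<^sup>2 * I3 \<le> 6 * N"
    using id nn l2 X0 by linarith+
  then have b1: "I1 / N \<le> 6" "I2 / N \<le> 6" "G / N \<le> 6" "l\<^sup>2 * I3 / N \<le> 6"
    using Npos by (simp_all add: divide_le_eq)
  have "l0\<^sup>2 * (I3 / N) \<le> l\<^sup>2 * (I3 / N)" using l nn Npos by (intro mult_right_mono) auto
  also have "l\<^sup>2 * (I3 / N) \<le> 6" using b1(4) by (simp only: times_divide_eq_right)
  finally have b3: "I3 / N \<le> 6 / l0\<^sup>2" using l0 by (simp only: le_divide_eq zero_less_power if_True mult.commute)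
  \<comment> \<open>\<open>q'\<close> is the flux minus \<open>2 sech V\<close>, and
    \<open>60 = 2 * 6 + 8 * 6\<close>.\<close>
  have b4: "(\<integral>t. (u t $ 4)\<^sup>2 \<partial>lborel) \<le> 60"
  proof -
    define g where "g t = u t $ 4 + 2 * (sech t * u t $ 1)" for t
    have g: "sq g" unfolding g_def[abs_def] by (rule sq_flux[OF u])
    have "(\<integral>t. (u t $ 4)\<^sup>2 \<partial>lborel) \<le> (\<integral>t. 2 * (g t)\<^sup>2 + 8 * (u t $ 1)\<^sup>2 \<partial>lborel)"
    proof (rule integral_mono)
      show "integrable lborel (\<lambda>t. (u t $ 4)\<^sup>2)" by (rule sq_int[OF H1_pairs_sq(4)[OF u]])
      show "integrable lborel (\<lambda>t. 2 * (g t)\<^sup>2 + 8 * (u t $ 1)\<^sup>2)" using sq_int[OF g] sq_int[OF H1_pairs_sq(1)[OF u]] by simp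
      fix t
      define p where "p = 2 * (sech t * u t $ 1)"
      have "0 \<le> (g t + p)\<^sup>2" by simp
      then have "(g t - p)\<^sup>2 \<le> 2 * (g t)\<^sup>2 + 2 * p\<^sup>2" by (simp add: power2_eq_square algebra_simps)
      moreover have "(sech t)\<^sup>2 * (u t $ 1)\<^sup>2 \<le> 1 * (u t $ 1)\<^sup>2" by (intro mult_right_mono sech_sq_le_1) simp
      then have "2 * p\<^sup>2 \<le> 8 * (u t $ 1)\<^sup>2" by (simp add: p_def power_mult_distrib)
      ultimately show "(u t $ 4)\<^sup>2 \<le> 2 * (g t)\<^sup>2 + 8 * (u t $ 1)\<^sup>2" by (simp add: g_def p_def)
    qed
    also have "\<dots> = 2 * (\<integral>t. (g t)\<^sup>2 \<partial>lborel) + 8 * (\<integral>t. (u t $ 1)\<^sup>2 \<partial>lborel)"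
      using sq_int[OF g] sq_int[OF H1_pairs_sq(1)[OF u]] by simp
    also have "(\<integral>t. (g t)\<^sup>2 \<partial>lborel) = G / N"
    proof -
      have "(g t)\<^sup>2 = c\<^sup>2 * (U t $ 4 + 2 * (sech t * U t $ 1))\<^sup>2" for t
        by (simp add: g_def u_def power_mult_distrib[symmetric] algebra_simps)
      then show ?thesis by (simp add: c G_def)
    qed
    also have "2 * (G / N) + 8 * (\<integral>t. (u t $ 1)\<^sup>2 \<partial>lborel) \<le> 60" using b1 unfolding uint I1_def[symmetric] by linarith
    finally show ?thesis .
  qed
  have N1: "(\<integral>t. (sech t)\<^sup>2 * (u t $ 1)\<^sup>2 \<partial>lborel) = 1"
  proof -
    have "(\<integral>t. (sech t)\<^sup>2 * (u t $ 1)\<^sup>2 \<partial>lborel) = (\<integral>t. c\<^sup>2 * ((sech t)\<^sup>2 * (U t $ 1)\<^sup>2) \<partial>lborel)"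
      by (rule Bochner_Integration.integral_cong[OF refl]) (simp add: u_def power_mult_distrib)
    then show ?thesis using Npos by (simp add: c N_def)
  qed
  have pu: "pencil k l u v = c * pencil k l U v" for v unfolding u_def[abs_def] by (rule pencil_scale_left)
  \<comment> \<open>The residual is \<open>- c * e * x (Suc i)\<close>. Its square is at most
    \<open>e * (e * X / N)\<close>, and \<open>e * X \<le> 6 * N\<close>.\<close>
  have row: "\<bar>pencil k l u (family z (from_nat i))\<bar> \<le> sqrt (6 / real (Suc n))" if "i < n" for i
  proof -
    have "pencil k l U (b (Suc i)) = - e * x (Suc i)" using rows(2)[of "Suc i"] that by simp
    then have q: "pencil k l u (family z (from_nat i)) = - c * e * x (Suc i)" by (simp add: pu b_def)
    have "(x (Suc i))\<^sup>2 \<le> X" unfolding X_def by (rule member_le_sum) (use that in auto)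
    then have "e * (x (Suc i))\<^sup>2 \<le> e * X" using e by (intro mult_left_mono) auto
    also have "\<dots> \<le> 6 * N" using id nn l2 by linarith
    finally have "e * (x (Suc i))\<^sup>2 / N \<le> 6" using Npos by (simp add: divide_le_eq)
    then have "e * (e * (x (Suc i))\<^sup>2 / N) \<le> e * 6" using e by (intro mult_left_mono) auto
    moreover have "(- c * e * x (Suc i))\<^sup>2 = e * (e * (x (Suc i))\<^sup>2 / N)"
      by (simp add: power_mult_distrib c power2_eq_square[of e])
    ultimately have "(- c * e * x (Suc i))\<^sup>2 \<le> 6 / real (Suc n)" by (simp add: e_def)
    then show ?thesis unfolding q by (metis real_sqrt_abs real_sqrt_le_mono)
  qed
  show ?thesis
  proof (intro exI conjI)
    show "u \<in> H1_pairs" by (rule u)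
    show "l \<in> {l0..3}" by (rule lx(1))
    show "(\<integral>x. (sech x)\<^sup>2 * (u x $ 1)\<^sup>2 \<partial>lborel) = 1" by (rule N1)
    show "(\<integral>x. (u x $ 1)\<^sup>2 \<partial>lborel) \<le> 6" "(\<integral>x. (u x $ 2)\<^sup>2 \<partial>lborel) \<le> 6" "(\<integral>x. (u x $ 3)\<^sup>2 \<partial>lborel) \<le> 6 / l0\<^sup>2"
      unfolding uint using b1 b3 by (simp_all add: I1_def I2_def I3_def)
    show "(\<integral>x. (u x $ 4)\<^sup>2 \<partial>lborel) \<le> 60" by (rule b4)
    show "pencil k l u z = 0" using rows(1) by (simp add: pu b_def)
    show "\<forall>i<n. \<bar>pencil k l u (family z (from_nat i))\<bar> \<le> sqrt (6 / real (Suc n))" using row by blast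
  qed
qed

subsection \<open>Passage to the limit\<close>

lemma Fatou_sq:
  assumes f: "\<And>n. sq (f n)" and b: "\<And>n. (\<integral>x. (f n x)\<^sup>2 \<partial>lborel) \<le> C"
    and l: "\<And>x. (\<lambda>n. f n x) \<longlonglongrightarrow> g x" and g: "g \<in> borel_measurable borel"
  shows "sq g"
  unfolding sq_def
proof
  have fm: "f n \<in> borel_measurable borel" for n using f by (simp add: sq_def)
  have "(\<integral>\<^sup>+ x. ennreal ((g x)\<^sup>2) \<partial>lborel) = (\<integral>\<^sup>+ x. liminf (\<lambda>n. ennreal ((f n x)\<^sup>2)) \<partial>lborel)"
  proof (rule nn_integral_cong)
    fix x
    have "(\<lambda>n. ennreal ((f n x)\<^sup>2)) \<longlonglongrightarrow> ennreal ((g x)\<^sup>2)" by (intro tendsto_ennrealI tendsto_power l)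
    then show "ennreal ((g x)\<^sup>2) = liminf (\<lambda>n. ennreal ((f n x)\<^sup>2))"
      by (rule lim_imp_Liminf[OF trivial_limit_sequentially, symmetric])
  qed
  also have "\<dots> \<le> liminf (\<lambda>n. \<integral>\<^sup>+ x. ennreal ((f n x)\<^sup>2) \<partial>lborel)"
    by (rule nn_integral_liminf) (use fm in measurable)
  also have "\<dots> \<le> liminf (\<lambda>n. ennreal C)"
  proof (rule Liminf_mono, rule always_eventually, rule allI)
    fix n
    have "(\<integral>\<^sup>+ x. ennreal ((f n x)\<^sup>2) \<partial>lborel) = ennreal (\<integral>x. (f n x)\<^sup>2 \<partial>lborel)"
      by (rule nn_integral_eq_integral) (use f in \<open>auto simp: sq_def\<close>)
    then show "(\<integral>\<^sup>+ x. ennreal ((f n x)\<^sup>2) \<partial>lborel) \<le> ennreal C" using b by (simp add: ennreal_leI)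
  qed
  also have "\<dots> = ennreal C" by (simp add: Liminf_const)
  also have "\<dots> < \<infinity>" by simp
  finally have fin: "(\<integral>\<^sup>+ x. ennreal ((g x)\<^sup>2) \<partial>lborel) < \<infinity>" .
  have gm: "(\<lambda>x. (g x)\<^sup>2) \<in> borel_measurable lborel" using g by measurable
  show "integrable lborel (\<lambda>x. (g x)\<^sup>2)"
    by (rule integrableI_bounded[OF gm]) (use fin in simp)
qed (rule g)

text \<open>Equicontinuity carries convergence from the rationals to every point and makes the limit
  continuous.\<close>

lemma Hoelder_limit:
  fixes g :: "nat \<Rightarrow> real \<Rightarrow> real"
  assumes C: "0 \<le> C" and h: "\<And>n x y. (g n x - g n y)\<^sup>2 \<le> C * \<bar>x - y\<bar>"
    and r: "\<And>x. x \<in> \<rat> \<Longrightarrow> \<exists>l. (\<lambda>n. g n x) \<longlonglongrightarrow> l"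
  obtains G where "\<And>x. (\<lambda>n. g n x) \<longlonglongrightarrow> G x" "continuous_on UNIV G"
proof -
  have small: "\<exists>t>0. \<forall>x y. \<bar>x - y\<bar> < t \<longrightarrow> C * \<bar>x - y\<bar> < e\<^sup>2" if e: "e > 0" for e :: real
  proof (intro exI conjI allI impI)
    show "0 < e\<^sup>2 / (C + 1)" using C e by simp
    fix x y :: real assume "\<bar>x - y\<bar> < e\<^sup>2 / (C + 1)"
    then have "\<bar>x - y\<bar> * (C + 1) < e\<^sup>2" using C by (simp add: less_divide_eq)
    moreover have "C * \<bar>x - y\<bar> \<le> \<bar>x - y\<bar> * (C + 1)" by (simp add: algebra_simps)
    ultimately show "C * \<bar>x - y\<bar> < e\<^sup>2" by linarith
  qed
  have sqless: "\<bar>p\<bar> < e" if "p\<^sup>2 < e\<^sup>2" "e > 0" for p e :: real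
    using that by (metis abs_le_square_iff abs_of_pos not_less)
  have "convergent (\<lambda>n. g n x)" for x
    unfolding Cauchy_convergent_iff[symmetric]
  proof (rule metric_CauchyI)
    fix e :: real assume "e > 0"
    then have e3: "e / 3 > 0" by simp
    obtain t where t: "t > 0" "\<And>x y. \<bar>x - y\<bar> < t \<Longrightarrow> C * \<bar>x - y\<bar> < (e/3)\<^sup>2" using small[OF e3] by blast
    obtain y where y: "y \<in> \<rat>" "x < y" "y < x + t" using Rats_dense_in_real[of x "x + t"] t(1) by auto
    have "\<bar>g n x - g n y\<bar> < e / 3" for n
      using h[of n x y] t(2)[of x y] y e3 by (intro sqless) auto
    note near = this
    have "Cauchy (\<lambda>n. g n y)" using r[OF y(1)] by (auto intro: LIMSEQ_imp_Cauchy)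
    then obtain M where M: "\<And>m n. m \<ge> M \<Longrightarrow> n \<ge> M \<Longrightarrow> dist (g m y) (g n y) < e / 3" using e3 by (metis metric_CauchyD)
    show "\<exists>M. \<forall>m\<ge>M. \<forall>n\<ge>M. dist (g m x) (g n x) < e"
    proof (intro exI allI impI)
      fix m n assume "M \<le> m" "M \<le> n"
      then have "\<bar>g m y - g n y\<bar> < e / 3" using M by (simp add: dist_real_def)
      then have "\<bar>g m x - g n x\<bar> < e" using near[of m] near[of n] unfolding abs_if by argo
      then show "dist (g m x) (g n x) < e" by (simp add: dist_real_def)
    qed
  qed
  then have "\<forall>x. \<exists>l. (\<lambda>n. g n x) \<longlonglongrightarrow> l" by (simp add: convergent_def)
  then obtain G where G: "\<And>x. (\<lambda>n. g n x) \<longlonglongrightarrow> G x" by metis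
  have hG: "(G x - G y)\<^sup>2 \<le> C * \<bar>x - y\<bar>" for x y
    by (rule LIMSEQ_le_const2[of "\<lambda>n. (g n x - g n y)\<^sup>2"]) (use h in \<open>auto intro!: tendsto_intros G\<close>)
  have "continuous_on UNIV G"
    unfolding continuous_on_iff
  proof (intro ballI allI impI)
    fix x e :: real assume e: "e > 0"
    obtain t where t: "t > 0" "\<And>x y. \<bar>x - y\<bar> < t \<Longrightarrow> C * \<bar>x - y\<bar> < e\<^sup>2" using small[OF e] by blast
    show "\<exists>d>0. \<forall>x'\<in>UNIV. dist x' x < d \<longrightarrow> dist (G x') (G x) < e"
    proof (intro exI conjI ballI impI)
      show "t > 0" by (rule t(1))
      fix x' assume "dist x' x < t"
      then show "dist (G x') (G x) < e" using hG[of x' x] t(2)[of x' x] e sqless[of "G x' - G x" e] by (simp add: dist_real_def)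
    qed
  qed
  then show ?thesis using that G by blast
qed

lemma AC_Hoelder_line:
  assumes f: "H1 f f'" and C: "(\<integral>x. (f' x)\<^sup>2 \<partial>lborel) \<le> C"
  shows "(f x - f y)\<^sup>2 \<le> C * \<bar>x - y\<bar>"
proof -
  have le: "(f q - f p)\<^sup>2 \<le> C * (q - p)" if "p \<le> q" for p q
  proof -
    have "(LINT t:{p..q}|lborel. (f' t)\<^sup>2) \<le> (\<integral>x. (f' x)\<^sup>2 \<partial>lborel)"
      unfolding set_lebesgue_integral_def
      by (rule integral_mono) (use sq_int[OF H1_sq'[OF f]] integrable_mult_indicator[of "{p..q}" lborel "\<lambda>x. (f' x)\<^sup>2"] in \<open>auto simp: indicator_def\<close>)
    then have "(q - p) * (LINT t:{p..q}|lborel. (f' t)\<^sup>2) \<le> (q - p) * C" using that C by (intro mult_left_mono) auto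
    then show ?thesis using AC_Hoelder[OF H1_AC[OF f] H1_sq'[OF f] that] by (simp add: mult.commute)
  qed
  show ?thesis
  proof (cases "x \<le> y")
    case True
    then show ?thesis using le[OF True] by (simp add: power2_commute)
  next
    case False
    then show ?thesis using le[of y x] by simp
  qed
qed

text \<open>The bound on the integral of \<open>f'\<^sup>2\<close> in dual form: the left-hand side
  is the square of the pairing of \<open>f'\<close> with \<open>p\<close>, written without
  \<open>f'\<close>. So it survives pointwise limits, and \<open>dual_bound_sq\<close> recovers the
  bound from it.\<close>

lemma AC_dual_bound:
  assumes f: "H1 f f'" and C: "(\<integral>x. (f' x)\<^sup>2 \<partial>lborel) \<le> C" and p: "AC p p'" and ab: "a \<le> b"
  shows "(f b * p b - f a * p a - (LINT x:{a..b}|lborel. f x * p' x))\<^sup>2 \<le> C * (LINT x:{a..b}|lborel. (p x)\<^sup>2)"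
proof -
  have pm: "p \<in> borel_measurable borel" by (rule AC_borel[OF p])
  have ii: "(indicat_real {a..b} x)\<^sup>2 = indicat_real {a..b} x" for x by (simp add: indicator_def)
  have "set_integrable lborel {a..b} (\<lambda>x. (p x)\<^sup>2)"
    by (rule borel_integrable_atLeastAtMost') (intro continuous_intros AC_cont_on[OF p])
  then have sp: "sq (\<lambda>x. indicat_real {a..b} x * p x)"
    using pm by (simp add: sq_def set_integrable_def power_mult_distrib ii)
  have m: "set_integrable lborel {a..b} (\<lambda>x. f' x * p x)" "set_integrable lborel {a..b} (\<lambda>x. f x * p' x)"
  proof -
    show "set_integrable lborel {a..b} (\<lambda>x. f x * p' x)"
      by (intro set_integrable_cont_mult AC_cont_on[OF H1_AC[OF f]] AC_borel[OF H1_AC[OF f]] AC_int[OF p])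
    show "set_integrable lborel {a..b} (\<lambda>x. f' x * p x)"
      using set_integrable_cont_mult[OF AC_cont_on[OF p] pm AC_int[OF H1_AC[OF f]], of a b] by (simp add: mult.commute)
  qed
  have "f b * p b - f a * p a = (LINT x:{a..b}|lborel. f' x * p x + f x * p' x)"
    by (rule AC_eq[OF AC_mult[OF H1_AC[OF f] p] ab])
  also have "\<dots> = (LINT x:{a..b}|lborel. f' x * p x) + (LINT x:{a..b}|lborel. f x * p' x)" by (rule set_integral_add(2)[OF m])
  finally have "f b * p b - f a * p a - (LINT x:{a..b}|lborel. f x * p' x) = (\<integral>x. f' x * (indicat_real {a..b} x * p x) \<partial>lborel)"
    by (simp add: set_lebesgue_integral_def mult_ac)
  then have "(f b * p b - f a * p a - (LINT x:{a..b}|lborel. f x * p' x))\<^sup>2 \<le> (\<integral>x. (f' x)\<^sup>2 \<partial>lborel) * (\<integral>x. (indicat_real {a..b} x * p x)\<^sup>2 \<partial>lborel)"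
    using Cauchy_Schwarz_integral[OF H1_sq'[OF f] sp] by simp
  also have "\<dots> \<le> C * (\<integral>x. (indicat_real {a..b} x * p x)\<^sup>2 \<partial>lborel)" by (rule mult_right_mono[OF C]) simp
  finally show ?thesis by (simp add: set_lebesgue_integral_def power_mult_distrib ii)
qed

text \<open>Only continuity of \<open>V\<close> and \<open>q\<close> is known at this point, hence
  the equations tested with rational hats and the derivative bounds in dual form.\<close>

lemma limit_mode:
  fixes k :: real
  assumes k: "k\<^sup>2 < 1"
  obtains l :: real and V q :: "real \<Rightarrow> real" and C :: real where "0 < l" "continuous_on UNIV V" "continuous_on UNIV q" "sq V" "sq q"
    "(\<integral>x. (sech x)\<^sup>2 * (V x)\<^sup>2 \<partial>lborel) = 1"
    "\<And>y d. y \<in> \<rat> \<Longrightarrow> d \<in> \<rat> \<Longrightarrow> d > 0 \<Longrightarrow>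
       (\<integral>x. V x * ((l\<^sup>2 + 1 - 2 * (sech x)\<^sup>2) * hat y d x + 2 * k * l * hat' y d x) \<partial>lborel)
       - (V (y + d) + V (y - d) - 2 * V y) / d - 2 * (\<integral>x. q x * (sech' x * hat y d x + sech x * hat' y d x) \<partial>lborel) = 0"
    "\<And>y d. y \<in> \<rat> \<Longrightarrow> d \<in> \<rat> \<Longrightarrow> d > 0 \<Longrightarrow>
       (\<integral>x. q x * (l\<^sup>2 * hat y d x + 2 * k * l * hat' y d x) \<partial>lborel)
       - (q (y + d) + q (y - d) - 2 * q y) / d + 2 * (\<integral>x. V x * (sech x * hat' y d x) \<partial>lborel) = 0"
    "\<And>p p' a b. a \<le> b \<Longrightarrow> AC p p' \<Longrightarrow> (V b * p b - V a * p a - (LINT x:{a..b}|lborel. V x * p' x))\<^sup>2 \<le> C * (LINT x:{a..b}|lborel. (p x)\<^sup>2)"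
    "\<And>p p' a b. a \<le> b \<Longrightarrow> AC p p' \<Longrightarrow> (q b * p b - q a * p a - (LINT x:{a..b}|lborel. q x * p' x))\<^sup>2 \<le> C * (LINT x:{a..b}|lborel. (p x)\<^sup>2)"
proof -
  obtain z l0 where z: "z \<in> H1_pairs" "parity 1 z" "z 0 $ 1 = 1/2" and l0: "0 < l0" "l0 \<le> 3"
    and trial: "\<And>w. w \<in> H1_pairs \<Longrightarrow> parity (-1) w \<Longrightarrow>
       l0\<^sup>2 * mass z z + energy z z \<le> l0\<^sup>2 * mass w w + energy w w - 4 * k * l0 * shift z w"
    using trial_exists[OF k] by metis
  define C where "C = 60 + 6 / l0\<^sup>2"
  have C: "6 \<le> C" "60 \<le> C" "6 / l0\<^sup>2 \<le> C" by (simp_all add: C_def)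
  define P where "P n u l \<longleftrightarrow> u \<in> H1_pairs \<and> l \<in> {l0..3} \<and> (\<integral>x. (sech x)\<^sup>2 * (u x $ 1)\<^sup>2 \<partial>lborel) = 1 \<and>
     (\<integral>x. (u x $ 1)\<^sup>2 \<partial>lborel) \<le> 6 \<and> (\<integral>x. (u x $ 2)\<^sup>2 \<partial>lborel) \<le> 6 \<and> (\<integral>x. (u x $ 3)\<^sup>2 \<partial>lborel) \<le> 6 / l0\<^sup>2 \<and>
     (\<integral>x. (u x $ 4)\<^sup>2 \<partial>lborel) \<le> 60 \<and> pencil k l u z = 0 \<and>
     (\<forall>i<n. \<bar>pencil k l u (family z (from_nat i))\<bar> \<le> sqrt (6 / real (Suc n)))" for n u l
  have "\<forall>n. \<exists>u l. P n u l"
    unfolding P_def using approximate_modes[OF z l0 trial] by blast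
  then obtain u l where ul: "\<And>n. P n (u n) (l n)" by metis
  have u: "u n \<in> H1_pairs" and l: "l n \<in> {l0..3}"
    and n1: "(\<integral>x. (sech x)\<^sup>2 * (u n x $ 1)\<^sup>2 \<partial>lborel) = 1"
    and bd: "(\<integral>x. (u n x $ 1)\<^sup>2 \<partial>lborel) \<le> 6" "(\<integral>x. (u n x $ 2)\<^sup>2 \<partial>lborel) \<le> 6"
      "(\<integral>x. (u n x $ 3)\<^sup>2 \<partial>lborel) \<le> 6 / l0\<^sup>2" "(\<integral>x. (u n x $ 4)\<^sup>2 \<partial>lborel) \<le> 60"
    and pz: "pencil k (l n) (u n) z = 0" for n
    using ul[of n] unfolding P_def by blast+
  have pf: "\<bar>pencil k (l n) (u n) (family z (from_nat i))\<bar> \<le> sqrt (6 / real (Suc n))" if "i < n" for n i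
    using ul[of n] that unfolding P_def by blast
  define M where "M = sqrt (2 * C)"
  have M0: "0 \<le> M" using C by (simp add: M_def)
  note uH = H1_pairs_H1[OF u] and uS = H1_pairs_sq[OF u]
  have bdC: "(\<integral>x. (u n x $ 1)\<^sup>2 \<partial>lborel) \<le> C" "(\<integral>x. (u n x $ 2)\<^sup>2 \<partial>lborel) \<le> C" "(\<integral>x. (u n x $ 3)\<^sup>2 \<partial>lborel) \<le> C" "(\<integral>x. (u n x $ 4)\<^sup>2 \<partial>lborel) \<le> C" for n
    using bd(1)[of n] bd(2)[of n] bd(3)[of n] bd(4)[of n] C by linarith+
  have sup: "\<bar>u n x $ 1\<bar> \<le> M" "\<bar>u n x $ 3\<bar> \<le> M" for n x
  proof -
    have "(u n x $ 1)\<^sup>2 \<le> 2 * C" using H1_sup_bound[OF uH(1), of n x] bdC(1)[of n] bdC(2)[of n] by linarith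
    then show "\<bar>u n x $ 1\<bar> \<le> M" unfolding M_def by (metis real_sqrt_abs real_sqrt_le_mono)
    have "(u n x $ 3)\<^sup>2 \<le> 2 * C" using H1_sup_bound[OF uH(2), of n x] bdC(3)[of n] bdC(4)[of n] by linarith
    then show "\<bar>u n x $ 3\<bar> \<le> M" unfolding M_def by (metis real_sqrt_abs real_sqrt_le_mono)
  qed
  \<comment> \<open>A diagonal subsequence over the rationals; \<open>l\<close> is part of the tuple
    so that the growth rates converge along it too.\<close>
  obtain r :: "nat \<Rightarrow> nat" where r: "strict_mono r"
    and rc: "\<And>x. x \<in> \<rat> \<Longrightarrow> \<exists>L. (\<lambda>n. (u (r n) x $ 1, u (r n) x $ 3, l (r n))) \<longlonglongrightarrow> L"
  proof (rule function_convergent_subsequence[of "\<rat>::real set" "\<lambda>n x. (u n x $ 1, u n x $ 3, l n)" "M + (M + 3)"])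
    show "countable (\<rat>::real set)" by (rule countable_rat)
    fix n and x :: real
    have "norm (u n x $ 1, u n x $ 3, l n) \<le> norm (u n x $ 1) + norm (u n x $ 3, l n)" by (rule norm_Pair_le)
    also have "norm (u n x $ 3, l n) \<le> norm (u n x $ 3) + norm (l n)" by (rule norm_Pair_le)
    finally show "norm (u n x $ 1, u n x $ 3, l n) \<le> M + (M + 3)" using sup[of n x] l[of n] l0 by simp
  qed (use that in blast)
  have rc1: "\<exists>L. (\<lambda>n. u (r n) x $ 1) \<longlonglongrightarrow> L" and rc3: "\<exists>L. (\<lambda>n. u (r n) x $ 3) \<longlonglongrightarrow> L" and rcl: "\<exists>L. (\<lambda>n. l (r n)) \<longlonglongrightarrow> L" if x: "x \<in> \<rat>" for x
  proof -
    obtain L where "(\<lambda>n. (u (r n) x $ 1, u (r n) x $ 3, l (r n))) \<longlonglongrightarrow> L" using rc[OF x] by blast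
    from tendsto_fst[OF this] tendsto_fst[OF tendsto_snd[OF this]] tendsto_snd[OF tendsto_snd[OF this]]
    show "\<exists>L. (\<lambda>n. u (r n) x $ 1) \<longlonglongrightarrow> L" "\<exists>L. (\<lambda>n. u (r n) x $ 3) \<longlonglongrightarrow> L" "\<exists>L. (\<lambda>n. l (r n)) \<longlonglongrightarrow> L" by auto
  qed
  obtain lam where lam: "(\<lambda>n. l (r n)) \<longlonglongrightarrow> lam" using rcl[of 0] by auto
  have lamb: "l0 \<le> lam" "lam \<le> 3"
    using LIMSEQ_le_const[OF lam, of l0] LIMSEQ_le_const2[OF lam, of 3] l by auto
  have C0: "0 \<le> C" using C by linarith
  obtain V where V: "\<And>x. (\<lambda>n. u (r n) x $ 1) \<longlonglongrightarrow> V x" "continuous_on UNIV V"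
    by (rule Hoelder_limit[of C "\<lambda>n x. u (r n) x $ 1"]) (use C0 AC_Hoelder_line[OF uH(1) bdC(2)] rc1 in auto)
  obtain q where q: "\<And>x. (\<lambda>n. u (r n) x $ 3) \<longlonglongrightarrow> q x" "continuous_on UNIV q"
    by (rule Hoelder_limit[of C "\<lambda>n x. u (r n) x $ 3"]) (use C0 AC_Hoelder_line[OF uH(2) bdC(4)] rc3 in auto)
  have Vm[measurable]: "V \<in> borel_measurable borel" and qm[measurable]: "q \<in> borel_measurable borel"
    using V(2) q(2) by (auto intro: borel_measurable_continuous_onI)
  have um[measurable]: "(\<lambda>x. u n x $ 1) \<in> borel_measurable borel" "(\<lambda>x. u n x $ 3) \<in> borel_measurable borel" for n
    using sq_meas[OF uS(1)] sq_meas[OF uS(3)] by auto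
  have sV: "sq V"
  proof (rule Fatou_sq[of "\<lambda>n x. u (r n) x $ 1" C])
    show "sq (\<lambda>x. u (r n) x $ 1)" "(\<integral>x. (u (r n) x $ 1)\<^sup>2 \<partial>lborel) \<le> C" for n by (rule uS(1), rule bdC(1))
  qed (rule V(1), rule Vm)
  have sq: "sq q"
  proof (rule Fatou_sq[of "\<lambda>n x. u (r n) x $ 3" C])
    show "sq (\<lambda>x. u (r n) x $ 3)" "(\<integral>x. (u (r n) x $ 3)\<^sup>2 \<partial>lborel) \<le> C" for n by (rule uS(3), rule bdC(3))
  qed (rule q(1), rule qm)
  \<comment> \<open>Part of the norm may escape to infinity, but not this part: the states are
    uniformly bounded and \<open>sech\<^sup>2\<close> is integrable.\<close>
  have NV: "(\<integral>x. (sech x)\<^sup>2 * (V x)\<^sup>2 \<partial>lborel) = 1"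
  proof -
    have "(\<lambda>n. \<integral>x. (sech x)\<^sup>2 * (u (r n) x $ 1)\<^sup>2 \<partial>lborel) \<longlonglongrightarrow> (\<integral>x. (sech x)\<^sup>2 * (V x)\<^sup>2 \<partial>lborel)"
    proof (rule integral_dominated_convergence[where w="\<lambda>x. M\<^sup>2 * (sech x)\<^sup>2"])
      show "integrable lborel (\<lambda>x. M\<^sup>2 * (sech x)\<^sup>2)" using sech2_int by simp
      show "AE x in lborel. (\<lambda>n. (sech x)\<^sup>2 * (u (r n) x $ 1)\<^sup>2) \<longlonglongrightarrow> (sech x)\<^sup>2 * (V x)\<^sup>2"
        by (intro AE_I2 tendsto_intros V)
      show "AE x in lborel. norm ((sech x)\<^sup>2 * (u (r n) x $ 1)\<^sup>2) \<le> M\<^sup>2 * (sech x)\<^sup>2" for n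
      proof (rule AE_I2)
        fix x
        have "(u (r n) x $ 1)\<^sup>2 \<le> M\<^sup>2" using power_mono[OF sup(1)[of "r n" x], of 2] by simp
        then have "(sech x)\<^sup>2 * (u (r n) x $ 1)\<^sup>2 \<le> (sech x)\<^sup>2 * M\<^sup>2" by (intro mult_left_mono) auto
        then show "norm ((sech x)\<^sup>2 * (u (r n) x $ 1)\<^sup>2) \<le> M\<^sup>2 * (sech x)\<^sup>2" by (simp add: mult.commute)
      qed
    qed measurable
    then have "(\<lambda>n. 1) \<longlonglongrightarrow> (\<integral>x. (sech x)\<^sup>2 * (V x)\<^sup>2 \<partial>lborel)" by (simp only: n1)
    then show ?thesis by (simp add: LIMSEQ_const_iff)
  qed
  have lim0: "(\<lambda>n. pencil k (l (r n)) (u (r n)) (base p (of_rat y) (of_rat d))) \<longlonglongrightarrow> 0" if d: "d > 0" for p y d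
  proof -
    have f0: "(\<lambda>n. pencil k (l (r n)) (u (r n)) (family z a)) \<longlonglongrightarrow> 0" for a
    proof (rule Lim_null_comparison)
      have l: "(\<lambda>n. sqrt (6 * (1 / real (Suc n)))) \<longlonglongrightarrow> sqrt (6 * 0)"
        by (intro tendsto_intros lim_1_over_n[THEN LIMSEQ_Suc])
      then have "(\<lambda>n. sqrt (6 * (1 / real (Suc (r n))))) \<longlonglongrightarrow> sqrt (6 * 0)"
        using LIMSEQ_subseq_LIMSEQ[OF l r] by (simp add: o_def)
      then show "(\<lambda>n. sqrt (6 / real (Suc (r n)))) \<longlonglongrightarrow> 0" by simp
      show "\<forall>\<^sub>F n in sequentially. norm (pencil k (l (r n)) (u (r n)) (family z a)) \<le> sqrt (6 / real (Suc (r n)))"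
        unfolding eventually_sequentially
      proof (intro exI allI impI)
        \<comment> \<open>A fixed member of the family is among the rows once \<open>n\<close>
          exceeds its number.\<close>
        fix n assume "Suc (to_nat a) \<le> n"
        then have "to_nat a < r n" using seq_suble[OF r, of n] by linarith
        from pf[OF this] show "norm (pencil k (l (r n)) (u (r n)) (family z a)) \<le> sqrt (6 / real (Suc (r n)))" by simp
      qed
    qed
    have "(\<lambda>n. (pencil k (l (r n)) (u (r n)) (family z (p, True, y, d)) + pencil k (l (r n)) (u (r n)) (family z (p, False, y, d))) / 2) \<longlonglongrightarrow> (0 + 0) / 2"
      by (intro tendsto_intros f0) simp
    then show ?thesis unfolding pencil_base[OF u z(1) d pz] by simp
  qed
  \<comment> \<open>Hats have bounded support and bounded slope, so the uniform bounds
    \<open>M\<close> and \<open>A\<close> give a dominating function.\<close>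
  have dct: "(\<lambda>n. \<integral>x. w n x * (c n x * hat y d x + e n x * hat' y d x) \<partial>lborel) \<longlonglongrightarrow> (\<integral>x. W x * (c' x * hat y d x + e' x * hat' y d x) \<partial>lborel)"
    if d: "d > 0" and w: "\<And>n. w n \<in> borel_measurable borel" "\<And>n x. \<bar>w n x\<bar> \<le> M" "\<And>x. (\<lambda>n. w n x) \<longlonglongrightarrow> W x" "W \<in> borel_measurable borel"
      and c: "\<And>n. c n \<in> borel_measurable borel" "\<And>n x. \<bar>c n x\<bar> \<le> A" "\<And>x. (\<lambda>n. c n x) \<longlonglongrightarrow> c' x" "c' \<in> borel_measurable borel"
      and e: "\<And>n. e n \<in> borel_measurable borel" "\<And>n x. \<bar>e n x\<bar> \<le> A" "\<And>x. (\<lambda>n. e n x) \<longlonglongrightarrow> e' x" "e' \<in> borel_measurable borel"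
    for w W c c' e e' A y d
  proof (rule integral_dominated_convergence[where w="\<lambda>x. M * (A + A / d) * indicat_real {y - d..y + d} x"])
    have hm: "hat y d \<in> borel_measurable borel" "hat' y d \<in> borel_measurable borel" using AC_borel[OF AC_hat] AC_meas[OF AC_hat] by auto
    have A0: "0 \<le> A" using c(2)[of 0 0] by linarith
    show "(\<lambda>x. W x * (c' x * hat y d x + e' x * hat' y d x)) \<in> borel_measurable lborel"
      using w(4) c(4) e(4) hm by measurable
    show "(\<lambda>x. w n x * (c n x * hat y d x + e n x * hat' y d x)) \<in> borel_measurable lborel" for n
      using w(1)[of n] c(1)[of n] e(1)[of n] hm by measurable
    show "integrable lborel (\<lambda>x. M * (A + A / d) * indicat_real {y - d..y + d} x)" using d by simp
    show "AE x in lborel. (\<lambda>n. w n x * (c n x * hat y d x + e n x * hat' y d x)) \<longlonglongrightarrow> W x * (c' x * hat y d x + e' x * hat' y d x)"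
      by (intro AE_I2 tendsto_intros w c e)
    show "AE x in lborel. norm (w n x * (c n x * hat y d x + e n x * hat' y d x)) \<le> M * (A + A / d) * indicat_real {y - d..y + d} x" for n
    proof (rule AE_I2)
      fix x show "norm (w n x * (c n x * hat y d x + e n x * hat' y d x)) \<le> M * (A + A / d) * indicat_real {y - d..y + d} x"
      proof (cases "x \<in> {y - d..y + d}")
        case False
        then show ?thesis using hat_outside[OF d False] by simp
      next
        case True
        have "\<bar>c n x * hat y d x\<bar> \<le> A * 1" "\<bar>e n x * hat' y d x\<bar> \<le> A * (1/d)"
          unfolding abs_mult using A0 by (intro mult_mono c e hat_bounds[OF d]; simp)+
        then have "\<bar>c n x * hat y d x + e n x * hat' y d x\<bar> \<le> A + A / d" by (simp add: abs_if split: if_splits)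
        then have "\<bar>w n x\<bar> * \<bar>c n x * hat y d x + e n x * hat' y d x\<bar> \<le> M * (A + A / d)"
          by (intro mult_mono w M0) auto
        then show ?thesis using True by (simp add: abs_mult)
      qed
    qed
  qed
  have lbd: "(l n)\<^sup>2 \<le> 9" "\<bar>l n\<bar> \<le> 3" "\<bar>2 * k * l n\<bar> \<le> 6" for n
  proof -
    show 1: "\<bar>l n\<bar> \<le> 3" using l[of n] l0 by auto
    show "(l n)\<^sup>2 \<le> 9" using power_mono[OF 1, of 2] by simp
    have "\<bar>k\<bar> \<le> 1" using k by (intro abs_square_le_1[THEN iffD1]) simp
    then have "\<bar>k\<bar> * \<bar>l n\<bar> \<le> 1 * 3" using 1 by (intro mult_mono) auto
    then show "\<bar>2 * k * l n\<bar> \<le> 6" by (simp add: abs_mult)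
  qed
  have E1: "(\<integral>x. V x * ((lam\<^sup>2 + 1 - 2 * (sech x)\<^sup>2) * hat y d x + 2 * k * lam * hat' y d x) \<partial>lborel)
       - (V (y + d) + V (y - d) - 2 * V y) / d - 2 * (\<integral>x. q x * (sech' x * hat y d x + sech x * hat' y d x) \<partial>lborel) = 0"
    if yd: "y \<in> \<rat>" "d \<in> \<rat>" "d > 0" for y d
  proof (rule LIMSEQ_unique)
    obtain y' where y': "y = of_rat y'" using yd(1) by (auto elim: Rats_cases)
    obtain d' where d': "d = of_rat d'" using yd(2) by (auto elim: Rats_cases)
    have "d' > 0" using yd(3) d' by simp
    then show "(\<lambda>n. pencil k (l (r n)) (u (r n)) (base True y d)) \<longlonglongrightarrow> 0" unfolding y' d' by (rule lim0)
    have a: "(\<lambda>n. \<integral>x. u (r n) x $ 1 * (((l (r n))\<^sup>2 + 1 - 2 * (sech x)\<^sup>2) * hat y d x + 2 * k * l (r n) * hat' y d x) \<partial>lborel)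
        \<longlonglongrightarrow> (\<integral>x. V x * ((lam\<^sup>2 + 1 - 2 * (sech x)\<^sup>2) * hat y d x + 2 * k * lam * hat' y d x) \<partial>lborel)"
    proof (rule dct[where A=12, OF yd(3) _ sup(1) V(1) Vm])
      show "\<bar>(l (r n))\<^sup>2 + 1 - 2 * (sech x)\<^sup>2\<bar> \<le> 12" for n x
        using lbd(1)[of "r n"] sech_sq_le_1[of x] zero_le_power2[of "sech x"] zero_le_power2[of "l (r n)"]
        unfolding abs_le_iff by argo
      show "\<bar>2 * k * l (r n)\<bar> \<le> 12" for n using lbd(3)[of "r n"] by linarith
    qed (auto intro!: tendsto_intros lam)
    have b: "(\<lambda>n. \<integral>x. u (r n) x $ 3 * (sech' x * hat y d x + sech x * hat' y d x) \<partial>lborel)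
        \<longlonglongrightarrow> (\<integral>x. q x * (sech' x * hat y d x + sech x * hat' y d x) \<partial>lborel)"
      by (rule dct[where A=1, OF yd(3) _ sup(2) q(1) qm]) (use sech_deriv_bounds AC_borel[OF AC_sech(2)] in auto)
    show "(\<lambda>n. pencil k (l (r n)) (u (r n)) (base True y d)) \<longlonglongrightarrow>
       (\<integral>x. V x * ((lam\<^sup>2 + 1 - 2 * (sech x)\<^sup>2) * hat y d x + 2 * k * lam * hat' y d x) \<partial>lborel)
       - (V (y + d) + V (y - d) - 2 * V y) / d - 2 * (\<integral>x. q x * (sech' x * hat y d x + sech x * hat' y d x) \<partial>lborel)"
      unfolding pencil_base_V[OF u yd(3)] using yd(3) by (intro tendsto_diff tendsto_mult tendsto_const tendsto_divide tendsto_add a b V(1)) auto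
  qed
  have E2: "(\<integral>x. q x * (lam\<^sup>2 * hat y d x + 2 * k * lam * hat' y d x) \<partial>lborel)
       - (q (y + d) + q (y - d) - 2 * q y) / d + 2 * (\<integral>x. V x * (sech x * hat' y d x) \<partial>lborel) = 0"
    if yd: "y \<in> \<rat>" "d \<in> \<rat>" "d > 0" for y d
  proof (rule LIMSEQ_unique)
    obtain y' where y': "y = of_rat y'" using yd(1) by (auto elim: Rats_cases)
    obtain d' where d': "d = of_rat d'" using yd(2) by (auto elim: Rats_cases)
    have "d' > 0" using yd(3) d' by simp
    then show "(\<lambda>n. pencil k (l (r n)) (u (r n)) (base False y d)) \<longlonglongrightarrow> 0" unfolding y' d' by (rule lim0)
    have a: "(\<lambda>n. \<integral>x. u (r n) x $ 3 * ((l (r n))\<^sup>2 * hat y d x + 2 * k * l (r n) * hat' y d x) \<partial>lborel)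
        \<longlonglongrightarrow> (\<integral>x. q x * (lam\<^sup>2 * hat y d x + 2 * k * lam * hat' y d x) \<partial>lborel)"
    proof (rule dct[where A=12, OF yd(3) _ sup(2) q(1) qm])
      show "\<bar>(l (r n))\<^sup>2\<bar> \<le> 12" for n using lbd(1)[of "r n"] by simp
      show "\<bar>2 * k * l (r n)\<bar> \<le> 12" for n using lbd(3)[of "r n"] by linarith
    qed (auto intro!: tendsto_intros lam)
    have "(\<lambda>n. \<integral>x. u (r n) x $ 1 * (0 * hat y d x + sech x * hat' y d x) \<partial>lborel)
        \<longlonglongrightarrow> (\<integral>x. V x * (0 * hat y d x + sech x * hat' y d x) \<partial>lborel)"
      by (rule dct[where A=1, OF yd(3) _ sup(1) V(1) Vm]) (use sech_deriv_bounds in auto)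
    then have b: "(\<lambda>n. \<integral>x. u (r n) x $ 1 * (sech x * hat' y d x) \<partial>lborel)
        \<longlonglongrightarrow> (\<integral>x. V x * (sech x * hat' y d x) \<partial>lborel)" by simp
    show "(\<lambda>n. pencil k (l (r n)) (u (r n)) (base False y d)) \<longlonglongrightarrow>
       (\<integral>x. q x * (lam\<^sup>2 * hat y d x + 2 * k * lam * hat' y d x) \<partial>lborel)
       - (q (y + d) + q (y - d) - 2 * q y) / d + 2 * (\<integral>x. V x * (sech x * hat' y d x) \<partial>lborel)"
      unfolding pencil_base_q[OF u yd(3)] using yd(3) by (intro tendsto_diff tendsto_mult tendsto_const tendsto_divide tendsto_add a b q(1)) auto
  qed
  have dual: "(W b * p b - W a * p a - (LINT x:{a..b}|lborel. W x * p' x))\<^sup>2 \<le> C * (LINT x:{a..b}|lborel. (p x)\<^sup>2)"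
    if ab: "a \<le> b" and p: "AC p p'" and w: "\<And>n. H1 (w n) (w' n)" "\<And>n. (\<integral>x. (w' n x)\<^sup>2 \<partial>lborel) \<le> C" "\<And>n x. \<bar>w n x\<bar> \<le> M"
      "\<And>x. (\<lambda>n. w n x) \<longlonglongrightarrow> W x" "W \<in> borel_measurable borel" for w w' W p p' a b
  proof (rule LIMSEQ_le_const2)
    have pm: "p' \<in> borel_measurable borel" by (rule AC_meas[OF p])
    have wm: "w n \<in> borel_measurable borel" for n using sq_meas[OF H1_sq[OF w(1)]] .
    have "(\<lambda>n. LINT x:{a..b}|lborel. w n x * p' x) \<longlonglongrightarrow> (LINT x:{a..b}|lborel. W x * p' x)"
      unfolding set_lebesgue_integral_def
    proof (rule integral_dominated_convergence[where w="\<lambda>x. M * \<bar>indicat_real {a..b} x *\<^sub>R p' x\<bar>"])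
      show "integrable lborel (\<lambda>x. M * \<bar>indicat_real {a..b} x *\<^sub>R p' x\<bar>)"
        using AC_int[OF p, of a b] unfolding set_integrable_def by (intro integrable_mult_right integrable_abs)
      show "(\<lambda>x. indicat_real {a..b} x *\<^sub>R (W x * p' x)) \<in> borel_measurable lborel" using w(5) pm by measurable
      show "(\<lambda>x. indicat_real {a..b} x *\<^sub>R (w n x * p' x)) \<in> borel_measurable lborel" for n using wm[of n] pm by measurable
      show "AE x in lborel. (\<lambda>n. indicat_real {a..b} x *\<^sub>R (w n x * p' x)) \<longlonglongrightarrow> indicat_real {a..b} x *\<^sub>R (W x * p' x)"
        by (intro AE_I2 tendsto_intros w)
      show "AE x in lborel. norm (indicat_real {a..b} x *\<^sub>R (w n x * p' x)) \<le> M * \<bar>indicat_real {a..b} x *\<^sub>R p' x\<bar>" for n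
        using w(3) by (intro AE_I2) (auto simp: indicator_def abs_mult intro!: mult_right_mono)
    qed
    then show "(\<lambda>n. (w n b * p b - w n a * p a - (LINT x:{a..b}|lborel. w n x * p' x))\<^sup>2)
       \<longlonglongrightarrow> (W b * p b - W a * p a - (LINT x:{a..b}|lborel. W x * p' x))\<^sup>2"
      by (intro tendsto_intros w)
    show "\<exists>N. \<forall>n\<ge>N. (w n b * p b - w n a * p a - (LINT x:{a..b}|lborel. w n x * p' x))\<^sup>2 \<le> C * (LINT x:{a..b}|lborel. (p x)\<^sup>2)"
      using AC_dual_bound[OF w(1,2) p ab] by blast
  qed
  show ?thesis
  proof (rule that[of lam V q C])
    show "0 < lam" using lamb l0 by linarith
    show "(V b * p b - V a * p a - (LINT x:{a..b}|lborel. V x * p' x))\<^sup>2 \<le> C * (LINT x:{a..b}|lborel. (p x)\<^sup>2)"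
      if "a \<le> b" "AC p p'" for p p' a b
      by (rule dual[OF that, of "\<lambda>n x. u (r n) x $ 1" "\<lambda>n x. u (r n) x $ 2"]) (use uH(1) bdC(2) sup(1) V(1) Vm in auto)
    show "(q b * p b - q a * p a - (LINT x:{a..b}|lborel. q x * p' x))\<^sup>2 \<le> C * (LINT x:{a..b}|lborel. (p x)\<^sup>2)"
      if "a \<le> b" "AC p p'" for p p' a b
      by (rule dual[OF that, of "\<lambda>n x. u (r n) x $ 3" "\<lambda>n x. u (r n) x $ 4"]) (use uH(2) bdC(4) sup(2) q(1) qm in auto)
  qed (fact V(2) q(2) sV sq NV E1 E2)+
qed

subsection \<open>Regularity of the limit and instability\<close>

text \<open>By continuity the identity extends to all real data. Integrating it in \<open>d\<close>
  expresses \<open>g\<close> through its antiderivative, so \<open>g\<close> is differentiable;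
  differentiating it in \<open>d\<close> then shows that \<open>g'\<close> is constant.\<close>

lemma rational_second_difference_affine:
  fixes g :: "real \<Rightarrow> real"
  assumes c: "continuous_on UNIV g" and z: "\<And>y d. y \<in> \<rat> \<Longrightarrow> d \<in> \<rat> \<Longrightarrow> d > 0 \<Longrightarrow> g (y + d) + g (y - d) - 2 * g y = 0"
  obtains \<alpha> \<beta> where "\<And>x. g x = \<alpha> + \<beta> * x"
proof -
  have gl: "(\<lambda>n. g (X n)) \<longlonglongrightarrow> g x" if "X \<longlonglongrightarrow> x" for X x
    using c that by (intro isCont_tendsto_compose[of x g]) (simp_all add: continuous_on_eq_continuous_at)
  have approx: "\<exists>q. (\<forall>n::nat. q n \<in> \<rat> \<and> x < q n) \<and> q \<longlonglongrightarrow> x" for x :: real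
  proof -
    have "\<forall>n::nat. \<exists>q\<in>\<rat>. x < q \<and> q < x + 1 / real (Suc n)" by (intro allI Rats_dense_in_real) simp
    then obtain q where q: "\<And>n. q n \<in> \<rat>" "\<And>n. x < q n" "\<And>n. q n < x + 1 / real (Suc n)" by metis
    have "q \<longlonglongrightarrow> x"
    proof (rule tendsto_sandwich[of "\<lambda>n. x" _ _ "\<lambda>n. x + 1 / real (Suc n)"])
      show "(\<lambda>n. x + 1 / real (Suc n)) \<longlonglongrightarrow> x"
        using tendsto_add[OF tendsto_const[of x] lim_1_over_n[THEN LIMSEQ_Suc]] by simp
    qed (use q(2,3) in \<open>auto intro!: always_eventually less_imp_le\<close>)
    then show ?thesis using q by blast
  qed
  have all: "g (y + d) + g (y - d) - 2 * g y = 0" if d: "d > 0" for y d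
  proof -
    obtain Y where Y: "\<And>n. Y n \<in> \<rat>" "Y \<longlonglongrightarrow> y" using approx[of y] by blast
    \<comment> \<open>Approximation from above keeps the widths positive.\<close>
    obtain D where D: "\<And>n. D n \<in> \<rat>" "\<And>n. d < D n" "D \<longlonglongrightarrow> d" using approx[of d] by blast
    have "(\<lambda>n. g (Y n + D n) + g (Y n - D n) - 2 * g (Y n)) \<longlonglongrightarrow> g (y + d) + g (y - d) - 2 * g y"
      by (intro tendsto_intros gl Y D)
    moreover have "g (Y n + D n) + g (Y n - D n) - 2 * g (Y n) = 0" for n
      by (rule z[OF Y(1) D(1)]) (use D(2)[of n] d in linarith)
    ultimately show ?thesis by (simp add: LIMSEQ_const_iff)
  qed
  obtain P where P: "\<And>x. (P has_real_derivative g x) (at x)" using antiderivative_UNIV[OF c] by blast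
  have Pd: "P (y + d) - P (y - d) = 2 * d * g y" if d: "0 \<le> d" for y d
  proof (cases "d = 0")
    case False
    with d have "0 < d" by simp
    define f where "f t = P (y + t) - P (y - t) - 2 * t * g y" for t
    have D: "(f has_real_derivative g (y + t) + g (y - t) - 2 * g y) (at t)" for t
      unfolding f_def[abs_def] by (auto intro!: derivative_eq_intros DERIV_chain2[OF P])
    have D0: "(f has_real_derivative 0) (at t)" if "0 < t" for t using D[of t] all[OF that, of y] by simp
    have "f d = f 0"
    proof (rule DERIV_isconst_end[OF \<open>0 < d\<close>])
      show "continuous_on {0..d} f" by (intro continuous_at_imp_continuous_on ballI DERIV_isCont[OF D])
    qed (use D0 in auto)
    then show ?thesis by (simp add: f_def)
  qed simp
  define h where "h y = (g (y + 1) - g (y - 1)) / 2" for y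
  have Dg: "(g has_real_derivative h y) (at y)" for y
  proof -
    have "g = (\<lambda>y. (P (y + 1) - P (y - 1)) / 2)" using Pd[of 1] by (auto simp: fun_eq_iff)
    moreover have "((\<lambda>y. (P (y + 1) - P (y - 1)) / 2) has_real_derivative h y) (at y)"
      unfolding h_def by (auto intro!: derivative_eq_intros DERIV_chain2[OF P])
    ultimately show ?thesis by simp
  qed
  have hd: "h (y + d) = h (y - d)" if d: "d > 0" for y d
  proof -
    have "((\<lambda>t. g (y + t) + g (y - t) - 2 * g y) has_real_derivative h (y + d) - h (y - d)) (at d)"
      by (auto intro!: derivative_eq_intros DERIV_chain2[OF Dg])
    moreover have "((\<lambda>t. g (y + t) + g (y - t) - 2 * g y) has_real_derivative 0) (at d)"
    proof (rule has_field_derivative_transform_within[of "\<lambda>t. 0" _ _ _ d])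
      show "0 = g (y + t) + g (y - t) - 2 * g y" if "dist t d < d" for t
        using all[of t y] that by (auto simp: dist_real_def abs_if split: if_splits)
    qed (use d in auto)
    ultimately have "h (y + d) - h (y - d) = 0" by (rule DERIV_unique)
    then show ?thesis by simp
  qed
  have hc: "h x = h 0" for x
  proof -
    have "h p = h q" if "p < q" for p q
      using hd[of "(q - p) / 2" "(p + q) / 2"] that by (simp add: field_simps)
    then show ?thesis by (metis linorder_neqE_linordered_idom)
  qed
  have De: "((\<lambda>x. g x - h 0 * x) has_real_derivative 0) (at x)" for x
    using hc[of x] by (auto intro!: derivative_eq_intros Dg)
  have e: "g x - h 0 * x = g 0 - h 0 * 0" for x by (rule DERIV_isconst_all[of "\<lambda>x. g x - h 0 * x"]) (use De in blast)
  show ?thesis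
  proof (rule that)
    show "g x = g 0 + h 0 * x" for x using e[of x] by linarith
  qed
qed

lemma hat_integral:
  assumes d: "d > 0" and P: "AC P f" and R: "AC R P"
  shows "(\<integral>x. f x * hat y d x \<partial>lborel) = (R (y + d) + R (y - d) - 2 * R y) / d"
proof -
  have o: "x \<notin> {y - d..y + d} \<Longrightarrow> hat y d x = 0 \<and> hat' y d x = 0" for x using hat_outside[OF d] by blast
  have "(\<integral>x. hat' y d x * P x \<partial>lborel) = - (\<integral>x. hat y d x * f x \<partial>lborel)"
    by (rule AC_by_parts_compact(3)[OF AC_hat P o])
  then have "(\<integral>x. hat y d x * f x \<partial>lborel) = (R (y + d) + R (y - d) - 2 * R y) / d"
    unfolding hat'_integral[OF d R] by (simp only: neg_equal_iff_equal)
  then show ?thesis by (simp only: mult.commute[of "hat y d _"])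
qed

text \<open>With \<open>R'' = F\<close> and \<open>T' = H\<close> the hypothesis says that all
  rational second differences of \<open>R - T - f\<close> vanish, so this function is affine; its
  slope is absorbed into the free constant of \<open>P\<close>.\<close>

lemma weak_second_order:
  fixes f F H :: "real \<Rightarrow> real"
  assumes c: "continuous_on UNIV f" "continuous_on UNIV F" "continuous_on UNIV H"
    and e: "\<And>y d. y \<in> \<rat> \<Longrightarrow> d \<in> \<rat> \<Longrightarrow> d > 0 \<Longrightarrow>
      (\<integral>x. F x * hat y d x \<partial>lborel) + (\<integral>x. hat' y d x * H x \<partial>lborel) - (f (y + d) + f (y - d) - 2 * f y) / d = 0"
  obtains P where "\<And>x. (P has_real_derivative F x) (at x)" "\<And>x. (f has_real_derivative P x - H x) (at x)"
proof -
  obtain P where P: "\<And>x. (P has_real_derivative F x) (at x)" using antiderivative_UNIV[OF c(2)] by blast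
  have cP: "continuous_on UNIV P" by (intro continuous_at_imp_continuous_on ballI DERIV_isCont[OF P])
  obtain R where R: "\<And>x. (R has_real_derivative P x) (at x)" using antiderivative_UNIV[OF cP] by blast
  obtain T where T: "\<And>x. (T has_real_derivative H x) (at x)" using antiderivative_UNIV[OF c(3)] by blast
  have cR: "continuous_on UNIV R" "continuous_on UNIV T"
    by (intro continuous_at_imp_continuous_on ballI DERIV_isCont[OF R] DERIV_isCont[OF T])+
  note A = AC_C1[OF P c(2)] AC_C1[OF R cP] AC_C1[OF T c(3)]
  obtain \<alpha> \<beta> where ab: "\<And>x. R x - T x - f x = \<alpha> + \<beta> * x"
  proof (rule rational_second_difference_affine[of "\<lambda>x. R x - T x - f x"])
    show "continuous_on UNIV (\<lambda>x. R x - T x - f x)" by (intro continuous_intros cR c)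
    fix y d :: real assume yd: "y \<in> \<rat>" "d \<in> \<rat>" "d > 0"
    have "(R (y + d) + R (y - d) - 2 * R y) / d + - (T (y + d) + T (y - d) - 2 * T y) / d - (f (y + d) + f (y - d) - 2 * f y) / d = 0"
      using e[OF yd] unfolding hat_integral[OF yd(3) A(1,2)] hat'_integral[OF yd(3) A(3)] .
    then have "((R (y + d) + R (y - d) - 2 * R y) + - (T (y + d) + T (y - d) - 2 * T y) - (f (y + d) + f (y - d) - 2 * f y)) / d = 0"
      by (simp only: add_divide_distrib diff_divide_distrib)
    then show "(R (y + d) - T (y + d) - f (y + d)) + (R (y - d) - T (y - d) - f (y - d)) - 2 * (R y - T y - f y) = 0"
      using yd(3) by (simp add: algebra_simps)
  qed blast
  have f: "f = (\<lambda>x. R x - T x - (\<alpha> + \<beta> * x))" using ab by (auto simp: fun_eq_iff algebra_simps)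
  show ?thesis
  proof (rule that[of "\<lambda>x. P x - \<beta>"])
    show "((\<lambda>x. P x - \<beta>) has_real_derivative F x) (at x)" for x by (auto intro!: derivative_eq_intros P)
    show "(f has_real_derivative P x - \<beta> - H x) (at x)" for x
      by (subst f) (auto intro!: derivative_eq_intros R T)
  qed
qed

text \<open>Take \<open>p = f1\<close> itself: the left-hand side becomes the square of
  \<open>I\<close>, the integral of \<open>f1\<^sup>2\<close> over the interval, and
  \<open>I\<^sup>2 \<le> C * I\<close> bounds \<open>I\<close> independently of the
  interval.\<close>

lemma dual_bound_sq:
  fixes f f1 f2 :: "real \<Rightarrow> real"
  assumes d: "AC f f1" "AC f1 f2"
    and dual: "\<And>p p' a b. a \<le> b \<Longrightarrow> AC p p' \<Longrightarrow> (f b * p b - f a * p a - (LINT x:{a..b}|lborel. f x * p' x))\<^sup>2 \<le> C * (LINT x:{a..b}|lborel. (p x)\<^sup>2)"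
  shows "sq f1"
proof -
  have m: "f1 \<in> borel_measurable borel" by (rule AC_borel[OF d(2)])
  have ii: "(indicat_real {a..b} x)\<^sup>2 = indicat_real {a..b} x" for a b x :: real by (simp add: indicator_def)
  have s: "set_integrable lborel {a..b} (\<lambda>x. (f1 x)\<^sup>2)" for a b
    by (rule borel_integrable_atLeastAtMost') (intro continuous_intros AC_cont_on[OF d(2)])
  have bd: "(LINT x:{- real n..real n}|lborel. (f1 x)\<^sup>2) \<le> \<bar>C\<bar>" for n
  proof -
    let ?a = "- real n" and ?b = "real n"
    define I where "I = (LINT x:{?a..?b}|lborel. (f1 x)\<^sup>2)"
    have I0: "0 \<le> I" unfolding I_def set_lebesgue_integral_def by (rule integral_nonneg_AE) simp
    have s2: "set_integrable lborel {?a..?b} (\<lambda>x. f x * f2 x)"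
      by (intro set_integrable_cont_mult AC_cont_on[OF d(1)] AC_borel[OF d(1)] AC_int[OF d(2)])
    have "f ?b * f1 ?b - f ?a * f1 ?a = (LINT x:{?a..?b}|lborel. f1 x * f1 x + f x * f2 x)"
      by (rule AC_eq[OF AC_mult[OF d]]) simp
    also have "\<dots> = I + (LINT x:{?a..?b}|lborel. f x * f2 x)"
      using set_integral_add(2)[OF s s2] by (simp add: I_def power2_eq_square)
    finally have "f ?b * f1 ?b - f ?a * f1 ?a - (LINT x:{?a..?b}|lborel. f x * f2 x) = I" by simp
    then have "I\<^sup>2 \<le> C * I" using dual[of ?a ?b f1 f2, OF _ d(2)] by (simp add: I_def)
    then have "I * I \<le> \<bar>C\<bar> * I" using I0 mult_right_mono[OF abs_ge_self[of C] I0] by (simp add: power2_eq_square)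
    then have "I \<le> \<bar>C\<bar>" using I0 by (cases "I = 0") (auto simp: mult_le_cancel_right)
    then show ?thesis by (simp add: I_def)
  qed
  show ?thesis
  proof (rule Fatou_sq[of "\<lambda>n x. indicat_real {- real n..real n} x * f1 x" "\<bar>C\<bar>"])
    show "sq (\<lambda>x. indicat_real {- real n..real n} x * f1 x)" for n
      using m s[of "- real n" "real n"] by (simp add: sq_def set_integrable_def power_mult_distrib ii)
    show "(\<integral>x. (indicat_real {- real n..real n} x * f1 x)\<^sup>2 \<partial>lborel) \<le> \<bar>C\<bar>" for n
      using bd[of n] by (simp add: set_lebesgue_integral_def power_mult_distrib ii)
    fix x
    obtain N :: nat where N: "\<bar>x\<bar> \<le> real N" using real_arch_simple by blast
    have "eventually (\<lambda>n. indicat_real {- real n..real n} x * f1 x = f1 x) sequentially"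
      unfolding eventually_sequentially
    proof (intro exI allI impI)
      fix n assume "N \<le> n"
      then have "real N \<le> real n" by simp
      then have "\<bar>x\<bar> \<le> real n" using N by linarith
      then show "indicat_real {- real n..real n} x * f1 x = f1 x" by (simp add: abs_le_iff)
    qed
    then show "(\<lambda>n. indicat_real {- real n..real n} x * f1 x) \<longlonglongrightarrow> f1 x" by (rule tendsto_eventually)
  qed (rule m)
qed

text \<open>The second component of the mode is \<open>q1 = q'\<close>, which undoes the passage to
  \<open>q\<close>; its equation is the derivative of the one for \<open>q\<close>. Higher
  regularity is read off the equations.\<close>

lemma unstable_mode:
  fixes k :: real
  assumes k: "k\<^sup>2 < 1"
  obtains l :: real and V V1 V2 q1 q2 q3 :: "real \<Rightarrow> real" where "0 < l"
    "AC V V1" "AC V1 V2" "AC q1 q2" "AC q2 q3" "sq V" "sq V1" "sq V2" "sq q1" "sq q2" "sq q3"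
    "(\<integral>x. (sech x)\<^sup>2 * (V x)\<^sup>2 \<partial>lborel) = 1"
    "\<And>x. l\<^sup>2 * V x - 2 * k * l * V1 x - V2 x + V x - 2 * (sech x)\<^sup>2 * V x + 2 * sech x * q1 x = 0"
    "\<And>x. l\<^sup>2 * q1 x - 2 * k * l * q2 x - q3 x - 2 * ((sech'' x * V x + sech' x * V1 x) + (sech' x * V1 x + sech x * V2 x)) = 0"
proof -
  obtain l :: real and V q :: "real \<Rightarrow> real" and C :: real where l: "0 < l" and c: "continuous_on UNIV V" "continuous_on UNIV q" and s: "sq V" "sq q"
    and N: "(\<integral>x. (sech x)\<^sup>2 * (V x)\<^sup>2 \<partial>lborel) = 1"
    and E1: "\<And>y d. y \<in> \<rat> \<Longrightarrow> d \<in> \<rat> \<Longrightarrow> d > 0 \<Longrightarrow>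
       (\<integral>x. V x * ((l\<^sup>2 + 1 - 2 * (sech x)\<^sup>2) * hat y d x + 2 * k * l * hat' y d x) \<partial>lborel)
       - (V (y + d) + V (y - d) - 2 * V y) / d - 2 * (\<integral>x. q x * (sech' x * hat y d x + sech x * hat' y d x) \<partial>lborel) = 0"
    and E2: "\<And>y d. y \<in> \<rat> \<Longrightarrow> d \<in> \<rat> \<Longrightarrow> d > 0 \<Longrightarrow>
       (\<integral>x. q x * (l\<^sup>2 * hat y d x + 2 * k * l * hat' y d x) \<partial>lborel)
       - (q (y + d) + q (y - d) - 2 * q y) / d + 2 * (\<integral>x. V x * (sech x * hat' y d x) \<partial>lborel) = 0"
    and dV: "\<And>p p' a b. a \<le> b \<Longrightarrow> AC p p' \<Longrightarrow> (V b * p b - V a * p a - (LINT x:{a..b}|lborel. V x * p' x))\<^sup>2 \<le> C * (LINT x:{a..b}|lborel. (p x)\<^sup>2)"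
    and dq: "\<And>p p' a b. a \<le> b \<Longrightarrow> AC p p' \<Longrightarrow> (q b * p b - q a * p a - (LINT x:{a..b}|lborel. q x * p' x))\<^sup>2 \<le> C * (LINT x:{a..b}|lborel. (p x)\<^sup>2)"
  proof (rule limit_mode[OF k], goal_cases)
    case 1
    show ?case by (rule that[OF 1(2-7)]) (rule 1(8) 1(9) 1(10) 1(11); assumption)+
  qed
  have cs12: "continuous_on UNIV sech" "continuous_on UNIV sech'" by (rule AC_cont_on[OF AC_sech(1)] AC_cont_on[OF AC_sech(2)])+
  have cs3: "continuous_on UNIV sech''" unfolding sech''_def[abs_def] by (intro continuous_intros cs12)
  note cs = cs12 cs3
  have Ds: "(sech has_real_derivative sech' x) (at x)" "(sech' has_real_derivative sech'' x) (at x)" for x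
    by (rule AC_has_deriv[OF AC_sech(1) cs(2)] AC_has_deriv[OF AC_sech(2) cs(3)])+
  have sm: "sech' \<in> borel_measurable borel" "sech'' \<in> borel_measurable borel" by (rule borel_measurable_continuous_onI[OF cs(2)] borel_measurable_continuous_onI[OF cs(3)])+
  have sb: "sq (\<lambda>x. sech x * f x)" "sq (\<lambda>x. sech' x * f x)" "sq (\<lambda>x. sech'' x * f x)" "sq (\<lambda>x. (sech x)\<^sup>2 * f x)" if "sq f" for f
  proof -
    have b: "\<bar>(sech x)\<^sup>2\<bar> \<le> 1" for x using sech_sq_le_1[of x] by simp
    have m: "(\<lambda>x. (sech x)\<^sup>2) \<in> borel_measurable borel" using borel_sech by (rule borel_measurable_power)
    show "sq (\<lambda>x. sech x * f x)" "sq (\<lambda>x. sech' x * f x)" "sq (\<lambda>x. sech'' x * f x)" "sq (\<lambda>x. (sech x)\<^sup>2 * f x)"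
      by (rule sq_bmult[OF borel_sech sech_deriv_bounds(1) that] sq_bmult[OF sm(1) sech_deriv_bounds(2) that]
          sq_bmult[OF sm(2) sech_deriv_bounds(3) that] sq_bmult[OF m b that])+
  qed
  have hi: "integrable lborel (\<lambda>x. f x * hat y d x)" "integrable lborel (\<lambda>x. f x * hat' y d x)" if "sq f" "d > 0" for f y d
    by (rule sq_mult[OF that(1) H1_sq[OF H1_hat[OF that(2)]]] sq_mult[OF that(1) H1_sq'[OF H1_hat[OF that(2)]]])+
  \<comment> \<open>Each equation takes the form \<open>f'' = F - H'\<close> of
    \<open>weak_second_order\<close>: \<open>F\<close> collects what multiplies the hat, and
    \<open>G1\<close>, \<open>G2\<close> collect what multiplies its derivative.\<close>
  define F1 where "F1 x = (l\<^sup>2 + 1) * V x - 2 * ((sech x)\<^sup>2 * V x) - 2 * (sech' x * q x)" for x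
  define G1 where "G1 x = 2 * k * l * V x - 2 * (sech x * q x)" for x
  define G2 where "G2 x = 2 * k * l * q x + 2 * (sech x * V x)" for x
  have sF: "sq F1" "sq G1" "sq G2"
    unfolding F1_def[abs_def] G1_def[abs_def] G2_def[abs_def] by (intro sq_diff sq_add sq_cmult sb s)+
  have cF: "continuous_on UNIV F1" "continuous_on UNIV G1" "continuous_on UNIV G2" "continuous_on UNIV (\<lambda>x. l\<^sup>2 * q x)"
    unfolding F1_def[abs_def] G1_def[abs_def] G2_def[abs_def] by (intro continuous_intros c cs)+
  obtain P1 where P1: "\<And>x. (P1 has_real_derivative F1 x) (at x)" "\<And>x. (V has_real_derivative P1 x - G1 x) (at x)"
  proof (rule weak_second_order[OF c(1) cF(1,2)])
    fix y d :: real assume yd: "y \<in> \<rat>" "d \<in> \<rat>" "d > 0"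
    note i = hi[OF sF(1) yd(3), of y] hi[OF sF(2) yd(3), of y] hi[OF s(1) yd(3), of y] hi[OF s(2) yd(3), of y]
      hi[OF sb(1)[OF s(2)] yd(3), of y] hi[OF sb(2)[OF s(2)] yd(3), of y] hi[OF sb(4)[OF s(1)] yd(3), of y]
    have i1: "integrable lborel (\<lambda>x. V x * ((l\<^sup>2 + 1 - 2 * (sech x)\<^sup>2) * hat y d x + 2 * k * l * hat' y d x))"
    proof -
      have "integrable lborel (\<lambda>x. (l\<^sup>2 + 1) * (V x * hat y d x) - 2 * ((sech x)\<^sup>2 * V x * hat y d x) + 2 * k * l * (V x * hat' y d x))"
        using i by simp
      then show ?thesis by (rule back_subst[of "integrable lborel"]) (simp add: fun_eq_iff algebra_simps)
    qed
    have i2: "integrable lborel (\<lambda>x. q x * (sech' x * hat y d x + sech x * hat' y d x))"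
    proof -
      have "integrable lborel (\<lambda>x. sech' x * q x * hat y d x + sech x * q x * hat' y d x)" using i by simp
      then show ?thesis by (rule back_subst[of "integrable lborel"]) (simp add: fun_eq_iff algebra_simps)
    qed
    have "(\<integral>x. F1 x * hat y d x \<partial>lborel) + (\<integral>x. hat' y d x * G1 x \<partial>lborel) = (\<integral>x. F1 x * hat y d x + G1 x * hat' y d x \<partial>lborel)"
      using i(1) i(4) by (simp add: mult.commute[of "hat' y d _"])
    also have "\<dots> = (\<integral>x. V x * ((l\<^sup>2 + 1 - 2 * (sech x)\<^sup>2) * hat y d x + 2 * k * l * hat' y d x) - 2 * (q x * (sech' x * hat y d x + sech x * hat' y d x)) \<partial>lborel)"
      by (rule Bochner_Integration.integral_cong[OF refl]) (simp add: F1_def G1_def algebra_simps)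
    also have "\<dots> = (\<integral>x. V x * ((l\<^sup>2 + 1 - 2 * (sech x)\<^sup>2) * hat y d x + 2 * k * l * hat' y d x) \<partial>lborel)
         - 2 * (\<integral>x. q x * (sech' x * hat y d x + sech x * hat' y d x) \<partial>lborel)"
      using i1 i2 by simp
    finally show "(\<integral>x. F1 x * hat y d x \<partial>lborel) + (\<integral>x. hat' y d x * G1 x \<partial>lborel) - (V (y + d) + V (y - d) - 2 * V y) / d = 0"
      using E1[OF yd] by linarith
  qed blast
  obtain P2 where P2: "\<And>x. (P2 has_real_derivative l\<^sup>2 * q x) (at x)" "\<And>x. (q has_real_derivative P2 x - G2 x) (at x)"
  proof (rule weak_second_order[OF c(2) cF(4,3)])
    fix y d :: real assume yd: "y \<in> \<rat>" "d \<in> \<rat>" "d > 0"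
    note i = hi[OF s(2) yd(3), of y] hi[OF sF(3) yd(3), of y] hi[OF sb(1)[OF s(1)] yd(3), of y]
    have i1: "integrable lborel (\<lambda>x. q x * (l\<^sup>2 * hat y d x + 2 * k * l * hat' y d x))"
    proof -
      have "integrable lborel (\<lambda>x. l\<^sup>2 * (q x * hat y d x) + 2 * k * l * (q x * hat' y d x))" using i by simp
      then show ?thesis by (rule back_subst[of "integrable lborel"]) (simp add: fun_eq_iff algebra_simps)
    qed
    have i2: "integrable lborel (\<lambda>x. V x * (sech x * hat' y d x))" using i(6) by (simp add: mult_ac)
    have "(\<integral>x. l\<^sup>2 * q x * hat y d x \<partial>lborel) + (\<integral>x. hat' y d x * G2 x \<partial>lborel) = (\<integral>x. l\<^sup>2 * (q x * hat y d x) + G2 x * hat' y d x \<partial>lborel)"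
      using i(1) i(4) by (simp add: mult.commute[of "hat' y d _"] mult.assoc)
    also have "\<dots> = (\<integral>x. q x * (l\<^sup>2 * hat y d x + 2 * k * l * hat' y d x) + 2 * (V x * (sech x * hat' y d x)) \<partial>lborel)"
      by (rule Bochner_Integration.integral_cong[OF refl]) (simp add: G2_def algebra_simps)
    also have "\<dots> = (\<integral>x. q x * (l\<^sup>2 * hat y d x + 2 * k * l * hat' y d x) \<partial>lborel) + 2 * (\<integral>x. V x * (sech x * hat' y d x) \<partial>lborel)"
      using i1 i2 by simp
    finally show "(\<integral>x. l\<^sup>2 * q x * hat y d x \<partial>lborel) + (\<integral>x. hat' y d x * G2 x \<partial>lborel) - (q (y + d) + q (y - d) - 2 * q y) / d = 0"
      using E2[OF yd] by linarith
  qed blast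
  define V1 where "V1 x = P1 x - G1 x" for x
  define q1 where "q1 x = P2 x - G2 x" for x
  \<comment> \<open>Solving for the highest derivative makes the identities of the conclusion hold
    by unfolding; only differentiability is left to check.\<close>
  define V2 where "V2 x = F1 x - (2 * k * l * V1 x - 2 * (sech' x * q x + sech x * q1 x))" for x
  define q2 where "q2 x = l\<^sup>2 * q x - (2 * k * l * q1 x + 2 * (sech' x * V x + sech x * V1 x))" for x
  define q3 where "q3 x = l\<^sup>2 * q1 x - (2 * k * l * q2 x + 2 * ((sech'' x * V x + sech' x * V1 x) + (sech' x * V1 x + sech x * V2 x)))" for x
  have DV: "(V has_real_derivative V1 x) (at x)" and Dq: "(q has_real_derivative q1 x) (at x)" for x
    using P1(2) P2(2) by (simp_all add: V1_def q1_def)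
  have DV1: "(V1 has_real_derivative V2 x) (at x)" for x
    unfolding V1_def[abs_def] G1_def[abs_def]
    by (rule DERIV_cong[OF DERIV_diff[OF P1(1) DERIV_diff[OF DERIV_cmult[OF DV] DERIV_cmult[OF DERIV_mult'[OF Ds(1) Dq]]]]])
      (simp add: V2_def)
  have Dq1: "(q1 has_real_derivative q2 x) (at x)" for x
    unfolding q1_def[abs_def] G2_def[abs_def]
    by (rule DERIV_cong[OF DERIV_diff[OF P2(1) DERIV_add[OF DERIV_cmult[OF Dq] DERIV_cmult[OF DERIV_mult'[OF Ds(1) DV]]]]])
      (simp add: q2_def)
  have Dq2: "(q2 has_real_derivative q3 x) (at x)" for x
    unfolding q2_def[abs_def]
    by (rule DERIV_cong[OF DERIV_diff[OF DERIV_cmult[OF Dq] DERIV_add[OF DERIV_cmult[OF Dq1]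
        DERIV_cmult[OF DERIV_add[OF DERIV_mult'[OF Ds(2) DV] DERIV_mult'[OF Ds(1) DV1]]]]]])
      (simp add: q3_def)
  have cont: "continuous_on UNIV V1" "continuous_on UNIV q1" "continuous_on UNIV q2"
    by (intro continuous_at_imp_continuous_on ballI DERIV_isCont[OF DV1] DERIV_isCont[OF Dq1] DERIV_isCont[OF Dq2])+
  have cV2: "continuous_on UNIV V2" unfolding V2_def[abs_def] by (intro continuous_intros cF cont cs c)
  have cq3: "continuous_on UNIV q3" unfolding q3_def[abs_def] by (intro continuous_intros cF cont cs c cV2)
  have A: "AC V V1" "AC V1 V2" "AC q q1" "AC q1 q2" "AC q2 q3"
    by (intro AC_C1 DV DV1 Dq Dq1 Dq2 cont cV2 cq3)+
  have s1: "sq V1" by (rule dual_bound_sq[OF A(1,2)]) (rule dV; assumption)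
  have s1': "sq q1" by (rule dual_bound_sq[OF A(3,4)]) (rule dq; assumption)
  note s1 = s1 s1'
  have s2: "sq V2" "sq q2" unfolding V2_def[abs_def] q2_def[abs_def] by (intro sq_diff sq_add sq_cmult sF sb s s1)+
  have s3: "sq q3" unfolding q3_def[abs_def] by (intro sq_diff sq_add sq_cmult sF sb s s1 s2)
  show ?thesis
  proof (rule that[OF l A(1,2,4,5) s(1) s1(1) s2(1) s1(2) s2(2) s3 N])
    show "l\<^sup>2 * V x - 2 * k * l * V1 x - V2 x + V x - 2 * (sech x)\<^sup>2 * V x + 2 * sech x * q1 x = 0" for x
      unfolding V2_def F1_def by (simp only: distrib_right distrib_left mult_1_left mult.assoc)
    show "l\<^sup>2 * q1 x - 2 * k * l * q2 x - q3 x - 2 * ((sech'' x * V x + sech' x * V1 x) + (sech' x * V1 x + sech x * V2 x)) = 0" for x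
      unfolding q3_def by linarith
  qed
qed

section \<open>The growing mode in the original variables\<close>

lemma cAC_of_real: "AC f g \<Longrightarrow> cAC (\<lambda>x. of_real (f x)) (\<lambda>x. of_real (g x))"
  unfolding cAC_def using H1_AC[OF H1_zero] by simp

lemma L2_of_real:
  assumes "sq f" shows "(\<lambda>x. complex_of_real (f x)) \<in> L2"
proof -
  have [measurable]: "f \<in> borel_measurable borel" using assms by (simp add: sq_def)
  have "(\<lambda>x. complex_of_real (f x)) \<in> borel_measurable borel" by measurable
  then show ?thesis using assms by (simp add: L2_def sq_def)
qed

lemma has_dt_exp_intro:
  "has_dt (\<lambda>t x. exp (\<mu> * complex_of_real t) * F x) (\<lambda>t x. exp (\<mu> * complex_of_real t) * (\<mu> * F x))"
  unfolding has_dt_def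
proof (intro allI impI)
  fix t x :: real
  have "((\<lambda>z. exp (\<mu> * z) * F x) has_field_derivative exp (\<mu> * of_real t) * (\<mu> * F x)) (at (of_real t))"
    by (rule derivative_eq_intros refl | simp)+
  from has_vector_derivative_real_field[OF this]
  show "((\<lambda>s. exp (\<mu> * complex_of_real s) * F x) has_vector_derivative exp (\<mu> * complex_of_real t) * (\<mu> * F x)) (at t within {0..})" .
qed

lemma kgz_instability_range:
  assumes c: "-1 < c" "c < 1" and k: "c\<^sup>2 < 1 - c\<^sup>2"
  shows "kgz_unstable c (kgz_\<phi> c) (kgz_\<psi> c)"
proof -
  have c1: "c\<^sup>2 < 1" using c by (simp add: abs_square_less_1)
  define s where "s = sqrt (1 - c\<^sup>2)"
  have s: "s > 0" "s\<^sup>2 = 1 - c\<^sup>2" using c1 by (simp_all add: s_def)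
  define kk where "kk = c / s"
  have ck: "c = kk * s" using s by (simp add: kk_def)
  have k2: "kk\<^sup>2 < 1" using k s c1 by (simp add: kk_def power_divide divide_less_eq)
  obtain l :: real and V V1 V2 q1 q2 q3 :: "real \<Rightarrow> real" where l: "0 < l"
    and A: "AC V V1" "AC V1 V2" "AC q1 q2" "AC q2 q3" and S: "sq V" "sq V1" "sq V2" "sq q1" "sq q2" "sq q3"
    and N: "(\<integral>x. (sech x)\<^sup>2 * (V x)\<^sup>2 \<partial>lborel) = 1"
    and e1: "\<And>x. l\<^sup>2 * V x - 2 * kk * l * V1 x - V2 x + V x - 2 * (sech x)\<^sup>2 * V x + 2 * sech x * q1 x = 0"
    and e2: "\<And>x. l\<^sup>2 * q1 x - 2 * kk * l * q2 x - q3 x - 2 * ((sech'' x * V x + sech' x * V1 x) + (sech' x * V1 x + sech x * V2 x)) = 0"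
  proof (rule unstable_mode[OF k2], goal_cases)
    case 1
    show ?case by (rule that[OF 1(2-13)]) (rule 1(14) 1(15))+
  qed
  define r where "r = 1 / s"
  have r: "r > 0" "r * s = 1" using s by (simp_all add: r_def)
  define f0 f1 f2 where "f0 x = V (r * x)" and "f1 x = r * V1 (r * x)" and "f2 x = r * (r * V2 (r * x))" for x
  \<comment> \<open>Inverse of the substitution used for stability: \<open>w = s W\<close> gives the
    extra factor \<open>r = 1 / s\<close>.\<close>
  define g0 g1 g2 where "g0 x = r * q1 (r * x)" and "g1 x = r * (r * q2 (r * x))" and "g2 x = r * (r * (r * q3 (r * x)))" for x
  define p0 p1 p2 where "p0 x = 2 * s * (sech (r * x) * V (r * x))"
    and "p1 x = 2 * s * (r * (sech' (r * x) * V (r * x) + sech (r * x) * V1 (r * x)))"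
    and "p2 x = 2 * s * (r * (r * ((sech'' (r * x) * V (r * x) + sech' (r * x) * V1 (r * x)) + (sech' (r * x) * V1 (r * x) + sech (r * x) * V2 (r * x)))))" for x
  have Af: "AC f0 f1" "AC f1 f2" "AC g0 g1" "AC g1 g2"
    unfolding f0_def[abs_def] f1_def[abs_def] f2_def[abs_def] g0_def[abs_def] g1_def[abs_def] g2_def[abs_def]
    by (intro AC_cmult AC_scale[OF r(1)] A)+
  have Sf: "sq f0" "sq f1" "sq f2" "sq g0" "sq g1" "sq g2"
    unfolding f0_def[abs_def] f1_def[abs_def] f2_def[abs_def] g0_def[abs_def] g1_def[abs_def] g2_def[abs_def]
    using r by (intro sq_cmult sq_scale S; simp)+
  have Ap: "AC p0 p1" "AC p1 p2"
  proof -
    have "AC (\<lambda>x. sech x * V x) (\<lambda>x. sech' x * V x + sech x * V1 x)" by (intro AC_mult AC_sech A)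
    from AC_cmult[OF AC_scale[OF r(1) this], of "2 * s"] show "AC p0 p1" by (simp add: p0_def[abs_def] p1_def[abs_def])
    have "AC (\<lambda>x. sech' x * V x + sech x * V1 x) (\<lambda>x. (sech'' x * V x + sech' x * V1 x) + (sech' x * V1 x + sech x * V2 x))"
      by (intro AC_add AC_mult AC_sech A)
    from AC_cmult[OF AC_cmult[OF AC_scale[OF r(1) this], of r], of "2 * s"] show "AC p1 p2" by (simp add: p1_def[abs_def] p2_def[abs_def])
  qed
  have phi: "kgz_\<phi> c x = 2 * s * sech (r * x)" "kgz_\<psi> c x = - 2 * (sech (r * x))\<^sup>2" for x
    using kgz_profiles[OF s_def, of x] by (simp_all add: r_def)
  have wd: "weak_deriv (\<lambda>x. a * complex_of_real (f x)) (\<lambda>x. a * complex_of_real (g x))" if "AC f g" for f g and a :: complex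
    by (intro cAC_weak_deriv cAC_cmult cAC_of_real that)
  have wd2: "weak_deriv2 (\<lambda>x. a * complex_of_real (f x)) (\<lambda>x. a * complex_of_real (h x))" if "AC f g" "AC g h" for f g h and a :: complex
    unfolding weak_deriv2_def using wd[OF that(1)] wd[OF that(2)] by blast
  have H2: "(\<lambda>x. complex_of_real (f x)) \<in> H2" if "AC f g" "AC g h" "sq f" "sq g" "sq h" for f g h
  proof -
    have "weak_deriv (\<lambda>x. complex_of_real (f x)) (\<lambda>x. complex_of_real (g x))" "weak_deriv (\<lambda>x. complex_of_real (g x)) (\<lambda>x. complex_of_real (h x))"
      using wd[OF that(1), of 1] wd[OF that(2), of 1] by simp_all
    with that(3-5)[THEN L2_of_real] show ?thesis unfolding H2_def by blast
  qed
  have h1: "c * r = kk"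
  proof -
    have "c * r = kk * (r * s)" unfolding ck by (simp only: mult_ac)
    then show ?thesis using r(2) by simp
  qed
  have h2: "(1 - c\<^sup>2) * (r * r) = 1"
  proof -
    have "(1 - c\<^sup>2) * (r * r) = s\<^sup>2 * (r * r)" by (simp only: s(2))
    also have "\<dots> = (r * s) * (r * s)" by (simp only: power2_eq_square mult_ac)
    finally have "(1 - c\<^sup>2) * (r * r) = (r * s) * (r * s)" .
    then show ?thesis using r(2) by simp
  qed
  have eq1: "l\<^sup>2 * f0 x - 2 * c * (l * f1 x) - (1 - c\<^sup>2) * f2 x + f0 x + kgz_\<psi> c x * f0 x + kgz_\<phi> c x * g0 x = 0" for x
  proof -
    have "2 * c * (l * f1 x) = 2 * kk * l * V1 (r * x)" unfolding f1_def h1[symmetric] by (simp only: mult_ac)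
    moreover have "(1 - c\<^sup>2) * f2 x = ((1 - c\<^sup>2) * (r * r)) * V2 (r * x)" by (simp only: f2_def mult.assoc)
    then have "(1 - c\<^sup>2) * f2 x = V2 (r * x)" unfolding h2 by simp
    moreover have "kgz_\<phi> c x * g0 x = (r * s) * (2 * sech (r * x) * q1 (r * x))" unfolding phi g0_def by (simp only: mult_ac)
    then have "kgz_\<phi> c x * g0 x = 2 * sech (r * x) * q1 (r * x)" unfolding r(2) by simp
    moreover have "kgz_\<psi> c x * f0 x = - (2 * (sech (r * x))\<^sup>2 * V (r * x))" unfolding phi f0_def by simp
    ultimately show ?thesis using e1[of "r * x"] unfolding f0_def by linarith
  qed
  have eq2: "l\<^sup>2 * g0 x - 2 * c * (l * g1 x) - (1 - c\<^sup>2) * g2 x - p2 x = 0" for x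
  proof -
    have "2 * c * (l * g1 x) = r * (2 * kk * l * q2 (r * x))" unfolding g1_def h1[symmetric] by (simp only: mult_ac)
    moreover have "(1 - c\<^sup>2) * g2 x = ((1 - c\<^sup>2) * (r * r)) * (r * q3 (r * x))" by (simp only: g2_def mult_ac)
    then have "(1 - c\<^sup>2) * g2 x = r * q3 (r * x)" unfolding h2 by simp
    moreover define B where "B = (sech'' (r * x) * V (r * x) + sech' (r * x) * V1 (r * x)) + (sech' (r * x) * V1 (r * x) + sech (r * x) * V2 (r * x))"
    have "p2 x = (r * s) * (r * (2 * B))" by (simp only: p2_def B_def mult_ac)
    then have "p2 x = r * (2 * B)" unfolding r(2) by simp
    moreover have "l\<^sup>2 * g0 x = r * (l\<^sup>2 * q1 (r * x))" unfolding g0_def by (simp only: mult_ac)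
    ultimately have "l\<^sup>2 * g0 x - 2 * c * (l * g1 x) - (1 - c\<^sup>2) * g2 x - p2 x
       = r * (l\<^sup>2 * q1 (r * x) - 2 * kk * l * q2 (r * x) - q3 (r * x) - 2 * B)"
      by (simp only: right_diff_distrib)
    then show ?thesis using e2[of "r * x"] unfolding B_def by (simp only: mult_zero_right)
  qed
  show ?thesis
    unfolding kgz_unstable_def
  proof (intro exI conjI)
    show "0 < Re (complex_of_real l)" using l by simp
    show "(\<lambda>x. complex_of_real (f0 x)) \<in> H2" by (rule H2[OF Af(1,2) Sf(1,2,3)])
    show "(\<lambda>x. complex_of_real (g0 x)) \<in> H2" by (rule H2[OF Af(3,4) Sf(4,5,6)])
    show "\<not> (AE x in lborel. complex_of_real (f0 x) = 0 \<and> complex_of_real (g0 x) = 0)"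
    proof
      assume "AE x in lborel. complex_of_real (f0 x) = 0 \<and> complex_of_real (g0 x) = 0"
      then have "AE x in lborel. f0 x = 0" by (rule eventually_mono) simp
      \<comment> \<open>\<open>f0\<close> is continuous, so it vanishes everywhere, against the
        normalization \<open>N\<close>.\<close>
      then have "f0 x = 0" for x by (rule AE_eq_imp_eq[OF AC_cont_on[OF Af(1)] continuous_on_const])
      then have V0: "V (r * x) = 0" for x unfolding f0_def .
      have "V x = 0" for x using V0[of "s * x"] unfolding mult.assoc[symmetric] r(2) by simp
      then show False using N by simp
    qed
    show "kgz_linearized_solution c (kgz_\<phi> c) (kgz_\<psi> c)
       (\<lambda>t x. exp (complex_of_real l * complex_of_real t) * complex_of_real (f0 x))
       (\<lambda>t x. exp (complex_of_real l * complex_of_real t) * complex_of_real (g0 x))"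
      unfolding kgz_linearized_solution_def
    proof (intro exI conjI allI impI)
      show "has_dt (\<lambda>t x. exp (complex_of_real l * complex_of_real t) * complex_of_real (f0 x))
          (\<lambda>t x. exp (complex_of_real l * complex_of_real t) * (complex_of_real l * complex_of_real (f0 x)))"
        "has_dt (\<lambda>t x. exp (complex_of_real l * complex_of_real t) * (complex_of_real l * complex_of_real (f0 x)))
          (\<lambda>t x. exp (complex_of_real l * complex_of_real t) * (complex_of_real l * (complex_of_real l * complex_of_real (f0 x))))"
        "has_dt (\<lambda>t x. exp (complex_of_real l * complex_of_real t) * complex_of_real (g0 x))
          (\<lambda>t x. exp (complex_of_real l * complex_of_real t) * (complex_of_real l * complex_of_real (g0 x)))"
        "has_dt (\<lambda>t x. exp (complex_of_real l * complex_of_real t) * (complex_of_real l * complex_of_real (g0 x)))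
          (\<lambda>t x. exp (complex_of_real l * complex_of_real t) * (complex_of_real l * (complex_of_real l * complex_of_real (g0 x))))"
        by (rule has_dt_exp_intro)+
      fix t :: real
      let ?E = "exp (complex_of_real l * complex_of_real t)"
      show "weak_deriv (\<lambda>x. ?E * (complex_of_real l * complex_of_real (f0 x))) (\<lambda>x. (?E * complex_of_real l) * complex_of_real (f1 x))"
        using wd[OF Af(1), of "?E * complex_of_real l"] by (simp add: mult.assoc)
      show "weak_deriv (\<lambda>x. ?E * (complex_of_real l * complex_of_real (g0 x))) (\<lambda>x. (?E * complex_of_real l) * complex_of_real (g1 x))"
        using wd[OF Af(3), of "?E * complex_of_real l"] by (simp add: mult.assoc)
      show "weak_deriv2 (\<lambda>x. ?E * complex_of_real (f0 x)) (\<lambda>x. ?E * complex_of_real (f2 x))" by (rule wd2[OF Af(1,2)])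
      show "weak_deriv2 (\<lambda>x. ?E * complex_of_real (g0 x)) (\<lambda>x. ?E * complex_of_real (g2 x))" by (rule wd2[OF Af(3,4)])
      have "(\<lambda>x. complex_of_real (kgz_\<phi> c x) * (?E * complex_of_real (f0 x))) = (\<lambda>x. ?E * complex_of_real (p0 x))"
        by (simp add: fun_eq_iff phi p0_def f0_def)
      then show "weak_deriv2 (\<lambda>x. complex_of_real (kgz_\<phi> c x) * (?E * complex_of_real (f0 x))) (\<lambda>x. ?E * complex_of_real (p2 x))"
        using wd2[OF Ap, of ?E] by simp
      show "AE x in lborel.
          ?E * (complex_of_real l * (complex_of_real l * complex_of_real (f0 x))) - complex_of_real (2 * c) * ((?E * complex_of_real l) * complex_of_real (f1 x))
            - complex_of_real (1 - c\<^sup>2) * (?E * complex_of_real (f2 x)) + ?E * complex_of_real (f0 x)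
            + complex_of_real (kgz_\<psi> c x) * (?E * complex_of_real (f0 x)) + complex_of_real (kgz_\<phi> c x) * (?E * complex_of_real (g0 x)) = 0 \<and>
          ?E * (complex_of_real l * (complex_of_real l * complex_of_real (g0 x))) - complex_of_real (2 * c) * ((?E * complex_of_real l) * complex_of_real (g1 x))
            - complex_of_real (1 - c\<^sup>2) * (?E * complex_of_real (g2 x)) - ?E * complex_of_real (p2 x) = 0"
      proof (rule AE_I2, rule conjI)
        fix x
        have "?E * complex_of_real (l\<^sup>2 * f0 x - 2 * c * (l * f1 x) - (1 - c\<^sup>2) * f2 x + f0 x + kgz_\<psi> c x * f0 x + kgz_\<phi> c x * g0 x) = 0"
          using eq1[of x] by (simp only: of_real_0 mult_zero_right)
        then show "?E * (complex_of_real l * (complex_of_real l * complex_of_real (f0 x))) - complex_of_real (2 * c) * ((?E * complex_of_real l) * complex_of_real (f1 x))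
            - complex_of_real (1 - c\<^sup>2) * (?E * complex_of_real (f2 x)) + ?E * complex_of_real (f0 x)
            + complex_of_real (kgz_\<psi> c x) * (?E * complex_of_real (f0 x)) + complex_of_real (kgz_\<phi> c x) * (?E * complex_of_real (g0 x)) = 0"
          by (simp only: of_real_add of_real_diff of_real_mult power2_eq_square distrib_left right_diff_distrib mult_ac)
        have "?E * complex_of_real (l\<^sup>2 * g0 x - 2 * c * (l * g1 x) - (1 - c\<^sup>2) * g2 x - p2 x) = 0"
          using eq2[of x] by (simp only: of_real_0 mult_zero_right)
        then show "?E * (complex_of_real l * (complex_of_real l * complex_of_real (g0 x))) - complex_of_real (2 * c) * ((?E * complex_of_real l) * complex_of_real (g1 x))
            - complex_of_real (1 - c\<^sup>2) * (?E * complex_of_real (g2 x)) - ?E * complex_of_real (p2 x) = 0"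
          by (simp only: of_real_add of_real_diff of_real_mult power2_eq_square distrib_left right_diff_distrib mult_ac)
      qed
    qed
  qed
qed

theorem theorem3:
  fixes c :: real
  assumes "c \<in> {-1<..<1}"
  shows "kgz_solution (\<lambda>t x. complex_of_real (kgz_\<phi> c (x - c * t))) (\<lambda>t x. kgz_\<psi> c (x - c * t)) \<and>
    (\<bar>c\<bar> \<in> {sqrt 2 / 2..<1} \<longrightarrow> kgz_stable c (kgz_\<phi> c) (kgz_\<psi> c)) \<and>
    (\<bar>c\<bar> \<in> {0..<sqrt 2 / 2} \<longrightarrow> kgz_unstable c (kgz_\<phi> c) (kgz_\<psi> c))"
proof (intro conjI impI)
  have c: "-1 < c" "c < 1" using assms by auto
  \<comment> \<open>At this speed \<open>c\<^sup>2\<close> and \<open>1 - c\<^sup>2\<close>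
    coincide, that is \<open>k\<^sup>2 = 1\<close>.\<close>
  have q: "(sqrt 2 / 2)\<^sup>2 = (1/2 :: real)" by (simp add: power_divide)
  show "kgz_solution (\<lambda>t x. complex_of_real (kgz_\<phi> c (x - c * t))) (\<lambda>t x. kgz_\<psi> c (x - c * t))"
    by (rule kgz_wave_solution[OF c])
  show "kgz_stable c (kgz_\<phi> c) (kgz_\<psi> c)" if "\<bar>c\<bar> \<in> {sqrt 2 / 2..<1}"
  proof -
    have "(sqrt 2 / 2)\<^sup>2 \<le> \<bar>c\<bar>\<^sup>2" using that by (intro power_mono) auto
    then have "1 - c\<^sup>2 \<le> c\<^sup>2" unfolding q by simp
    then show ?thesis by (rule kgz_stability_range[OF c])
  qed
  show "kgz_unstable c (kgz_\<phi> c) (kgz_\<psi> c)" if "\<bar>c\<bar> \<in> {0..<sqrt 2 / 2}"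
  proof -
    have "\<bar>c\<bar>\<^sup>2 < (sqrt 2 / 2)\<^sup>2" using that by (intro power_strict_mono) auto
    then have "c\<^sup>2 < 1 - c\<^sup>2" unfolding q by simp
    then show ?thesis by (rule kgz_instability_range[OF c])
  qed
qed

end
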